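(* Let $g$ be a trading cost function whose Legendre transform $G$ satisfies the growth condition (a) and the scaling condition (b) stated in the context, and let $\widehat{G}$ be the function in (b). Let $V_n=V_n(g,F_n)$ be the super-replication cost of $F_n=F(\mathcal{W}_n(S^{(n)}))$. Then $$ \liminf_{n\to\infty}V_n\ \ge\ \sup_{\alpha\in\mathcal{A}}\mathbb{E}^W\left[F(S_\alpha)-\int_0^1\widehat{G}\left(t,S_\alpha,a(t:S_\alpha)S_\alpha(t)\right)dt\right], $$ where $\mathcal{A}$ is the set of all bounded, progressively measurable processes and $\mathbb{E}^W$ denotes expectation with respect to $\mathbb{P}^W$.
   Context: Discrete model. $\Omega=\{-1,1\}^\infty$ with the product measure $\mathbb{Q}=\{\tfrac12,\tfrac12\}^\infty$; $\xi_i(\omega)=\omega_i$; $\mathcal{F}_k=\sigma\{\xi_1,\dots,\xi_k\}$, $\mathcal{F}_0$ trivial. $\mathcal{C}[0,1]$ is the space of continuous functions on $[0,1]$ with the uniform norm; $\mathcal{C}^+[0,1]$ is the subset of strictly positive functions. For constants $\sigma>0$, $s_0>0$, $S^{(n)}(k)=s_0\exp\left(\sigma n^{-1/2}\sum_{i=1}^k\xi_i\right)$, $0\le k\le n$. $\mathcal{W}_n:\mathbb{R}^{n+1}\to\mathcal{C}[0,1]$ is linear interpolation: $\mathcal{W}_n(y)(t)=([nt]+1-nt)y([nt])+(nt-[nt])y([nt]+1)$ (value $y(n)$ at $t=1$). $F:\mathcal{C}[0,1]\to\mathbb{R}_+$ is continuous with $F(y)\le C(1+\|y\|_\infty^p)$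 for some constants $C,p>0$, and $F_n:=F(\mathcal{W}_n(S^{(n)}))$. Trading cost. $g:[0,1]\times\mathcal{C}^+[0,1]\times\mathbb{R}\to[0,\infty)$ with $g(t,S,0)=0$, $g(t,S,\cdot)$ convex, and $g$ adapted ($g(t,S,\nu)=g(t,\hat S,\nu)$ whenever $S=\hat S$ on $[0,t]$). Legendre transform: $G(t,S,y)=\sup_{\nu\in\mathbb{R}}(\nu y-g(t,S,\nu))$. Conditions on $G$: (a) There are constants $C,p>0$ and $\beta\ge2$ such that $G(t,S,y)\le C|y|^\beta(1+\|S\|_\infty)^p$ for all $(t,S,y)\in[0,1]\times\mathcal{C}^+[0,1]\times\mathbb{R}$. (b) There is a continuous function $\widehat{G}:[0,1]\times\mathcal{C}^+[0,1]\times\mathbb{R}\to[0,\infty)$ such that for every bounded real sequence $\{\alpha_n\}$, every sequence $\epsilon_n\in\{-1,1\}$, and all convergent sequences $t_n\to t$ in $[0,1]$ and $S_n\to S$ in $\mathcal{C}^+[0,1]$ (in $\|\cdot\|_\infty$), $$\lim_{n\to\infty}\left|\,nG\left(t_n,S_n,\frac{\epsilon_n\alpha_n}{\sqrt n}S_n(t_n)\right)-\widehat{G}\left(t,S,\alpha_nS(t)\right)\right|=0.$$ Super-replication cost. A portfolio with initial capital $x$ in the $n$-step model is $\pi=(x,\{\gamma(k)\}_{k=0}^n)$ with $\gamma(0)=0$ and $\gamma(k)$ $\mathcal{F}_{k-1}$-measurable for $k\ge1$ (the set of these is $\mathcal{A}_n(x)$); its value satisfies $Y^\pi(0)=x$ and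 $Y^\pi(k+1)=Y^\pi(k)+\gamma(k+1)(S^{(n)}(k+1)-S^{(n)}(k))-g(\tfrac kn,\mathcal{W}_n(S^{(n)}),\gamma(k+1)-\gamma(k))$ for $0\le k\le n-1$. Then $V_n=V_n(g,F_n)=\inf\{x\mid\exists\,\pi\in\mathcal{A}_n(x):\ Y^\pi(n)\ge F_n\ \mathbb{Q}\text{-a.s.}\}$. Continuous-time objects. $(\Omega_W,\mathcal{F}^W,\mathbb{P}^W)$ is a complete probability space with a standard one-dimensional Brownian motion $W$ and filtration $\mathcal{F}^W_t=\sigma\{\sigma\{W(s)\mid s\le t\}\cup\mathcal{N}\}$, $\mathcal{N}$ the $\mathbb{P}^W$-null sets. For a bounded real-valued progressively measurable process $\alpha$, $S_\alpha(t)=s_0\exp\left(\int_0^t\alpha(u)dW(u)-\frac12\int_0^t\alpha^2(u)du\right)$, $t\in[0,1]$, and $a(t:S_\alpha)=\frac{\alpha^2(t)-\sigma^2}{2\sigma}$. *)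

theory Defs
  imports "HOL-Probability.Probability"
begin

section \<open>Path space\<close>

text \<open>
  Paths on $[0,1]$ are represented by extensional functions on \<open>{0..1}\<close>; this makes the
  supremum distance on them a metric. All functionals of paths are only constrained on this carrier.
\<close>

definition C01 :: "(real \<Rightarrow> real) metric" where
  "C01 = cfunspace (top_of_set {0..1}) euclidean_metric"

definition C01_pos :: "(real \<Rightarrow> real) set" where
  "C01_pos = {S \<in> mspace C01. \<forall>t\<in>{0..1}. 0 < S t}"

abbreviation C01_topology :: "(real \<Rightarrow> real) topology" where
  "C01_topology \<equiv> mtopology_of C01"

abbreviation C01_pos_topology :: "(real \<Rightarrow> real) topology" where
  "C01_pos_topology \<equiv> subtopology C01_topology C01_pos"

definition sup_norm :: "(real \<Rightarrow> real) \<Rightarrow> real" where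
  "sup_norm y = (SUP t\<in>{0..1}. \<bar>y t\<bar>)"

text \<open>At \<open>t = 1\<close> the value \<open>y (n + 1)\<close> occurs with coefficient \<open>0\<close>.\<close>

definition interpolation :: "nat \<Rightarrow> (nat \<Rightarrow> real) \<Rightarrow> real \<Rightarrow> real" where
  "interpolation n y = (\<lambda>t\<in>{0..1}.
     (let k = nat \<lfloor>real n * t\<rfloor> in
        (real k + 1 - real n * t) * y k + (real n * t - real k) * y (k + 1)))"

text \<open>
  The sigma-algebra on \<open>\<Omega>\<close> generated by the real-valued maps \<open>X i\<close>, \<open>i \<in> I\<close>, and the
  sets in \<open>\<N>\<close>. Only the measurable sets of the resulting measure space are relevant.
\<close>

definition generated_algebra ::
    "'a set \<Rightarrow> 'i set \<Rightarrow> ('i \<Rightarrow> 'a \<Rightarrow> real) \<Rightarrow> 'a set set \<Rightarrow> 'a measure" where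
  "generated_algebra \<Omega> I X \<N> =
     sigma \<Omega> ((\<Union>i\<in>I. sets (vimage_algebra \<Omega> (X i) borel)) \<union> \<N>)"


section \<open>Discrete model\<close>

definition coin_space :: "(nat \<Rightarrow> real) measure" where
  "coin_space = (\<Pi>\<^sub>M i\<in>{1..}. uniform_count_measure {-1, 1})"

definition coin_filtration :: "nat \<Rightarrow> (nat \<Rightarrow> real) measure" where
  "coin_filtration k = generated_algebra (space coin_space) {1..k} (\<lambda>i \<omega>. \<omega> i) {}"

definition stock :: "real \<Rightarrow> real \<Rightarrow> nat \<Rightarrow> (nat \<Rightarrow> real) \<Rightarrow> nat \<Rightarrow> real" where
  "stock \<sigma> s0 n \<omega> k = s0 * exp (\<sigma> / sqrt (real n) * (\<Sum>i=1..k. \<omega> i))"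

abbreviation stock_path :: "real \<Rightarrow> real \<Rightarrow> nat \<Rightarrow> (nat \<Rightarrow> real) \<Rightarrow> real \<Rightarrow> real" where
  "stock_path \<sigma> s0 n \<omega> \<equiv> interpolation n (stock \<sigma> s0 n \<omega>)"

text \<open>A strategy is a process \<open>\<gamma>\<close>; only \<open>\<gamma> 0, \<dots>, \<gamma> n\<close> matter in the \<open>n\<close>-step model.\<close>

definition strategies :: "nat \<Rightarrow> (nat \<Rightarrow> (nat \<Rightarrow> real) \<Rightarrow> real) set" where
  "strategies n = {\<gamma>. (\<forall>\<omega>\<in>space coin_space. \<gamma> 0 \<omega> = 0) \<and>
     (\<forall>k\<in>{1..n}. \<gamma> k \<in> borel_measurable (coin_filtration (k - 1)))}"

primrec portfolio_value ::
    "real \<Rightarrow> real \<Rightarrow> nat \<Rightarrow> (real \<Rightarrow> (real \<Rightarrow> real) \<Rightarrow> real \<Rightarrow> real) \<Rightarrow> real \<Rightarrow>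
     (nat \<Rightarrow> (nat \<Rightarrow> real) \<Rightarrow> real) \<Rightarrow> nat \<Rightarrow> (nat \<Rightarrow> real) \<Rightarrow> real" where
  "portfolio_value \<sigma> s0 n g x \<gamma> 0 \<omega> = x"
| "portfolio_value \<sigma> s0 n g x \<gamma> (Suc k) \<omega> =
     portfolio_value \<sigma> s0 n g x \<gamma> k \<omega>
     + \<gamma> (k + 1) \<omega> * (stock \<sigma> s0 n \<omega> (k + 1) - stock \<sigma> s0 n \<omega> k)
     - g (real k / real n) (stock_path \<sigma> s0 n \<omega>) (\<gamma> (k + 1) \<omega> - \<gamma> k \<omega>)"

definition super_replication_cost ::
    "real \<Rightarrow> real \<Rightarrow> nat \<Rightarrow> (real \<Rightarrow> (real \<Rightarrow> real) \<Rightarrow> real \<Rightarrow> real) \<Rightarrow>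
     ((nat \<Rightarrow> real) \<Rightarrow> real) \<Rightarrow> ereal" where
  "super_replication_cost \<sigma> s0 n g Fn =
     (INF x\<in>{x. \<exists>\<gamma>\<in>strategies n. AE \<omega> in coin_space. portfolio_value \<sigma> s0 n g x \<gamma> n \<omega> \<ge> Fn \<omega>}.
        ereal x)"


section \<open>Trading costs\<close>

definition trading_cost :: "(real \<Rightarrow> (real \<Rightarrow> real) \<Rightarrow> real \<Rightarrow> real) \<Rightarrow> bool" where
  "trading_cost g \<longleftrightarrow>
     (\<forall>t\<in>{0..1}. \<forall>S\<in>C01_pos.
        (\<forall>\<nu>. 0 \<le> g t S \<nu>) \<and> g t S 0 = 0 \<and> convex_on UNIV (g t S) \<and>
        (\<forall>S'\<in>C01_pos. (\<forall>s\<in>{0..t}. S s = S' s) \<longrightarrow> g t S = g t S'))"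

text \<open>The transform may be infinite in general, hence its type.\<close>

definition legendre ::
    "(real \<Rightarrow> (real \<Rightarrow> real) \<Rightarrow> real \<Rightarrow> real) \<Rightarrow> real \<Rightarrow> (real \<Rightarrow> real) \<Rightarrow> real \<Rightarrow> ereal" where
  "legendre g t S y = (SUP \<nu>. ereal (\<nu> * y - g t S \<nu>))"

definition growth_condition :: "(real \<Rightarrow> (real \<Rightarrow> real) \<Rightarrow> real \<Rightarrow> ereal) \<Rightarrow> bool" where
  "growth_condition G \<longleftrightarrow>
     (\<exists>C>0. \<exists>p>0. \<exists>\<beta>\<ge>2. \<forall>t\<in>{0..1}. \<forall>S\<in>C01_pos. \<forall>y.
        G t S y \<le> ereal (C * \<bar>y\<bar> powr \<beta> * (1 + sup_norm S) powr p))"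

definition scaling_condition ::
    "(real \<Rightarrow> (real \<Rightarrow> real) \<Rightarrow> real \<Rightarrow> ereal) \<Rightarrow> (real \<Rightarrow> (real \<Rightarrow> real) \<Rightarrow> real \<Rightarrow> real) \<Rightarrow> bool"
  where
  "scaling_condition G Gh \<longleftrightarrow>
     (\<forall>t\<in>{0..1}. \<forall>S\<in>C01_pos. \<forall>y. 0 \<le> Gh t S y) \<and>
     continuous_map (prod_topology (top_of_set {0..1}) (prod_topology C01_pos_topology euclideanreal))
       euclideanreal (\<lambda>(t, S, y). Gh t S y) \<and>
     (\<forall>(a :: nat \<Rightarrow> real) (\<epsilon> :: nat \<Rightarrow> real) tn t Sn S.
        bounded (range a) \<longrightarrow> range \<epsilon> \<subseteq> {-1, 1} \<longrightarrow>
        limitin (top_of_set {0..1}) tn t sequentially \<longrightarrow> range tn \<subseteq> {0..1} \<longrightarrow>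
        limitin C01_pos_topology Sn S sequentially \<longrightarrow> range Sn \<subseteq> C01_pos \<longrightarrow>
        (\<lambda>n. \<bar>ereal (real n) * G (tn n) (Sn n) (\<epsilon> n * a n / sqrt (real n) * Sn n (tn n))
              - ereal (Gh t S (a n * S t))\<bar>) \<longlonglongrightarrow> 0)"


section \<open>Brownian motion and the stochastic integral\<close>

definition brownian_motion :: "'a measure \<Rightarrow> (real \<Rightarrow> 'a \<Rightarrow> real) \<Rightarrow> bool" where
  "brownian_motion M W \<longleftrightarrow>
     (\<forall>t\<ge>0. W t \<in> borel_measurable M) \<and>
     (AE \<omega> in M. W 0 \<omega> = 0) \<and>
     (AE \<omega> in M. continuous_on {0..} (\<lambda>t. W t \<omega>)) \<and>
     (\<forall>s t. 0 \<le> s \<longrightarrow> s < t \<longrightarrow>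
        distributed M lborel (\<lambda>\<omega>. W t \<omega> - W s \<omega>) (normal_density 0 (sqrt (t - s)))) \<and>
     (\<forall>(n :: nat) (\<tau> :: nat \<Rightarrow> real). 0 \<le> \<tau> 0 \<longrightarrow> mono_on {..n} \<tau> \<longrightarrow>
        prob_space.indep_vars M (\<lambda>_. borel) (\<lambda>i \<omega>. W (\<tau> (Suc i)) \<omega> - W (\<tau> i) \<omega>) {..<n})"

definition brownian_filtration ::
    "'a measure \<Rightarrow> (real \<Rightarrow> 'a \<Rightarrow> real) \<Rightarrow> real \<Rightarrow> 'a measure" where
  "brownian_filtration M W t = generated_algebra (space M) {0..t} W (null_sets M)"

text \<open>Processes on $[0,1]$; their values at other times are irrelevant.\<close>

definition progressive :: "'a measure \<Rightarrow> (real \<Rightarrow> 'a \<Rightarrow> real) \<Rightarrow> (real \<Rightarrow> 'a \<Rightarrow> real) \<Rightarrow> bool" where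
  "progressive M W \<alpha> \<longleftrightarrow>
     (\<forall>t\<in>{0..1}. (\<lambda>(s, \<omega>). \<alpha> s \<omega>) \<in>
        borel_measurable (restrict_space borel {0..t} \<Otimes>\<^sub>M brownian_filtration M W t))"

definition bounded_progressive ::
    "'a measure \<Rightarrow> (real \<Rightarrow> 'a \<Rightarrow> real) \<Rightarrow> (real \<Rightarrow> 'a \<Rightarrow> real) set" where
  "bounded_progressive M W =
     {\<alpha>. progressive M W \<alpha> \<and> (\<exists>B. \<forall>t\<in>{0..1}. \<forall>\<omega>\<in>space M. \<bar>\<alpha> t \<omega>\<bar> \<le> B)}"

text \<open>
  A list of triples \<open>(a, b, \<eta>)\<close> stands for the elementary integrand
  $\sum \eta\, 1_{(a,b]}$, where each \<open>\<eta>\<close> is bounded and measurable with respect to the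
  information at time \<open>a\<close>.
\<close>

type_synonym 'a elementary = "(real \<times> real \<times> ('a \<Rightarrow> real)) list"

definition is_elementary :: "'a measure \<Rightarrow> (real \<Rightarrow> 'a \<Rightarrow> real) \<Rightarrow> 'a elementary \<Rightarrow> bool" where
  "is_elementary M W H \<longleftrightarrow>
     (\<forall>(a, b, \<eta>)\<in>set H. 0 \<le> a \<and> a \<le> b \<and> b \<le> 1 \<and>
        \<eta> \<in> borel_measurable (brownian_filtration M W a) \<and> (\<exists>B. \<forall>\<omega>\<in>space M. \<bar>\<eta> \<omega>\<bar> \<le> B))"

definition elementary_process :: "'a elementary \<Rightarrow> real \<Rightarrow> 'a \<Rightarrow> real" where
  "elementary_process H t \<omega> = (\<Sum>(a, b, \<eta>)\<leftarrow>H. \<eta> \<omega> * indicator {a<..b} t)"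

definition elementary_integral ::
    "(real \<Rightarrow> 'a \<Rightarrow> real) \<Rightarrow> 'a elementary \<Rightarrow> real \<Rightarrow> 'a \<Rightarrow> real" where
  "elementary_integral W H t \<omega> = (\<Sum>(a, b, \<eta>)\<leftarrow>H. \<eta> \<omega> * (W (min b t) \<omega> - W (min a t) \<omega>))"

text \<open>
  The Ito integral of a bounded progressively measurable process over $[0,t]$, $t \le 1$: the
  continuous adapted process obtained as $L^2$-limit of the integrals of elementary processes
  approximating the integrand in $L^2(dt \otimes M)$. It is unique up to indistinguishability;
  \<open>ito_integral\<close> selects a version.
\<close>

definition is_ito_integral ::
    "'a measure \<Rightarrow> (real \<Rightarrow> 'a \<Rightarrow> real) \<Rightarrow> (real \<Rightarrow> 'a \<Rightarrow> real) \<Rightarrow> (real \<Rightarrow> 'a \<Rightarrow> real) \<Rightarrow> bool" where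
  "is_ito_integral M W \<alpha> X \<longleftrightarrow>
     (\<forall>\<omega>\<in>space M. continuous_on {0..1} (\<lambda>t. X t \<omega>)) \<and>
     (\<forall>t\<in>{0..1}. X t \<in> borel_measurable (brownian_filtration M W t)) \<and>
     (\<exists>H :: nat \<Rightarrow> 'a elementary.
        (\<forall>m. is_elementary M W (H m)) \<and>
        (\<lambda>m. \<integral>\<^sup>+\<omega>. (\<integral>\<^sup>+t\<in>{0..1}. ennreal ((elementary_process (H m) t \<omega> - \<alpha> t \<omega>)\<^sup>2) \<partial>lborel) \<partial>M)
          \<longlonglongrightarrow> 0 \<and>
        (\<forall>t\<in>{0..1}.
          (\<lambda>m. \<integral>\<^sup>+\<omega>. ennreal ((elementary_integral W (H m) t \<omega> - X t \<omega>)\<^sup>2) \<partial>M) \<longlonglongrightarrow> 0))"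

definition ito_integral ::
    "'a measure \<Rightarrow> (real \<Rightarrow> 'a \<Rightarrow> real) \<Rightarrow> (real \<Rightarrow> 'a \<Rightarrow> real) \<Rightarrow> real \<Rightarrow> 'a \<Rightarrow> real" where
  "ito_integral M W \<alpha> = (SOME X. is_ito_integral M W \<alpha> X)"

definition exp_martingale ::
    "'a measure \<Rightarrow> (real \<Rightarrow> 'a \<Rightarrow> real) \<Rightarrow> real \<Rightarrow> (real \<Rightarrow> 'a \<Rightarrow> real) \<Rightarrow> 'a \<Rightarrow> real \<Rightarrow> real" where
  "exp_martingale M W s0 \<alpha> \<omega> =
     (\<lambda>t\<in>{0..1}. s0 * exp (ito_integral M W \<alpha> t \<omega> - 1/2 * (LBINT u:{0..t}. (\<alpha> u \<omega>)\<^sup>2)))"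

text \<open>The process $a(t : S_\alpha)$, i.e. $(\alpha^2 - \sigma^2) / (2\sigma)$.\<close>

definition excess_volatility :: "real \<Rightarrow> (real \<Rightarrow> 'a \<Rightarrow> real) \<Rightarrow> real \<Rightarrow> 'a \<Rightarrow> real" where
  "excess_volatility \<sigma> \<alpha> t \<omega> = ((\<alpha> t \<omega>)\<^sup>2 - \<sigma>\<^sup>2) / (2 * \<sigma>)"

end

theory Submission
  imports Defs
begin

text \<open>
  The bound rests on a pathwise duality. Let $\xi_1, \dots, \xi_n$ be signs on some probability space
  and $a_k$ coefficients with $a_0 = a_n = 0$ such that $M_k = S_k \exp(a_k \xi_k / \sqrt n)$ is a
  martingale, $S$ being the price driven by $\xi$. Summation by parts rewrites the expected gains of a
  super-replicating portfolio $\gamma$ as $E \sum_k (\gamma_{k+1} - \gamma_k)(M_k - S_k)$, and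
  $\nu y - g \le G$ yields $V_n \ge E[F - \sum_k G(k/n, S, M_k - S_k)]$. The martingale
  property forces conditional variance $(\sigma^2 + 2 \sigma a_k)/n$ on the logarithm, so that
  $a = (c^2 - \sigma^2)/(2 \sigma)$ produces volatility $c$.

  Such chains are built on the Brownian space itself. The control $\alpha$ is replaced by rounded
  averages over the preceding grid cell; on each cell the volatility is then a nonzero constant known
  in advance, and the signs are a quantile transform of the normalised Brownian increment, which
  is asymptotically exact by a central limit theorem. Maximal inequalities and Borel-Cantelli give a
  sequence of chains whose prices converge almost surely and uniformly to $S_\alpha$. The scaling
  condition then makes the costs converge pathwise; Fatou's lemma handles $F \ge 0$, and a uniform
  moment bound allows to pass to the limit in the expected costs.
\<close>

text \<open>The limiting cost involves the squared control, which is not a continuous function of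
  the price path, so convergence in law of the discrete prices does not identify it. Chains that
  live on the Brownian space let prices and coefficients converge jointly, outside a null set; that
  space is only assumed to carry \<open>W\<close>, hence signs that are functions of its increments.
  The transition probabilities are forced: the factor of the martingale in one step takes two values
  and has mean 1, with weights in [0, 1] exactly when |a_k| \<le> \<sigma> + a_(k+1). Coefficients
  may therefore rise at once but must fall slowly, and at the end of each block a ramp of length
  independent of n leads them back to 0; the excess never falls below -\<sigma>/2, so negative
  values respect the constraint. Every chain variable takes finitely many values: conditional
  expectations become sums over atoms and integrability is automatic. The volatility levels form a
  finite set for this reason, and avoid 0 because the central limit theorem divides by them.\<close>

lemmas bochner_add = Bochner_Integration.integral_add
  and bochner_integrable_add = Bochner_Integration.integrable_add
  and bochner_integrable_sum = Bochner_Integration.integrable_sum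
  and bochner_sum = Bochner_Integration.integral_sum
  and bochner_diff = Bochner_Integration.integral_diff
  and bochner_integrable_diff = Bochner_Integration.integrable_diff
  and bochner_cong = Bochner_Integration.integral_cong
  and bochner_bound = Bochner_Integration.integrable_bound

section \<open>Two-point steps\<close>


text \<open>The step of the log martingale from time k to k + 1 is (\<plusminus>b - s) h with b =
  \<sigma> + a_(k+1) and s = a_k \<xi>_k: the new deviation enters and the old one is taken back.
  The formula solves the equation that the exponential of this step has mean 1.\<close>

definition up_prob :: "real => real => real => real" where
  "up_prob h b s = (exp (s * h) - exp (- b * h)) / (exp (b * h) - exp (- b * h))"

text \<open>Values in a real vector space, so that real moments and complex characteristic functions
  come from the same operator.\<close>

definition step_mean :: "real => real => real => (real => 'v::real_vector) => 'v" where
  "step_mean h b s f =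
     up_prob h b s *\<^sub>R f ((b - s) * h) + (1 - up_prob h b s) *\<^sub>R f ((- b - s) * h)"

lemma exp_le_three_powr: "\<bar>y\<bar> \<le> 1 ==> exp \<bar>y::real\<bar> \<le> 3"
  by (meson exp_le exp_le_cancel_iff order_trans)

lemma exp_quadratic_bound:
  fixes y :: real assumes "\<bar>y\<bar> \<le> 1" shows "exp y \<le> 1 + y + 3 * y\<^sup>2"
proof -
  have "\<bar>exp y - (1 + y)\<bar> \<le> exp \<bar>y\<bar> * y\<^sup>2"
    using Taylor_exp_field[of y 1] by (simp add: power2_eq_square)
  also have "\<dots> \<le> 3 * y\<^sup>2"
    using exp_le_three_powr[OF assms] by (intro mult_right_mono) auto
  finally show ?thesis by linarith
qed

lemma exp_cubic_bound:
  fixes y :: real assumes "\<bar>y\<bar> \<le> 1" shows "\<bar>exp y - 1 - y - y\<^sup>2 / 2\<bar> \<le> 2 * \<bar>y\<bar> ^ 3"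
proof -
  have "\<bar>exp y - (1 + y + y\<^sup>2 / 2)\<bar> \<le> exp \<bar>y\<bar> * \<bar>y\<bar> ^ 3 / 2"
    using Taylor_exp_field[of y 2] by (simp add: numeral_2_eq_2 power3_eq_cube)
  also have "\<dots> \<le> 3 * \<bar>y\<bar> ^ 3 / 2"
    using exp_le_three_powr[OF assms] by (intro divide_right_mono mult_right_mono) auto
  also have "\<dots> \<le> 2 * \<bar>y\<bar> ^ 3" by simp
  finally show ?thesis by (simp add: algebra_simps)
qed

text \<open>The condition |s| \<le> b is what turns the forced weight into a probability; for chains
  it reads |a_k| \<le> \<sigma> + a_(k+1).\<close>

lemma up_prob_bounds:
  assumes "0 < h" "0 < b" "\<bar>s\<bar> \<le> b"
  shows "0 \<le> up_prob h b s" "up_prob h b s \<le> 1"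
proof -
  have "exp (- b * h) < exp (b * h)" using assms by simp
  moreover have "- b * h \<le> s * h" "s * h \<le> b * h"
    using assms by (intro mult_right_mono; linarith)+
  ultimately show "0 \<le> up_prob h b s" "up_prob h b s \<le> 1"
    unfolding up_prob_def by (auto simp: divide_simps)
qed

text \<open>The window |y| \<le> (b + |s|) h contains both values of the step, so Taylor bounds that
  hold only for small y can be integrated.\<close>

lemma step_mean_mono:
  assumes "0 < h" "0 < b" "\<bar>s\<bar> \<le> b"
    and "\<And>y. \<bar>y\<bar> \<le> (b + \<bar>s\<bar>) * h ==> f y \<le> g y"
  shows "step_mean h b s f \<le> (step_mean h b s g :: real)"
proof -
  have "\<bar>(b - s) * h\<bar> \<le> (b + \<bar>s\<bar>) * h" "\<bar>(- b - s) * h\<bar> \<le> (b + \<bar>s\<bar>) * h"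
    using assms(1-3) by (auto simp: abs_mult intro!: mult_right_mono)
  then show ?thesis unfolding step_mean_def
    using assms(4) up_prob_bounds[OF assms(1-3)]
    by (auto intro!: add_mono mult_left_mono)
qed

lemma step_mean_add: "step_mean h b s (\<lambda>y. f y + g y) = step_mean h b s f + step_mean h b s g"
  by (simp add: step_mean_def algebra_simps)

lemma step_mean_diff: "step_mean h b s (\<lambda>y. f y - g y) = step_mean h b s f - step_mean h b s g"
  by (simp add: step_mean_def algebra_simps)

lemma step_mean_const: "step_mean h b s (\<lambda>y. c) = c"
  by (simp add: step_mean_def algebra_simps)

lemma step_mean_mult: "step_mean h b s (\<lambda>y. c * f y) = c * (step_mean h b s f :: 'v::real_algebra)"
  by (simp add: step_mean_def algebra_simps)

lemma step_mean_of_real: 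
  "step_mean h b s (\<lambda>y. of_real (f y)) = (of_real (step_mean h b s f) :: 'v::real_algebra_1)"
  by (simp add: step_mean_def scaleR_conv_of_real)

lemma norm_step_mean_le:
  fixes f :: "real => 'v::real_normed_vector"
  assumes "0 < h" "0 < b" "\<bar>s\<bar> \<le> b"
    and "\<And>y. \<bar>y\<bar> \<le> (b + \<bar>s\<bar>) * h ==> norm (f y) \<le> c"
  shows "norm (step_mean h b s f) \<le> c"
proof -
  have "norm (step_mean h b s f) \<le> step_mean h b s (\<lambda>y. norm (f y))"
    unfolding step_mean_def using up_prob_bounds[OF assms(1-3)]
    by (intro order.trans[OF norm_triangle_ineq]) simp
  also have "\<dots> \<le> step_mean h b s (\<lambda>y. c)"
    by (rule step_mean_mono) (use assms in auto)
  finally show ?thesis by (simp add: step_mean_const)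
qed

lemma step_mean_exp:
  assumes "0 < h" "0 < b"
  shows "step_mean h b s exp = 1"
proof -
  have ne: "exp (b * h) - exp (- b * h) \<noteq> 0" using assms by simp
  have "step_mean h b s exp = exp (- s * h) *
      (up_prob h b s * (exp (b * h) - exp (- b * h)) + exp (- b * h))"
    by (simp add: step_mean_def algebra_simps exp_diff exp_add exp_minus divide_simps)
  also have "up_prob h b s * (exp (b * h) - exp (- b * h)) = exp (s * h) - exp (- b * h)"
    using ne by (simp add: up_prob_def)
  finally show ?thesis by (simp add: exp_minus)
qed

text \<open>\<open>C\<close> bounds the step in units of \<open>h\<close>. Chains use \<sigma> + 2
  A, because a coefficient of size at most A enters once through b and once through s.\<close>

context
  fixes h b s C :: real
  assumes h: "0 < h" and b: "0 < b" and s: "\<bar>s\<bar> \<le> b" and C: "b + \<bar>s\<bar> \<le> C"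
begin

lemma step_le: "\<bar>y\<bar> \<le> (b + \<bar>s\<bar>) * h ==> \<bar>y\<bar> \<le> C * h"
  using mult_right_mono[OF C, of h] h by linarith

lemma step_mean_sq_le: "step_mean h b s (\<lambda>y. y\<^sup>2) \<le> C\<^sup>2 * h\<^sup>2"
proof -
  have "step_mean h b s (\<lambda>y. y\<^sup>2) \<le> step_mean h b s (\<lambda>y. (C * h)\<^sup>2)"
    by (rule step_mean_mono[OF h b s]) (use step_le power_mono[of "\<bar>_\<bar>" "C * h" 2] in fastforce)
  then show ?thesis by (simp add: step_mean_const power_mult_distrib)
qed

text \<open>Jensen's inequality in the form 1 + y \<le> exp y, against the normalisation E exp Y =
  1. The lower bound that follows uses the quadratic upper bound on exp in the same way, so the
  drift is of second order in h.\<close>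

lemma step_mean_id_nonpos: "step_mean h b s (\<lambda>y. y) \<le> 0"
proof -
  have "step_mean h b s (\<lambda>y. 1 + y) \<le> step_mean h b s exp"
    by (rule step_mean_mono[OF h b s]) simp
  then show ?thesis by (simp add: step_mean_exp[OF h b] step_mean_add step_mean_const)
qed

lemma step_mean_id_ge:
  assumes "C * h \<le> 1"
  shows "- 3 * (C\<^sup>2 * h\<^sup>2) \<le> step_mean h b s (\<lambda>y. y)"
proof -
  have "step_mean h b s exp \<le> step_mean h b s (\<lambda>y. 1 + y + 3 * y\<^sup>2)"
    by (rule step_mean_mono[OF h b s]) (use step_le assms exp_quadratic_bound in fastforce)
  then have "0 \<le> step_mean h b s (\<lambda>y. y) + 3 * step_mean h b s (\<lambda>y. y\<^sup>2)"
    by (simp add: step_mean_exp[OF h b] step_mean_add step_mean_const step_mean_mult)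
  then show ?thesis using step_mean_sq_le by linarith
qed

text \<open>The linear term is as small as the quadratic one because the drift is of order h^2; |l|
  \<ge> 1 absorbs |l| into l^2.\<close>

lemma step_mean_exp_le:
  assumes "1 \<le> \<bar>l\<bar>" "\<bar>l\<bar> * C * h \<le> 1"
  shows "step_mean h b s (\<lambda>y. exp (l * y)) \<le> 1 + 6 * l\<^sup>2 * C\<^sup>2 * h\<^sup>2"
proof -
  have "C \<ge> 0" using b C by linarith
  have Ch: "C * h \<le> 1"
    using assms h \<open>C \<ge> 0\<close> mult_right_mono[OF assms(1), of "C * h"] by (simp add: mult.assoc)
  have l1: "\<bar>l * y\<bar> \<le> 1" if "\<bar>y\<bar> \<le> (b + \<bar>s\<bar>) * h" for y
    using mult_left_mono[OF step_le[OF that], of "\<bar>l\<bar>"] assms by (simp add: abs_mult mult.assoc)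
  have "step_mean h b s (\<lambda>y. exp (l * y)) \<le> step_mean h b s (\<lambda>y. 1 + l * y + 3 * l\<^sup>2 * y\<^sup>2)"
    by (rule step_mean_mono[OF h b s])
      (use l1 exp_quadratic_bound in \<open>fastforce simp: power_mult_distrib mult.assoc\<close>)
  also have "\<dots> = 1 + l * step_mean h b s (\<lambda>y. y) + 3 * l\<^sup>2 * step_mean h b s (\<lambda>y. y\<^sup>2)"
    by (simp add: step_mean_add step_mean_const step_mean_mult)
  also have "l * step_mean h b s (\<lambda>y. y) \<le> \<bar>l\<bar> * (3 * (C\<^sup>2 * h\<^sup>2))"
  proof -
    have "l * step_mean h b s (\<lambda>y. y) \<le> \<bar>l\<bar> * \<bar>step_mean h b s (\<lambda>y. y)\<bar>"
      by (metis abs_ge_self abs_mult)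
    also have "\<dots> \<le> \<bar>l\<bar> * (3 * (C\<^sup>2 * h\<^sup>2))"
      using step_mean_id_ge[OF Ch] step_mean_id_nonpos by (intro mult_left_mono) auto
    finally show ?thesis .
  qed
  also have "\<bar>l\<bar> * (3 * (C\<^sup>2 * h\<^sup>2)) \<le> l\<^sup>2 * (3 * (C\<^sup>2 * h\<^sup>2))"
    using mult_left_mono[OF assms(1), of "\<bar>l\<bar>"] by (intro mult_right_mono) (auto simp: power2_eq_square)
  also have "3 * l\<^sup>2 * step_mean h b s (\<lambda>y. y\<^sup>2) \<le> 3 * l\<^sup>2 * (C\<^sup>2 * h\<^sup>2)"
    by (intro mult_left_mono step_mean_sq_le) auto
  finally show ?thesis by (simp add: algebra_simps)
qed

text \<open>Powers of the martingale with exponent |l| \<ge> 1 are submartingales. For l \<ge> 1 the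
  power x^l lies above its tangent at x = 1, and E exp Y = 1; for l \<le> -1 the tangent 1 + l y
  together with the nonpositive drift suffices.\<close>

lemma step_mean_exp_ge:
  assumes "1 \<le> \<bar>l\<bar>"
  shows "1 \<le> step_mean h b s (\<lambda>y. exp (l * y))"
proof (cases "l \<ge> 0")
  case True
  have tangent: "1 + l * (exp y - 1) \<le> exp (l * y)" for y :: real
  proof -
    have "exp y \<le> (1 / l) * exp (l * y) + (1 - 1 / l)"
      using assms True convex_onD[OF exp_convex, of "1 - 1 / l" "l * y" 0] by simp
    then have "l * exp y \<le> l * ((1 / l) * exp (l * y) + (1 - 1 / l))"
      using True by (intro mult_left_mono) auto
    then show ?thesis using assms True by (simp add: algebra_simps)
  qed
  have "step_mean h b s (\<lambda>y. (1 - l) + l * exp y) \<le> step_mean h b s (\<lambda>y. exp (l * y))"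
    by (rule step_mean_mono[OF h b s]) (use tangent in \<open>simp add: algebra_simps\<close>)
  then show ?thesis
    by (simp add: step_mean_add step_mean_const step_mean_mult step_mean_exp[OF h b, unfolded])
next
  case False
  have "step_mean h b s (\<lambda>y. 1 + l * y) \<le> step_mean h b s (\<lambda>y. exp (l * y))"
    by (rule step_mean_mono[OF h b s]) simp
  moreover have "l * step_mean h b s (\<lambda>y. y) \<ge> 0"
    using False step_mean_id_nonpos by (simp add: mult_nonpos_nonpos)
  ultimately show ?thesis by (simp add: step_mean_add step_mean_const step_mean_mult)
qed

text \<open>Both values satisfy (Y + s h)^2 = b^2 h^2, so the second moment is (b^2 - s^2) h^2 up to
  the term - 2 s h E Y, and the drift E Y is already of order h^2.\<close>

lemma step_mean_sq:
  assumes "C * h \<le> 1"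
  shows "\<bar>step_mean h b s (\<lambda>y. y\<^sup>2) - (b\<^sup>2 - s\<^sup>2) * h\<^sup>2\<bar> \<le> 6 * C ^ 3 * h ^ 3"
proof -
  have "step_mean h b s (\<lambda>y. y\<^sup>2) = (b\<^sup>2 - s\<^sup>2) * h\<^sup>2 - 2 * s * h * step_mean h b s (\<lambda>y. y)"
    by (simp add: step_mean_def power2_eq_square algebra_simps)
  then have "\<bar>step_mean h b s (\<lambda>y. y\<^sup>2) - (b\<^sup>2 - s\<^sup>2) * h\<^sup>2\<bar> = 2 * \<bar>s\<bar> * h * \<bar>step_mean h b s (\<lambda>y. y)\<bar>"
    using h by (simp add: abs_mult)
  also have "\<dots> \<le> 2 * C * h * (3 * (C\<^sup>2 * h\<^sup>2))"
    using step_mean_id_ge[OF assms] step_mean_id_nonpos h b C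
    by (intro mult_mono) auto
  finally show ?thesis by (simp add: power2_eq_square power3_eq_cube algebra_simps)
qed

text \<open>The normal law with variance v and mean -v/2 has characteristic function exp (-(u^2 + i
  u) v / 2); this mean reflects E exp Y = 1. One step agrees with it up to order h^3, so n steps
  with h = 1 / sqrt n lose only O(h).\<close>

lemma step_mean_char:
  assumes Ch: "C * h \<le> 1"
  shows "norm (step_mean h b s (\<lambda>y. exp (\<i> * of_real (u * y))) -
      exp (- (of_real (u\<^sup>2) + \<i> * of_real u) * of_real ((b\<^sup>2 - s\<^sup>2) * h\<^sup>2) / 2))
      \<le> (9 * (\<bar>u\<bar> + u\<^sup>2 + \<bar>u\<bar> ^ 3) + exp (u\<^sup>2) * (u\<^sup>2 + \<bar>u\<bar>)\<^sup>2) * (C * h) ^ 3"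
proof -
  define E1 where "E1 = step_mean h b s (\<lambda>y. y)"
  define E2 where "E2 = step_mean h b s (\<lambda>y. y\<^sup>2)"
  define v where "v = (b\<^sup>2 - s\<^sup>2) * h\<^sup>2"
  define z :: complex where "z = - (of_real (u\<^sup>2) + \<i> * of_real u) / 2"
  define X where "X = (C * h) ^ 3"
  have C0: "0 \<le> C" "0 \<le> C * h" using b C h by auto
  have X0: "0 \<le> X" using C0 by (simp add: X_def)
  have y3: "\<bar>y\<bar> ^ 3 \<le> X" if "\<bar>y\<bar> \<le> (b + \<bar>s\<bar>) * h" for y
    unfolding X_def by (rule power_mono) (use step_le[OF that] in auto)
  have nz: "norm z \<le> (u\<^sup>2 + \<bar>u\<bar>) / 2"
  proof -
    have "norm (complex_of_real (u\<^sup>2) + \<i> * of_real u) \<le> u\<^sup>2 + \<bar>u\<bar>"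
      by (rule order.trans[OF norm_triangle_ineq]) (simp add: norm_mult norm_power)
    then show ?thesis unfolding z_def norm_divide norm_minus_cancel by simp
  qed
  have "norm (step_mean h b s (\<lambda>y. exp (\<i> * of_real (u * y)) - (1 + \<i> * of_real u * of_real y - of_real (u\<^sup>2 / 2) * of_real (y\<^sup>2))))
      \<le> \<bar>u\<bar> ^ 3 * X"
  proof (rule norm_step_mean_le[OF h b s])
    fix y assume y: "\<bar>y\<bar> \<le> (b + \<bar>s\<bar>) * h"
    have "norm (exp (\<i> * of_real (u * y)) - (1 + \<i> * of_real u * of_real y - of_real (u\<^sup>2 / 2) * of_real (y\<^sup>2)))
      \<le> \<bar>u * y\<bar> ^ 3 / 6"
    proof -
      have "\<bar>u * y\<bar> ^ 3 = \<bar>u * y\<bar> * \<bar>u * y\<bar> * \<bar>u * y\<bar>" by (simp only: power3_eq_cube)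
      also have "\<dots> = u * (u * (y * (y * \<bar>u * y\<bar>)))"
        by (simp only: abs_mult_self_eq) (simp add: algebra_simps)
      finally show ?thesis
        using iexp_approx1[of "u * y" 2] by (simp add: numeral_2_eq_2 power2_eq_square algebra_simps fact_reduce)
    qed
    also have "\<dots> \<le> \<bar>u\<bar> ^ 3 * \<bar>y\<bar> ^ 3" by (simp add: abs_mult power_mult_distrib)
    also have "\<dots> \<le> \<bar>u\<bar> ^ 3 * X" using y3[OF y] by (intro mult_left_mono) auto
    finally show "norm (exp (\<i> * of_real (u * y)) - (1 + \<i> * of_real u * of_real y - of_real (u\<^sup>2 / 2) * of_real (y\<^sup>2)))
      \<le> \<bar>u\<bar> ^ 3 * X" .
  qed
  then have A: "norm (step_mean h b s (\<lambda>y. exp (\<i> * of_real (u * y))) - (1 + \<i> * of_real u * of_real E1 - of_real (u\<^sup>2 / 2) * of_real E2)) \<le> \<bar>u\<bar> ^ 3 * X"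
    by (simp only: step_mean_diff step_mean_add step_mean_const step_mean_mult step_mean_of_real E1_def E2_def)
  \<comment> \<open>With E exp Y = 1 this says that the drift equals minus half the second moment up
    to third order.\<close>
  have "norm (step_mean h b s (\<lambda>y. exp y - 1 - y - y\<^sup>2 / 2)) \<le> 2 * X"
  proof (rule norm_step_mean_le[OF h b s])
    fix y assume y: "\<bar>y\<bar> \<le> (b + \<bar>s\<bar>) * h"
    then have "\<bar>y\<bar> \<le> 1" using step_le[OF y] Ch by simp
    then show "norm (exp y - 1 - y - y\<^sup>2 / 2) \<le> 2 * X"
      using exp_cubic_bound[of y] y3[OF y] by simp
  qed
  then have "\<bar>E1 + E2 / 2\<bar> \<le> 2 * X"
    using step_mean_mult[of h b s "1 / 2" "\<lambda>y. y\<^sup>2"]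
    by (simp add: step_mean_diff step_mean_const step_mean_exp[OF h b] E1_def E2_def)
  then have B: "norm (\<i> * of_real u * of_real (E1 + E2 / 2)) \<le> \<bar>u\<bar> * (2 * X)"
    unfolding norm_mult norm_of_real by (auto intro: mult_left_mono)
  have "\<bar>E2 - v\<bar> \<le> 6 * X"
    using step_mean_sq[OF Ch] by (simp add: E2_def v_def X_def power_mult_distrib)
  then have D: "norm (z * of_real (E2 - v)) \<le> (u\<^sup>2 + \<bar>u\<bar>) / 2 * (6 * X)"
    unfolding norm_mult norm_of_real by (intro mult_mono nz) auto
  have v: "0 \<le> v" "v \<le> (C * h)\<^sup>2"
  proof -
    have "s\<^sup>2 \<le> b\<^sup>2" using s by (simp add: abs_le_square_iff[symmetric])
    then show "0 \<le> v" by (simp add: v_def)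
    have "b \<le> C" using C by simp
    then have "b\<^sup>2 \<le> C\<^sup>2" using b by (intro power_mono) auto
    then have "b\<^sup>2 - s\<^sup>2 \<le> C\<^sup>2" using zero_le_power2[of s] by linarith
    then show "v \<le> (C * h)\<^sup>2" by (simp add: v_def power_mult_distrib mult_right_mono)
  qed
  have Ch2: "(C * h)\<^sup>2 \<le> 1" using C0 Ch by (simp add: power_le_one)
  \<comment> \<open>Return from the linearised to the exponential form. The error is of order v^2,
    hence of order (C h)^4, and C h \<le> 1 puts it below the cubic error \<open>X\<close>.\<close>
  have "norm (exp (z * of_real v) - (1 + z * of_real v)) \<le> exp \<bar>Re (z * of_real v)\<bar> * (norm (z * of_real v))\<^sup>2"
    using Taylor_exp[of "z * of_real v" 1] by (simp add: power2_eq_square)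
  also have "\<dots> \<le> exp (u\<^sup>2) * ((u\<^sup>2 + \<bar>u\<bar>) * (C * h)\<^sup>2)\<^sup>2"
  proof (intro mult_mono power_mono)
    have "\<bar>Re (z * of_real v)\<bar> = u\<^sup>2 / 2 * v" using v by (simp add: z_def abs_mult)
    also have "\<dots> \<le> u\<^sup>2 * 1" using v Ch2 by (intro mult_mono) auto
    finally show "exp \<bar>Re (z * of_real v)\<bar> \<le> exp (u\<^sup>2)" by simp
    have "norm (z * of_real v) \<le> (u\<^sup>2 + \<bar>u\<bar>) / 2 * (C * h)\<^sup>2"
      unfolding norm_mult norm_of_real using v by (intro mult_mono nz) auto
    also have "\<dots> \<le> (u\<^sup>2 + \<bar>u\<bar>) * (C * h)\<^sup>2" by (intro mult_right_mono) auto
    finally show "norm (z * of_real v) \<le> (u\<^sup>2 + \<bar>u\<bar>) * (C * h)\<^sup>2" .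
  qed auto
  also have "\<dots> = exp (u\<^sup>2) * (u\<^sup>2 + \<bar>u\<bar>)\<^sup>2 * ((C * h) ^ 3 * (C * h))"
    by (simp add: power2_eq_square power3_eq_cube)
  also have "\<dots> \<le> exp (u\<^sup>2) * (u\<^sup>2 + \<bar>u\<bar>)\<^sup>2 * X"
    unfolding X_def using C0 Ch by (intro mult_left_mono mult_left_le) auto
  finally have Fz: "norm (exp (z * of_real v) - (1 + z * of_real v)) \<le> exp (u\<^sup>2) * (u\<^sup>2 + \<bar>u\<bar>)\<^sup>2 * X" .
  have "step_mean h b s (\<lambda>y. exp (\<i> * of_real (u * y))) - exp (z * of_real v)
    = (step_mean h b s (\<lambda>y. exp (\<i> * of_real (u * y))) - (1 + \<i> * of_real u * of_real E1 - of_real (u\<^sup>2 / 2) * of_real E2))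
      + \<i> * of_real u * of_real (E1 + E2 / 2) + z * of_real (E2 - v) - (exp (z * of_real v) - (1 + z * of_real v))"
    by (simp add: z_def algebra_simps add_divide_distrib diff_divide_distrib)
  also have "norm \<dots> \<le> \<bar>u\<bar> ^ 3 * X + \<bar>u\<bar> * (2 * X) + (u\<^sup>2 + \<bar>u\<bar>) / 2 * (6 * X)
      + exp (u\<^sup>2) * (u\<^sup>2 + \<bar>u\<bar>)\<^sup>2 * X"
    by (intro norm_triangle_le_diff norm_triangle_le add_mono A B D Fz)
  also have "\<dots> \<le> (9 * (\<bar>u\<bar> + u\<^sup>2 + \<bar>u\<bar> ^ 3) + exp (u\<^sup>2) * (u\<^sup>2 + \<bar>u\<bar>)\<^sup>2) * X"
    using X0 by (simp add: algebra_simps)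
  finally show ?thesis by (simp add: z_def v_def X_def mult.commute)
qed

end

section \<open>Binary chains\<close>


text \<open>Induction on k for x P(B_k) \<le> E (1_(B_k) N_k): where the level x is reached for the
  first time at k + 1, N_(k+1) is at least x, and on the old event the submartingale property
  applies. That property is required only on these events, so the lemma serves the discrete chains
  and the Brownian martingales without a common notion of filtration.\<close>

lemma (in prob_space) maximal_inequality:
  fixes N :: "nat => 'a => real"
  assumes "k0 \<le> k1" "0 \<le> x"
    and int: "\<And>k. k0 \<le> k ==> k \<le> k1 ==> integrable M (N k)"
    and nonneg: "\<And>k w. k0 \<le> k ==> k \<le> k1 ==> w \<in> space M ==> 0 \<le> N k w"
    and sub: "\<And>k. k0 \<le> k ==> k < k1 ==>
      (\<integral>w. indicator {w\<in>space M. \<exists>l\<in>{k0..k}. x \<le> N l w} w * N k w \<partial>M)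
      \<le> (\<integral>w. indicator {w\<in>space M. \<exists>l\<in>{k0..k}. x \<le> N l w} w * N (Suc k) w \<partial>M)"
  shows "x * prob {w\<in>space M. \<exists>l\<in>{k0..k1}. x \<le> N l w} \<le> expectation (N k1)"
proof -
  define B where "B k = {w\<in>space M. \<exists>l\<in>{k0..k}. x \<le> N l w}" for k
  have B[measurable]: "B k \<in> sets M" if "k \<le> k1" for k
  proof -
    have "B k = (\<Union>l\<in>{k0..k}. {w\<in>space M. x \<le> N l w})" by (auto simp: B_def)
    also have "\<dots> \<in> sets M"
      using int that by (intro sets.finite_UN) (auto intro!: borel_measurable_le dest: borel_measurable_integrable)
    finally show ?thesis .
  qed
  have BI: "integrable M (\<lambda>w. indicator (B j) w * N k w)" if "j \<le> k1" "k0 \<le> k" "k \<le> k1" for j k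
    using integrable_real_mult_indicator[OF B[OF that(1)] int[OF that(2,3)]] by (simp add: mult.commute)
  have xI: "integrable M (\<lambda>w. x * indicator S w)" if "S \<in> sets M" for S
    by (intro integrable_mult_right integrable_real_indicator that) (simp add: emeasure_eq_measure)
  have "x * prob (B k) \<le> (\<integral>w. indicator (B k) w * N k w \<partial>M)" if "k0 \<le> k" "k \<le> k1" for k
    using that
  proof (induction k rule: dec_induct)
    case base
    have B0: "B k0 \<in> sets M" using B[of k0] base by simp
    then have "x * prob (B k0) = (\<integral>w. x * indicator (B k0) w \<partial>M)"
      by simp
    also have "\<dots> \<le> (\<integral>w. indicator (B k0) w * N k0 w \<partial>M)"
      using base by (intro integral_mono BI xI B0) (auto simp: B_def indicator_def)
    finally show ?case .
  next
    case (step k)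
    then have k: "k0 \<le> k" "k < k1" "Suc k \<le> k1" "k \<le> k1" by auto
    define D where "D = B (Suc k) - B k"
    have D[measurable]: "D \<in> sets M" using B k by (auto simp: D_def)
    have ID: "integrable M (\<lambda>w. indicator D w * N (Suc k) w)"
      using integrable_real_mult_indicator[OF D int[OF _ k(3)]] k by (simp add: mult.commute)
    have sub': "B k \<subseteq> B (Suc k)" by (force simp: B_def)
    have "x * prob (B (Suc k)) = x * prob (B k) + x * prob D"
      using finite_measure_Diff[OF B[OF k(3)] B[OF k(4)] sub'] by (simp add: D_def right_diff_distrib)
    also have "x * prob D = (\<integral>w. x * indicator D w \<partial>M)" by simp
    also have "\<dots> \<le> (\<integral>w. indicator D w * N (Suc k) w \<partial>M)"
    proof (intro integral_mono ID xI D)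
      fix w assume "w \<in> space M"
      show "x * indicator D w \<le> indicator D w * N (Suc k) w"
        using k by (auto simp: D_def B_def indicator_def le_Suc_eq)
    qed
    also have "x * prob (B k) \<le> (\<integral>w. indicator (B k) w * N k w \<partial>M)"
      using step k by simp
    also have "\<dots> \<le> (\<integral>w. indicator (B k) w * N (Suc k) w \<partial>M)"
      using sub[OF k(1,2)] by (simp add: B_def)
    also have "(\<integral>w. indicator (B k) w * N (Suc k) w \<partial>M) + (\<integral>w. indicator D w * N (Suc k) w \<partial>M)
       = (\<integral>w. indicator (B (Suc k)) w * N (Suc k) w \<partial>M)"
    proof (subst bochner_add[OF BI ID, symmetric])
      show "(\<integral>w. indicator (B k) w * N (Suc k) w + indicator D w * N (Suc k) w \<partial>M)
         = (\<integral>w. indicator (B (Suc k)) w * N (Suc k) w \<partial>M)"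
        using sub' by (intro bochner_cong) (auto simp: D_def indicator_def)
    qed (use k in auto)
    finally show ?case by simp
  qed
  from this[of k1] have "x * prob (B k1) \<le> (\<integral>w. indicator (B k1) w * N k1 w \<partial>M)"
    using assms(1) by simp
  also have "\<dots> \<le> expectation (N k1)"
    using assms(1) by (intro integral_mono BI int) (auto simp: indicator_def intro: nonneg)
  finally show ?thesis by (simp add: B_def)
qed

text \<open>\<open>T k\<close> is the information after k steps, a finite-valued map in place of a
  sigma-algebra; to be known at time k means to be a function of \<open>T k\<close>.
  \<open>one_step\<close> is the conditional law of the next sign, stated by integrating the two
  branches, and \<open>a_pred\<close> makes the next coefficient known one step ahead.\<close>

locale binary_chain = prob_space M for M :: "'a measure" +
  fixes n :: nat and \<sigma> h A :: real
    and T :: "nat => 'a => 't" and \<xi> a :: "nat => 'a => real"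
  assumes \<sigma>_pos: "0 < \<sigma>" and h_pos: "0 < h"
    and T_simple: "k \<le> n ==> simple_function M (T k)"
    and T_det: "k < n ==> w \<in> space M ==> w' \<in> space M ==> T (Suc k) w = T (Suc k) w' ==> T k w = T k w'"
    and \<xi>_det: "k \<le> n ==> w \<in> space M ==> w' \<in> space M ==> T k w = T k w' ==> \<xi> k w = \<xi> k w'"
    and a_det: "k \<le> n ==> w \<in> space M ==> w' \<in> space M ==> T k w = T k w' ==> a k w = a k w'"
    and a_pred: "k < n ==> w \<in> space M ==> w' \<in> space M ==> T k w = T k w' ==> a (Suc k) w = a (Suc k) w'"
    and \<xi>_values: "1 \<le> k ==> k \<le> n ==> w \<in> space M ==> \<xi> k w \<in> {-1, 1}"
    and a_0: "w \<in> space M ==> a 0 w = 0"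
    and a_bound: "k \<le> n ==> w \<in> space M ==> \<bar>a k w\<bar> \<le> A"
    and a_gap: "k < n ==> w \<in> space M ==> \<bar>a k w\<bar> \<le> \<sigma> + a (Suc k) w"
    and a_pos: "k < n ==> w \<in> space M ==> 0 < \<sigma> + a (Suc k) w"
    and one_step: "\<And>k u v. k < n ==>
      (\<And>w w'. w \<in> space M ==> w' \<in> space M ==> T k w = T k w' ==> u w = (u w' :: real)) ==>
      (\<And>w w'. w \<in> space M ==> w' \<in> space M ==> T k w = T k w' ==> v w = (v w' :: real)) ==>
      expectation (\<lambda>w. if \<xi> (Suc k) w = 1 then u w else v w) =
      expectation (\<lambda>w. up_prob h (\<sigma> + a (Suc k) w) (a k w * \<xi> k w) * u w
        + (1 - up_prob h (\<sigma> + a (Suc k) w) (a k w * \<xi> k w)) * v w)"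
begin

definition det :: "nat => ('a => 'b) => bool" where
  "det k f \<longleftrightarrow> (\<forall>w\<in>space M. \<forall>w'\<in>space M. T k w = T k w' --> f w = f w')"

lemma detI: "(\<And>w w'. w \<in> space M ==> w' \<in> space M ==> T k w = T k w' ==> f w = f w') ==> det k f"
  unfolding det_def by blast

lemma detD: "det k f ==> w \<in> space M ==> w' \<in> space M ==> T k w = T k w' ==> f w = f w'"
  unfolding det_def by blast

lemma det_comp2:
  assumes "det k f" "det k g" shows "det k (\<lambda>w. F (f w) (g w))"
proof (rule detI)
  fix w w' assume *: "w \<in> space M" "w' \<in> space M" "T k w = T k w'"
  show "F (f w) (g w) = F (f w') (g w')"
    by (simp only: detD[OF assms(1) *] detD[OF assms(2) *])
qed

lemma det_mult: "det k f ==> det k g ==> det k (\<lambda>w. f w * g w)"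
  by (rule det_comp2)

text \<open>A function that is constant on the fibres of \<open>T k\<close> factors through it, by a
  choice of one point in each fibre; it inherits finitely many values and thereby
  measurability.\<close>

lemma det_simple: assumes "k \<le> n" "det k f" shows "simple_function M f"
proof -
  define g where "g t = f (SOME w. w \<in> space M \<and> T k w = t)" for t
  have "f w = (g \<circ> T k) w" if "w \<in> space M" for w
  proof -
    have "\<exists>w'. w' \<in> space M \<and> T k w' = T k w" using that by auto
    from someI_ex[OF this] show ?thesis unfolding g_def o_def
      using detD[OF assms(2) that, of "SOME w'. w' \<in> space M \<and> T k w' = T k w"] by simp
  qed
  then show ?thesis
    using simple_function_compose[OF T_simple[OF assms(1)], of g] simple_function_cong[of M f "g \<circ> T k"] by simp
qed

lemma simple_integrable:
  fixes f :: "'a => real"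
  assumes "simple_function M f" shows "integrable M f"
proof (rule integrable_const_bound)
  have "finite (f ` space M)" using assms by (simp add: simple_function_def)
  then show "AE w in M. norm (f w) \<le> Max (norm ` f ` space M)"
    by (intro AE_I2 Max_ge) auto
qed (rule borel_measurable_simple_function[OF assms])

lemma det_integrable: "k \<le> n ==> det k f ==> integrable M (f :: 'a => real)"
  by (rule simple_integrable[OF det_simple])

lemma T_det_le:
  assumes "j \<le> k" "k \<le> n" "w \<in> space M" "w' \<in> space M" "T k w = T k w'"
  shows "T j w = T j w'"
  using assms(1,2,5)
proof (induction k rule: dec_induct)
  case (step k)
  then show ?case using T_det[of k w w'] assms(3,4) by auto
qed auto

lemma det_mono: "det j f ==> j \<le> k ==> k \<le> n ==> det k f"
proof (rule detI)
  fix w w' assume *: "det j f" "j \<le> k" "k \<le> n" "w \<in> space M" "w' \<in> space M" "T k w = T k w'"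
  show "f w = f w'" by (rule detD[OF *(1,4,5) T_det_le[OF *(2-6)]])
qed

text \<open>Logarithm of the martingale relative to its initial value; the step scale
  \<open>h\<close> is later 1 / sqrt n.\<close>

definition log_mart :: "nat => 'a => real" where
  "log_mart k w = h * (\<sigma> * (\<Sum>i=1..k. \<xi> i w) + a k w * \<xi> k w)"

lemma det_log_mart:
  assumes "j \<le> k" "k \<le> n" shows "det k (log_mart j)"
proof (rule det_mono[OF _ assms], rule detI)
  fix w w' assume *: "w \<in> space M" "w' \<in> space M" "T j w = T j w'"
  have j: "j \<le> n" using assms by simp
  have "\<xi> i w = \<xi> i w'" if "i \<le> j" for i
    by (rule \<xi>_det[OF _ *(1,2) T_det_le[OF that j *]]) (use that j in simp)
  then have "(\<Sum>i=1..j. \<xi> i w) = (\<Sum>i=1..j. \<xi> i w')" "\<xi> j w = \<xi> j w'"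
    by (auto intro: sum.cong)
  then show "log_mart j w = log_mart j w'"
    by (simp only: log_mart_def a_det[OF j *])
qed

text \<open>The conditional expectation, given \<open>T k\<close>, of g applied to the next step of
  the log martingale.\<close>

definition next_mean :: "nat => 'a => (real => real) => real" where
  "next_mean k w g = step_mean h (\<sigma> + a (Suc k) w) (a k w * \<xi> k w) g"

lemma step_params:
  assumes "k < n" "w \<in> space M"
  shows "0 < \<sigma> + a (Suc k) w" "\<bar>a k w * \<xi> k w\<bar> \<le> \<sigma> + a (Suc k) w"
    "\<sigma> + a (Suc k) w + \<bar>a k w * \<xi> k w\<bar> \<le> \<sigma> + 2 * A"
proof -
  have "\<bar>a k w * \<xi> k w\<bar> \<le> \<bar>a k w\<bar>"
    using \<xi>_values[of k w] a_0[of w] assms by (cases k) auto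
  then show "0 < \<sigma> + a (Suc k) w" "\<bar>a k w * \<xi> k w\<bar> \<le> \<sigma> + a (Suc k) w"
    "\<sigma> + a (Suc k) w + \<bar>a k w * \<xi> k w\<bar> \<le> \<sigma> + 2 * A"
    using a_pos[of k w] a_gap[of k w] a_bound[of k w] a_bound[of "Suc k" w] assms by auto
qed

lemma det_next_mean:
  assumes k: "k < n" shows "det k (\<lambda>w. next_mean k w g)"
proof (rule detI)
  fix w w' assume *: "w \<in> space M" "w' \<in> space M" "T k w = T k w'"
  show "next_mean k w g = next_mean k w' g"
    by (simp only: next_mean_def a_det[OF less_imp_le[OF k] *] a_pred[OF k *] \<xi>_det[OF less_imp_le[OF k] *])
qed

text \<open>Testing against every f known at time k replaces conditioning. Given \<open>T k\<close>
  the step can only take the two values \<open>y 1\<close> and \<open>y (-1)\<close>, themselves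
  known at time k, which reduces the claim to \<open>one_step\<close>.\<close>

lemma one_step_mean:
  assumes k: "k < n" and f: "det k f"
  shows "expectation (\<lambda>w. f w * g (log_mart (Suc k) w - log_mart k w))
    = expectation (\<lambda>w. f w * next_mean k w g)"
proof -
  define y where "y e w = (e * (\<sigma> + a (Suc k) w) - a k w * \<xi> k w) * h" for e w
  have y: "det k (y e)" for e
  proof (rule detI)
    fix w w' assume *: "w \<in> space M" "w' \<in> space M" "T k w = T k w'"
    show "y e w = y e w'"
      by (simp only: y_def a_det[OF less_imp_le[OF k] *] a_pred[OF k *] \<xi>_det[OF less_imp_le[OF k] *])
  qed
  have "expectation (\<lambda>w. f w * g (log_mart (Suc k) w - log_mart k w))
    = expectation (\<lambda>w. if \<xi> (Suc k) w = 1 then f w * g (y 1 w) else f w * g (y (-1) w))"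
  proof (rule bochner_cong[OF refl])
    fix w assume "w \<in> space M"
    then have "\<xi> (Suc k) w \<in> {-1, 1}" using k by (intro \<xi>_values) auto
    then show "f w * g (log_mart (Suc k) w - log_mart k w)
      = (if \<xi> (Suc k) w = 1 then f w * g (y 1 w) else f w * g (y (-1) w))"
      by (auto simp: log_mart_def y_def algebra_simps)
  qed
  also have "\<dots> = expectation (\<lambda>w. f w * next_mean k w g)"
  proof (subst one_step[OF k])
    show "expectation (\<lambda>w. up_prob h (\<sigma> + a (Suc k) w) (a k w * \<xi> k w) * (f w * g (y 1 w))
        + (1 - up_prob h (\<sigma> + a (Suc k) w) (a k w * \<xi> k w)) * (f w * g (y (- 1) w)))
      = expectation (\<lambda>w. f w * next_mean k w g)"
      by (rule bochner_cong[OF refl])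
        (simp add: next_mean_def step_mean_def y_def algebra_simps)
  next
    fix w w' assume *: "w \<in> space M" "w' \<in> space M" "T k w = T k w'"
    show "f w * g (y 1 w) = f w' * g (y 1 w')" "f w * g (y (- 1) w) = f w' * g (y (- 1) w')"
      by (simp_all only: detD[OF f *] detD[OF y *])
  qed
  finally show ?thesis .
qed

lemma martingale:
  assumes k: "k < n" and f: "det k f"
  shows "expectation (\<lambda>w. f w * (exp (log_mart (Suc k) w) - exp (log_mart k w))) = 0"
proof -
  define f' where "f' w = f w * exp (log_mart k w)" for w
  have f': "det k f'" unfolding f'_def
    using f det_comp2[OF det_log_mart[of k k] det_log_mart[of k k], of "\<lambda>x _. exp x"] k by (intro det_mult) auto
  have "expectation (\<lambda>w. f w * (exp (log_mart (Suc k) w) - exp (log_mart k w)))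
    = expectation (\<lambda>w. f' w * (exp (log_mart (Suc k) w - log_mart k w) - 1))"
    by (rule bochner_cong) (simp_all add: f'_def algebra_simps exp_diff)
  also have "\<dots> = expectation (\<lambda>w. f' w * next_mean k w (\<lambda>y. exp y - 1))"
    by (rule one_step_mean[OF k f'])
  also have "\<dots> = expectation (\<lambda>w. 0)"
    using step_params[OF k] h_pos
    by (intro bochner_cong) (auto simp: next_mean_def step_mean_diff step_mean_const step_mean_exp)
  finally show ?thesis by simp
qed

lemma exp_maximal_inequality:
  assumes k: "k0 \<le> k1" "k1 \<le> n" and l: "1 \<le> \<bar>l\<bar>" "\<bar>l\<bar> * (\<sigma> + 2 * A) * h \<le> 1" and x: "0 \<le> x"
  shows "x * prob {w\<in>space M. \<exists>k\<in>{k0..k1}. x \<le> exp (l * (log_mart k w - log_mart k0 w))}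
    \<le> (1 + 6 * l\<^sup>2 * (\<sigma> + 2 * A)\<^sup>2 * h\<^sup>2) ^ (k1 - k0)"
proof -
  define N where "N k w = exp (l * (log_mart k w - log_mart k0 w))" for k w
  have detN: "det k (N j)" if "k0 \<le> j" "j \<le> k" "k \<le> n" for j k
    unfolding N_def using det_comp2[OF det_log_mart[of j k] det_log_mart[of k0 k], of "\<lambda>x y. exp (l * (x - y))"] that
    by auto
  have N_Suc: "expectation (\<lambda>w. f w * N (Suc k) w) = expectation (\<lambda>w. f w * N k w * next_mean k w (\<lambda>y. exp (l * y)))"
    if "k0 \<le> k" "k < k1" "det k f" for k and f :: "'a => real"
  proof -
    have "det k (\<lambda>w. f w * N k w)"
      using that detN[of k k] k by (intro det_mult) auto
    from one_step_mean[OF _ this, of "\<lambda>y. exp (l * y)"] that k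
    have "expectation (\<lambda>w. f w * N k w * exp (l * (log_mart (Suc k) w - log_mart k w))) =
       expectation (\<lambda>w. f w * N k w * next_mean k w (\<lambda>y. exp (l * y)))" by simp
    moreover have "f w * N k w * exp (l * (log_mart (Suc k) w - log_mart k w)) = f w * N (Suc k) w" for w
      by (simp add: N_def mult.assoc flip: exp_add) (simp add: algebra_simps)
    ultimately show ?thesis by simp
  qed
  have max: "x * prob {w\<in>space M. \<exists>k\<in>{k0..k1}. x \<le> N k w} \<le> expectation (N k1)"
  proof (rule maximal_inequality[OF k(1) x])
    fix i assume i: "k0 \<le> i" "i < k1"
    define f :: "'a => real" where "f = indicator {w \<in> space M. \<exists>l\<in>{k0..i}. x \<le> N l w}"
    have f: "det i f"
    proof (rule detI)
      fix w w' assume *: "w \<in> space M" "w' \<in> space M" "T i w = T i w'"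
      have "N l w = N l w'" if "l \<in> {k0..i}" for l
        by (rule detD[OF detN[of l i] *]) (use that i k in auto)
      then have "(\<exists>l\<in>{k0..i}. x \<le> N l w) \<longleftrightarrow> (\<exists>l\<in>{k0..i}. x \<le> N l w')" by simp
      then show "f w = f w'" using *(1,2) by (simp add: f_def indicator_def)
    qed
    have det1: "det i (\<lambda>w. f w * N i w)" using f detN[of i i] i k by (intro det_mult) auto
    have det2: "det i (\<lambda>w. f w * N i w * next_mean i w (\<lambda>y. exp (l * y)))"
      using det1 det_next_mean[of i "\<lambda>y. exp (l * y)"] i k by (intro det_mult[OF det1]) auto
    have "expectation (\<lambda>w. f w * N i w) \<le> expectation (\<lambda>w. f w * N i w * next_mean i w (\<lambda>y. exp (l * y)))"
    proof (intro integral_mono)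
      show "integrable M (\<lambda>w. f w * N i w)" "integrable M (\<lambda>w. f w * N i w * next_mean i w (\<lambda>y. exp (l * y)))"
        using det1 det2 i k by (auto intro: det_integrable[of i])
      fix w assume w: "w \<in> space M"
      have "1 \<le> next_mean i w (\<lambda>y. exp (l * y))"
        unfolding next_mean_def
        using step_params[of i w] w i k by (intro step_mean_exp_ge[OF h_pos _ _ order_refl l(1)]) auto
      then have "f w * N i w * 1 \<le> f w * N i w * next_mean i w (\<lambda>y. exp (l * y))"
        by (intro mult_left_mono) (auto simp: f_def N_def)
      then show "f w * N i w \<le> f w * N i w * next_mean i w (\<lambda>y. exp (l * y))" by simp
    qed
    then show "expectation (\<lambda>w. indicator {w \<in> space M. \<exists>l\<in>{k0..i}. x \<le> N l w} w * N i w)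
      \<le> expectation (\<lambda>w. indicator {w \<in> space M. \<exists>l\<in>{k0..i}. x \<le> N l w} w * N (Suc i) w)"
      using N_Suc[OF i f] by (simp add: f_def)
  next
    fix i assume "k0 \<le> i" "i \<le> k1" then show "integrable M (N i)"
      using detN[of i i] k by (auto intro: det_integrable[of i])
  qed (auto simp: N_def)
  have moment: "expectation (N i) \<le> (1 + 6 * l\<^sup>2 * (\<sigma> + 2 * A)\<^sup>2 * h\<^sup>2) ^ (i - k0)" if "k0 \<le> i" "i \<le> k1" for i
    using that
  proof (induction i rule: dec_induct)
    case base
    show ?case by (simp add: N_def prob_space)
  next
    case (step i)
    let ?c = "1 + 6 * l\<^sup>2 * (\<sigma> + 2 * A)\<^sup>2 * h\<^sup>2"
    have "expectation (N (Suc i)) = expectation (\<lambda>w. N i w * next_mean i w (\<lambda>y. exp (l * y)))"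
      using N_Suc[of i "\<lambda>_. 1"] step by (simp add: det_def)
    also have "\<dots> \<le> expectation (\<lambda>w. N i w * ?c)"
    proof (rule integral_mono)
      have "det i (\<lambda>w. N i w * next_mean i w (\<lambda>y. exp (l * y)))"
        using detN[of i i] det_next_mean[of i "\<lambda>y. exp (l * y)"] step k by (intro det_mult) auto
      then show "integrable M (\<lambda>w. N i w * next_mean i w (\<lambda>y. exp (l * y)))"
        using step k by (auto intro: det_integrable[of i])
      show "integrable M (\<lambda>w. N i w * ?c)"
        using step k detN[of i i] by (auto intro: det_integrable[of i])
      fix w assume w: "w \<in> space M"
      then show "N i w * next_mean i w (\<lambda>y. exp (l * y)) \<le> N i w * ?c"
        unfolding next_mean_def
        using step_params[of i w] step k
        by (intro mult_left_mono step_mean_exp_le[OF h_pos _ _ _ l]) (auto simp: N_def)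
    qed
    also have "\<dots> = expectation (N i) * ?c" by simp
    also have "\<dots> \<le> ?c ^ (i - k0) * ?c" using step by (intro mult_right_mono) auto
    also have "\<dots> = ?c ^ (Suc i - k0)" using step by (simp add: Suc_diff_le)
    finally show ?case .
  qed
  from order.trans[OF max moment[OF k(1) order_refl]] show ?thesis by (simp add: N_def)
qed

end

section \<open>Monotone coupling with the normal distribution\<close>


abbreviation "\<Phi> \<equiv> cdf std_normal_distribution"

interpretation std_normal: real_distribution std_normal_distribution
  by (rule real_dist_normal_dist)

text \<open>The density is strictly positive, so an interval without mass would be a Lebesgue null
  set.\<close>

lemma cdf_normal_strict_mono:
  assumes "x < y" shows "\<Phi> x < \<Phi> y"
proof -
  have "0 < measure std_normal_distribution {x<..y}"
  proof (rule ccontr)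
    assume "\<not> ?thesis"
    then have "emeasure std_normal_distribution {x<..y} = 0"
      by (simp add: std_normal.emeasure_eq_measure zero_less_measure_iff)
    then have "(\<integral>\<^sup>+z. ennreal (std_normal_density z) * indicator {x<..y} z \<partial>lborel) = 0"
      by (simp add: emeasure_density)
    then have "AE z in lborel. ennreal (std_normal_density z) * indicator {x<..y} z = 0"
      by (simp add: nn_integral_0_iff_AE)
    then have "AE z in lborel. z \<notin> {x<..y}"
      by eventually_elim (auto simp: indicator_def std_normal_density_def split: if_splits)
    then have "emeasure lborel {x<..y} = 0"
    proof -
      have "{z \<in> space lborel. \<not> z \<notin> {x<..y}} = {x<..y}" by auto
      from AE_iff_measurable[OF _ this] \<open>AE z in lborel. z \<notin> {x<..y}\<close> show ?thesis by simp
    qed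
    with assms show False by simp
  qed
  then show ?thesis
    using std_normal.cdf_diff_eq[OF assms] by linarith
qed

lemma cdf_normal_le_iff: "\<Phi> x \<le> \<Phi> y \<longleftrightarrow> x \<le> y"
  by (metis cdf_normal_strict_mono linorder_not_le order_le_less)

lemma cdf_normal_pos: "0 < \<Phi> x" and cdf_normal_less_1: "\<Phi> x < 1"
  using cdf_normal_strict_mono[of "x - 1" x] cdf_normal_strict_mono[of x "x + 1"]
    std_normal.cdf_nonneg[of "x - 1"] std_normal.cdf_bounded_prob[of "x + 1"] by auto

lemma isCont_cdf_normal: "isCont \<Phi> x"
proof -
  have "emeasure std_normal_distribution {x} = 0"
    by (subst emeasure_density) (auto intro!: nn_integral_zero' AE_I'[of "{x}"])
  then show ?thesis
    by (simp add: std_normal.isCont_cdf measure_def)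
qed

lemma normal_quantile_exists:
  assumes "0 < c" "c < 1" shows "\<exists>g. \<Phi> g = c"
proof -
  have "\<exists>x. \<Phi> x < c"
    using eventually_happens'[OF trivial_limit_at_bot_linorder order_tendstoD(2)[OF std_normal.cdf_lim_at_bot assms(1)]] .
  moreover have "\<exists>y. c < \<Phi> y"
    using eventually_happens'[OF trivial_limit_at_top_linorder order_tendstoD(1)[OF std_normal.cdf_lim_at_top_prob assms(2)]] .
  ultimately obtain x y where xy: "\<Phi> x < c" "c < \<Phi> y" by auto
  then have "x \<le> y" using cdf_normal_le_iff[of x y] by simp
  then show ?thesis
    using IVT[of \<Phi> x c y] isCont_cdf_normal xy by auto
qed

text \<open>\<Phi> is uniformly distributed under the normal law. The values c = 0 and c = 1 are
  included because partial sums of weights reach them.\<close>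

lemma measure_cdf_normal_le:
  assumes "0 \<le> c" "c \<le> 1"
  shows "{g. \<Phi> g \<le> c} \<in> sets borel" "measure std_normal_distribution {g. \<Phi> g \<le> c} = c"
proof -
  consider "c = 0" | "c = 1" | "0 < c" "c < 1" using assms by linarith
  then have "{g. \<Phi> g \<le> c} \<in> sets borel \<and> measure std_normal_distribution {g. \<Phi> g \<le> c} = c"
  proof cases
    case 1 then have "{g. \<Phi> g \<le> c} = {}" using cdf_normal_pos by (auto simp: not_le)
    then show ?thesis using 1 by simp
  next
    case 2 then have "{g. \<Phi> g \<le> c} = UNIV" using cdf_normal_less_1 by (auto intro: less_imp_le)
    then show ?thesis using 2 std_normal.prob_space by simp
  next
    case 3
    then obtain g0 where "\<Phi> g0 = c" using normal_quantile_exists by blast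
    then have "{g. \<Phi> g \<le> c} = {..g0}" using cdf_normal_le_iff by auto
    then show ?thesis using \<open>\<Phi> g0 = c\<close> by (simp add: cdf_def)
  qed
  then show "{g. \<Phi> g \<le> c} \<in> sets borel" "measure std_normal_distribution {g. \<Phi> g \<le> c} = c" by auto
qed

text \<open>The quantile transform of a weighted finite set, ordered by \<open>Z\<close>.\<close>

lemma quantile_map_exists:
  fixes Z :: "'x => real" and w :: "'x => real"
  assumes "finite X" "\<And>x. x \<in> X ==> 0 \<le> w x" "sum w X \<le> 1"
  shows "\<exists>H. (\<forall>x\<in>X. {g. \<Phi> g \<le> sum w X \<and> H g = x} \<in> sets borel \<and>
      measure std_normal_distribution {g. \<Phi> g \<le> sum w X \<and> H g = x} = w x) \<and>
    (\<forall>g. \<Phi> g \<le> sum w X --> H g \<in> X \<and> \<Phi> g \<le> sum w {x\<in>X. Z x \<le> Z (H g)} \<and>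
      sum w {x\<in>X. Z x < Z (H g)} \<le> \<Phi> g)"
  using assms
proof (induction X rule: finite_ranking_induct[where f = Z])
  case empty
  then show ?case using cdf_normal_pos by (auto simp: not_le)
next
  case (insert x X)
  show ?case
  \<comment> \<open>The induction inserts points in increasing order of \<open>Z\<close>, but may
    insert one that is already present.\<close>
  proof (cases "x \<in> X")
    case True
    then show ?thesis using insert by (simp add: insert_absorb)
  next
    case xX: False
  note hyps = insert.hyps xX
  define t where "t = sum w X"
  have xX: "sum w (insert x X) = t + w x" using insert xX by (simp add: t_def)
  have t: "0 \<le> t" "0 \<le> w x" "t + w x \<le> 1"
    using insert xX by (auto simp: t_def intro: sum_nonneg)
  have "t \<le> 1" using t by linarith
  obtain H where
    H1: "\<And>y. y \<in> X ==> {g. \<Phi> g \<le> t \<and> H g = y} \<in> sets borel"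
      "\<And>y. y \<in> X ==> measure std_normal_distribution {g. \<Phi> g \<le> t \<and> H g = y} = w y" and
    H2: "\<And>g. \<Phi> g \<le> t ==> H g \<in> X" "\<And>g. \<Phi> g \<le> t ==> \<Phi> g \<le> sum w {x\<in>X. Z x \<le> Z (H g)}"
      "\<And>g. \<Phi> g \<le> t ==> sum w {x\<in>X. Z x < Z (H g)} \<le> \<Phi> g"
    using insert.IH insert.prems t unfolding t_def by (auto simp: xX)
  \<comment> \<open>The new point has the largest \<open>Z\<close> so far and receives the quantile
    levels above t up to t + w x.\<close>
  define H' where "H' g = (if \<Phi> g \<le> t then H g else x)" for g
  have old: "{g. \<Phi> g \<le> t + w x \<and> H' g = y} = {g. \<Phi> g \<le> t \<and> H g = y}" if "y \<in> X" for y
    using that hyps t by (auto simp: H'_def)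
  have new: "{g. \<Phi> g \<le> t + w x \<and> H' g = x} = {g. \<Phi> g \<le> t + w x} - {g. \<Phi> g \<le> t}"
    using H2(1) hyps by (auto simp: H'_def split: if_splits)
  have "measure std_normal_distribution ({g. \<Phi> g \<le> t + w x} - {g. \<Phi> g \<le> t}) = w x"
    using measure_cdf_normal_le[of t] measure_cdf_normal_le[of "t + w x"] t \<open>t \<le> 1\<close>
    by (subst std_normal.finite_measure_Diff) auto
  moreover have "{g. \<Phi> g \<le> t + w x} - {g. \<Phi> g \<le> t} \<in> sets borel"
    using measure_cdf_normal_le[of t] measure_cdf_normal_le[of "t + w x"] t \<open>t \<le> 1\<close> by auto
  ultimately have A: "\<forall>y\<in>insert x X. {g. \<Phi> g \<le> t + w x \<and> H' g = y} \<in> sets borel \<and>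
      measure std_normal_distribution {g. \<Phi> g \<le> t + w x \<and> H' g = y} = w y"
    using H1 old new by auto
  have w0: "\<And>y. y \<in> insert x X ==> 0 \<le> w y" using insert.prems by auto
  have B: "H' g \<in> insert x X \<and> \<Phi> g \<le> sum w {y\<in>insert x X. Z y \<le> Z (H' g)} \<and>
      sum w {y\<in>insert x X. Z y < Z (H' g)} \<le> \<Phi> g" if g: "\<Phi> g \<le> t + w x" for g
  proof (cases "\<Phi> g \<le> t")
    case True
    have "sum w {y\<in>X. Z y \<le> Z (H g)} \<le> sum w {y\<in>insert x X. Z y \<le> Z (H g)}"
      using insert.hyps(1) w0 by (intro sum_mono2) auto
    moreover have "{y\<in>insert x X. Z y < Z (H g)} = {y\<in>X. Z y < Z (H g)}"
      using hyps(2) H2(1)[OF True] by force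
    ultimately show ?thesis using H2[OF True] True by (auto simp: H'_def)
  next
    case False
    have "{y\<in>insert x X. Z y \<le> Z x} = insert x X" using insert.hyps by auto
    moreover have "sum w {y\<in>insert x X. Z y < Z x} \<le> sum w X"
      using insert.hyps(1) w0 by (intro sum_mono2) auto
    ultimately show ?thesis using False g by (auto simp: H'_def xX t_def)
  qed
  show ?thesis unfolding xX using A B by (intro exI[of _ H']) auto
  qed
qed

text \<open>Both g and Z (H g) are quantiles at the same level \<Phi> g. Levy's continuity theorem
  gives convergence of the distribution functions, and since \<Phi> is continuous and strictly
  increasing the quantiles converge for every g, without an exceptional set.\<close>

lemma monotone_coupling:
  fixes X :: "nat => 'x set" and w Z :: "nat => 'x => real"
  assumes fin: "\<And>n. finite (X n)" and nonneg: "\<And>n x. x \<in> X n ==> 0 \<le> w n x"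
    and sum1: "\<And>n. sum (w n) (X n) = 1"
    and char: "\<And>u. (\<lambda>n. \<Sum>x\<in>X n. w n x *\<^sub>R iexp (u * Z n x)) \<longlonglongrightarrow> of_real (exp (- (u\<^sup>2) / 2))"
  obtains H where
    "\<And>n g. H n g \<in> X n"
    "\<And>n x. x \<in> X n ==> {g. H n g = x} \<in> sets borel"
    "\<And>n x. x \<in> X n ==> measure std_normal_distribution {g. H n g = x} = w n x"
    "\<And>g. (\<lambda>n. Z n (H n g)) \<longlonglongrightarrow> g"
proof -
  have "\<exists>H. (\<forall>x\<in>X n. {g. H g = x} \<in> sets borel \<and> measure std_normal_distribution {g. H g = x} = w n x) \<and>
    (\<forall>g. H g \<in> X n \<and> \<Phi> g \<le> sum (w n) {x\<in>X n. Z n x \<le> Z n (H g)} \<and>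
      sum (w n) {x\<in>X n. Z n x < Z n (H g)} \<le> \<Phi> g)" for n
  proof -
    have le1: "\<Phi> g \<le> 1" for g using cdf_normal_less_1[of g] by simp
    show ?thesis
      using quantile_map_exists[of "X n" "w n" "Z n"] fin[of n] nonneg[of _ n] sum1[of n]
      by (simp add: le1)
  qed
  then obtain H where
    H1: "\<And>n x. x \<in> X n ==> {g. H n g = x} \<in> sets borel"
      "\<And>n x. x \<in> X n ==> measure std_normal_distribution {g. H n g = x} = w n x" and
    H2: "\<And>n g. H n g \<in> X n" "\<And>n g. \<Phi> g \<le> sum (w n) {x\<in>X n. Z n x \<le> Z n (H n g)}"
      "\<And>n g. sum (w n) {x\<in>X n. Z n x < Z n (H n g)} \<le> \<Phi> g"
    using choice[of "\<lambda>n H. (\<forall>x\<in>X n. {g. H g = x} \<in> sets borel \<and> measure std_normal_distribution {g. H g = x} = w n x) \<and>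
    (\<forall>g. H g \<in> X n \<and> \<Phi> g \<le> sum (w n) {x\<in>X n. Z n x \<le> Z n (H g)} \<and>
      sum (w n) {x\<in>X n. Z n x < Z n (H g)} \<le> \<Phi> g)"] by blast
  \<comment> \<open>The weights are turned into a probability mass function in order to have
    measures whose characteristic functions are the given sums.\<close>
  define P where "P n = embed_pmf (\<lambda>x. if x \<in> X n then w n x else 0)" for n
  have pmf: "pmf (P n) x = (if x \<in> X n then w n x else 0)" for n x
    unfolding P_def
  proof (rule pmf_embed_pmf)
    have "(\<integral>\<^sup>+x. ennreal (if x \<in> X n then w n x else 0) \<partial>count_space UNIV)
      = (\<Sum>x\<in>X n. ennreal (w n x))"
      using fin[of n] by (subst nn_integral_count_space'[of "X n"]) auto
    also have "\<dots> = ennreal (sum (w n) (X n))" using nonneg by (intro sum_ennreal) auto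
    finally show "(\<integral>\<^sup>+x. ennreal (if x \<in> X n then w n x else 0) \<partial>count_space UNIV) = 1"
      using sum1[of n] by simp
  qed (use nonneg in auto)
  define \<mu> where "\<mu> n = distr (measure_pmf (P n)) borel (Z n)" for n
  interpret \<mu>: real_distribution "\<mu> n" for n
    unfolding \<mu>_def by (rule prob_space.real_distribution_distr) (auto intro: prob_space_measure_pmf)
  have int: "(\<integral>x. f x \<partial>measure_pmf (P n)) = (\<Sum>x\<in>X n. w n x *\<^sub>R f x)" for f :: "'x => complex" and n
    by (subst integral_measure_pmf[OF fin[of n]]) (auto simp: pmf set_pmf_eq split: if_splits)
  have "char (\<mu> n) u = (\<Sum>x\<in>X n. w n x *\<^sub>R iexp (u * Z n x))" for n u
    unfolding char_def \<mu>_def by (subst integral_distr) (auto simp: int)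
  then have weak: "weak_conv_m \<mu> std_normal_distribution"
    using char by (intro levy_continuity \<mu>.real_distribution_axioms std_normal.real_distribution_axioms)
      (simp add: char_std_normal_distribution)
  have cdf: "cdf (\<mu> n) x = sum (w n) {p\<in>X n. Z n p \<le> x}" for n x
  proof -
    have "cdf (\<mu> n) x = measure (measure_pmf (P n)) {p. Z n p \<le> x}"
      by (simp add: cdf_def \<mu>_def measure_distr vimage_def)
    also have "\<dots> = measure (measure_pmf (P n)) {p\<in>X n. Z n p \<le> x}"
      by (rule measure_eq_AE) (auto simp: AE_measure_pmf_iff set_pmf_eq pmf split: if_splits)
    also have "\<dots> = sum (w n) {p\<in>X n. Z n p \<le> x}"
      using fin[of n] by (subst measure_measure_pmf_finite) (auto simp: pmf)
    finally show ?thesis .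
  qed
  have lim: "(\<lambda>n. sum (w n) {p\<in>X n. Z n p \<le> x}) \<longlonglongrightarrow> \<Phi> x" for x
    using weak isCont_cdf_normal[of x] by (simp add: weak_conv_m_def weak_conv_def cdf)
  have "(\<lambda>n. Z n (H n g)) \<longlonglongrightarrow> g" for g
  proof (rule order_tendstoI)
    fix x assume "x < g"
    from order_tendstoD(2)[OF lim cdf_normal_strict_mono[OF this]]
    show "\<forall>\<^sub>F n in sequentially. x < Z n (H n g)"
    proof eventually_elim
      case (elim n)
      show ?case
      proof (rule ccontr)
        assume "\<not> ?thesis"
        then have "sum (w n) {p\<in>X n. Z n p \<le> Z n (H n g)} \<le> sum (w n) {p\<in>X n. Z n p \<le> x}"
          using fin[of n] nonneg[of _ n] by (intro sum_mono2) auto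
        with H2(2)[of g n] elim show False by linarith
      qed
    qed
  next
    fix x assume "g < x"
    \<comment> \<open>The lower bound on \<Phi> g concerns the strict event Z < Z (H g), which
      contains Z \<le> y for y < x.\<close>
    define y where "y = (g + x) / 2"
    have y: "g < y" "y < x" using \<open>g < x\<close> by (auto simp: y_def)
    from order_tendstoD(1)[OF lim cdf_normal_strict_mono[OF y(1)]]
    show "\<forall>\<^sub>F n in sequentially. Z n (H n g) < x"
    proof eventually_elim
      case (elim n)
      show ?case
      proof (rule ccontr)
        assume "\<not> ?thesis"
        then have "sum (w n) {p\<in>X n. Z n p \<le> y} \<le> sum (w n) {p\<in>X n. Z n p < Z n (H n g)}"
          using fin[of n] nonneg[of _ n] y by (intro sum_mono2) auto
        with H2(3)[of n g] elim show False by linarith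
      qed
    qed
  qed
  then show ?thesis using H1 H2(1) that by blast
qed

section \<open>Central limit theorem for chains\<close>


text \<open>The value 0 on the empty path only meets the coefficient with index 0, which vanishes
  for the profiles below.\<close>

definition last_step :: "real list => real" where
  "last_step p = (if p = [] then 0 else hd p)"

definition chain_up :: "real => real => (nat => real) => real list => real" where
  "chain_up \<sigma> h a p = up_prob h (\<sigma> + a (Suc (length p))) (a (length p) * last_step p)"

text \<open>Paths are stored in reverse: the head of the list is the most recent step.\<close>

primrec chain_weight :: "real => real => (nat => real) => real list => real" where
  "chain_weight \<sigma> h a [] = 1"
| "chain_weight \<sigma> h a (e # p) =
     chain_weight \<sigma> h a p * (if e = 1 then chain_up \<sigma> h a p else 1 - chain_up \<sigma> h a p)"

text \<open>Logarithm of the ratio by which the martingale has changed since the start of a block;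
  steps are counted from that start.\<close>

definition log_ratio :: "real => real => (nat => real) => real list => real" where
  "log_ratio \<sigma> h a p = h * (\<sigma> * sum_list p + a (length p) * last_step p)"

definition sign_paths :: "nat => real list set" where
  "sign_paths L = {p. length p = L \<and> set p \<subseteq> {-1, 1}}"

lemma finite_sign_paths: "finite (sign_paths L)"
  using finite_lists_length_eq[of "{-1, 1::real}" L] by (simp add: sign_paths_def conj_commute)

lemma sign_paths_0: "sign_paths 0 = {[]}"
  by (auto simp: sign_paths_def)

lemma sum_sign_paths_Suc:
  "(\<Sum>p\<in>sign_paths (Suc L). f p) = (\<Sum>p\<in>sign_paths L. f (1 # p) + (f (-1 # p) :: 'v::comm_monoid_add))"
proof -
  have "sign_paths (Suc L) = (#) 1 ` sign_paths L \<union> (#) (-1) ` sign_paths L"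
    by (auto simp: sign_paths_def length_Suc_conv)
  moreover have "(#) 1 ` sign_paths L \<inter> (#) (-1) ` sign_paths L = {}" by auto
  ultimately show ?thesis
    by (simp add: sum.union_disjoint finite_sign_paths sum.reindex sum.distrib)
qed

lemma last_step_values: "p \<in> sign_paths L ==> last_step p \<in> {-1, 0, 1}"
  by (cases p) (auto simp: sign_paths_def last_step_def)

lemma chain_step:
  fixes f :: "real list => 'v::real_vector"
  shows "(\<Sum>p\<in>sign_paths (Suc L). chain_weight \<sigma> h a p *\<^sub>R f p) =
    (\<Sum>p\<in>sign_paths L. chain_weight \<sigma> h a p *\<^sub>R
      (chain_up \<sigma> h a p *\<^sub>R f (1 # p) + (1 - chain_up \<sigma> h a p) *\<^sub>R f (-1 # p)))"
  unfolding sum_sign_paths_Suc by (simp add: scaleR_add_right)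

text \<open>The two transition weights add up to 1, so later steps sum out. Dropping from the head
  removes the most recent steps.\<close>

lemma chain_prefix:
  fixes f :: "real list => 'v::real_vector"
  assumes "j \<le> L"
  shows "(\<Sum>p\<in>sign_paths L. chain_weight \<sigma> h a p *\<^sub>R f (drop (L - j) p)) =
    (\<Sum>p\<in>sign_paths j. chain_weight \<sigma> h a p *\<^sub>R f p)"
  using assms
proof (induction L rule: dec_induct)
  case base
  show ?case by simp
next
  case (step L)
  have eq: "Suc L - j = Suc (L - j)" using step by simp
  show ?case
    unfolding chain_step eq drop_Suc_Cons using step.IH
    by (simp flip: scaleR_add_left)
qed

lemma chain_weight_sum: "(\<Sum>p\<in>sign_paths L. chain_weight \<sigma> h a p) = 1"
  using chain_prefix[of 0 L \<sigma> h a "\<lambda>_. 1::real"] by (simp add: sign_paths_0)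

text \<open>The coefficients within a single block, deterministic once the volatility level of the
  block is fixed.\<close>

locale chain_profile =
  fixes \<sigma> h A :: real and a :: "nat => real" and L :: nat
  assumes \<sigma>: "0 < \<sigma>" and h: "0 < h" and a_0: "a 0 = 0"
    and a_bound: "j \<le> L ==> \<bar>a j\<bar> \<le> A"
    and a_gap: "j < L ==> \<bar>a j\<bar> \<le> \<sigma> + a (Suc j)"
    and a_pos: "j < L ==> 0 < \<sigma> + a (Suc j)"
begin

lemma step_params:
  assumes "j < L" "p \<in> sign_paths j"
  shows "\<bar>a j * last_step p\<bar> \<le> \<sigma> + a (Suc j)"
    "\<sigma> + a (Suc j) + \<bar>a j * last_step p\<bar> \<le> \<sigma> + 2 * A"
    "(a j * last_step p)\<^sup>2 = (a j)\<^sup>2"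
proof -
  have "\<bar>a j * last_step p\<bar> = \<bar>a j\<bar>"
    using last_step_values[OF assms(2)] a_0 assms(2)
    by (cases p) (auto simp: sign_paths_def last_step_def)
  then show "\<bar>a j * last_step p\<bar> \<le> \<sigma> + a (Suc j)"
    "\<sigma> + a (Suc j) + \<bar>a j * last_step p\<bar> \<le> \<sigma> + 2 * A"
    "(a j * last_step p)\<^sup>2 = (a j)\<^sup>2"
    using a_gap[of j] a_bound[of j] a_bound[of "Suc j"] assms(1) by (auto simp: power2_eq_iff abs_if split: if_splits)
qed

lemma chain_weight_nonneg: "p \<in> sign_paths j ==> j \<le> L ==> 0 \<le> chain_weight \<sigma> h a p"
proof (induction p arbitrary: j)
  case (Cons e p)
  then have p: "p \<in> sign_paths (length p)" "length p < L" by (auto simp: sign_paths_def)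
  have "0 \<le> chain_up \<sigma> h a p" "chain_up \<sigma> h a p \<le> 1"
    unfolding chain_up_def
    by (intro up_prob_bounds h a_pos p step_params(1)[OF p(2,1)])+
  with Cons.IH[OF p(1)] p show ?case by simp
qed simp

definition char_fun :: "real => nat => complex" where
  "char_fun u j = (\<Sum>p\<in>sign_paths j. chain_weight \<sigma> h a p *\<^sub>R iexp (u * log_ratio \<sigma> h a p))"

lemma char_fun_Suc:
  assumes j: "j < L"
  shows "char_fun u (Suc j) = (\<Sum>p\<in>sign_paths j. chain_weight \<sigma> h a p *\<^sub>R
      (iexp (u * log_ratio \<sigma> h a p) *
       step_mean h (\<sigma> + a (Suc j)) (a j * last_step p) (\<lambda>y. exp (\<i> * of_real (u * y)))))"
  unfolding char_fun_def chain_step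
proof (rule sum.cong[OF refl])
  fix p assume p: "p \<in> sign_paths j"
  then have len: "length p = j" by (simp add: sign_paths_def)
  have e: "log_ratio \<sigma> h a (e # p) = log_ratio \<sigma> h a p + (e * (\<sigma> + a (Suc j)) - a j * last_step p) * h" for e
    by (simp add: log_ratio_def len last_step_def algebra_simps)
  have "iexp (u * log_ratio \<sigma> h a (e # p)) = iexp (u * log_ratio \<sigma> h a p) *
      exp (\<i> * of_real (u * ((e * (\<sigma> + a (Suc j)) - a j * last_step p) * h)))" for e
    unfolding e by (simp add: algebra_simps flip: exp_add)
  from this[of 1] this[of "-1"]
  show "chain_weight \<sigma> h a p *\<^sub>R
      (chain_up \<sigma> h a p *\<^sub>R iexp (u * log_ratio \<sigma> h a (1 # p)) +
       (1 - chain_up \<sigma> h a p) *\<^sub>R iexp (u * log_ratio \<sigma> h a (-1 # p))) =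
    chain_weight \<sigma> h a p *\<^sub>R
      (iexp (u * log_ratio \<sigma> h a p) *
       step_mean h (\<sigma> + a (Suc j)) (a j * last_step p) (\<lambda>y. exp (\<i> * of_real (u * y))))"
    unfolding step_mean_def chain_up_def len
    by (simp only: distrib_left mult_scaleR_right mult_1_left mult_minus1 minus_add_distrib)
qed

text \<open>Each step contributes a Gaussian factor with variance ((\<sigma> + a_(j+1))^2 - a_j^2)
  h^2. The previous sign enters the variance only through its square, so the factor is the same for
  all sign paths and can be pulled out of the sum; its modulus is at most 1, so the errors of the
  steps merely add.\<close>

lemma char_fun_approx:
  assumes Ch: "(\<sigma> + 2 * A) * h \<le> 1" and j: "j \<le> L"
  shows "norm (char_fun u j - exp (- (of_real (u\<^sup>2) + \<i> * of_real u) *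
        of_real ((\<Sum>i<j. (\<sigma> + a (Suc i))\<^sup>2 - (a i)\<^sup>2) * h\<^sup>2) / 2))
    \<le> real j * ((9 * (\<bar>u\<bar> + u\<^sup>2 + \<bar>u\<bar> ^ 3) + exp (u\<^sup>2) * (u\<^sup>2 + \<bar>u\<bar>)\<^sup>2) * ((\<sigma> + 2 * A) * h) ^ 3)"
  using j
proof (induction j)
  case 0
  show ?case by (simp add: char_fun_def sign_paths_0 log_ratio_def last_step_def)
next
  case (Suc j)
  then have j: "j < L" "j \<le> L" by auto
  define K where "K = (9 * (\<bar>u\<bar> + u\<^sup>2 + \<bar>u\<bar> ^ 3) + exp (u\<^sup>2) * (u\<^sup>2 + \<bar>u\<bar>)\<^sup>2) * ((\<sigma> + 2 * A) * h) ^ 3"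
  define v where "v i = ((\<sigma> + a (Suc i))\<^sup>2 - (a i)\<^sup>2) * h\<^sup>2" for i
  define E where "E x = exp (- (of_real (u\<^sup>2) + \<i> * of_real u) * of_real x / 2)" for x :: real
  have sumv: "(\<Sum>i<k. (\<sigma> + a (Suc i))\<^sup>2 - (a i)\<^sup>2) * h\<^sup>2 = sum v {..<k}" for k
    by (simp add: v_def sum_distrib_right)
  have "norm (char_fun u (Suc j) - char_fun u j * E (v j))
    = norm (\<Sum>p\<in>sign_paths j. chain_weight \<sigma> h a p *\<^sub>R (iexp (u * log_ratio \<sigma> h a p) *
       (step_mean h (\<sigma> + a (Suc j)) (a j * last_step p) (\<lambda>y. exp (\<i> * of_real (u * y))) - E (v j))))"
    unfolding char_fun_Suc[OF j(1)]
    by (simp only: char_fun_def sum_distrib_right sum_subtractf[symmetric] right_diff_distrib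
        scaleR_diff_right mult_scaleR_left)
  also have "\<dots> \<le> (\<Sum>p\<in>sign_paths j. chain_weight \<sigma> h a p * K)"
  proof (rule sum_norm_le)
    fix p assume p: "p \<in> sign_paths j"
    have "norm (step_mean h (\<sigma> + a (Suc j)) (a j * last_step p) (\<lambda>y. exp (\<i> * of_real (u * y))) - E (v j)) \<le> K"
      using step_mean_char[OF h a_pos[OF j(1)] step_params(1,2)[OF j(1) p] Ch, of u]
      unfolding K_def E_def v_def step_params(3)[OF j(1) p] .
    then show "norm (chain_weight \<sigma> h a p *\<^sub>R (iexp (u * log_ratio \<sigma> h a p) *
       (step_mean h (\<sigma> + a (Suc j)) (a j * last_step p) (\<lambda>y. exp (\<i> * of_real (u * y))) - E (v j)))) \<le> chain_weight \<sigma> h a p * K"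
      using chain_weight_nonneg[OF p j(2)] by (simp add: norm_mult mult_left_mono)
  qed
  also have "\<dots> = K" by (simp add: chain_weight_sum flip: sum_distrib_right)
  finally have 1: "norm (char_fun u (Suc j) - char_fun u j * E (v j)) \<le> K" .
  have "0 \<le> v j"
  proof -
    have "(a j)\<^sup>2 \<le> (\<sigma> + a (Suc j))\<^sup>2"
      using a_gap[OF j(1)] by (simp add: abs_le_square_iff[symmetric])
    then show ?thesis by (simp add: v_def)
  qed
  then have nE: "norm (E (v j)) \<le> 1" by (simp add: E_def)
  have "norm (char_fun u j * E (v j) - E (sum v {..<j}) * E (v j)) \<le> norm (char_fun u j - E (sum v {..<j})) * 1"
    unfolding left_diff_distrib[symmetric] norm_mult by (intro mult_left_mono nE) auto
  also have "\<dots> \<le> real j * K"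
    using Suc.IH[OF j(2)] unfolding sumv E_def K_def by simp
  finally have 2: "norm (char_fun u j * E (v j) - E (sum v {..<j}) * E (v j)) \<le> real j * K" .
  have 3: "E (sum v {..<Suc j}) = E (sum v {..<j}) * E (v j)"
    by (simp add: E_def flip: exp_add) (simp add: algebra_simps diff_divide_distrib add_divide_distrib)
  have "norm (char_fun u (Suc j) - E (sum v {..<Suc j})) \<le> K + real j * K"
    using norm_triangle_mono[OF 1 2] unfolding 3 by simp
  also have "\<dots> = real (Suc j) * K" by (simp add: algebra_simps)
  finally show ?case unfolding sumv E_def K_def .
qed

text \<open>The squares of the coefficients telescope, which leaves \<sigma>^2 + 2 \<sigma> a_(i+1)
  per step.\<close>

lemma sum_variance:
  "(\<Sum>i<L. (\<sigma> + a (Suc i))\<^sup>2 - (a i)\<^sup>2) = \<sigma>\<^sup>2 * real L + 2 * \<sigma> * (\<Sum>i<L. a (Suc i)) + (a L)\<^sup>2"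
proof -
  have "(\<Sum>i<L. (\<sigma> + a (Suc i))\<^sup>2 - (a i)\<^sup>2) = (\<Sum>i<L. \<sigma>\<^sup>2 + 2 * \<sigma> * a (Suc i) + ((a (Suc i))\<^sup>2 - (a i)\<^sup>2))"
    by (simp add: power2_eq_square algebra_simps)
  also have "\<dots> = \<sigma>\<^sup>2 * real L + 2 * \<sigma> * (\<Sum>i<L. a (Suc i)) + ((a L)\<^sup>2 - (a 0)\<^sup>2)"
    by (subst sum_lessThan_telescope[symmetric]) (simp add: sum.distrib sum_distrib_left)
  finally show ?thesis by (simp add: a_0)
qed

end

text \<open>The log ratio of a block is asymptotically normal with variance c^2 \<tau> and mean -c^2
  \<tau> / 2, which explains the shift and the scaling. The cubic errors of L steps add up to order
  L h^3, and this tends to 0 because L h^2 converges.\<close>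

lemma chain_clt:
  fixes h :: "nat => real" and a :: "nat => nat => real" and L :: "nat => nat"
  assumes profile: "\<And>n. chain_profile \<sigma> (h n) A (a n) (L n)"
    and h0: "h \<longlonglongrightarrow> 0" and L: "(\<lambda>n. real (L n) * (h n)\<^sup>2) \<longlonglongrightarrow> \<tau>"
    and V: "(\<lambda>n. (\<sigma>\<^sup>2 * real (L n) + 2 * \<sigma> * (\<Sum>i<L n. a n (Suc i)) + (a n (L n))\<^sup>2) * (h n)\<^sup>2) \<longlonglongrightarrow> c\<^sup>2 * \<tau>"
    and c: "c \<noteq> 0" and \<tau>: "0 < \<tau>"
  shows "(\<lambda>n. \<Sum>p\<in>sign_paths (L n). chain_weight \<sigma> (h n) (a n) p *\<^sub>R
      iexp (u * ((log_ratio \<sigma> (h n) (a n) p + c\<^sup>2 * \<tau> / 2) / (c * sqrt \<tau>))))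
    \<longlonglongrightarrow> of_real (exp (- (u\<^sup>2) / 2))"
proof -
  define t where "t = u / (c * sqrt \<tau>)"
  define C where "C = \<sigma> + 2 * A"
  define K where "K = 9 * (\<bar>t\<bar> + t\<^sup>2 + \<bar>t\<bar> ^ 3) + exp (t\<^sup>2) * (t\<^sup>2 + \<bar>t\<bar>)\<^sup>2"
  define V' where "V' n = (\<sigma>\<^sup>2 * real (L n) + 2 * \<sigma> * (\<Sum>i<L n. a n (Suc i)) + (a n (L n))\<^sup>2) * (h n)\<^sup>2" for n
  define \<phi> where "\<phi> n = chain_profile.char_fun \<sigma> (h n) (a n) t (L n)" for n
  have "(\<lambda>n. C * h n) \<longlonglongrightarrow> C * 0" by (intro tendsto_intros h0)
  then have ev: "\<forall>\<^sub>F n in sequentially. C * h n < 1" by (intro order_tendstoD(2)) auto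
  have bound: "\<forall>\<^sub>F n in sequentially. norm (\<phi> n - exp (- (of_real (t\<^sup>2) + \<i> * of_real t) * of_real (V' n) / 2))
      \<le> real (L n) * (K * (C * h n) ^ 3)"
    using ev
  proof eventually_elim
    case (elim n)
    interpret chain_profile \<sigma> "h n" A "a n" "L n" by (rule profile)
    show ?case
      using char_fun_approx[of "L n" t] elim
      unfolding \<phi>_def V'_def K_def C_def sum_variance by simp
  qed
  have "(\<lambda>n. (real (L n) * (h n)\<^sup>2) * (K * C ^ 3 * h n)) \<longlonglongrightarrow> \<tau> * (K * C ^ 3 * 0)"
    by (intro tendsto_intros L h0)
  then have "(\<lambda>n. real (L n) * (K * (C * h n) ^ 3)) \<longlonglongrightarrow> 0"
    by (simp add: power2_eq_square power3_eq_cube algebra_simps)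
  then have "(\<lambda>n. \<phi> n - exp (- (of_real (t\<^sup>2) + \<i> * of_real t) * of_real (V' n) / 2)) \<longlonglongrightarrow> 0"
    by (rule Lim_null_comparison[OF bound])
  moreover have "(\<lambda>n. exp (- (of_real (t\<^sup>2) + \<i> * of_real t) * of_real (V' n) / 2))
     \<longlonglongrightarrow> exp (- (of_real (t\<^sup>2) + \<i> * of_real t) * of_real (c\<^sup>2 * \<tau>) / 2)"
    by (intro tendsto_intros tendsto_of_real V[folded V'_def]) simp_all
  ultimately have lim: "\<phi> \<longlonglongrightarrow> exp (- (of_real (t\<^sup>2) + \<i> * of_real t) * of_real (c\<^sup>2 * \<tau>) / 2)"
    by (rule Lim_transform[rotated])
  have ct: "c * sqrt \<tau> \<noteq> 0" using c \<tau> by simp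
  have "(\<Sum>p\<in>sign_paths (L n). chain_weight \<sigma> (h n) (a n) p *\<^sub>R
      iexp (u * ((log_ratio \<sigma> (h n) (a n) p + c\<^sup>2 * \<tau> / 2) / (c * sqrt \<tau>)))) = iexp (t * (c\<^sup>2 * \<tau> / 2)) * \<phi> n" for n
  proof -
    interpret chain_profile \<sigma> "h n" A "a n" "L n" by (rule profile)
    have "iexp (u * ((log_ratio \<sigma> (h n) (a n) p + c\<^sup>2 * \<tau> / 2) / (c * sqrt \<tau>)))
      = iexp (t * (c\<^sup>2 * \<tau> / 2)) * iexp (t * log_ratio \<sigma> (h n) (a n) p)" for p
    proof -
      have "u * ((log_ratio \<sigma> (h n) (a n) p + c\<^sup>2 * \<tau> / 2) / (c * sqrt \<tau>))
        = t * (c\<^sup>2 * \<tau> / 2) + t * log_ratio \<sigma> (h n) (a n) p"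
        using ct by (simp add: t_def add_divide_distrib algebra_simps)
      then show ?thesis by (simp add: exp_add distrib_left)
    qed
    then show ?thesis by (simp add: \<phi>_def char_fun_def sum_distrib_left)
  qed
  moreover have "(\<lambda>n. iexp (t * (c\<^sup>2 * \<tau> / 2)) * \<phi> n) \<longlonglongrightarrow>
      iexp (t * (c\<^sup>2 * \<tau> / 2)) * exp (- (of_real (t\<^sup>2) + \<i> * of_real t) * of_real (c\<^sup>2 * \<tau>) / 2)"
    by (intro tendsto_intros lim)
  moreover have "iexp (t * (c\<^sup>2 * \<tau> / 2)) * exp (- (of_real (t\<^sup>2) + \<i> * of_real t) * of_real (c\<^sup>2 * \<tau>) / 2)
     = of_real (exp (- (u\<^sup>2) / 2))"
  proof -
    have "t\<^sup>2 * (c\<^sup>2 * \<tau>) = u\<^sup>2"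
      using ct \<tau> by (simp add: t_def power_divide power_mult_distrib)
    then have "complex_of_real (t\<^sup>2 * (c\<^sup>2 * \<tau>)) = of_real (u\<^sup>2)" by simp
    then show ?thesis
      by (simp add: algebra_simps add_divide_distrib diff_divide_distrib flip: exp_add exp_of_real)
  qed
  ultimately show ?thesis by (simp only:)
qed

section \<open>Chains driven by Gaussian increments\<close>


definition excess :: "real => real => real" where
  "excess \<sigma> c = (c\<^sup>2 - \<sigma>\<^sup>2) / (2 * \<sigma>)"

text \<open>The last \<open>r\<close> steps of a block bring the deviation back to \<open>0\<close>, so that the
  martingale agrees with the stock price at the block ends.\<close>

definition profile :: "real => nat => nat => real => nat => real" where
  "profile \<sigma> r L c j = (if j = 0 then 0 else excess \<sigma> c * min 1 (real (L - j) / real r))"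

text \<open>Even volatility 0 asks for no less than -\<sigma>/2, so \<sigma> plus the excess stays
  at least \<sigma>/2.\<close>

lemma excess_ge: "0 < \<sigma> ==> - (\<sigma> / 2) \<le> excess \<sigma> c"
  by (simp add: excess_def field_simps power2_eq_square)

lemma excess_bound:
  assumes "0 < \<sigma>" "\<bar>c\<bar> \<le> B" shows "\<bar>excess \<sigma> c\<bar> \<le> (B\<^sup>2 + \<sigma>\<^sup>2) / (2 * \<sigma>)"
proof -
  have "c\<^sup>2 \<le> B\<^sup>2" using assms(2) by (simp add: power2_le_iff_abs_le)
  then have "\<bar>c\<^sup>2 - \<sigma>\<^sup>2\<bar> \<le> B\<^sup>2 + \<sigma>\<^sup>2" using zero_le_power2[of c] zero_le_power2[of \<sigma>] by (smt (verit))
  then show ?thesis using assms by (simp add: excess_def divide_right_mono)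
qed

lemma profile_last: "profile \<sigma> r L c L = 0"
  by (simp add: profile_def)

text \<open>For a nonnegative excess the ramp falls by at most A / r \<le> \<sigma>/2 per step, by
  the choice of r. For a negative one |a_j| \<le> \<sigma>/2 \<le> \<sigma> + a_(j+1). At the first
  step a_0 = 0, so the jump up to the full excess is admissible.\<close>

lemma chain_profile_profile:
  assumes \<sigma>: "0 < \<sigma>" and h: "0 < h" and A: "\<bar>excess \<sigma> c\<bar> \<le> A" and r: "2 * A \<le> \<sigma> * real r" "0 < r"
  shows "chain_profile \<sigma> h A (profile \<sigma> r L c) L"
proof
  define x where "x = excess \<sigma> c"
  define t where "t j = min 1 (real (L - j) / real r)" for j
  have t: "0 \<le> t j" "t j \<le> 1" for j by (auto simp: t_def)
  have tS: "t j - t (Suc j) \<le> 1 / real r" if "j < L" for j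
  proof -
    have "real (L - j) / real r = real (L - Suc j) / real r + 1 / real r"
      using that by (simp add: of_nat_diff flip: add_divide_distrib)
    moreover have "min 1 x - min 1 y \<le> z" if "x = y + z" "0 \<le> z" for x y z :: real
      using that by (auto simp: min_def)
    ultimately show ?thesis unfolding t_def by simp
  qed
  have xge: "- (\<sigma> / 2) \<le> x" using excess_ge[OF \<sigma>] by (simp add: x_def)
  have xt: "- (\<sigma> / 2) \<le> x * t j" for j
  proof (cases "x \<ge> 0")
    case True
    then have "0 \<le> x * t j" using t by simp
    then show ?thesis using \<sigma> by linarith
  next
    case False
    then have "x * 1 \<le> x * t j" using t[of j] by (intro mult_left_mono_neg) auto
    then show ?thesis using xge by linarith
  qed
  have pr: "profile \<sigma> r L c j = (if j = 0 then 0 else x * t j)" for j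
    by (simp add: profile_def x_def t_def)
  show "\<bar>profile \<sigma> r L c j\<bar> \<le> A" for j
  proof -
    have "\<bar>x * t j\<bar> \<le> \<bar>x\<bar> * 1" unfolding abs_mult using t[of j] by (intro mult_left_mono) auto
    then show ?thesis using A by (auto simp: pr x_def)
  qed
  show "0 < \<sigma> + profile \<sigma> r L c (Suc j)" for j
    using xt[of "Suc j"] \<sigma> by (simp add: pr)
  show "\<bar>profile \<sigma> r L c j\<bar> \<le> \<sigma> + profile \<sigma> r L c (Suc j)" if j: "j < L" for j
  proof (cases "j = 0")
    case True then show ?thesis using xt[of "Suc j"] \<sigma> by (simp add: pr)
  next
    case False
    show ?thesis
    proof (cases "x \<ge> 0")
      case True
      have "x * (t j - t (Suc j)) \<le> x * (1 / real r)"
        using True tS[OF j] by (intro mult_left_mono) auto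
      also have "\<dots> \<le> \<sigma>"
        using A r \<sigma> True by (simp add: x_def divide_simps mult.commute)
      finally show ?thesis using False True t[of j] by (simp add: pr algebra_simps)
    next
      case neg: False
      have "x * t j \<le> 0" using neg t[of j] by (simp add: mult_nonpos_nonneg)
      then show ?thesis using False xt[of j] xt[of "Suc j"] by (simp add: pr)
    qed
  qed
qed (use \<sigma> h in \<open>auto simp: profile_def\<close>)

text \<open>Only the last r coefficients of the block can differ from the excess, each by at most
  A.\<close>

lemma profile_sum:
  assumes A: "\<bar>excess \<sigma> c\<bar> \<le> A" and r: "0 < r"
  shows "\<bar>(\<Sum>i<L. profile \<sigma> r L c (Suc i)) - real L * excess \<sigma> c\<bar> \<le> real r * A"
proof -
  have A0: "0 \<le> A" using A by linarith
  have "\<bar>(\<Sum>i<L. profile \<sigma> r L c (Suc i)) - real L * excess \<sigma> c\<bar>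
     = \<bar>\<Sum>i<L. profile \<sigma> r L c (Suc i) - excess \<sigma> c\<bar>" by (simp add: sum_subtractf)
  also have "\<dots> \<le> (\<Sum>i<L. if L - Suc i < r then A else 0)"
  proof (rule order.trans[OF sum_abs], rule sum_mono)
    fix i
    define t where "t = min 1 (real (L - Suc i) / real r)"
    have t: "0 \<le> t" "t \<le> 1" "\<not> L - Suc i < r ==> t = 1"
      using r by (auto simp: t_def min_def divide_simps)
    have "\<bar>excess \<sigma> c * t - excess \<sigma> c\<bar> = \<bar>excess \<sigma> c\<bar> * (1 - t)"
    proof -
      have "excess \<sigma> c * t - excess \<sigma> c = - (excess \<sigma> c * (1 - t))" by (simp add: algebra_simps)
      then show ?thesis using t by (simp add: abs_mult)
    qed
    also have "\<dots> \<le> A * 1" using t A A0 by (intro mult_mono) auto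
    finally have "\<bar>excess \<sigma> c * t - excess \<sigma> c\<bar> \<le> A" by simp
    with t(3) show "\<bar>profile \<sigma> r L c (Suc i) - excess \<sigma> c\<bar> \<le> (if L - Suc i < r then A else 0)"
      unfolding profile_def t_def[symmetric] by (cases "L - Suc i < r") auto
  qed
  also have "\<dots> = A * real (card {i. i < L \<and> L - Suc i < r})"
    by (simp add: sum.If_cases Int_def lessThan_def)
  also have "\<dots> \<le> A * real r"
  proof (intro mult_left_mono A0)
    have "card {i. i < L \<and> L - Suc i < r} \<le> card {..<r}"
      by (rule card_inj_on_le[where f = "\<lambda>i. L - Suc i"]) (auto simp: inj_on_def)
    then show "real (card {i. i < L \<and> L - Suc i < r}) \<le> real r" by simp
  qed
  finally show ?thesis by (simp add: mult.commute)
qed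

section \<open>Division of the n steps into m blocks\<close>

definition block_start :: "nat => nat => nat => nat" where
  "block_start m n i = (i * n) div m"

abbreviation block_length :: "nat => nat => nat => nat" where
  "block_length m n i \<equiv> block_start m n (Suc i) - block_start m n i"

lemma block_start_bounds:
  assumes "0 < m"
  shows "real (block_start m n i) \<le> real i * real n / real m"
    "real i * real n / real m < real (block_start m n i) + 1"
proof -
  have eq: "real (i * n) = real (block_start m n i) * real m + real (i * n mod m)"
    unfolding block_start_def by (metis div_mult_mod_eq of_nat_add of_nat_mult)
  have "real (i * n mod m) < real m" using assms by simp
  then show "real (block_start m n i) \<le> real i * real n / real m"
    "real i * real n / real m < real (block_start m n i) + 1"
    using eq assms by (auto simp: field_simps)
qed

lemma block_start_0 [simp]: "block_start m n 0 = 0"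
  by (simp add: block_start_def)

lemma block_start_m [simp]: "0 < m ==> block_start m n m = n"
  by (simp add: block_start_def)

lemma block_start_mono: "i \<le> j ==> block_start m n i \<le> block_start m n j"
  by (simp add: block_start_def div_le_mono)

text \<open>Block i runs at the level \<kappa> i, known from \<open>G i\<close>, and is driven by
  the normalised increment \<open>D i\<close>. \<open>D_indep\<close> expresses two facts at once:
  \<open>D i\<close> is standard normal (take for E the whole space) and independent of
  \<open>G i\<close>.\<close>

locale block_data = prob_space M for M :: "'a measure" +
  fixes m :: nat and \<sigma> B :: real and V :: "real set"
    and G :: "nat => 'a measure" and \<kappa> D :: "nat => 'a => real"
  assumes m: "0 < m" and \<sigma>: "0 < \<sigma>"
    and G_sets: "i \<le> m ==> sets (G i) \<subseteq> sets M" and G_space: "i \<le> m ==> space (G i) = space M"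
    and G_mono: "i < m ==> sets (G i) \<subseteq> sets (G (Suc i))"
    and V: "finite V" "0 \<notin> V" "\<And>c. c \<in> V ==> \<bar>c\<bar> \<le> B"
    and \<kappa>_meas: "i < m ==> \<kappa> i \<in> borel_measurable (G i)"
    and \<kappa>_V: "i < m ==> w \<in> space M ==> \<kappa> i w \<in> V"
    and D_meas: "i < m ==> D i \<in> borel_measurable (G (Suc i))"
    and D_indep: "i < m ==> E \<in> sets (G i) ==> U \<in> sets borel ==>
       prob (E \<inter> {w\<in>space M. D i w \<in> U}) = prob E * measure std_normal_distribution U"
begin

definition A :: real where "A = (B\<^sup>2 + \<sigma>\<^sup>2) / (2 * \<sigma>)"

definition r :: nat where "r = Suc (nat \<lceil>2 * A / \<sigma>\<rceil>)"

lemma r: "2 * A \<le> \<sigma> * real r" "0 < r"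
proof -
  have "2 * A / \<sigma> \<le> real r" unfolding r_def by linarith
  then show "2 * A \<le> \<sigma> * real r" using \<sigma> by (simp add: field_simps)
qed (simp add: r_def)

lemma chain_profile: "c \<in> V ==> 0 < h ==> chain_profile \<sigma> h A (profile \<sigma> r L c) L"
  unfolding A_def by (intro chain_profile_profile \<sigma> excess_bound V r[unfolded A_def])

lemma G_mono_le: "i \<le> j ==> j \<le> m ==> sets (G i) \<subseteq> sets (G j)"
proof (induction j rule: dec_induct)
  case (step j)
  then show ?case using G_mono[of j] by auto
qed simp

lemma simple_G_mono:
  assumes "simple_function (G i) f" "i \<le> j" "j \<le> m" shows "simple_function (G j) f"
  using assms G_mono_le[of i j] G_space[of i] G_space[of j] by (auto simp: simple_function_def)

lemma simple_G_M: "simple_function (G i) f ==> i \<le> m ==> simple_function M f"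
  using G_sets[of i] G_space[of i] by (auto simp: simple_function_def)

lemma simple_\<kappa>: "i < m ==> simple_function (G i) (\<kappa> i)"
proof (rule simple_function_borel_measurable[OF \<kappa>_meas])
  assume "i < m"
  then have "\<kappa> i ` space (G i) \<subseteq> V" using \<kappa>_V G_space[of i] by auto
  then show "finite (\<kappa> i ` space (G i))" using V(1) finite_subset by blast
qed

end

text \<open>\<open>H i c\<close> converts a standard normal value into the signs of block i at level
  c. The law of the signs is exact for the given n; only the closeness of the resulting log ratio to
  the normal value is asymptotic and is dealt with separately.\<close>

locale block_coupling = block_data M m \<sigma> B V G \<kappa> D
  for M :: "'a measure" and m :: nat and \<sigma> B :: real and V :: "real set"
    and G :: "nat => 'a measure" and \<kappa> D :: "nat => 'a => real" +
  fixes n :: nat and H :: "nat => real => real => real list"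
  assumes n: "0 < n"
    and H_paths: "i < m ==> c \<in> V ==> H i c g \<in> sign_paths (block_length m n i)"
    and H_meas: "i < m ==> c \<in> V ==> p \<in> sign_paths (block_length m n i) ==> {g. H i c g = p} \<in> sets borel"
    and H_law: "i < m ==> c \<in> V ==> p \<in> sign_paths (block_length m n i) ==>
      measure std_normal_distribution {g. H i c g = p} =
        chain_weight \<sigma> (1 / sqrt n) (profile \<sigma> r (block_length m n i) c) p"
begin

abbreviation "b \<equiv> block_start m n"
abbreviation "len \<equiv> block_length m n"
abbreviation "h \<equiv> 1 / sqrt (real n)"
abbreviation "prf i \<equiv> profile \<sigma> r (len i)"

definition path :: "nat => 'a => real list" where
  "path i w = H i (\<kappa> i w) (D i w)"

primrec full :: "nat => 'a => real list" where
  "full 0 w = []"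
| "full (Suc i) w = path i w @ full i w"

text \<open>Newest first, like \<open>full\<close>. The list \<open>levels (Suc i)\<close> already
  contains the level of block i, which is known when that block begins.\<close>

primrec levels :: "nat => 'a => real list" where
  "levels 0 w = []"
| "levels (Suc i) w = \<kappa> i w # levels i w"

lemma path_in: "i < m ==> w \<in> space M ==> path i w \<in> sign_paths (len i)"
  unfolding path_def by (intro H_paths \<kappa>_V)

lemma full_in: "i \<le> m ==> w \<in> space M ==> full i w \<in> sign_paths (b i)"
proof (induction i)
  case (Suc i)
  then show ?case using path_in[of i w] block_start_mono[of i "Suc i" m n]
    by (auto simp: sign_paths_def)
qed (simp add: sign_paths_def)

text \<open>On E the level is constant, so the event restricts \<open>D i\<close> alone, and
  independence of the past applies.\<close>

lemma path_event:
  assumes i: "i < m" and c: "c \<in> V" and p: "p \<in> sign_paths (len i)" and E: "E \<in> sets (G i)"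
    and Ec: "\<And>w. w \<in> E ==> \<kappa> i w = c"
  shows "E \<inter> {w\<in>space M. path i w = p} \<in> sets (G (Suc i))"
    "prob (E \<inter> {w\<in>space M. path i w = p}) = prob E * chain_weight \<sigma> h (prf i c) p"
proof -
  have eq: "E \<inter> {w\<in>space M. path i w = p} = E \<inter> {w\<in>space M. D i w \<in> {g. H i c g = p}}"
    using Ec by (auto simp: path_def)
  have "D i -` {g. H i c g = p} \<inter> space (G (Suc i)) \<in> sets (G (Suc i))"
    using D_meas[OF i] H_meas[OF i c p] by (rule measurable_sets)
  then have "{w\<in>space M. D i w \<in> {g. H i c g = p}} \<in> sets (G (Suc i))"
    using G_space[of "Suc i"] i by (simp add: vimage_def Int_def conj_commute)
  then show "E \<inter> {w\<in>space M. path i w = p} \<in> sets (G (Suc i))"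
    unfolding eq using E G_mono[OF i] by auto
  show "prob (E \<inter> {w\<in>space M. path i w = p}) = prob E * chain_weight \<sigma> h (prf i c) p"
    unfolding eq D_indep[OF i E H_meas[OF i c p]] H_law[OF i c p] ..
qed

lemma \<kappa>_event:
  assumes "i < m" shows "{w\<in>space M. \<kappa> i w = c} \<in> sets (G i)"
  using simple_functionD(2)[OF simple_\<kappa>[OF assms], of "{c}"] G_space[of i] assms
  by (simp add: vimage_def Int_def conj_commute)

lemma simple_path: assumes i: "i < m" shows "simple_function (G (Suc i)) (path i)"
proof (unfold simple_function_def, intro conjI ballI)
  have sp: "space (G (Suc i)) = space M" using G_space[of "Suc i"] i by simp
  have "path i ` space (G (Suc i)) \<subseteq> sign_paths (len i)" using path_in[OF i] sp by auto
  then show "finite (path i ` space (G (Suc i)))" using finite_sign_paths finite_subset by blast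
  fix p assume "p \<in> path i ` space (G (Suc i))"
  then have p: "p \<in> sign_paths (len i)" using path_in[OF i] sp by auto
  have "path i -` {p} \<inter> space (G (Suc i)) =
      (\<Union>c\<in>V. {w\<in>space M. \<kappa> i w = c} \<inter> {w\<in>space M. path i w = p})"
    using \<kappa>_V[OF i] sp by auto
  also have "\<dots> \<in> sets (G (Suc i))"
    using V(1) by (intro sets.finite_UN path_event(1)[OF i _ p \<kappa>_event[OF i]]) auto
  finally show "path i -` {p} \<inter> space (G (Suc i)) \<in> sets (G (Suc i))" .
qed

lemma simple_full: "i \<le> m ==> simple_function (G i) (full i)"
proof (induction i)
  case (Suc i)
  then show ?case
    using simple_function_compose2[OF simple_path[of i] simple_G_mono[of i "full i" "Suc i"], of "(@)"] by simp
qed (simp add: full.simps[abs_def])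

lemma simple_levels: "i < m ==> simple_function (G i) (levels (Suc i))"
proof (induction i)
  case 0
  then show ?case using simple_function_compose1[OF simple_\<kappa>[of 0], of "\<lambda>x. [x]"] by simp
next
  case (Suc i)
  then show ?case
    using simple_function_compose2[OF simple_\<kappa>[of "Suc i"] simple_G_mono[of i "levels (Suc i)" "Suc i"], of "(#)"]
    by (simp del: levels.simps add: levels.simps(2)[abs_def, of "Suc i"])
qed

text \<open>The past of block i takes finitely many values, and on each of its atoms
  \<open>path_event\<close> provides the law of the new signs. The level of block i itself counts as
  past.\<close>

lemma expectation_path:
  fixes f :: "real list \<times> real list => real list => real"
  assumes i: "i < m"
  shows "expectation (\<lambda>w. f (levels (Suc i) w, full i w) (path i w)) =
    expectation (\<lambda>w. \<Sum>p\<in>sign_paths (len i). chain_weight \<sigma> h (prf i (\<kappa> i w)) p * f (levels (Suc i) w, full i w) p)"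
proof -
  define Y where "Y w = (levels (Suc i) w, full i w)" for w
  have sY: "simple_function (G i) Y"
    unfolding Y_def using i by (intro simple_function_Pair simple_levels simple_full) auto
  have sp: "space (G i) = space M" using G_space i by simp
  define R where "R = Y ` space M"
  have fR: "finite R" using simple_functionD(1)[OF sY] by (simp add: R_def sp)
  have EY: "{w\<in>space M. Y w = y} \<in> sets (G i)" for y
    using simple_functionD(2)[OF sY, of "{y}"] by (simp add: sp vimage_def Int_def conj_commute)
  have EYM: "{w\<in>space M. Y w = y} \<in> sets M" for y
    by (rule subsetD[OF G_sets EY]) (use i in simp)
  have c: "hd (fst y) \<in> V" if "y \<in> R" for y using that \<kappa>_V[OF i] by (auto simp: R_def Y_def)
  have \<kappa>Y: "\<kappa> i w = hd (fst (Y w))" for w by (simp add: Y_def)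
  have ev: "{w\<in>space M. Y w = y} \<inter> {w\<in>space M. path i w = p} \<in> sets M"
    "prob ({w\<in>space M. Y w = y} \<inter> {w\<in>space M. path i w = p}) =
      prob {w\<in>space M. Y w = y} * chain_weight \<sigma> h (prf i (hd (fst y))) p"
    if "y \<in> R" "p \<in> sign_paths (len i)" for y p
    using path_event[OF i c[OF that(1)] that(2) EY[of y]] G_sets[of "Suc i"] i by (auto simp: \<kappa>Y)
  have indI: "integrable M (\<lambda>w. x * indicator S w)" if "S \<in> sets M" for S and x :: real
    by (intro integrable_mult_right integrable_real_indicator that) (simp add: emeasure_eq_measure)
  have "expectation (\<lambda>w. f (Y w) (path i w)) =
    expectation (\<lambda>w. \<Sum>y\<in>R. \<Sum>p\<in>sign_paths (len i). f y p * indicator ({w\<in>space M. Y w = y} \<inter> {w\<in>space M. path i w = p}) w)"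
  proof (rule bochner_cong[OF refl])
    fix w assume w: "w \<in> space M"
    then have YR: "Y w \<in> R" by (simp add: R_def)
    have "(\<Sum>y\<in>R. \<Sum>p\<in>sign_paths (len i). f y p * indicator ({w\<in>space M. Y w = y} \<inter> {w\<in>space M. path i w = p}) w)
      = (\<Sum>y\<in>R. if y = Y w then \<Sum>p\<in>sign_paths (len i). if p = path i w then f y p else 0 else 0)"
      using w by (intro sum.cong refl) (auto intro!: sum.cong sum.neutral simp: indicator_def)
    also have "\<dots> = f (Y w) (path i w)"
      using YR path_in[OF i w] by (simp add: fR finite_sign_paths)
    finally show "f (Y w) (path i w) = (\<Sum>y\<in>R. \<Sum>p\<in>sign_paths (len i). f y p * indicator ({w\<in>space M. Y w = y} \<inter> {w\<in>space M. path i w = p}) w)" ..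
  qed
  also have "\<dots> = (\<Sum>y\<in>R. \<Sum>p\<in>sign_paths (len i). f y p * prob ({w\<in>space M. Y w = y} \<inter> {w\<in>space M. path i w = p}))"
  proof -
    have "expectation (\<lambda>w. \<Sum>p\<in>sign_paths (len i). f y p * indicator ({w\<in>space M. Y w = y} \<inter> {w\<in>space M. path i w = p}) w)
       = (\<Sum>p\<in>sign_paths (len i). f y p * prob ({w\<in>space M. Y w = y} \<inter> {w\<in>space M. path i w = p}))"
      if "y \<in> R" for y
      using ev(1)[OF that] by (subst bochner_sum[OF indI]) auto
    then show ?thesis
      by (subst bochner_sum[OF bochner_integrable_sum[OF indI[OF ev(1)]]]) auto
  qed
  also have "\<dots> = (\<Sum>y\<in>R. prob {w\<in>space M. Y w = y} * (\<Sum>p\<in>sign_paths (len i). chain_weight \<sigma> h (prf i (hd (fst y))) p * f y p))"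
    using ev(2) by (intro sum.cong refl) (simp add: sum_distrib_left mult_ac)
  also have "\<dots> = expectation (\<lambda>w. \<Sum>y\<in>R. (\<Sum>p\<in>sign_paths (len i). chain_weight \<sigma> h (prf i (hd (fst y))) p * f y p) * indicator {w\<in>space M. Y w = y} w)"
    using EYM by (subst bochner_sum[OF indI]) (auto simp: mult.commute)
  also have "\<dots> = expectation (\<lambda>w. \<Sum>p\<in>sign_paths (len i). chain_weight \<sigma> h (prf i (\<kappa> i w)) p * f (Y w) p)"
  proof (rule bochner_cong[OF refl])
    fix w assume w: "w \<in> space M"
    then have YR: "Y w \<in> R" by (simp add: R_def)
    have "(\<Sum>y\<in>R. (\<Sum>p\<in>sign_paths (len i). chain_weight \<sigma> h (prf i (hd (fst y))) p * f y p) * indicator {w\<in>space M. Y w = y} w)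
      = (\<Sum>y\<in>R. if y = Y w then (\<Sum>p\<in>sign_paths (len i). chain_weight \<sigma> h (prf i (hd (fst y))) p * f y p) else 0)"
      using w by (intro sum.cong refl) (auto simp: indicator_def)
    also have "\<dots> = (\<Sum>p\<in>sign_paths (len i). chain_weight \<sigma> h (prf i (\<kappa> i w)) p * f (Y w) p)"
      using YR by (simp add: fR \<kappa>Y)
    finally show "(\<Sum>y\<in>R. (\<Sum>p\<in>sign_paths (len i). chain_weight \<sigma> h (prf i (hd (fst y))) p * f y p) * indicator {w\<in>space M. Y w = y} w)
       = (\<Sum>p\<in>sign_paths (len i). chain_weight \<sigma> h (prf i (\<kappa> i w)) p * f (Y w) p)" .
  qed
  finally show ?thesis by (simp only: Y_def)
qed

text \<open>The block that contains the step from k to k + 1; \<open>LEAST\<close> skips empty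
  blocks, since the end of an empty block coincides with its start. At k = n there is no such step,
  and the last block makes \<open>info n\<close> contain all levels.\<close>

definition block_of :: "nat => nat" where
  "block_of k = (if k < n then LEAST i. k < b (Suc i) else m - 1)"

lemma block_of:
  assumes k: "k < n"
  shows "block_of k < m" "b (block_of k) \<le> k" "k < b (Suc (block_of k))"
proof -
  have ex: "k < b (Suc (m - 1))" using k m by simp
  show *: "k < b (Suc (block_of k))"
    unfolding block_of_def using k LeastI[of "\<lambda>i. k < b (Suc i)", OF ex] by simp
  have "block_of k \<le> m - 1"
    unfolding block_of_def using k Least_le[of "\<lambda>i. k < b (Suc i)", OF ex] by simp
  then show "block_of k < m" using m by simp
  show "b (block_of k) \<le> k"
  proof (cases "block_of k")
    case (Suc i)
    then have "i < (LEAST i. k < b (Suc i))" using k by (simp add: block_of_def)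
    from not_less_Least[OF this] Suc show ?thesis by simp
  qed simp
qed

lemma block_of_less: "block_of k < m"
  using block_of[of k] m by (cases "k < n") (auto simp: block_of_def)

lemma block_of_mono: "block_of k \<le> block_of (Suc k)"
proof (cases "Suc k < n")
  case True
  then show ?thesis
    using block_of(3)[of "Suc k"] by (simp add: block_of_def) (rule Least_le, simp)
next
  case False
  then have "block_of (Suc k) = m - 1" by (simp add: block_of_def)
  then show ?thesis using block_of_less[of k] by simp
qed

definition hist :: "nat => 'a => real list" where
  "hist k w = drop (n - k) (full m w)"

text \<open>The level of the block of the next step is included, so that the next coefficient is
  known in advance.\<close>

definition info :: "nat => 'a => real list \<times> real list" where
  "info k w = (levels (Suc (block_of k)) w, hist k w)"

definition sgn_step :: "nat => 'a => real" where
  "sgn_step k w = last_step (hist k w)"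

definition dev :: "nat => 'a => real" where
  "dev k w = (if k = 0 then 0 else
     let i = block_of (k - 1) in prf i (\<kappa> i w) (k - b i))"

lemma drop_full:
  assumes w: "w \<in> space M" and "i \<le> j" "j \<le> m"
  shows "drop (b j - b i) (full j w) = full i w"
  using assms(2,3)
proof (induction j rule: dec_induct)
  case (step j)
  have "length (path j w) = len j" using path_in[OF _ w, of j] step by (auto simp: sign_paths_def)
  moreover have "b (Suc j) - b i = len j + (b j - b i)"
    using block_start_mono[of i j m n] block_start_mono[of j "Suc j" m n] step by simp
  ultimately show ?case using step by simp
qed simp

lemma hist_eq:
  assumes w: "w \<in> space M" and i: "i < m" and k: "b i \<le> k" "k \<le> b (Suc i)"
  shows "hist k w = drop (b (Suc i) - k) (path i w) @ full i w"
proof -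
  have le: "b (Suc i) \<le> n" using block_start_mono[of "Suc i" m m n] i m by simp
  have "n - k = (b (Suc i) - k) + (b m - b (Suc i))" using k le m by simp
  then have "hist k w = drop (b (Suc i) - k) (full (Suc i) w)"
    using drop_full[OF w, of "Suc i" m] i by (simp add: hist_def flip: drop_drop)
  moreover have "length (path i w) = len i" using path_in[OF i w] by (auto simp: sign_paths_def)
  ultimately show ?thesis using k by simp
qed

lemma hist_block_start: "w \<in> space M ==> i \<le> m ==> hist (b i) w = full i w"
  using drop_full[of w i m] m by (simp add: hist_def)

lemma hist_in: 
  assumes "w \<in> space M" "k \<le> n" shows "hist k w \<in> sign_paths k"
  using full_in[OF order_refl assms(1)] assms(2) m set_drop_subset[of "n - k" "full m w"]
  by (auto simp: hist_def sign_paths_def)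

lemma tl_hist: "k < n ==> hist k w = tl (hist (Suc k) w)"
  by (simp add: hist_def tl_drop flip: drop_Suc) (simp add: Suc_diff_Suc flip: drop_Suc)

text \<open>The deviation at k is defined through the block of the step that ends at k, whereas the
  law of the next step refers to the block in which it starts. At a block boundary the two
  descriptions agree because every profile begins and ends with 0.\<close>

lemma dev_at:
  assumes k: "k < n"
  shows "dev k w = prf (block_of k) (\<kappa> (block_of k) w) (k - b (block_of k))"
    "dev (Suc k) w = prf (block_of k) (\<kappa> (block_of k) w) (Suc (k - b (block_of k)))"
proof -
  define i where "i = block_of k"
  have i: "i < m" "b i \<le> k" "k < b (Suc i)" using block_of[OF k] by (auto simp: i_def)
  show "dev (Suc k) w = prf (block_of k) (\<kappa> (block_of k) w) (Suc (k - b (block_of k)))"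
    using i by (simp add: dev_def i_def[symmetric] Suc_diff_le Let_def)
  show "dev k w = prf (block_of k) (\<kappa> (block_of k) w) (k - b (block_of k))"
  proof (cases "k = b i")
    case True
    show ?thesis
    proof (cases k)
      case 0 then show ?thesis by (simp add: dev_def profile_def)
    next
      case (Suc k')
      define i' where "i' = block_of k'"
      have i': "i' < m" "b i' \<le> k'" "k' < b (Suc i')" using block_of[of k'] k Suc by (auto simp: i'_def)
      have "\<not> i \<le> i'" using block_start_mono[of i i' m n] i' True Suc by auto
      then have "b (Suc i') \<le> b i" by (intro block_start_mono) auto
      then have "k = b (Suc i')" using i' True Suc by auto
      have "dev k w = prf i' (\<kappa> i' w) (k - b i')"
        unfolding Suc by (simp add: dev_def i'_def Let_def)
      also have "\<dots> = 0" unfolding \<open>k = b (Suc i')\<close> by (rule profile_last)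
      finally have "dev k w = 0" .
      moreover have "k - b i = 0" using True by simp
      ultimately show ?thesis unfolding i_def[symmetric] by (simp only: profile_def) simp
    qed
  next
    case False
    then obtain k' where k': "k = Suc k'" "b i \<le> k'" using i by (cases k) auto
    have "block_of k' = i"
    proof (rule antisym)
      show "block_of k' \<le> i" using k k' i by (simp add: block_of_def) (rule Least_le, simp)
      show "i \<le> block_of k'"
      proof (rule ccontr)
        assume "\<not> ?thesis"
        then have "b (Suc (block_of k')) \<le> b i" by (intro block_start_mono) auto
        then show False using block_of(3)[of k'] k k' by simp
      qed
    qed
    then have "dev k w = prf i (\<kappa> i w) (k - b i)"
      by (simp add: dev_def k'(1) Let_def)
    then show ?thesis by (simp only: i_def)
  qed
qed

lemma levels_tl: "i \<le> j ==> levels i w = drop (j - i) (levels j w)"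
proof (induction j rule: dec_induct)
  case (step j)
  then show ?case by (simp add: Suc_diff_le)
qed simp

lemma simple_info: "k \<le> n ==> simple_function M (info k)"
  using simple_function_Pair[OF simple_G_M[OF simple_levels[OF block_of_less[of k]] less_imp_le[OF block_of_less]]
      simple_function_compose1[OF simple_G_M[OF simple_full[OF order_refl] order_refl], of "drop (n - k)"]]
  by (simp only: hist_def info_def[abs_def])

text \<open>Within a block this is a statement about weighted sign paths: the steps after k + 1 sum
  out by \<open>chain_prefix\<close>, and \<open>chain_step\<close> splits off step k + 1.
  \<open>expectation_path\<close> carries both sides from the probability space to such sums and
  back.\<close>

lemma one_step_expectation:
  fixes u v :: "'a => real"
  assumes k: "k < n"
    and u: "\<And>w w'. w \<in> space M ==> w' \<in> space M ==> info k w = info k w' ==> u w = u w'"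
    and v: "\<And>w w'. w \<in> space M ==> w' \<in> space M ==> info k w = info k w' ==> v w = v w'"
  shows "expectation (\<lambda>w. if sgn_step (Suc k) w = 1 then u w else v w) =
    expectation (\<lambda>w. up_prob h (\<sigma> + dev (Suc k) w) (dev k w * sgn_step k w) * u w
      + (1 - up_prob h (\<sigma> + dev (Suc k) w) (dev k w * sgn_step k w)) * v w)"
proof -
  define i where "i = block_of k"
  define j where "j = k - b i"
  define L where "L = len i"
  have i: "i < m" "b i \<le> k" "k < b (Suc i)" using block_of[OF k] by (auto simp: i_def)
  have j: "j < L" "b (Suc i) - k = L - j" "b (Suc i) - Suc k = L - Suc j" "L - j = Suc (L - Suc j)"
    using i by (auto simp: j_def L_def)
  have ex: "\<exists>f. \<forall>w\<in>space M. v w = f (info k w)"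
    if v: "\<And>w w'. w \<in> space M ==> w' \<in> space M ==> info k w = info k w' ==> v w = v w'"
    for v :: "'a => real"
  proof (intro exI ballI)
    fix w assume w: "w \<in> space M"
    then have "\<exists>w'. w' \<in> space M \<and> info k w' = info k w" by blast
    from someI_ex[OF this]
    show "v w = (\<lambda>t. v (SOME w'. w' \<in> space M \<and> info k w' = t)) (info k w)"
      by (intro v[OF w]) auto
  qed
  obtain fu where fu: "\<And>w. w \<in> space M ==> u w = fu (info k w)" using ex[of u, OF u] by blast
  obtain fv where fv: "\<And>w. w \<in> space M ==> v w = fv (info k w)" using ex[of v, OF v] by blast
  have info: "info k w = (levels (Suc i) w, drop (L - j) (path i w) @ full i w)" if "w \<in> space M" for w
    using hist_eq[OF that i(1,2) less_imp_le[OF i(3)]] by (simp add: info_def i_def[symmetric] j)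
  define U where "U y p = fu (fst y, p @ snd y)" for y :: "real list \<times> real list" and p
  define W where "W y p = fv (fst y, p @ snd y)" for y :: "real list \<times> real list" and p
  \<comment> \<open>Among the first j + 1 signs of the block, stored newest first, the head is the
    sign of step k + 1 and the tail is what is known at time k.\<close>
  define f1 where "f1 y p = (if hd (drop (L - Suc j) p) = 1 then U y (tl (drop (L - Suc j) p)) else W y (tl (drop (L - Suc j) p)))"
    for y and p :: "real list"
  define q where "q c p = chain_up \<sigma> h (prf i c) p" for c p
  define f2 where "f2 y p = (let p' = drop (L - j) p in q (hd (fst y)) p' * U y p' + (1 - q (hd (fst y)) p') * W y p')"
    for y and p :: "real list"
  have "expectation (\<lambda>w. if sgn_step (Suc k) w = 1 then u w else v w)
    = expectation (\<lambda>w. f1 (levels (Suc i) w, full i w) (path i w))"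
  proof (rule bochner_cong[OF refl])
    fix w assume w: "w \<in> space M"
    have "length (path i w) = L" using path_in[OF i(1) w] by (auto simp: sign_paths_def L_def)
    then have "drop (L - Suc j) (path i w) \<noteq> []" using j by simp
    moreover have "hist (Suc k) w = drop (L - Suc j) (path i w) @ full i w"
      using hist_eq[OF w i(1), of "Suc k"] i j by simp
    ultimately have "sgn_step (Suc k) w = hd (drop (L - Suc j) (path i w))"
      by (simp add: sgn_step_def last_step_def)
    moreover have "drop (L - j) (path i w) = tl (drop (L - Suc j) (path i w))"
      unfolding j(4) by (simp add: drop_Suc tl_drop)
    ultimately show "(if sgn_step (Suc k) w = 1 then u w else v w) = f1 (levels (Suc i) w, full i w) (path i w)"
      using w by (simp add: f1_def U_def W_def fu fv info)
  qed
  also have "\<dots> = expectation (\<lambda>w. \<Sum>p\<in>sign_paths L. chain_weight \<sigma> h (prf i (\<kappa> i w)) p * f1 (levels (Suc i) w, full i w) p)"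
    unfolding L_def by (rule expectation_path[OF i(1)])
  also have "\<dots> = expectation (\<lambda>w. \<Sum>p\<in>sign_paths L. chain_weight \<sigma> h (prf i (\<kappa> i w)) p * f2 (levels (Suc i) w, full i w) p)"
  proof (rule bochner_cong[OF refl])
    fix w
    let ?y = "(levels (Suc i) w, full i w)" and ?w = "chain_weight \<sigma> h (prf i (\<kappa> i w))"
    have "(\<Sum>p\<in>sign_paths L. ?w p * f1 ?y p) = (\<Sum>p\<in>sign_paths (Suc j). ?w p * (if hd p = 1 then U ?y (tl p) else W ?y (tl p)))"
      using chain_prefix[of "Suc j" L \<sigma> h "prf i (\<kappa> i w)" "\<lambda>p. if hd p = 1 then U ?y (tl p) else W ?y (tl p)"] j(1)
      by (simp add: f1_def del: levels.simps)
    also have "\<dots> = (\<Sum>p\<in>sign_paths j. ?w p * (q (\<kappa> i w) p * U ?y p + (1 - q (\<kappa> i w) p) * W ?y p))"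
      using chain_step[of \<sigma> h "prf i (\<kappa> i w)" "\<lambda>p. if hd p = 1 then U ?y (tl p) else W ?y (tl p)" j]
      by (simp add: q_def del: levels.simps)
    also have "\<dots> = (\<Sum>p\<in>sign_paths L. ?w p * f2 ?y p)"
      using chain_prefix[of j L \<sigma> h "prf i (\<kappa> i w)" "\<lambda>p. q (\<kappa> i w) p * U ?y p + (1 - q (\<kappa> i w) p) * W ?y p"] j(1)
      by (simp add: f2_def Let_def)
    finally show "(\<Sum>p\<in>sign_paths L. ?w p * f1 ?y p) = (\<Sum>p\<in>sign_paths L. ?w p * f2 ?y p)" .
  qed
  also have "\<dots> = expectation (\<lambda>w. f2 (levels (Suc i) w, full i w) (path i w))"
    unfolding L_def by (rule expectation_path[OF i(1), symmetric])
  also have "\<dots> = expectation (\<lambda>w. up_prob h (\<sigma> + dev (Suc k) w) (dev k w * sgn_step k w) * u w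
      + (1 - up_prob h (\<sigma> + dev (Suc k) w) (dev k w * sgn_step k w)) * v w)"
  proof (rule bochner_cong[OF refl])
    fix w assume w: "w \<in> space M"
    let ?p = "drop (L - j) (path i w)"
    have len: "length ?p = j" using path_in[OF i(1) w] j(1) by (auto simp: sign_paths_def L_def)
    have dev: "dev k w = prf i (\<kappa> i w) j" "dev (Suc k) w = prf i (\<kappa> i w) (Suc j)"
      using dev_at[OF k] by (simp_all add: i_def j_def)
    have "hist k w = ?p @ full i w" using info[OF w] by (simp add: info_def)
    \<comment> \<open>For j = 0 the last sign in the history belongs to the previous block, while
      the path within the block is empty; the coefficient 0 makes both products vanish.\<close>
    then have s: "prf i (\<kappa> i w) j * last_step ?p = dev k w * sgn_step k w"
      using len by (cases "j = 0") (auto simp: dev sgn_step_def last_step_def profile_def)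
    have "q (\<kappa> i w) ?p = up_prob h (\<sigma> + dev (Suc k) w) (dev k w * sgn_step k w)"
      unfolding q_def chain_up_def len s dev(2) ..
    then show "f2 (levels (Suc i) w, full i w) (path i w) = up_prob h (\<sigma> + dev (Suc k) w) (dev k w * sgn_step k w) * u w
      + (1 - up_prob h (\<sigma> + dev (Suc k) w) (dev k w * sgn_step k w)) * v w"
      using w by (simp add: f2_def Let_def U_def W_def fu fv info)
  qed
  finally show ?thesis .
qed

lemma levels_det:
  assumes "info k w = info k w'" "i \<le> block_of k" shows "\<kappa> i w = \<kappa> i w'"
proof -
  have "levels (Suc i) w = levels (Suc i) w'"
    using assms by (simp only: levels_tl[of "Suc i" "Suc (block_of k)"] info_def prod.inject Suc_le_mono)
  then show ?thesis by simp
qed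

lemma dev_bounds:
  assumes w: "w \<in> space M"
  shows "k < n ==> \<bar>dev k w\<bar> \<le> \<sigma> + dev (Suc k) w" "k < n ==> 0 < \<sigma> + dev (Suc k) w"
    "k \<le> n ==> \<bar>dev k w\<bar> \<le> A"
proof -
  have cp: "chain_profile \<sigma> h A (prf (block_of k) (\<kappa> (block_of k) w)) (len (block_of k))" for k
    using \<kappa>_V[OF block_of_less w] n by (intro chain_profile) auto
  have j: "k - b (block_of k) < len (block_of k)" if "k < n" for k
    using block_of[OF that] by simp
  show "\<bar>dev k w\<bar> \<le> \<sigma> + dev (Suc k) w" if "k < n"
    unfolding dev_at[OF that] by (rule chain_profile.a_gap[OF cp j[OF that]])
  show "0 < \<sigma> + dev (Suc k) w" if "k < n"
    unfolding dev_at[OF that] by (rule chain_profile.a_pos[OF cp j[OF that]])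
  show "\<bar>dev k w\<bar> \<le> A" if "k \<le> n"
  proof (cases k)
    case 0
    then show ?thesis using chain_profile.a_bound[OF cp, of 0 0] by (simp add: dev_def profile_def)
  next
    case (Suc k')
    then have k': "k' < n" using that by simp
    show ?thesis unfolding Suc dev_at[OF k'] by (rule chain_profile.a_bound[OF cp]) (use j[OF k'] in simp)
  qed
qed

sublocale chain: binary_chain M n \<sigma> h A info sgn_step dev
proof
  show "0 < h" using n by simp
  fix k w w' assume w: "w \<in> space M" "w' \<in> space M"
  show "info k w = info k w'" if "k < n" and eq: "info (Suc k) w = info (Suc k) w'"
  proof -
    have "levels (Suc (block_of k)) w = levels (Suc (block_of k)) w'"
      using eq block_of_mono[of k]
      by (simp only: levels_tl[of "Suc (block_of k)" "Suc (block_of (Suc k))"] info_def prod.inject Suc_le_mono)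
    moreover have "hist k w = hist k w'"
      using eq by (simp only: tl_hist[OF that(1)] info_def prod.inject)
    ultimately show ?thesis by (simp only: info_def)
  qed
  show "sgn_step k w = sgn_step k w'" if "info k w = info k w'"
    using that by (simp only: info_def prod.inject sgn_step_def)
  show "dev k w = dev k w'" if "k \<le> n" and eq: "info k w = info k w'"
  proof (cases k)
    case 0 then show ?thesis by (simp add: dev_def)
  next
    case (Suc k')
    then have "block_of k' \<le> block_of k" using block_of_mono[of k'] by simp
    from levels_det[OF eq this] show ?thesis using Suc by (simp add: dev_def)
  qed
  show "dev (Suc k) w = dev (Suc k) w'" if "k < n" and eq: "info k w = info k w'"
    using levels_det[OF eq order_refl] by (simp only: dev_at(2)[OF that(1)])
  show "sgn_step k w \<in> {- 1, 1}" if "1 \<le> k" "k \<le> n"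
    using hist_in[OF w(1) that(2)] that(1) by (cases "hist k w") (auto simp: sgn_step_def last_step_def sign_paths_def)
  show "dev 0 w = 0" by (simp add: dev_def)
  show "\<bar>dev k w\<bar> \<le> A" if "k \<le> n" by (rule dev_bounds(3)[OF w(1) that])
  show "\<bar>dev k w\<bar> \<le> \<sigma> + dev (Suc k) w" if "k < n" by (rule dev_bounds(1)[OF w(1) that])
  show "0 < \<sigma> + dev (Suc k) w" if "k < n" by (rule dev_bounds(2)[OF w(1) that])
qed (fact \<sigma> simple_info one_step_expectation)+

end


section \<open>Oscillation of the log martingale and its values at block ends\<close>

lemma (in binary_chain) log_mart_measurable [measurable]: "k \<le> n ==> log_mart k \<in> borel_measurable M"
  by (rule borel_measurable_simple_function[OF det_simple[OF _ det_log_mart]]) auto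

text \<open>A two-sided Chernoff bound: the maximal inequality with exponents l and -l, the two
  exceptional events being united in E.\<close>

lemma (in binary_chain) oscillation:
  assumes k: "k0 \<le> k1" "k1 \<le> n" and l: "1 \<le> l" "l * (\<sigma> + 2 * A) * h \<le> 1"
  obtains E where "E \<in> events"
    "prob E \<le> 2 * exp (- l * \<delta>) * (1 + 6 * l\<^sup>2 * (\<sigma> + 2 * A)\<^sup>2 * h\<^sup>2) ^ (k1 - k0)"
    "\<And>w k. w \<in> space M - E ==> k \<in> {k0..k1} ==> \<bar>log_mart k w - log_mart k0 w\<bar> < \<delta>"
proof
  define c where "c = (1 + 6 * l\<^sup>2 * (\<sigma> + 2 * A)\<^sup>2 * h\<^sup>2) ^ (k1 - k0)"
  define E where "E l' = {w\<in>space M. \<exists>k\<in>{k0..k1}. exp (l * \<delta>) \<le> exp (l' * (log_mart k w - log_mart k0 w))}" for l'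
  have meas: "E l' \<in> events" for l'
  proof -
    have "E l' = (\<Union>k\<in>{k0..k1}. {w\<in>space M. exp (l * \<delta>) \<le> exp (l' * (log_mart k w - log_mart k0 w))})"
      by (auto simp: E_def)
    also have "\<dots> \<in> events" using k by (intro sets.finite_UN) auto
    finally show ?thesis .
  qed
  then show "E l \<union> E (- l) \<in> events" by auto
  have p: "prob (E l') \<le> exp (- l * \<delta>) * c" if "\<bar>l'\<bar> = l" for l'
  proof -
    have "exp (l * \<delta>) * prob (E l') \<le> (1 + 6 * l'\<^sup>2 * (\<sigma> + 2 * A)\<^sup>2 * h\<^sup>2) ^ (k1 - k0)"
      unfolding E_def using l that by (intro exp_maximal_inequality k) auto
    also have "l'\<^sup>2 = l\<^sup>2" using that by (metis power2_abs)
    finally have "exp (- l * \<delta>) * (exp (l * \<delta>) * prob (E l')) \<le> exp (- l * \<delta>) * c"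
      unfolding c_def by (intro mult_left_mono) auto
    moreover have "exp (- l * \<delta>) * (exp (l * \<delta>) * prob (E l')) = prob (E l')"
      by (simp add: exp_minus)
    ultimately show ?thesis by (simp only:)
  qed
  have "prob (E l \<union> E (- l)) \<le> prob (E l) + prob (E (- l))"
    by (rule measure_Un_le[OF meas meas])
  also have "\<dots> \<le> 2 * exp (- l * \<delta>) * c" using p[of l] p[of "- l"] l by simp
  finally show "prob (E l \<union> E (- l)) \<le> 2 * exp (- l * \<delta>) * (1 + 6 * l\<^sup>2 * (\<sigma> + 2 * A)\<^sup>2 * h\<^sup>2) ^ (k1 - k0)"
    unfolding c_def .
  show "\<bar>log_mart k w - log_mart k0 w\<bar> < \<delta>" if "w \<in> space M - (E l \<union> E (- l))" "k \<in> {k0..k1}" for w k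
  proof -
    have "l * (log_mart k w - log_mart k0 w) < l * \<delta>" "- l * (log_mart k w - log_mart k0 w) < l * \<delta>"
      using that by (auto simp: E_def not_le)
    then have "l * (log_mart k w - log_mart k0 w) < l * \<delta>" "l * (log_mart k0 w - log_mart k w) < l * \<delta>"
      by (simp_all add: algebra_simps)
    moreover have "0 < l" using l by simp
    ultimately show ?thesis by (simp only: mult_less_cancel_left_pos abs_less_iff minus_diff_eq)
  qed
qed

context block_coupling
begin

lemma block_of_eq:
  assumes "i < m" "b i \<le> k" "k < b (Suc i)" shows "block_of k = i"
proof (rule antisym)
  have k: "k < n" using assms block_start_mono[of "Suc i" m m n] m by simp
  show "block_of k \<le> i" using k assms by (simp add: block_of_def) (rule Least_le, simp)
  show "i \<le> block_of k"
  proof (rule ccontr)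
    assume "\<not> ?thesis"
    then have "b (Suc (block_of k)) \<le> b i" by (intro block_start_mono) auto
    then show False using block_of(3)[OF k] assms by simp
  qed
qed

lemma dev_block_start:
  assumes "i \<le> m" shows "dev (b i) w = 0"
proof (cases "b i")
  case 0 then show ?thesis by (simp add: dev_def)
next
  case (Suc k)
  have "b i \<le> n" using block_start_mono[OF assms, of m n] m by simp
  define i' where "i' = block_of k"
  have i': "b i' \<le> k" "k < b (Suc i')" using block_of[of k] Suc \<open>b i \<le> n\<close> by (auto simp: i'_def)
  have "\<not> i \<le> i'" using block_start_mono[of i i' m n] i' Suc by auto
  then have "b (Suc i') \<le> b i" by (intro block_start_mono) auto
  then have eq: "b i = b (Suc i')" using i' Suc by auto
  have "dev (b i) w = prf i' (\<kappa> i' w) (b i - b i')"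
    unfolding Suc by (simp add: dev_def i'_def Let_def)
  also have "\<dots> = 0" unfolding eq by (rule profile_last)
  finally show ?thesis .
qed

lemma dev_last: "dev n w = 0"
  using dev_block_start[OF order_refl] m by simp

lemma dev_bulk:
  assumes "i < m" "b i < k" "k + r \<le> b (Suc i)"
  shows "dev k w = excess \<sigma> (\<kappa> i w)"
proof -
  obtain k' where k: "k = Suc k'" using assms by (cases k) auto
  have "block_of k' = i" using assms k r(2) by (intro block_of_eq) auto
  then have "dev k w = prf i (\<kappa> i w) (k - b i)"
    unfolding k by (simp add: dev_def Let_def)
  moreover have "min 1 (real x / real r) = 1" if "r \<le> x" for x
    using that r(2) by (simp add: min_def divide_simps)
  then have "min 1 (real (len i - (k - b i)) / real r) = 1"
    using assms by (simp del: of_nat_diff)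
  ultimately show ?thesis using assms by (simp add: profile_def)
qed

lemma sum_sgn_step: "k \<le> n ==> w \<in> space M ==> (\<Sum>i=1..k. sgn_step i w) = sum_list (hist k w)"
proof (induction k)
  case 0
  then show ?case using hist_in[of w 0] by (simp add: sign_paths_def)
next
  case (Suc k)
  have "hist (Suc k) w \<noteq> []" using hist_in[of w "Suc k"] Suc by (auto simp: sign_paths_def)
  then have "hist (Suc k) w = sgn_step (Suc k) w # hist k w"
    using tl_hist[of k w] Suc by (simp add: sgn_step_def last_step_def)
  then show ?case using Suc by simp
qed

text \<open>Where the deviation vanishes, log martingale and log price agree, and the latter is a
  sum over completed blocks.\<close>

lemma log_mart_block_start:
  assumes i: "i \<le> m" and w: "w \<in> space M"
  shows "chain.log_mart (b i) w = (\<Sum>l<i. log_ratio \<sigma> h (prf l (\<kappa> l w)) (path l w))"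
proof -
  have "b i \<le> n" using block_start_mono[OF i, of m n] m by simp
  then have "chain.log_mart (b i) w = h * \<sigma> * sum_list (full i w)"
    using sum_sgn_step[OF _ w] hist_block_start[OF w i]
    by (simp add: chain.log_mart_def dev_block_start[OF i])
  also have "sum_list (full i w) = (\<Sum>l<i. sum_list (path l w))"
    by (induction i) auto
  also have "h * \<sigma> * \<dots> = (\<Sum>l<i. log_ratio \<sigma> h (prf l (\<kappa> l w)) (path l w))"
    unfolding sum_distrib_left
  proof (rule sum.cong[OF refl])
    fix l assume "l \<in> {..<i}"
    then have "length (path l w) = len l" using path_in[of l w] i w by (auto simp: sign_paths_def)
    then show "h * \<sigma> * sum_list (path l w) = log_ratio \<sigma> h (prf l (\<kappa> l w)) (path l w)"
      by (simp add: log_ratio_def profile_last)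
  qed
  finally show ?thesis .
qed

end

section \<open>Asymptotically exact coupling of blocks and its error\<close>

lemma block_length_limit:
  assumes m: "0 < m"
  shows "(\<lambda>n. real (block_length m (Suc n) i) * (1 / sqrt (real (Suc n)))\<^sup>2) \<longlonglongrightarrow> 1 / real m"
proof (rule tendsto_sandwich)
  show "(\<lambda>n. 1 / real m - 1 / real (Suc n)) \<longlonglongrightarrow> 1 / real m"
    using tendsto_diff[OF tendsto_const lim_inverse_n'[THEN LIMSEQ_Suc], of "1 / real m"] by simp
  show "(\<lambda>n. 1 / real m + 1 / real (Suc n)) \<longlonglongrightarrow> 1 / real m"
    using tendsto_add[OF tendsto_const lim_inverse_n'[THEN LIMSEQ_Suc], of "1 / real m"] by simp
  have bounds: "\<bar>real (block_length m (Suc n) i) - real (Suc n) / real m\<bar> \<le> 1" for n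
  proof -
    have "real (Suc i) * real (Suc n) / real m = real i * real (Suc n) / real m + real (Suc n) / real m"
      by (simp add: add_divide_distrib[symmetric] algebra_simps)
    then show ?thesis
      using block_start_bounds[OF m, where n = "Suc n" and i = i] block_start_bounds[OF m, where n = "Suc n" and i = "Suc i"]
        block_start_mono[of i "Suc i" m "Suc n"] by (simp only: of_nat_diff)
  qed
  have eq: "real (block_length m (Suc n) i) * (1 / sqrt (real (Suc n)))\<^sup>2 = real (block_length m (Suc n) i) / real (Suc n)" for n
    by (simp add: power_divide)
  have div: "(real (Suc n) / real m + c) / real (Suc n) = 1 / real m + c / real (Suc n)" for n c
    by (simp add: add_divide_distrib del: of_nat_Suc)
  have "(real (Suc n) / real m + - 1) / real (Suc n) \<le> real (block_length m (Suc n) i) / real (Suc n)"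
    "real (block_length m (Suc n) i) / real (Suc n) \<le> (real (Suc n) / real m + 1) / real (Suc n)" for n
    using bounds[of n] by (intro divide_right_mono; linarith)+
  then show "\<forall>\<^sub>F n in sequentially. 1 / real m - 1 / real (Suc n) \<le> real (block_length m (Suc n) i) * (1 / sqrt (real (Suc n)))\<^sup>2"
    "\<forall>\<^sub>F n in sequentially. real (block_length m (Suc n) i) * (1 / sqrt (real (Suc n)))\<^sup>2 \<le> 1 / real m + 1 / real (Suc n)"
    unfolding eq div by (auto simp del: of_nat_Suc)
qed

context block_data
begin

text \<open>The ramp affects at most r coefficients, so the variance of the block tends to
  (\<sigma>^2 + 2 \<sigma> excess) / m = c^2 / m, and \<open>chain_clt\<close> feeds
  \<open>monotone_coupling\<close>. The limit is the log return, over time 1/m, of a geometric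
  Brownian motion with volatility c whose normalised increment is g.\<close>

lemma coupling_exists:
  assumes i: "i < m" and c: "c \<in> V"
  shows "\<exists>H. (\<forall>n>0. (\<forall>g. H n g \<in> sign_paths (block_length m n i)) \<and>
      (\<forall>p\<in>sign_paths (block_length m n i). {g. H n g = p} \<in> sets borel \<and>
        measure std_normal_distribution {g. H n g = p} =
          chain_weight \<sigma> (1 / sqrt n) (profile \<sigma> r (block_length m n i) c) p)) \<and>
    (\<forall>g. (\<lambda>n. log_ratio \<sigma> (1 / sqrt n) (profile \<sigma> r (block_length m n i) c) (H n g))
       \<longlonglongrightarrow> c * g / sqrt m - c\<^sup>2 / (2 * m))"
proof -
  define h where "h n = 1 / sqrt (real (Suc n))" for n
  define L where "L n = block_length m (Suc n) i" for n
  define a where "a n = profile \<sigma> r (L n) c" for n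
  have c0: "c \<noteq> 0" using c V(2) by auto
  have h2: "(h n)\<^sup>2 = 1 / real (Suc n)" for n by (simp add: h_def power_divide)
  have h0: "h \<longlonglongrightarrow> 0" unfolding h_def
    by (rule LIMSEQ_Suc[of "\<lambda>n. 1 / sqrt (real n)"]) real_asymp
  have Lh: "(\<lambda>n. real (L n) * (h n)\<^sup>2) \<longlonglongrightarrow> 1 / real m"
    unfolding L_def h_def by (rule block_length_limit[OF m])
  have prof: "chain_profile \<sigma> (h n) A (a n) (L n)" for n
    unfolding a_def by (rule chain_profile[OF c]) (simp add: h_def)
  have A: "\<bar>excess \<sigma> c\<bar> \<le> A" unfolding A_def by (intro excess_bound \<sigma> V(3) c)
  have "(\<lambda>n. ((\<Sum>j<L n. a n (Suc j)) - real (L n) * excess \<sigma> c) * (h n)\<^sup>2) \<longlonglongrightarrow> 0"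
  proof (rule Lim_null_comparison[OF always_eventually])
    show "\<forall>n. norm (((\<Sum>j<L n. a n (Suc j)) - real (L n) * excess \<sigma> c) * (h n)\<^sup>2) \<le> real r * A * (h n)\<^sup>2"
      using profile_sum[OF A r(2)] unfolding a_def by (auto simp: abs_mult intro!: mult_right_mono)
    show "(\<lambda>n. real r * A * (h n)\<^sup>2) \<longlonglongrightarrow> 0"
      using tendsto_mult[OF tendsto_const tendsto_power[OF h0, of 2], of "real r * A"] by simp
  qed
  from tendsto_add[OF tendsto_mult[OF tendsto_const[of "\<sigma>\<^sup>2 + 2 * \<sigma> * excess \<sigma> c"] Lh] tendsto_mult[OF tendsto_const[of "2 * \<sigma>"] this]]
  have "(\<lambda>n. (\<sigma>\<^sup>2 * real (L n) + 2 * \<sigma> * (\<Sum>j<L n. a n (Suc j)) + (a n (L n))\<^sup>2) * (h n)\<^sup>2)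
     \<longlonglongrightarrow> (\<sigma>\<^sup>2 + 2 * \<sigma> * excess \<sigma> c) * (1 / real m)"
    by (simp add: a_def profile_last algebra_simps)
  moreover have "\<sigma>\<^sup>2 + 2 * \<sigma> * excess \<sigma> c = c\<^sup>2" using \<sigma> by (simp add: excess_def)
  ultimately have V': "(\<lambda>n. (\<sigma>\<^sup>2 * real (L n) + 2 * \<sigma> * (\<Sum>j<L n. a n (Suc j)) + (a n (L n))\<^sup>2) * (h n)\<^sup>2)
     \<longlonglongrightarrow> c\<^sup>2 * (1 / real m)" by simp
  define s where "s = c * sqrt (1 / real m)"
  define Z where "Z n p = (log_ratio \<sigma> (h n) (a n) p + c\<^sup>2 * (1 / real m) / 2) / s" for n p
  have s0: "s \<noteq> 0" using c0 m by (simp add: s_def)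
  obtain H where H: "\<And>n g. H n g \<in> sign_paths (L n)"
    "\<And>n p. p \<in> sign_paths (L n) ==> {g. H n g = p} \<in> sets borel"
    "\<And>n p. p \<in> sign_paths (L n) ==> measure std_normal_distribution {g. H n g = p} = chain_weight \<sigma> (h n) (a n) p"
    "\<And>g. (\<lambda>n. Z n (H n g)) \<longlonglongrightarrow> g"
  proof (rule monotone_coupling[of "\<lambda>n. sign_paths (L n)" "\<lambda>n. chain_weight \<sigma> (h n) (a n)" Z])
    show "(\<lambda>n. \<Sum>p\<in>sign_paths (L n). chain_weight \<sigma> (h n) (a n) p *\<^sub>R iexp (u * Z n p)) \<longlonglongrightarrow> of_real (exp (- (u\<^sup>2) / 2))" for u
      unfolding Z_def s_def using m by (intro chain_clt[OF prof h0 Lh V' c0]) auto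
    show "0 \<le> chain_weight \<sigma> (h n) (a n) p" if "p \<in> sign_paths (L n)" for n p
      by (rule chain_profile.chain_weight_nonneg[OF prof that order_refl])
  qed (auto simp: finite_sign_paths chain_weight_sum)
  \<comment> \<open>The sequences above are taken at n + 1 to keep 1 / sqrt n positive; this undoes
    the shift.\<close>
  define H' where "H' n = H (n - 1)" for n
  have "(\<lambda>n. log_ratio \<sigma> (1 / sqrt n) (profile \<sigma> r (block_length m n i) c) (H' n g))
       \<longlonglongrightarrow> c * g / sqrt m - c\<^sup>2 / (2 * m)" for g
  proof (rule LIMSEQ_offset[of _ 1])
    have "(\<lambda>n. s * Z n (H n g) - c\<^sup>2 * (1 / real m) / 2) \<longlonglongrightarrow> s * g - c\<^sup>2 * (1 / real m) / 2"
      by (intro tendsto_intros H)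
    moreover have "(\<lambda>n. s * Z n (H n g) - c\<^sup>2 * (1 / real m) / 2) =
        (\<lambda>n. log_ratio \<sigma> (1 / sqrt (real (n + 1))) (profile \<sigma> r (block_length m (n + 1) i) c) (H' (n + 1) g))"
      using s0 by (simp add: Z_def H'_def h_def a_def L_def add.commute fun_eq_iff)
    moreover have "s * g - c\<^sup>2 * (1 / real m) / 2 = c * g / sqrt m - c\<^sup>2 / (2 * m)"
      by (simp add: s_def real_sqrt_divide)
    ultimately show "(\<lambda>n. log_ratio \<sigma> (1 / sqrt (real (n + 1))) (profile \<sigma> r (block_length m (n + 1) i) c) (H' (n + 1) g))
       \<longlonglongrightarrow> c * g / sqrt m - c\<^sup>2 / (2 * m)"
      by (simp only:)
  qed
  moreover have "(\<forall>g. H' n g \<in> sign_paths (block_length m n i)) \<and>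
      (\<forall>p\<in>sign_paths (block_length m n i). {g. H' n g = p} \<in> sets borel \<and>
        measure std_normal_distribution {g. H' n g = p} =
          chain_weight \<sigma> (1 / sqrt n) (profile \<sigma> r (block_length m n i) c) p)" if "0 < n" for n
    using H(1)[of "n - 1"] H(2,3)[of _ "n - 1"] that by (auto simp: H'_def L_def h_def a_def)
  ultimately show ?thesis by blast
qed

text \<open>Logarithm, relative to the initial value, at time i/m of the stochastic exponential
  whose volatility on cell l is \<kappa> l.\<close>

definition target :: "nat => 'a => real" where
  "target i w = (\<Sum>l<i. \<kappa> l w * D l w / sqrt m - (\<kappa> l w)\<^sup>2 / (2 * m))"

lemma target_measurable: assumes i: "i \<le> m" shows "target i \<in> borel_measurable M"
proof -
  have "\<kappa> l \<in> borel_measurable M" "D l \<in> borel_measurable M" if "l < i" for l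
    using that i \<kappa>_meas[of l] D_meas[of l] G_sets[of l] G_sets[of "Suc l"] G_space[of l] G_space[of "Suc l"]
    by (auto intro: measurable_mono[THEN subsetD, OF order_refl refl])
  then show ?thesis unfolding target_def
    by (intro borel_measurable_sum borel_measurable_diff borel_measurable_divide borel_measurable_times borel_measurable_power) auto
qed

text \<open>The first \<delta> bounds the probability of a bad block end. The second term adds, over
  m blocks, the probability of a large oscillation with exponent sqrt m; it vanishes for large m
  because exp (- sqrt m \<delta> / 3) decays faster than 1/m.\<close>

definition error_bound :: "real => real" where
  "error_bound \<delta> = \<delta> + 2 * real m * exp (12 * (\<sigma> + 2 * A)\<^sup>2) * exp (- sqrt m * (\<delta> / 3))"

text \<open>All steps of a block, including its end, are compared with the target at the start of
  the block.\<close>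

definition tracks_target ::
    "nat => real => (nat => 'a => real list \<times> real list) => (nat => 'a => real) => (nat => 'a => real) => 'a set => bool" where
  "tracks_target n \<delta> T \<xi> a E \<longleftrightarrow> binary_chain M n \<sigma> (1 / sqrt n) A T \<xi> a \<and> (\<forall>w. a n w = 0) \<and>
    (\<forall>w i k. i < m --> block_start m n i < k --> k + r \<le> block_start m n (Suc i) --> a k w = excess \<sigma> (\<kappa> i w)) \<and>
    E \<in> events \<and> prob E \<le> error_bound \<delta> \<and>
    (\<forall>w\<in>space M - E. \<forall>i<m. \<forall>k\<in>{block_start m n i..block_start m n (Suc i)}.
       \<bar>\<sigma> / sqrt n * (\<Sum>j=1..k. \<xi> j w) - target i w\<bar> \<le> \<delta>)"

text \<open>At block ends the coupled log prices converge for every outcome, hence in probability;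
  inside a block only the oscillation matters. With exponent l = sqrt m and at most 2 n / m steps in
  a block the moment factor is at most exp (12 C^2), uniformly in m and n.\<close>

theorem discrete_approximation:
  assumes \<delta>: "0 < \<delta>"
  shows "\<exists>N. \<forall>n\<ge>N. \<exists>T \<xi> a E. tracks_target n \<delta> T \<xi> a E"
proof -
  define P where "P i c H \<longleftrightarrow> (\<forall>n>0. (\<forall>g. H n g \<in> sign_paths (block_length m n i)) \<and>
      (\<forall>p\<in>sign_paths (block_length m n i). {g. H n g = p} \<in> sets borel \<and>
        measure std_normal_distribution {g. H n g = p} =
          chain_weight \<sigma> (1 / sqrt n) (profile \<sigma> r (block_length m n i) c) p)) \<and>
    (\<forall>g. (\<lambda>n. log_ratio \<sigma> (1 / sqrt n) (profile \<sigma> r (block_length m n i) c) (H n g))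
       \<longlonglongrightarrow> c * g / sqrt m - c\<^sup>2 / (2 * m))" for i c H
  define H where "H i c = (SOME H. P i c H)" for i c
  have "P i c (H i c)" if "i < m" "c \<in> V" for i c
  proof -
    have "\<exists>H. P i c H" using coupling_exists[OF that] unfolding P_def .
    then show ?thesis unfolding H_def by (rule someI_ex)
  qed
  note H = this[unfolded P_def]
  define K where "K n i c = H i c n" for n i c
  have bc: "block_coupling M m \<sigma> B V G \<kappa> D n (K n)" if "0 < n" for n
    using that H by unfold_locales (auto simp: K_def)
  define R where "R n i w = (\<Sum>l<i. log_ratio \<sigma> (1 / sqrt n) (profile \<sigma> r (block_length m n l) (\<kappa> l w))
      (block_coupling.path \<kappa> D (K n) l w))" for n i w
  have R_lim: "(\<lambda>n. R n i w) \<longlonglongrightarrow> target i w" if "i \<le> m" "w \<in> space M" for i w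
    unfolding R_def target_def
  proof (rule tendsto_sum)
    fix l assume "l \<in> {..<i}"
    then have l: "l < m" "\<kappa> l w \<in> V" using that \<kappa>_V by auto
    have "block_coupling.path \<kappa> D (K n) l w = H l (\<kappa> l w) n (D l w)" if "0 < n" for n
      using block_coupling.path_def[OF bc[OF that]] by (simp add: K_def)
    then have ev: "\<forall>\<^sub>F n in sequentially. log_ratio \<sigma> (1 / sqrt n) (profile \<sigma> r (block_length m n l) (\<kappa> l w)) (H l (\<kappa> l w) n (D l w))
       = log_ratio \<sigma> (1 / sqrt n) (profile \<sigma> r (block_length m n l) (\<kappa> l w)) (block_coupling.path \<kappa> D (K n) l w)"
      by (intro eventually_mono[OF eventually_gt_at_top[of 0]]) simp
    show "(\<lambda>n. log_ratio \<sigma> (1 / sqrt n) (profile \<sigma> r (block_length m n l) (\<kappa> l w)) (block_coupling.path \<kappa> D (K n) l w))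
       \<longlonglongrightarrow> \<kappa> l w * D l w / sqrt m - (\<kappa> l w)\<^sup>2 / (2 * m)"
      using Lim_transform_eventually[OF _ ev] H[OF l] by blast
  qed
  define lm where "lm n = binary_chain.log_mart \<sigma> (1 / sqrt (real n)) (block_coupling.sgn_step m \<kappa> D n (K n)) (block_coupling.dev m \<sigma> B \<kappa> n)" for n
  have lm_R: "lm n (block_start m n i) w = R n i w" if "0 < n" "i \<le> m" "w \<in> space M" for n i w
    using block_coupling.log_mart_block_start[OF bc[OF that(1)] that(2,3)] by (simp add: lm_def R_def)
  define Bad where "Bad n i = {w\<in>space M. \<delta> / 3 < \<bar>lm n (block_start m n i) w - target i w\<bar>}" for n i
  have Bad_meas: "Bad n i \<in> events" if "0 < n" "i \<le> m" for n i
  proof -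
    interpret bc: block_coupling M m \<sigma> B V G \<kappa> D n "K n" by (rule bc[OF that(1)])
    have [measurable]: "lm n (block_start m n i) \<in> borel_measurable M"
      unfolding lm_def using block_start_mono[OF that(2), of m n] m by (intro bc.chain.log_mart_measurable) simp
    have [measurable]: "target i \<in> borel_measurable M" by (rule target_measurable[OF that(2)])
    show ?thesis unfolding Bad_def by measurable
  qed
  have Bad_lim: "(\<lambda>n. prob (Bad (Suc n) i)) \<longlonglongrightarrow> 0" if i: "i \<le> m" for i
  proof -
    have "(\<lambda>n. \<integral>w. indicat_real (Bad (Suc n) i) w \<partial>M) \<longlonglongrightarrow> (\<integral>w. 0 \<partial>M)"
    proof (rule integral_dominated_convergence[where w = "\<lambda>_. 1"])
      show "AE w in M. (\<lambda>n. indicat_real (Bad (Suc n) i) w) \<longlonglongrightarrow> 0"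
      proof (rule AE_I2)
        fix w assume w: "w \<in> space M"
        have "(\<lambda>n. \<bar>R (Suc n) i w - target i w\<bar>) \<longlonglongrightarrow> 0"
          using LIMSEQ_Suc[OF R_lim[OF i w]] by (intro tendsto_rabs_zero) (simp add: LIM_zero_iff)
        then have "\<forall>\<^sub>F n in sequentially. \<bar>R (Suc n) i w - target i w\<bar> < \<delta> / 3"
          using \<delta> by (intro order_tendstoD(2)) auto
        then have "\<forall>\<^sub>F n in sequentially. indicat_real (Bad (Suc n) i) w = 0"
          by eventually_elim (use w i in \<open>auto simp: Bad_def lm_R\<close>)
        then show "(\<lambda>n. indicat_real (Bad (Suc n) i) w) \<longlonglongrightarrow> 0" by (rule tendsto_eventually)
      qed
    qed (use Bad_meas[OF _ i] in auto)
    then show ?thesis using Bad_meas[OF _ i] by simp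
  qed
  have "(\<lambda>n. \<Sum>i\<le>m. prob (Bad (Suc n) i)) \<longlonglongrightarrow> (\<Sum>i\<le>m. 0)"
    by (intro tendsto_sum Bad_lim) auto
  then have "\<forall>\<^sub>F n in sequentially. (\<Sum>i\<le>m. prob (Bad (Suc n) i)) < \<delta>"
    using \<delta> by (intro order_tendstoD(2)) auto
  then obtain N1 where N1: "\<And>n. N1 \<le> n ==> (\<Sum>i\<le>m. prob (Bad (Suc n) i)) < \<delta>"
    by (auto simp: eventually_sequentially)
  define C where "C = \<sigma> + 2 * A"
  have A0: "0 \<le> A" using \<sigma> by (simp add: A_def)
  have C0: "0 < C" using A0 \<sigma> by (simp add: C_def)
  \<comment> \<open>The summands ensure in turn that bad block ends are improbable, that n \<ge> m,
    that the exponent sqrt m is admissible, and that a deviation of size A / sqrt n is at most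
    \<delta>/3.\<close>
  define N where "N = Suc N1 + m + nat \<lceil>real m * C\<^sup>2\<rceil> + nat \<lceil>(3 * A / \<delta>)\<^sup>2\<rceil>"
  show ?thesis
  proof (intro exI[of _ N] allI impI)
    fix n assume "N \<le> n"
    then have n: "0 < n" "Suc N1 \<le> n" "m \<le> n" "real m * C\<^sup>2 \<le> real n" "(3 * A / \<delta>)\<^sup>2 \<le> real n"
      unfolding N_def by linarith+
    interpret bc: block_coupling M m \<sigma> B V G \<kappa> D n "K n" by (rule bc[OF n(1)])
    define l where "l = sqrt (real m)"
    have l1: "1 \<le> l" using m by (simp add: l_def)
    have "l * C \<le> sqrt (real n)"
    proof -
      have "l * C = sqrt (real m * C\<^sup>2)" using C0 by (simp add: l_def real_sqrt_mult)
      then show ?thesis using n(4) by simp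
    qed
    then have lC: "l * (\<sigma> + 2 * A) * bc.h \<le> 1" using n(1) by (simp add: C_def)
    have An: "A / sqrt n \<le> \<delta> / 3"
    proof -
      have "3 * A / \<delta> \<le> sqrt (real n)" using n(5) by (simp add: real_le_rsqrt)
      then show ?thesis using \<delta> n(1) by (simp add: field_simps)
    qed
    have osc: "\<exists>E\<in>events. prob E \<le> 2 * exp (12 * C\<^sup>2) * exp (- l * (\<delta> / 3)) \<and>
        (\<forall>w\<in>space M - E. \<forall>k\<in>{bc.b i..bc.b (Suc i)}. \<bar>lm n k w - lm n (bc.b i) w\<bar> < \<delta> / 3)" if i: "i < m" for i
    proof -
      have k: "bc.b i \<le> bc.b (Suc i)" "bc.b (Suc i) \<le> n"
        using block_start_mono[of i "Suc i" m n] block_start_mono[of "Suc i" m m n] i m by auto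
      obtain E where E: "E \<in> events"
        "prob E \<le> 2 * exp (- l * (\<delta> / 3)) * (1 + 6 * l\<^sup>2 * (\<sigma> + 2 * A)\<^sup>2 * bc.h\<^sup>2) ^ (bc.b (Suc i) - bc.b i)"
        "\<And>w k. w \<in> space M - E ==> k \<in> {bc.b i..bc.b (Suc i)} ==>
          \<bar>bc.chain.log_mart k w - bc.chain.log_mart (bc.b i) w\<bar> < \<delta> / 3"
        using bc.chain.oscillation[OF k l1 lC] by blast
      have x: "6 * l\<^sup>2 * (\<sigma> + 2 * A)\<^sup>2 * bc.h\<^sup>2 = 6 * real m * C\<^sup>2 / real n"
        by (simp add: l_def C_def power_divide)
      have len: "real (bc.b (Suc i) - bc.b i) \<le> 2 * real n / real m"
      proof -
        have "real (Suc i) * real n / real m = real i * real n / real m + real n / real m"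
          by (simp add: add_divide_distrib[symmetric] algebra_simps)
        moreover have "1 \<le> real n / real m" using n(3) m by simp
        ultimately show ?thesis
          using block_start_bounds[OF m, where n = n and i = i] block_start_bounds[OF m, where n = n and i = "Suc i"] k(1) by simp
      qed
      have "(1 + 6 * l\<^sup>2 * (\<sigma> + 2 * A)\<^sup>2 * bc.h\<^sup>2) ^ (bc.b (Suc i) - bc.b i)
        \<le> exp (6 * real m * C\<^sup>2 / real n) ^ (bc.b (Suc i) - bc.b i)"
        unfolding x by (intro power_mono exp_ge_add_one_self) simp
      also have "\<dots> = exp (real (bc.b (Suc i) - bc.b i) * (6 * real m * C\<^sup>2 / real n))"
        by (rule exp_of_nat_mult[symmetric])
      also have "\<dots> \<le> exp (2 * real n / real m * (6 * real m * C\<^sup>2 / real n))"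
        unfolding exp_le_cancel_iff by (intro mult_right_mono len) simp
      also have "2 * real n / real m * (6 * real m * C\<^sup>2 / real n) = 12 * C\<^sup>2"
        using n(1) m by simp
      finally have "2 * exp (- l * (\<delta> / 3)) * (1 + 6 * l\<^sup>2 * (\<sigma> + 2 * A)\<^sup>2 * bc.h\<^sup>2) ^ (bc.b (Suc i) - bc.b i)
        \<le> 2 * exp (- l * (\<delta> / 3)) * exp (12 * C\<^sup>2)"
        by (intro mult_left_mono) auto
      from order.trans[OF E(2) this] have "prob E \<le> 2 * exp (12 * C\<^sup>2) * exp (- l * (\<delta> / 3))"
        by (simp only: mult_ac)
      with E(1,3) show ?thesis unfolding lm_def by (intro bexI[of _ E] conjI ballI) auto
    qed
    then obtain E where E: "\<And>i. i < m ==> E i \<in> events"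
      "\<And>i. i < m ==> prob (E i) \<le> 2 * exp (12 * C\<^sup>2) * exp (- l * (\<delta> / 3))"
      "\<And>i w k. i < m ==> w \<in> space M - E i ==> k \<in> {bc.b i..bc.b (Suc i)} ==> \<bar>lm n k w - lm n (bc.b i) w\<bar> < \<delta> / 3"
      by metis
    define F where "F = (\<Union>i\<le>m. Bad n i) \<union> (\<Union>i<m. E i)"
    have ev1: "(\<Union>i\<le>m. Bad n i) \<in> events" using Bad_meas[OF n(1)] by (intro sets.finite_UN) auto
    have ev2: "(\<Union>i<m. E i) \<in> events" using E(1) by (intro sets.finite_UN) auto
    have Fev: "F \<in> events" using ev1 ev2 by (auto simp: F_def)
    have "prob F \<le> prob (\<Union>i\<le>m. Bad n i) + prob (\<Union>i<m. E i)"
      unfolding F_def by (rule measure_Un_le[OF ev1 ev2])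
    also have "prob (\<Union>i\<le>m. Bad n i) \<le> (\<Sum>i\<le>m. prob (Bad n i))"
      using Bad_meas[OF n(1)] by (intro measure_UNION_le) auto
    also have "\<dots> \<le> \<delta>"
    proof -
      have "N1 \<le> n - 1" using n(2) by linarith
      from N1[OF this] show ?thesis using n(1) by simp
    qed
    also have "prob (\<Union>i<m. E i) \<le> (\<Sum>i<m. prob (E i))"
      using E(1) by (intro measure_UNION_le) auto
    also have "\<dots> \<le> (\<Sum>i<m. 2 * exp (12 * C\<^sup>2) * exp (- l * (\<delta> / 3)))"
      using E(2) by (intro sum_mono) auto
    finally have Fp: "prob F \<le> error_bound \<delta>" by (simp add: error_bound_def C_def l_def mult_ac)
    \<comment> \<open>Three errors of size \<delta>/3: the martingale at the block start, its
      oscillation within the block, and the deviation of the price from the martingale.\<close>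
    have close: "\<bar>\<sigma> / sqrt n * (\<Sum>j=1..k. bc.sgn_step j w) - target i w\<bar> \<le> \<delta>"
      if w: "w \<in> space M - F" and i: "i < m" and k: "k \<in> {bc.b i..bc.b (Suc i)}" for w i k
    proof -
      have wM: "w \<in> space M" using w by simp
      have kn: "k \<le> n" using k block_start_mono[of "Suc i" m m n] i m by simp
      have "w \<notin> Bad n i" using w i by (auto simp: F_def)
      then have 1: "\<bar>lm n (bc.b i) w - target i w\<bar> \<le> \<delta> / 3" using wM by (auto simp: Bad_def)
      have 2: "\<bar>lm n k w - lm n (bc.b i) w\<bar> < \<delta> / 3" using E(3)[OF i _ k] w i by (auto simp: F_def)
      have "lm n k w = \<sigma> / sqrt n * (\<Sum>j=1..k. bc.sgn_step j w) + bc.dev k w * bc.sgn_step k w / sqrt n"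
        by (simp add: lm_def bc.chain.log_mart_def algebra_simps add_divide_distrib)
      moreover have "\<bar>bc.dev k w * bc.sgn_step k w / sqrt n\<bar> \<le> \<delta> / 3"
      proof -
        have "\<bar>bc.dev k w * bc.sgn_step k w\<bar> \<le> \<bar>bc.dev k w\<bar>"
          using bc.chain.\<xi>_values[of k w] wM kn by (cases k) (auto simp: bc.dev_def)
        also have "\<dots> \<le> A" by (rule bc.dev_bounds(3)[OF wM kn])
        finally have "\<bar>bc.dev k w * bc.sgn_step k w\<bar> / sqrt n \<le> A / sqrt n" by (intro divide_right_mono) auto
        from order.trans[OF this An] show ?thesis by simp
      qed
      ultimately show ?thesis using 1 2 by linarith
    qed
    have "tracks_target n \<delta> bc.info bc.sgn_step bc.dev F"
      unfolding tracks_target_def using bc.chain.binary_chain_axioms bc.dev_last bc.dev_bulk Fev Fp close by blast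
    then show "\<exists>T \<xi> a E. tracks_target n \<delta> T \<xi> a E" by blast
  qed
qed

end

section \<open>Path space\<close>


lemma mspace_C01: "mspace C01 = {f. f \<in> extensional {0..1} \<and> continuous_on {0..1} f}"
proof -
  have "compactin (top_of_set {0..1::real}) (topspace (top_of_set {0..1}))"
    by (simp add: compactin_subtopology)
  then show ?thesis
    unfolding C01_def by (subst compactin_mspace_cfunspace) auto
qed

lemma C01_posI:
  assumes "f \<in> extensional {0..1}" "continuous_on {0..1} f" "\<And>t. t \<in> {0..1} ==> 0 < f t"
  shows "f \<in> C01_pos"
  using assms by (auto simp: C01_pos_def mspace_C01)

lemma C01_posD:
  assumes "f \<in> C01_pos"
  shows "f \<in> mspace C01" "continuous_on {0..1} f" "\<And>t. t \<in> {0..1} ==> 0 < f t" "f \<in> extensional {0..1}"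
  using assms by (auto simp: C01_pos_def mspace_C01)

lemma limitin_C01:
  assumes "f \<in> mspace C01" "\<And>n. u n \<in> mspace C01"
    and lim: "\<And>e. 0 < e ==> \<forall>\<^sub>F n in sequentially. \<forall>t\<in>{0..1}. \<bar>u n t - f t\<bar> \<le> e"
  shows "limitin C01_topology u f sequentially"
proof -
  interpret Metric_space "mspace C01" "mdist C01" by simp
  have "\<exists>N. \<forall>n\<ge>N. mdist C01 (u n) f < e" if e: "0 < e" for e
  proof -
    have "\<forall>\<^sub>F n in sequentially. mdist C01 (u n) f < e"
      using lim[OF half_gt_zero[OF e]]
    proof eventually_elim
      case (elim n)
      have "mdist C01 (u n) f \<le> e / 2"
        unfolding C01_def by (rule mdist_cfunspace_le) (use elim e in \<open>auto simp: dist_real_def\<close>)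
      then show ?case using e by simp
    qed
    then show ?thesis by (simp add: eventually_sequentially)
  qed
  then show ?thesis
    unfolding mtopology_of_def limit_metric_sequentially using assms(1,2) by auto
qed

lemma limitin_C01_pos:
  assumes "f \<in> C01_pos" "\<And>n. u n \<in> C01_pos"
    and "\<And>e. 0 < e ==> \<forall>\<^sub>F n in sequentially. \<forall>t\<in>{0..1}. \<bar>u n t - f t\<bar> \<le> e"
  shows "limitin C01_pos_topology u f sequentially"
  using limitin_C01[OF C01_posD(1)[OF assms(1)] C01_posD(1)[OF assms(2)] assms(3)] assms(1,2)
  by (simp add: limitin_subtopology)

section \<open>Supremum norm and linear interpolation\<close>

lemma le_sup_norm:
  assumes "y \<in> mspace C01" "t \<in> {0..1}" shows "\<bar>y t\<bar> \<le> sup_norm y"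
proof -
  have "continuous_on {0..1} (\<lambda>t. \<bar>y t\<bar>)" using assms(1) by (auto simp: mspace_C01 intro: continuous_intros)
  then have "compact ((\<lambda>t. \<bar>y t\<bar>) ` {0..1})" by (intro compact_continuous_image) auto
  then have "bdd_above ((\<lambda>t. \<bar>y t\<bar>) ` {0..1})" by (intro bounded_imp_bdd_above compact_imp_bounded)
  then show ?thesis unfolding sup_norm_def using assms(2) by (intro cSUP_upper)
qed

lemma sup_norm_le: "(\<And>t. t \<in> {0..1} ==> \<bar>y t\<bar> \<le> c) ==> sup_norm y \<le> c"
  unfolding sup_norm_def by (intro cSUP_least) auto

lemma sup_norm_nonneg: "y \<in> mspace C01 ==> 0 \<le> sup_norm y"
  using le_sup_norm[of y 0] by auto

lemma interpolation_extensional: "interpolation n y \<in> extensional {0..1}"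
  by (simp add: interpolation_def)

text \<open>A closed form from which continuity is evident.\<close>

lemma interpolation_telescope:
  assumes t: "t \<in> {0..1}"
  shows "interpolation n y t = y 0 + (\<Sum>k<n. (y (Suc k) - y k) * max 0 (min 1 (real n * t - real k)))"
proof -
  define j where "j = nat \<lfloor>real n * t\<rfloor>"
  have nt: "0 \<le> real n * t" "real n * t \<le> real n" using t by (auto simp: mult_left_le)
  have j: "real j \<le> real n * t" "real n * t < real j + 1" using nt by (simp_all add: j_def)
  have jn: "j \<le> n" using j(1) nt(2) by (simp flip: of_nat_le_iff)
  have low: "(\<Sum>k<j. (y (Suc k) - y k) * max 0 (min 1 (real n * t - real k))) = y j - y 0"
  proof -
    have "max 0 (min 1 (real n * t - real k)) = 1" if "k < j" for k
    proof -
      have "real k + 1 \<le> real j" using that by simp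
      then show ?thesis using j by simp
    qed
    then have "(\<Sum>k<j. (y (Suc k) - y k) * max 0 (min 1 (real n * t - real k))) = (\<Sum>k<j. y (Suc k) - y k)"
      by (intro sum.cong) auto
    then show ?thesis by (simp add: sum_lessThan_telescope)
  qed
  have high: "(\<Sum>k\<in>{Suc j..<n}. (y (Suc k) - y k) * max 0 (min 1 (real n * t - real k))) = 0"
  proof (rule sum.neutral, rule ballI)
    fix k assume "k \<in> {Suc j..<n}"
    then have "real j + 1 \<le> real k" by simp
    then show "(y (Suc k) - y k) * max 0 (min 1 (real n * t - real k)) = 0" using j by simp
  qed
  have val: "interpolation n y t = y j + (real n * t - real j) * (y (Suc j) - y j)"
    using t by (simp add: interpolation_def Let_def j_def algebra_simps)
  show ?thesis
  proof (cases "j = n")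
    case True
    then have "real n * t = real n" using j nt by simp
    then show ?thesis using val low True by simp
  next
    case False
    then have jn': "j < n" using jn by simp
    define f where "f k = (y (Suc k) - y k) * max 0 (min 1 (real n * t - real k))" for k
    have "sum f {..<n} = sum f {..<j} + (f j + sum f {Suc j..<n})"
      using sum.atLeastLessThan_concat[of 0 j n f] jn' sum.atLeast_Suc_lessThan[of j n f]
      by (simp add: lessThan_atLeast0)
    moreover have "f j = (y (Suc j) - y j) * (real n * t - real j)"
    proof -
      have "max 0 (min 1 (real n * t - real j)) = real n * t - real j" using j by linarith
      then show ?thesis by (simp only: f_def)
    qed
    ultimately have "sum f {..<n} = y j - y 0 + (y (Suc j) - y j) * (real n * t - real j)"
      using low high unfolding f_def[symmetric] by linarith
    then show ?thesis using val unfolding f_def by (simp only: mult.commute)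
  qed
qed

lemma interpolation_continuous: "continuous_on {0..1} (interpolation n y)"
  by (subst continuous_on_cong[OF refl interpolation_telescope]) (auto intro!: continuous_intros)

lemma interpolation_C01: "interpolation n y \<in> mspace C01"
  by (simp add: mspace_C01 interpolation_extensional interpolation_continuous)

text \<open>The \<open>min\<close> keeps the index within the model at t = 1, where the right
  neighbour has weight 0.\<close>

lemma interpolation_convex:
  assumes t: "t \<in> {0..1}" and n: "0 < n"
  obtains u where "0 \<le> u" "u \<le> 1" "interpolation n y t = (1 - u) * y (nat \<lfloor>real n * t\<rfloor>) + u * y (min n (Suc (nat \<lfloor>real n * t\<rfloor>)))"
    "nat \<lfloor>real n * t\<rfloor> \<le> n" "real (nat \<lfloor>real n * t\<rfloor>) \<le> real n * t" "real n * t < real (nat \<lfloor>real n * t\<rfloor>) + 1"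
proof
  define j where "j = nat \<lfloor>real n * t\<rfloor>"
  have nt: "0 \<le> real n * t" "real n * t \<le> real n" using t by (auto simp: mult_left_le)
  have j: "real j \<le> real n * t" "real n * t < real j + 1" using nt by (simp_all add: j_def)
  show "0 \<le> real n * t - real j" "real n * t - real j \<le> 1" using j by auto
  have jn: "j \<le> n" using j(1) nt(2) by (simp flip: of_nat_le_iff)
  show "interpolation n y t = (1 - (real n * t - real j)) * y (nat \<lfloor>real n * t\<rfloor>) + (real n * t - real j) * y (min n (Suc (nat \<lfloor>real n * t\<rfloor>)))"
  proof (cases "j = n")
    case True
    then have "real n * t = real n" using j nt by simp
    then have "t = 1" using n by simp
    then show ?thesis using True by (simp add: interpolation_def Let_def)
  next
    case False
    then have "min n (Suc j) = Suc j" using jn by simp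
    moreover have "interpolation n y t = y j + (real n * t - real j) * (y (Suc j) - y j)"
      using t by (simp add: interpolation_def Let_def j_def algebra_simps)
    ultimately show ?thesis unfolding j_def[symmetric] by (simp only:) (simp add: algebra_simps)
  qed
  show "nat \<lfloor>real n * t\<rfloor> \<le> n" "real (nat \<lfloor>real n * t\<rfloor>) \<le> real n * t" "real n * t < real (nat \<lfloor>real n * t\<rfloor>) + 1"
    using jn j by (auto simp: j_def)
qed

lemma interpolation_grid:
  assumes "k \<le> n" "0 < n" shows "interpolation n y (real k / real n) = y k"
  using assms by (simp add: interpolation_def Let_def)

text \<open>The definition mentions y (n + 1), but the telescoped form contains only the values up
  to n.\<close>

lemma interpolation_cong:
  assumes n: "0 < n" and eq: "\<And>k. k \<le> n ==> y k = z k" shows "interpolation n y = interpolation n z"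
proof (rule ext)
  fix t show "interpolation n y t = interpolation n z t"
  proof (cases "t \<in> {0..1}")
    case True
    then show ?thesis using eq by (simp add: interpolation_telescope)
  next
    case False
    then show ?thesis
      using interpolation_extensional[of n y] interpolation_extensional[of n z] by (simp add: extensional_def)
  qed
qed

lemma interpolation_pos:
  assumes "0 < n" "\<And>k. k \<le> n ==> 0 < y k" shows "interpolation n y \<in> C01_pos"
proof (rule C01_posI[OF interpolation_extensional interpolation_continuous])
  fix t :: real assume t: "t \<in> {0..1}"
  obtain u where u: "0 \<le> u" "u \<le> 1" "interpolation n y t = (1 - u) * y (nat \<lfloor>real n * t\<rfloor>) + u * y (min n (Suc (nat \<lfloor>real n * t\<rfloor>)))"
    and j: "nat \<lfloor>real n * t\<rfloor> \<le> n"
    using interpolation_convex[OF t assms(1)] by metis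
  have p: "0 < y (nat \<lfloor>real n * t\<rfloor>)" "0 < y (min n (Suc (nat \<lfloor>real n * t\<rfloor>)))" using assms(2) j by auto
  show "0 < interpolation n y t"
  proof (cases "u = 0")
    case True then show ?thesis using u p by simp
  next
    case False
    then have "0 < u * y (min n (Suc (nat \<lfloor>real n * t\<rfloor>)))" using u p by simp
    moreover have "0 \<le> (1 - u) * y (nat \<lfloor>real n * t\<rfloor>)" using u p by simp
    ultimately show ?thesis using u by linarith
  qed
qed

text \<open>The value at t is a convex combination of two grid values whose positions lie within 1/n
  of t.\<close>

lemma interpolation_close:
  assumes n: "0 < n" and t: "t \<in> {0..1}"
    and close: "\<And>k. k \<le> n ==> \<bar>real k / real n - t\<bar> \<le> 1 / real n ==> \<bar>y k - c\<bar> \<le> e"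
  shows "\<bar>interpolation n y t - c\<bar> \<le> e"
proof -
  define j where "j = nat \<lfloor>real n * t\<rfloor>"
  obtain u where u: "0 \<le> u" "u \<le> 1" "interpolation n y t = (1 - u) * y j + u * y (min n (Suc j))"
    and j: "j \<le> n" "real j \<le> real n * t" "real n * t < real j + 1"
    using interpolation_convex[OF t n, of y] unfolding j_def by metis
  have nt: "real n * t \<le> real n" using t by (auto simp: mult_left_le)
  have eq: "real k / real n - t = (real k - real n * t) / real n" for k
    using n by (simp add: diff_divide_distrib)
  have "\<bar>real j - real n * t\<bar> \<le> 1" using j by auto
  then have "\<bar>real j / real n - t\<bar> \<le> 1 / real n" unfolding eq using n by (simp add: divide_right_mono)
  then have 1: "\<bar>y j - c\<bar> \<le> e" using j by (intro close) auto
  have "\<bar>real (min n (Suc j)) - real n * t\<bar> \<le> 1" using j nt by (auto simp: min_def)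
  then have "\<bar>real (min n (Suc j)) / real n - t\<bar> \<le> 1 / real n"
    unfolding eq using n by (simp add: divide_right_mono)
  then have 2: "\<bar>y (min n (Suc j)) - c\<bar> \<le> e" by (intro close) auto
  have "interpolation n y t - c = (1 - u) * (y j - c) + u * (y (min n (Suc j)) - c)"
    by (simp add: u(3) algebra_simps)
  also have "\<bar>\<dots>\<bar> \<le> (1 - u) * \<bar>y j - c\<bar> + u * \<bar>y (min n (Suc j)) - c\<bar>"
    using u by (intro order.trans[OF abs_triangle_ineq]) (simp add: abs_mult)
  also have "\<dots> \<le> (1 - u) * e + u * e" using u 1 2 by (intro add_mono mult_left_mono) auto
  finally show ?thesis by (simp add: algebra_simps)
qed

lemma sup_norm_interpolation_le:
  assumes n: "0 < n" and "\<And>k. k \<le> n ==> \<bar>y k\<bar> \<le> e"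
  shows "sup_norm (interpolation n y) \<le> e"
  using interpolation_close[OF n, of _ y 0 e] assms(2) by (intro sup_norm_le) auto

section \<open>Duality\<close>


lemma space_coin_space: "space coin_space = (\<Pi>\<^sub>E i\<in>{1..}. {-1, 1})"
  by (simp add: coin_space_def space_PiM space_uniform_count_measure)

lemma vimage_algebra_generator: "(\<Union>i\<in>I. sets (vimage_algebra \<Omega> (X i) borel)) \<subseteq> Pow \<Omega>"
  using sets.sets_into_space[of _ "vimage_algebra \<Omega> (X _) borel"] by fastforce

text \<open>The sets that do not separate points with equal coordinates are closed under the
  sigma-algebra operations and contain the generators.\<close>

lemma generated_algebra_invariant:
  assumes A: "A \<in> sets (generated_algebra \<Omega> I X {})"
    and w: "w \<in> \<Omega>" "w' \<in> \<Omega>" "\<And>i. i \<in> I ==> X i w = X i w'"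
  shows "w \<in> A \<longleftrightarrow> w' \<in> A"
proof -
  have sub: "(\<Union>i\<in>I. sets (vimage_algebra \<Omega> (X i) borel)) \<union> {} \<subseteq> Pow \<Omega>"
    using vimage_algebra_generator[of \<Omega> X I] by simp
  have "A \<in> sigma_sets \<Omega> ((\<Union>i\<in>I. sets (vimage_algebra \<Omega> (X i) borel)) \<union> {})"
    using A unfolding generated_algebra_def by (simp add: sets_measure_of[OF sub[simplified]])
  then show ?thesis
  proof induction
    case (Basic A)
    then obtain i where i: "i \<in> I" "A \<in> sets (vimage_algebra \<Omega> (X i) borel)" by auto
    then obtain B where "A = X i -` B \<inter> \<Omega>" by (auto simp: sets_vimage_algebra2)
    then show ?case using w i(1) by simp
  qed (use w in auto)
qed

text \<open>The level set of \<gamma> k through w belongs to the filtration and so contains every w'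
  with the same first k - 1 coins. Measurability thus becomes a functional dependence that holds
  everywhere, and the strategy can be run under the law of another chain.\<close>

lemma strategy_nonanticipating:
  assumes "\<gamma> \<in> strategies n" "k \<in> {1..n}" "w \<in> space coin_space" "w' \<in> space coin_space"
    and eq: "\<And>i. i \<in> {1..k - 1} ==> w i = w' i"
  shows "\<gamma> k w = \<gamma> k w'"
proof -
  have meas: "\<gamma> k \<in> borel_measurable (coin_filtration (k - 1))"
    using assms(1,2) by (auto simp: strategies_def)
  have sp: "space (coin_filtration (k - 1)) = space coin_space"
    unfolding coin_filtration_def generated_algebra_def
    using vimage_algebra_generator[of "space coin_space" _ "{1..k - 1}"] by (intro space_measure_of) simp
  have mem: "\<gamma> k -` {\<gamma> k w} \<inter> space coin_space \<in> sets (coin_filtration (k - 1))"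
    using measurable_sets[OF meas, of "{\<gamma> k w}"] sp by simp
  have "w \<in> \<gamma> k -` {\<gamma> k w} \<inter> space coin_space \<longleftrightarrow> w' \<in> \<gamma> k -` {\<gamma> k w} \<inter> space coin_space"
    by (rule generated_algebra_invariant[OF mem[unfolded coin_filtration_def] assms(3,4)]) (rule eq)
  then show ?thesis using assms(3,4) by auto
qed

lemma coin_cylinder:
  assumes "w \<in> space coin_space"
  shows "0 < emeasure coin_space {w'\<in>space coin_space. \<forall>i\<in>{1..n}. w' i = w i}"
proof -
  define U where "U = uniform_count_measure {-1, 1 :: real}"
  have U: "prob_space U" unfolding U_def by (rule prob_space_uniform_count_measure) auto
  interpret product_prob_space "\<lambda>_. U" "{1..}::nat set"
    using U by (intro product_prob_spaceI)
  have w: "w i \<in> {-1, 1}" if "i \<in> {1..n}" for i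
    using assms that by (auto simp: space_coin_space PiE_iff)
  have "emeasure coin_space {w'\<in>space coin_space. \<forall>i\<in>{1..n}. w' i \<in> {w i}} = (\<Prod>i\<in>{1..n}. emeasure U {w i})"
    unfolding coin_space_def U_def[symmetric]
    by (rule emeasure_PiM_Collect) (use w in \<open>auto simp: U_def sets_uniform_count_measure\<close>)
  also have "\<dots> = (\<Prod>i\<in>{1..n}. ennreal (1 / 2))"
    using w by (intro prod.cong refl) (auto simp: U_def emeasure_uniform_count_measure)
  also have "\<dots> = ennreal (\<Prod>i\<in>{1..n}. 1 / 2)" by (rule prod_ennreal) auto
  also have "\<dots> > 0" by (simp only: ennreal_less_zero_iff) (auto intro: prod_pos)
  finally show ?thesis by simp
qed

text \<open>A cylinder that fixes n coins has positive probability, so an almost sure statement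
  about n coins holds at every point. This carries super-replication over from the coin measure to
  any other law of the signs.\<close>

lemma AE_coin_space_finite:
  assumes AE: "AE w in coin_space. P w"
    and dep: "\<And>w w'. w \<in> space coin_space ==> w' \<in> space coin_space ==>
      (\<And>i. i \<in> {1..n} ==> w i = w' i) ==> P w ==> P w'"
    and w: "w \<in> space coin_space"
  shows "P w"
proof (rule ccontr)
  assume "\<not> P w"
  obtain N where N: "{w\<in>space coin_space. \<not> P w} \<subseteq> N" "N \<in> null_sets coin_space"
    using AE by (auto elim!: AE_E simp: null_sets_def)
  define Z where "Z = {w'\<in>space coin_space. \<forall>i\<in>{1..n}. w' i = w i}"
  have "Z \<subseteq> {w\<in>space coin_space. \<not> P w}"
  proof (intro subsetI CollectI conjI notI)
    fix x assume x: "x \<in> Z"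
    then show "x \<in> space coin_space" by (simp add: Z_def)
    assume "P x"
    with x have "P w" by (intro dep[of x w] w) (auto simp: Z_def)
    with \<open>\<not> P w\<close> show False ..
  qed
  then have "emeasure coin_space Z \<le> emeasure coin_space N"
    using N by (intro emeasure_mono) auto
  then show False using coin_cylinder[OF w, of n] N(2) by (simp add: Z_def null_setsD1)
qed

lemma stock_cong:
  "(\<And>i. i \<in> {1..k} ==> w i = w' i) ==> stock \<sigma> s0 n w k = stock \<sigma> s0 n w' k"
  unfolding stock_def by (intro arg_cong2[where f = "(*)"] arg_cong[where f = exp] sum.cong refl) auto

lemma stock_path_cong:
  assumes "0 < n" "\<And>i. i \<in> {1..n} ==> w i = w' i"
  shows "stock_path \<sigma> s0 n w = stock_path \<sigma> s0 n w'"
  using assms(2) by (intro interpolation_cong[OF assms(1)] stock_cong) auto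

lemma portfolio_value_cong:
  assumes "0 < n" "\<gamma> \<in> strategies n" "w \<in> space coin_space" "w' \<in> space coin_space"
    and eq: "\<And>i. i \<in> {1..n} ==> w i = w' i" and "k \<le> n"
  shows "portfolio_value \<sigma> s0 n g x \<gamma> k w = portfolio_value \<sigma> s0 n g x \<gamma> k w'"
  using \<open>k \<le> n\<close>
proof (induction k)
  case (Suc k)
  have \<gamma>: "\<gamma> j w = \<gamma> j w'" if "j \<le> n" for j
  proof (cases "j = 0")
    case True then show ?thesis using assms(2,3,4) by (simp add: strategies_def)
  next
    case False
    then show ?thesis using eq that by (intro strategy_nonanticipating[OF assms(2) _ assms(3,4)]) auto
  qed
  have S: "stock \<sigma> s0 n w j = stock \<sigma> s0 n w' j" if "j \<le> n" for j
    using eq that by (intro stock_cong) auto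
  have "stock_path \<sigma> s0 n w = stock_path \<sigma> s0 n w'" by (rule stock_path_cong[OF assms(1) eq])
  then show ?case using Suc by (simp add: \<gamma> S)
qed simp

text \<open>The boundary term disappears at j = n when the martingale ends at the price. The trades
  then meet only the gaps M_k - S_k, which become the arguments of the conjugate cost.\<close>

lemma summation_by_parts:
  fixes \<gamma> S M :: "nat => real"
  assumes "\<gamma> 0 = 0"
  shows "(\<Sum>k<j. \<gamma> (Suc k) * (S (Suc k) - S k)) =
    (\<Sum>k<j. \<gamma> (Suc k) * (M (Suc k) - M k)) + (\<Sum>k<j. (\<gamma> (Suc k) - \<gamma> k) * (M k - S k)) - \<gamma> j * (M j - S j)"
  using assms by (induction j) (simp_all add: algebra_simps)

lemma portfolio_value_sum:
  "portfolio_value \<sigma> s0 n g x \<gamma> j w = x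
    + (\<Sum>k<j. \<gamma> (Suc k) w * (stock \<sigma> s0 n w (Suc k) - stock \<sigma> s0 n w k))
    - (\<Sum>k<j. g (real k / real n) (stock_path \<sigma> s0 n w) (\<gamma> (Suc k) w - \<gamma> k w))"
  by (induction j) simp_all

locale scaled_chain = binary_chain M n \<sigma> "1 / sqrt (real n)" A T \<xi> a
  for M :: "'a measure" and n :: nat and \<sigma> A :: real
    and T :: "nat => 'a => 't" and \<xi> a :: "nat => 'a => real" +
  fixes s0 :: real
  assumes s0: "0 < s0" and a_last: "\<And>w. a n w = 0"
begin

lemma n_pos: "0 < n" using h_pos by (cases n) auto

text \<open>Coordinates after n are set to 1 merely to obtain a point of the coin space.\<close>

definition coins :: "'a => nat => real" where
  "coins w = (\<lambda>i\<in>{1..}. if i \<le> n then \<xi> i w else 1)"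

lemma coins_in: "w \<in> space M ==> coins w \<in> space coin_space"
  using \<xi>_values by (auto simp: coins_def space_coin_space)

lemma coins_det:
  assumes "k \<le> n" "w \<in> space M" "w' \<in> space M" "T k w = T k w'" "i \<in> {1..k}"
  shows "coins w i = coins w' i"
  using \<xi>_det[OF _ assms(2,3) T_det_le[OF _ assms(1-4)], of i] assms(1,5) by (simp add: coins_def)

definition price :: "nat => 'a => real" where
  "price k w = stock \<sigma> s0 n (coins w) k"

definition price_path :: "'a => real => real" where
  "price_path w = stock_path \<sigma> s0 n (coins w)"

definition deviation :: "nat => 'a => real" where
  "deviation k w = s0 * exp (log_mart k w) - price k w"

lemma price_eq: "k \<le> n ==> price k w = s0 * exp (\<sigma> / sqrt n * (\<Sum>i=1..k. \<xi> i w))"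
  unfolding price_def stock_def by (simp add: coins_def)

lemma mart_eq: "k \<le> n ==> s0 * exp (log_mart k w) = price k w * exp (a k w * \<xi> k w / sqrt n)"
  by (simp add: price_eq log_mart_def mult.assoc flip: exp_add) (simp add: algebra_simps add_divide_distrib)

lemma deviation_eq: "k \<le> n ==> deviation k w = price k w * (exp (a k w * \<xi> k w / sqrt n) - 1)"
  by (simp add: deviation_def mart_eq algebra_simps)

lemma price_pos: "0 < price k w"
  using s0 by (simp add: price_def stock_def)

lemma price_path_pos: "price_path w \<in> C01_pos"
  unfolding price_path_def using s0 by (intro interpolation_pos n_pos) (simp add: stock_def)

lemma det_coins:
  assumes "k \<le> n" and f: "\<And>w w'. w \<in> space coin_space ==> w' \<in> space coin_space ==>
      (\<And>i. i \<in> {1..k} ==> w i = w' i) ==> f w = f w'"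
  shows "det k (\<lambda>w. f (coins w))"
  by (rule detI) (intro f coins_in coins_det[OF assms(1)])

lemma det_price_path: "det n price_path"
  unfolding price_path_def by (intro det_coins order_refl stock_path_cong n_pos)

lemma det_price: "k \<le> n ==> det k (price k)"
  unfolding price_def by (intro det_coins stock_cong)

lemma det_deviation:
  assumes "k \<le> n" shows "det k (deviation k)"
  unfolding deviation_def
  using det_comp2[OF det_log_mart[OF order_refl assms] det_price[OF assms], of "\<lambda>x y. s0 * exp x - y"] .

definition cost :: "(real => (real => real) => real => real) => 'a => real" where
  "cost G w = (\<Sum>k<n. G (real k / real n) (price_path w) (deviation k w))"

lemma det_cost: "det n (cost G)"
proof (rule detI)
  fix w w' assume *: "w \<in> space M" "w' \<in> space M" "T n w = T n w'"
  show "cost G w = cost G w'"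
    unfolding cost_def
  proof (rule sum.cong[OF refl])
    fix k assume "k \<in> {..<n}"
    then have k: "k \<le> n" by simp
    show "G (real k / real n) (price_path w) (deviation k w) = G (real k / real n) (price_path w') (deviation k w')"
      by (simp only: detD[OF det_price_path *] detD[OF det_mono[OF det_deviation[OF k] k order_refl] *])
  qed
qed

lemma duality:
  assumes G: "\<And>t S y \<nu>. t \<in> {0..1} ==> S \<in> C01_pos ==> \<nu> * y - g t S \<nu> \<le> G t S y"
  shows "ereal (expectation (\<lambda>w. F (price_path w) - cost G w))
    \<le> super_replication_cost \<sigma> s0 n g (\<lambda>w. F (stock_path \<sigma> s0 n w))"
  unfolding super_replication_cost_def
proof (rule INF_greatest, clarify)
  fix x \<gamma>
  assume \<gamma>: "\<gamma> \<in> strategies n"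
    and rep: "AE w in coin_space. F (stock_path \<sigma> s0 n w) \<le> portfolio_value \<sigma> s0 n g x \<gamma> n w"
  have rep': "F (stock_path \<sigma> s0 n w) \<le> portfolio_value \<sigma> s0 n g x \<gamma> n w" if "w \<in> space coin_space" for w
  proof (rule AE_coin_space_finite[OF rep _ that, of n])
    fix w w' assume *: "w \<in> space coin_space" "w' \<in> space coin_space" "\<And>i. i \<in> {1..n} ==> w i = w' i"
      and "F (stock_path \<sigma> s0 n w) \<le> portfolio_value \<sigma> s0 n g x \<gamma> n w"
    then show "F (stock_path \<sigma> s0 n w') \<le> portfolio_value \<sigma> s0 n g x \<gamma> n w'"
      using stock_path_cong[OF n_pos *(3)] portfolio_value_cong[OF n_pos \<gamma> * order_refl] by simp
  qed
  \<comment> \<open>The given strategy, run along the signs of the chain; it is predictable for the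
    chain because it depends on the earlier coins only.\<close>
  define c where "c k w = \<gamma> k (coins w)" for k w
  define X where "X k w = c (Suc k) w * (s0 * exp (log_mart (Suc k) w) - s0 * exp (log_mart k w))" for k w
  have det_c: "det k (c (Suc k))" if "k < n" for k
    unfolding c_def
  proof (rule det_coins)
    fix w w' assume "w \<in> space coin_space" "w' \<in> space coin_space" "\<And>i. i \<in> {1..k} ==> w i = w' i"
    then show "\<gamma> (Suc k) w = \<gamma> (Suc k) w'"
      using that by (intro strategy_nonanticipating[OF \<gamma>]) auto
  qed (use that in simp)
  have X0: "expectation (X k) = 0" if "k < n" for k
  proof -
    have "expectation (X k) = expectation (\<lambda>w. s0 * (c (Suc k) w * (exp (log_mart (Suc k) w) - exp (log_mart k w))))"
      by (intro bochner_cong) (simp_all add: X_def algebra_simps)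
    then show ?thesis by (simp add: martingale[OF that det_c[OF that]])
  qed
  have XI: "integrable M (X k)" if k: "k < n" for k
  proof (rule det_integrable)
    show "det (Suc k) (X k)" unfolding X_def
      using det_comp2[OF det_log_mart[of "Suc k" "Suc k"] det_log_mart[of k "Suc k"], of "\<lambda>x y. s0 * exp x - s0 * exp y"] k
      by (intro det_mult det_mono[OF det_c[OF k]]) auto
  qed (use k in simp)
  have "F (price_path w) - cost G w \<le> x + (\<Sum>k<n. X k w)" if w: "w \<in> space M" for w
  proof -
    define M' where "M' k = s0 * exp (log_mart k w)" for k
    have c0: "c 0 w = 0" using \<gamma> coins_in[OF w] by (auto simp: c_def strategies_def)
    have dev_n: "M' n - price n w = 0" using a_last by (simp add: M'_def mart_eq)
    have "F (price_path w) \<le> portfolio_value \<sigma> s0 n g x \<gamma> n (coins w)"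
      unfolding price_path_def by (rule rep'[OF coins_in[OF w]])
    also have "\<dots> = x + (\<Sum>k<n. c (Suc k) w * (price (Suc k) w - price k w))
        - (\<Sum>k<n. g (real k / real n) (price_path w) (c (Suc k) w - c k w))"
      by (simp add: portfolio_value_sum c_def price_def price_path_def)
    also have "(\<Sum>k<n. c (Suc k) w * (price (Suc k) w - price k w)) =
        (\<Sum>k<n. c (Suc k) w * (M' (Suc k) - M' k)) + (\<Sum>k<n. (c (Suc k) w - c k w) * (M' k - price k w))"
      using summation_by_parts[where \<gamma> = "\<lambda>k. c k w" and S = "\<lambda>k. price k w" and M = M' and j = n, OF c0] by (simp add: dev_n)
    also have "(\<Sum>k<n. c (Suc k) w * (M' (Suc k) - M' k)) = (\<Sum>k<n. X k w)"
      by (simp add: X_def M'_def)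
    also have "(\<Sum>k<n. (c (Suc k) w - c k w) * (M' k - price k w))
      \<le> (\<Sum>k<n. g (real k / real n) (price_path w) (c (Suc k) w - c k w) + G (real k / real n) (price_path w) (deviation k w))"
    proof (rule sum_mono)
      fix k assume "k \<in> {..<n}"
      then have "real k / real n \<in> {0..1}" by auto
      from G[OF this price_path_pos, of "c (Suc k) w - c k w" "deviation k w" w]
      show "(c (Suc k) w - c k w) * (M' k - price k w)
        \<le> g (real k / real n) (price_path w) (c (Suc k) w - c k w) + G (real k / real n) (price_path w) (deviation k w)"
        by (simp add: deviation_def M'_def)
    qed
    finally show ?thesis by (simp add: cost_def sum.distrib)
  qed
  then have "expectation (\<lambda>w. F (price_path w) - cost G w) \<le> expectation (\<lambda>w. x + (\<Sum>k<n. X k w))"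
    using det_integrable[OF order_refl det_comp2[OF det_price_path det_cost, of "\<lambda>p c. F p - c"]]
    by (intro integral_mono) (auto intro!: XI)
  also have "\<dots> = x"
    using XI X0 by (subst bochner_add) (auto simp: bochner_sum prob_space)
  finally show "ereal (expectation (\<lambda>w. F (price_path w) - cost G w)) \<le> ereal x" by simp
qed

section \<open>Uniform moments of the maximal price\<close>

lemma sum_inverse_squares: "(\<Sum>j=1..J. 1 / (real j)\<^sup>2) \<le> 2"
proof -
  have "(\<Sum>j=1..J. 1 / (real j)\<^sup>2) \<le> 2 - 1 / real J" if "1 \<le> J" for J
    using that
  proof (induction J rule: dec_induct)
    case (step J)
    have J: "0 < real J" using step by simp
    have "1 / (real (Suc J))\<^sup>2 \<le> 1 / real J - 1 / real (Suc J)"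
      using J by (simp add: divide_simps power2_eq_square)
    then show ?case using step by simp
  qed simp
  from this[of J] show ?thesis by (cases "1 \<le> J") (auto intro: order.trans)
qed

text \<open>Let Y be the maximum of exp (q log M). The maximal inequality with exponent 2 q gives
  P(Y \<ge> j) \<le> K / j^2, where K bounds (1 + 24 q^2 (\<sigma> + 2 A)^2 / n)^n, and summing
  these tails bounds E Y independently of n. A price exceeds s0 times the normalised martingale by
  at most the factor exp A.\<close>

lemma sup_moment:
  assumes q: "1 \<le> q" and n: "2 * real q * (\<sigma> + 2 * A) \<le> sqrt n"
  shows "expectation (\<lambda>w. (1 + sup_norm (price_path w)) ^ q)
    \<le> 2 ^ q * (1 + (s0 * exp A) ^ q * (1 + 2 * exp (24 * (real q)\<^sup>2 * (\<sigma> + 2 * A)\<^sup>2)))"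
proof -
  define K where "K = exp (24 * (real q)\<^sup>2 * (\<sigma> + 2 * A)\<^sup>2)"
  have A0: "0 \<le> A" using a_bound[of 0] not_empty by fastforce
  define Y where "Y w = Max ((\<lambda>k. exp (real q * log_mart k w)) ` {0..n})" for w
  have detY: "det n Y"
  proof (rule detI)
    fix w w' assume *: "w \<in> space M" "w' \<in> space M" "T n w = T n w'"
    have "(\<lambda>k. exp (real q * log_mart k w)) ` {0..n} = (\<lambda>k. exp (real q * log_mart k w')) ` {0..n}"
      using detD[OF det_log_mart[OF _ order_refl] *] by (intro image_cong) auto
    then show "Y w = Y w'" by (simp only: Y_def)
  qed
  have Y0: "0 < Y w" for w
  proof -
    have "exp (real q * log_mart 0 w) \<le> Y w" unfolding Y_def by (intro Max_ge) auto
    then show ?thesis using exp_gt_zero less_le_trans by blast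
  qed
  have "finite (Y ` space M)" using det_simple[OF order_refl detY] by (simp add: simple_function_def)
  then obtain J where J: "\<And>w. w \<in> space M ==> Y w \<le> real J"
  proof -
    obtain J :: nat where "Max (Y ` space M) \<le> real J" using real_arch_simple by blast
    then show ?thesis using that \<open>finite (Y ` space M)\<close> by (meson Max_ge image_eqI order_trans)
  qed
  have ev: "{w\<in>space M. real j \<le> Y w} \<in> events" for j
  proof -
    have "Y \<in> borel_measurable M" by (rule borel_measurable_simple_function[OF det_simple[OF order_refl detY]])
    then show ?thesis by measurable
  qed
  have prob: "prob {w\<in>space M. real j \<le> Y w} \<le> K * (1 / (real j)\<^sup>2)" if j: "1 \<le> j" for j
  proof -
    have "{w\<in>space M. real j \<le> Y w} = {w\<in>space M. \<exists>k\<in>{0..n}. (real j)\<^sup>2 \<le> exp (2 * real q * (log_mart k w - log_mart 0 w))}"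
    proof (intro Collect_cong conj_cong refl)
      fix w assume w: "w \<in> space M"
      have l0: "log_mart 0 w = 0" using a_0[OF w] by (simp add: log_mart_def)
      have "real j \<le> Y w \<longleftrightarrow> (\<exists>k\<in>{0..n}. real j \<le> exp (real q * log_mart k w))"
        unfolding Y_def by (subst Max_ge_iff) auto
      also have "\<dots> \<longleftrightarrow> (\<exists>k\<in>{0..n}. (real j)\<^sup>2 \<le> (exp (real q * log_mart k w))\<^sup>2)"
        by (simp add: power_mono_iff)
      also have "\<dots> \<longleftrightarrow> (\<exists>k\<in>{0..n}. (real j)\<^sup>2 \<le> exp (2 * real q * log_mart k w))"
        by (simp add: exp_double[symmetric] mult.assoc)
      finally show "real j \<le> Y w \<longleftrightarrow> (\<exists>k\<in>{0..n}. (real j)\<^sup>2 \<le> exp (2 * real q * (log_mart k w - log_mart 0 w)))"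
        by (simp add: l0)
    qed
    then have "(real j)\<^sup>2 * prob {w\<in>space M. real j \<le> Y w} \<le> (1 + 6 * (2 * real q)\<^sup>2 * (\<sigma> + 2 * A)\<^sup>2 * (1 / sqrt n)\<^sup>2) ^ (n - 0)"
    proof (simp only:, intro exp_maximal_inequality)
      show "1 \<le> \<bar>2 * real q\<bar>" using q by simp
      show "\<bar>2 * real q\<bar> * (\<sigma> + 2 * A) * (1 / sqrt n) \<le> 1" using n n_pos by simp
    qed auto
    also have "\<dots> \<le> exp (6 * (2 * real q)\<^sup>2 * (\<sigma> + 2 * A)\<^sup>2 * (1 / sqrt n)\<^sup>2) ^ (n - 0)"
      by (intro power_mono exp_ge_add_one_self) simp
    also have "\<dots> = exp (real n * (6 * (2 * real q)\<^sup>2 * (\<sigma> + 2 * A)\<^sup>2 * (1 / sqrt n)\<^sup>2))"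
      unfolding minus_nat.diff_0 by (rule exp_of_nat_mult[symmetric])
    also have "real n * (6 * (2 * real q)\<^sup>2 * (\<sigma> + 2 * A)\<^sup>2 * (1 / sqrt n)\<^sup>2) = 24 * (real q)\<^sup>2 * (\<sigma> + 2 * A)\<^sup>2"
      using n_pos by (simp add: power_divide power_mult_distrib)
    finally show ?thesis using j by (simp add: K_def field_simps)
  qed
  \<comment> \<open>The layer-cake estimate; J, an upper bound for the finitely many values of Y,
    keeps the sum finite.\<close>
  have "Y w \<le> 1 + (\<Sum>j=1..J. indicator {w\<in>space M. real j \<le> Y w} w)" if w: "w \<in> space M" for w
  proof -
    define f where "f = nat \<lfloor>Y w\<rfloor>"
    have f: "real f \<le> Y w" "Y w < real f + 1" using Y0[of w] by (simp_all add: f_def)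
    have "f \<le> J" using f(1) J[OF w] by (simp flip: of_nat_le_iff)
    have "real f = (\<Sum>j=1..f. 1)" by simp
    also have "\<dots> \<le> (\<Sum>j=1..f. indicator {w\<in>space M. real j \<le> Y w} w)"
    proof (rule sum_mono)
      fix j assume "j \<in> {1..f}"
      then have "real j \<le> real f" by simp
      then show "1 \<le> indicat_real {w\<in>space M. real j \<le> Y w} w" using f(1) w by simp
    qed
    also have "\<dots> \<le> (\<Sum>j=1..J. indicator {w\<in>space M. real j \<le> Y w} w)"
      using \<open>f \<le> J\<close> by (intro sum_mono2) auto
    finally show ?thesis using f(2) by linarith
  qed
  then have "expectation Y \<le> expectation (\<lambda>w. 1 + (\<Sum>j=1..J. indicator {w\<in>space M. real j \<le> Y w} w))"
    using ev by (intro integral_mono det_integrable[OF order_refl detY])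
      (auto intro!: bochner_integrable_add bochner_integrable_sum integrable_real_indicator simp: emeasure_eq_measure simp del: indicator_eq_0_iff)
  also have "\<dots> = 1 + (\<Sum>j=1..J. prob {w\<in>space M. real j \<le> Y w})"
    using ev by (subst bochner_add)
      (auto intro!: bochner_integrable_sum integrable_real_indicator simp: emeasure_eq_measure prob_space bochner_sum)
  also have "\<dots> \<le> 1 + (\<Sum>j=1..J. K * (1 / (real j)\<^sup>2))"
    using prob by (intro add_left_mono sum_mono) auto
  also have "\<dots> = 1 + K * (\<Sum>j=1..J. 1 / (real j)\<^sup>2)" by (simp add: sum_distrib_left)
  also have "\<dots> \<le> 1 + K * 2"
    using sum_inverse_squares by (intro add_left_mono mult_left_mono) (auto simp: K_def)
  finally have EY: "expectation Y \<le> 1 + 2 * K" by simp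
  have bound: "(1 + sup_norm (price_path w)) ^ q \<le> 2 ^ q * (1 + (s0 * exp A) ^ q * Y w)" if w: "w \<in> space M" for w
  proof -
    define s where "s = sup_norm (price_path w)"
    have s_nn: "0 \<le> s" unfolding s_def by (intro sup_norm_nonneg C01_posD(1)[OF price_path_pos])
    obtain k where k: "k \<le> n" "s \<le> price k w"
    proof -
      define p where "p = Max ((\<lambda>k. price k w) ` {0..n})"
      have "p \<in> (\<lambda>k. price k w) ` {0..n}" unfolding p_def by (intro Max_in) auto
      then obtain k where "k \<le> n" "p = price k w" by auto
      moreover have "s \<le> p" unfolding s_def price_path_def
      proof (rule sup_norm_interpolation_le[OF n_pos])
        fix j assume "j \<le> n"
        then have "price j w \<le> p" unfolding p_def by (intro Max_ge) auto
        then show "\<bar>stock \<sigma> s0 n (coins w) j\<bar> \<le> p" using price_pos[of j w] by (simp add: price_def)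
      qed
      ultimately show ?thesis using that by auto
    qed
    \<comment> \<open>At k = 0 the value of \<xi> need not be a sign, but the coefficient there is
      0.\<close>
    have "\<bar>a k w * \<xi> k w\<bar> \<le> A"
      using \<xi>_values[of k w] a_bound[OF k(1) w] a_0[OF w] k(1) w A0 by (cases k) auto
    moreover have "1 \<le> sqrt n" using n_pos by simp
    moreover have "\<bar>y / z\<bar> \<le> \<bar>y\<bar>" if "1 \<le> z" for y z :: real
      using that mult_left_mono[of 1 z "\<bar>y\<bar>"] by (simp add: abs_divide divide_le_eq)
    ultimately have "\<bar>a k w * \<xi> k w / sqrt n\<bar> \<le> A"
      by (meson order_trans)
    then have "- A \<le> a k w * \<xi> k w / sqrt n" by (simp only: abs_le_iff) linarith
    then have "exp (- A) \<le> exp (a k w * \<xi> k w / sqrt n)" by (simp only: exp_le_cancel_iff)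
    then have "price k w * exp (- A) \<le> s0 * exp (log_mart k w)"
      unfolding mart_eq[OF k(1)] using price_pos[of k w] by (intro mult_left_mono) auto
    then have "price k w * exp (- A) * exp A \<le> s0 * exp (log_mart k w) * exp A"
      by (rule mult_right_mono) simp
    then have "price k w \<le> s0 * exp A * exp (log_mart k w)"
      by (simp add: mult.assoc mult.left_commute flip: exp_add) (simp add: add.commute)
    then have "s ^ q \<le> (s0 * exp A * exp (log_mart k w)) ^ q"
      using k s_nn by (intro power_mono) auto
    also have "\<dots> = (s0 * exp A) ^ q * exp (real q * log_mart k w)"
      by (simp add: power_mult_distrib exp_of_nat_mult)
    also have "\<dots> \<le> (s0 * exp A) ^ q * Y w"
      unfolding Y_def using k(1) s0 by (intro mult_left_mono Max_ge) auto
    finally have sq: "s ^ q \<le> (s0 * exp A) ^ q * Y w" .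
    have "(1 + s) ^ q \<le> (2 * max 1 s) ^ q" using s_nn by (intro power_mono) auto
    also have "\<dots> = 2 ^ q * (max 1 s) ^ q" by (simp add: power_mult_distrib)
    also have "(max 1 s) ^ q \<le> 1 + s ^ q" using s_nn by (simp add: max_def)
    also have "1 + s ^ q \<le> 1 + (s0 * exp A) ^ q * Y w" using sq by simp
    finally show ?thesis unfolding s_def by simp
  qed
  have "expectation (\<lambda>w. (1 + sup_norm (price_path w)) ^ q) \<le> expectation (\<lambda>w. 2 ^ q * (1 + (s0 * exp A) ^ q * Y w))"
  proof (rule integral_mono)
    show "integrable M (\<lambda>w. (1 + sup_norm (price_path w)) ^ q)"
      using det_comp2[OF det_price_path det_price_path, of "\<lambda>p _. (1 + sup_norm p) ^ q"] by (rule det_integrable[OF order_refl])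
    show "integrable M (\<lambda>w. 2 ^ q * (1 + (s0 * exp A) ^ q * Y w))"
      using det_comp2[OF detY detY, of "\<lambda>y _. 2 ^ q * (1 + (s0 * exp A) ^ q * y)"] by (rule det_integrable[OF order_refl])
  qed (rule bound)
  also have "\<dots> = 2 ^ q * (1 + (s0 * exp A) ^ q * expectation Y)"
    using det_integrable[OF order_refl detY] by (simp add: prob_space)
  also have "\<dots> \<le> 2 ^ q * (1 + (s0 * exp A) ^ q * (1 + 2 * K))"
    using EY s0 by (intro mult_left_mono add_left_mono) auto
  finally show ?thesis by (simp add: K_def)
qed

end

section \<open>Brownian filtration and elementary integrals\<close>


lemma Int_stable_vimage: "Int_stable {f -` A \<inter> S |A. A \<in> sets N}"
proof (rule Int_stableI)
  fix a b assume "a \<in> {f -` A \<inter> S |A. A \<in> sets N}" "b \<in> {f -` A \<inter> S |A. A \<in> sets N}"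
  then obtain A B where *: "a = f -` A \<inter> S" "A \<in> sets N" "b = f -` B \<inter> S" "B \<in> sets N" by blast
  have "a \<inter> b = f -` (A \<inter> B) \<inter> S" unfolding *(1,3) by auto
  moreover have "A \<inter> B \<in> sets N" using * by auto
  ultimately show "a \<inter> b \<in> {f -` A \<inter> S |A. A \<in> sets N}" by blast
qed

locale brownian = prob_space M + complete_measure M for M :: "'a measure" +
  fixes W :: "real => 'a => real"
  assumes bm: "brownian_motion M W"
begin

abbreviation FF :: "real => 'a measure" where "FF t \<equiv> brownian_filtration M W t"

lemma W_measurable [measurable]: "0 \<le> t ==> W t \<in> borel_measurable M"
  using bm by (simp add: brownian_motion_def)

lemma FF_generator: "(\<Union>i\<in>{0..t}. sets (vimage_algebra (space M) (W i) borel)) \<union> null_sets M \<subseteq> Pow (space M)"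
  using vimage_algebra_generator[of "space M" W "{0..t}"] sets.sets_into_space[of _ M] by (auto simp: null_sets_def)

lemma space_FF: "space (FF t) = space M"
  unfolding brownian_filtration_def generated_algebra_def by (rule space_measure_of[OF FF_generator])

lemma sets_FF: "sets (FF t) = sigma_sets (space M) ((\<Union>i\<in>{0..t}. sets (vimage_algebra (space M) (W i) borel)) \<union> null_sets M)"
  unfolding brownian_filtration_def generated_algebra_def by (rule sets_measure_of[OF FF_generator])

lemma sets_FF_subset: "sets (FF t) \<subseteq> sets M"
  unfolding sets_FF
proof (rule sets.sigma_sets_subset, safe)
  fix A i assume i: "i \<in> {0..t}" and A: "A \<in> sets (vimage_algebra (space M) (W i) borel)"
  have "sets (vimage_algebra (space M) (W i) borel) = {W i -` B \<inter> space M |B. B \<in> sets borel}"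
    by (rule sets_vimage_algebra2) simp
  then show "A \<in> sets M" using A i W_measurable[of i] by (auto dest: measurable_sets)
qed auto

lemma sets_FF_mono: "s \<le> t ==> sets (FF s) \<subseteq> sets (FF t)"
  unfolding sets_FF by (rule sigma_sets_mono') auto

lemma null_sets_FF: "N \<in> null_sets M ==> N \<in> sets (FF t)"
  unfolding sets_FF by (rule sigma_sets.Basic) simp

lemma measurable_FF_mono: "f \<in> borel_measurable (FF s) ==> s \<le> t ==> f \<in> borel_measurable (FF t)"
  using sets_FF_mono[of s t] by (auto simp: measurable_def space_FF)

lemma measurable_FF: "f \<in> borel_measurable (FF s) ==> f \<in> borel_measurable M"
  using sets_FF_subset[of s] by (auto simp: measurable_def space_FF)

lemma W_FF: "0 \<le> u ==> u \<le> t ==> W u \<in> borel_measurable (FF t)"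
proof (rule measurableI)
  fix B :: "real set" assume "0 \<le> u" "u \<le> t" "B \<in> sets borel"
  then have "W u -` B \<inter> space M \<in> sets (vimage_algebra (space M) (W u) borel)" by (intro in_vimage_algebra)
  then show "W u -` B \<inter> space (FF t) \<in> sets (FF t)"
    unfolding space_FF sets_FF using \<open>0 \<le> u\<close> \<open>u \<le> t\<close> by (intro sigma_sets.Basic) auto
qed simp

text \<open>All null sets belong to the filtration and M is complete, so a change on a null set
  preserves adaptedness.\<close>

lemma measurable_FF_AE:
  fixes f g :: "'a => real"
  assumes f: "f \<in> borel_measurable (FF t)" and eq: "AE w in M. f w = g w"
  shows "g \<in> borel_measurable (FF t)"
proof (rule measurableI)
  fix B :: "real set" assume B: "B \<in> sets borel"
  obtain N where N: "{w\<in>space M. f w \<noteq> g w} \<subseteq> N" "N \<in> null_sets M"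
    using eq by (auto elim!: AE_E simp: null_sets_def)
  have "N \<subseteq> space M" using N(2) sets.sets_into_space by (auto simp: null_sets_def)
  have sub: "{w\<in>N. g w \<in> B} \<in> null_sets M"
    by (rule complete2[OF _ N(2)]) auto
  have "g -` B \<inter> space (FF t) = (f -` B \<inter> space (FF t) - N) \<union> {w\<in>N. g w \<in> B}"
    using N(1) \<open>N \<subseteq> space M\<close> by (auto simp: space_FF)
  also have "\<dots> \<in> sets (FF t)"
    using measurable_sets[OF f B] null_sets_FF[OF N(2)] null_sets_FF[OF sub] by auto
  finally show "g -` B \<inter> space (FF t) \<in> sets (FF t)" .
qed simp

lemma W_0: "AE w in M. W 0 w = 0"
  using bm by (simp add: brownian_motion_def)

lemma increment_distributed:
  "0 \<le> s ==> s < t ==> distributed M lborel (\<lambda>w. W t w - W s w) (normal_density 0 (sqrt (t - s)))"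
  using bm by (simp add: brownian_motion_def)

text \<open>Sorted and completed by 0 and s, the times in J produce increments that are independent
  of the final one, from s to t; each W u - W 0 is a partial sum of them. As W 0 = 0 almost surely,
  the same holds for the values W u.\<close>

lemma finite_dim_indep:
  assumes st: "0 \<le> s" "s < t" and J: "finite J" "J \<subseteq> {0..s}" and B: "\<And>u. u \<in> J ==> B u \<in> sets borel"
    and U: "U \<in> sets borel"
  shows "prob ({w\<in>space M. \<forall>u\<in>J. W u w \<in> B u} \<inter> {w\<in>space M. W t w - W s w \<in> U}) =
    prob {w\<in>space M. \<forall>u\<in>J. W u w \<in> B u} * prob {w\<in>space M. W t w - W s w \<in> U}"
proof -
  define us where "us = sorted_list_of_set (insert 0 (insert s J))"
  have fin: "finite (insert 0 (insert s J))" using J by simp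
  have us: "set us = insert 0 (insert s J)" "sorted us" "distinct us"
    by (simp_all only: us_def set_sorted_list_of_set[OF fin] sorted_sorted_list_of_set distinct_sorted_list_of_set)
  define r where "r = length us - 1"
  have len: "length us = Suc r" using us(1) by (cases us) (auto simp: r_def)
  have us_range: "us ! i \<in> {0..s}" if "i \<le> r" for i
    using nth_mem[of i us] that us(1) J(2) st(1) by (auto simp: len)
  have us0: "us ! 0 = 0"
  proof -
    obtain i where "i < length us" "us ! i = 0" using us(1) by (metis in_set_conv_nth insertI1)
    then show ?thesis using sorted_nth_mono[OF us(2), of 0 i] us_range[of 0] by auto
  qed
  have usr: "us ! r = s"
  proof -
    obtain i where "i < length us" "us ! i = s" using us(1) by (metis in_set_conv_nth insertI1 insertI2)
    then show ?thesis using sorted_nth_mono[OF us(2), of i r] us_range[of r] by (auto simp: len)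
  qed
  define \<tau> where "\<tau> i = (if i \<le> r then us ! i else t)" for i
  have mono: "mono_on {..Suc r} \<tau>"
  proof (rule mono_onI)
    fix i j :: nat assume "i \<in> {..Suc r}" "j \<in> {..Suc r}" "i \<le> j"
    then show "\<tau> i \<le> \<tau> j"
      using sorted_nth_mono[OF us(2), of i j] us_range[of i] st by (auto simp: \<tau>_def len)
  qed
  define X where "X i w = W (\<tau> (Suc i)) w - W (\<tau> i) w" for i w
  have "indep_vars (\<lambda>_. borel) X {..<Suc r}"
  proof -
    have "\<forall>(n :: nat) (\<tau> :: nat => real). 0 \<le> \<tau> 0 --> mono_on {..n} \<tau> -->
        indep_vars (\<lambda>_. borel) (\<lambda>i w. W (\<tau> (Suc i)) w - W (\<tau> i) w) {..<n}"
      using bm unfolding brownian_motion_def by blast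
    moreover have "0 \<le> \<tau> 0" using us0 by (simp add: \<tau>_def)
    ultimately show ?thesis unfolding X_def using mono by blast
  qed
  from indep_var_restrict[OF this, of "{..<r}" "{r}"]
  have ind: "indep_var (PiM {..<r} (\<lambda>_. borel)) (\<lambda>w. \<lambda>i\<in>{..<r}. X i w) (PiM {r} (\<lambda>_. borel)) (\<lambda>w. \<lambda>i\<in>{r}. X i w)"
    by auto
  define idx where "idx u = (SOME i. i \<le> r \<and> us ! i = u)" for u
  have idx: "idx u \<le> r" "us ! idx u = u" if "u \<in> J" for u
  proof -
    have "u \<in> set us" using that us(1) by simp
    then have "\<exists>i. i \<le> r \<and> us ! i = u" by (auto simp: in_set_conv_nth len less_Suc_eq_le)
    from someI_ex[OF this] show "idx u \<le> r" "us ! idx u = u" by (auto simp: idx_def)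
  qed
  have sumX: "(\<Sum>i<k. X i w) = W (us ! k) w - W 0 w" if "k \<le> r" for k w
  proof -
    have "(\<Sum>i<k. X i w) = W (\<tau> k) w - W (\<tau> 0) w" unfolding X_def by (rule sum_lessThan_telescope)
    then show ?thesis using that us0 by (simp add: \<tau>_def)
  qed
  define S where "S = {v\<in>space (PiM {..<r} (\<lambda>_. borel)). \<forall>u\<in>J. (\<Sum>i<idx u. v i) \<in> B u}"
  have S: "S \<in> sets (PiM {..<r} (\<lambda>_. borel))"
  proof -
    have "(\<lambda>v. \<Sum>i<idx u. v i) \<in> borel_measurable (PiM {..<r} (\<lambda>_. borel :: real measure))" if "u \<in> J" for u
      using idx(1)[OF that] by (intro borel_measurable_sum measurable_component_singleton) auto
    then have "\<And>u. u \<in> J ==> {v\<in>space (PiM {..<r} (\<lambda>_. borel)). (\<Sum>i<idx u. v i) \<in> B u} \<in> sets (PiM {..<r} (\<lambda>_. borel))"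
      using B by (auto dest!: measurable_sets simp: vimage_def Int_def conj_commute)
    then show ?thesis unfolding S_def using J(1) by (intro sets.sets_Collect_finite_All) auto
  qed
  define R where "R = {v\<in>space (PiM {r} (\<lambda>_. borel :: real measure)). v r \<in> U}"
  have R: "R \<in> sets (PiM {r} (\<lambda>_. borel))"
    unfolding R_def using U by measurable
  have e1: "{w\<in>space M. \<forall>u\<in>J. W u w - W 0 w \<in> B u} = (\<lambda>w. \<lambda>i\<in>{..<r}. X i w) -` S \<inter> space M"
  proof -
    have "(\<Sum>i<idx u. (\<lambda>i\<in>{..<r}. X i w) i) = W u w - W 0 w" if "u \<in> J" for u w
    proof -
      have "(\<Sum>i<idx u. (\<lambda>i\<in>{..<r}. X i w) i) = (\<Sum>i<idx u. X i w)"
        using idx(1)[OF that] by (intro sum.cong) auto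
      then show ?thesis using sumX[OF idx(1)[OF that]] idx(2)[OF that] by simp
    qed
    then show ?thesis by (auto simp: S_def space_PiM simp del: restrict_apply)
  qed
  have e2: "{w\<in>space M. W t w - W s w \<in> U} = (\<lambda>w. \<lambda>i\<in>{r}. X i w) -` R \<inter> space M"
    by (auto simp: R_def space_PiM X_def \<tau>_def usr)
  have "prob ({w\<in>space M. \<forall>u\<in>J. W u w - W 0 w \<in> B u} \<inter> {w\<in>space M. W t w - W s w \<in> U}) =
    prob {w\<in>space M. \<forall>u\<in>J. W u w - W 0 w \<in> B u} * prob {w\<in>space M. W t w - W s w \<in> U}"
    unfolding e1 e2
    by (rule indep_setD[OF conjunct2[OF iffD1[OF indep_var_eq ind]]]) (use S R in \<open>auto intro!: sigma_sets.Basic\<close>)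
  moreover have AE: "AE w in M. (\<forall>u\<in>J. W u w - W 0 w \<in> B u) \<longleftrightarrow> (\<forall>u\<in>J. W u w \<in> B u)"
    using W_0 by eventually_elim simp
  have meas: "{w\<in>space M. \<forall>u\<in>J. W u w \<in> B u} \<in> events" "{w\<in>space M. \<forall>u\<in>J. W u w - W 0 w \<in> B u} \<in> events"
    "{w\<in>space M. W t w - W s w \<in> U} \<in> events"
  proof -
    have "{w\<in>space M. W u w \<in> B u} \<in> events" "{w\<in>space M. W u w - W 0 w \<in> B u} \<in> events" if "u \<in> J" for u
    proof -
      have [measurable]: "W u \<in> borel_measurable M" "W 0 \<in> borel_measurable M" "B u \<in> sets borel"
        using J(2) that B by (auto intro!: W_measurable)
      show "{w\<in>space M. W u w \<in> B u} \<in> events" "{w\<in>space M. W u w - W 0 w \<in> B u} \<in> events" by measurable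
    qed
    then show "{w\<in>space M. \<forall>u\<in>J. W u w \<in> B u} \<in> events" "{w\<in>space M. \<forall>u\<in>J. W u w - W 0 w \<in> B u} \<in> events"
      using J(1) by (auto intro!: sets.sets_Collect_finite_All)
    have [measurable]: "W t \<in> borel_measurable M" "W s \<in> borel_measurable M"
      using st by (auto intro!: W_measurable)
    show "{w\<in>space M. W t w - W s w \<in> U} \<in> events" using U by measurable
  qed
  moreover have "prob {w\<in>space M. \<forall>u\<in>J. W u w - W 0 w \<in> B u} = prob {w\<in>space M. \<forall>u\<in>J. W u w \<in> B u}"
    using AE meas by (intro finite_measure_eq_AE) auto
  moreover have "prob ({w\<in>space M. \<forall>u\<in>J. W u w - W 0 w \<in> B u} \<inter> {w\<in>space M. W t w - W s w \<in> U})
      = prob ({w\<in>space M. \<forall>u\<in>J. W u w \<in> B u} \<inter> {w\<in>space M. W t w - W s w \<in> U})"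
    using AE meas by (intro finite_measure_eq_AE) auto
  ultimately show ?thesis by simp
qed

text \<open>Finite-dimensional cylinders together with the null sets are stable under intersection
  and generate the completed sigma-algebra at time s, so independence extends from them.\<close>

lemma indep_set_increment:
  assumes st: "0 \<le> s" "s < t"
  shows "indep_set (sets (FF s)) {{w\<in>space M. W t w - W s w \<in> U} |U. U \<in> sets borel}"
proof -
  define I where "I = {{w\<in>space M. W t w - W s w \<in> U} |U. U \<in> sets borel}"
  define cyl where "cyl J B = {w\<in>space M. \<forall>u\<in>J. W u w \<in> B u}" for J and B :: "real => real set"
  define E where "E = {cyl J B |J B. finite J \<and> J \<subseteq> {0..s} \<and> (\<forall>u. B u \<in> sets borel)} \<union> null_sets M"
  have cylM: "cyl J B \<in> events" if "finite J" "J \<subseteq> {0..s}" "\<And>u. B u \<in> sets borel" for J B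
  proof -
    have "{w\<in>space M. W u w \<in> B u} \<in> events" if "u \<in> J" for u
      using measurable_sets[OF W_measurable \<open>B u \<in> sets borel\<close>, of u] \<open>J \<subseteq> {0..s}\<close> that
      by (auto simp: vimage_def Int_def conj_commute)
    then show ?thesis unfolding cyl_def using that(1) by (intro sets.sets_Collect_finite_All) auto
  qed
  have E_events: "E \<subseteq> events" using cylM by (auto simp: E_def)
  have [measurable]: "W t \<in> borel_measurable M" "W s \<in> borel_measurable M"
    using st by (auto intro!: W_measurable)
  have I_events: "I \<subseteq> events" by (auto simp: I_def)
  have "indep_set E I"
  proof (rule indep_setI[OF E_events I_events])
    fix a b assume ab: "a \<in> E" "b \<in> I"
    show "prob (a \<inter> b) = prob a * prob b"
    proof (cases "a \<in> null_sets M")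
      case True
      then have "a \<inter> b \<in> null_sets M" using ab I_events by (intro null_set_Int2) auto
      then show ?thesis using True by (simp add: measure_eq_0_null_sets)
    next
      case False
      then obtain J B where a: "a = cyl J B" "finite J" "J \<subseteq> {0..s}" "\<And>u. B u \<in> sets borel"
        using ab(1) by (auto simp: E_def)
      obtain U where b: "b = {w\<in>space M. W t w - W s w \<in> U}" "U \<in> sets borel" using ab(2) by (auto simp: I_def)
      show ?thesis unfolding a(1) b(1) cyl_def by (rule finite_dim_indep[OF st a(2,3,4) b(2)])
    qed
  qed
  moreover have "Int_stable E"
  proof (rule Int_stableI)
    fix a b assume ab: "a \<in> E" "b \<in> E"
    show "a \<inter> b \<in> E"
    proof (cases "a \<in> null_sets M \<or> b \<in> null_sets M")
      case True
      then have "a \<inter> b \<in> null_sets M"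
        using ab E_events null_set_Int2[of a M b] null_set_Int1[of b M a] by blast
      then show ?thesis by (simp add: E_def)
    next
      case False
      then obtain J B J' B' where *: "a = cyl J B" "finite J" "J \<subseteq> {0..s}" "\<And>u. B u \<in> sets borel"
        "b = cyl J' B'" "finite J'" "J' \<subseteq> {0..s}" "\<And>u. B' u \<in> sets borel"
        using ab by (auto simp: E_def)
      define B'' where "B'' u = (if u \<in> J then B u else UNIV) \<inter> (if u \<in> J' then B' u else UNIV)" for u
      have "a \<inter> b = cyl (J \<union> J') B''" by (auto simp: * cyl_def B''_def split: if_splits)
      moreover have "B'' u \<in> sets borel" for u using * by (auto simp: B''_def)
      ultimately show ?thesis unfolding E_def using * by blast
    qed
  qed
  moreover have "Int_stable I"
  proof (rule Int_stableI)
    fix a b assume "a \<in> I" "b \<in> I"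
    then obtain U U' where *: "a = {w\<in>space M. W t w - W s w \<in> U}" "U \<in> sets borel"
      "b = {w\<in>space M. W t w - W s w \<in> U'}" "U' \<in> sets borel" by (auto simp: I_def)
    then have "a \<inter> b = {w\<in>space M. W t w - W s w \<in> U \<inter> U'}" by auto
    then show "a \<inter> b \<in> I" using * unfolding I_def by blast
  qed
  ultimately have "indep_set (sigma_sets (space M) E) (sigma_sets (space M) I)"
    by (rule indep_set_sigma_sets)
  moreover have "sets (FF s) \<subseteq> sigma_sets (space M) E"
    unfolding sets_FF
  proof (rule sigma_sets_mono, safe)
    fix A i assume i: "i \<in> {0..s}" and "A \<in> sets (vimage_algebra (space M) (W i) borel)"
    moreover have "sets (vimage_algebra (space M) (W i) borel) = {W i -` B \<inter> space M |B. B \<in> sets borel}"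
      by (rule sets_vimage_algebra2) simp
    ultimately obtain B where "A = W i -` B \<inter> space M" "B \<in> sets borel" by auto
    then have "A = cyl {i} (\<lambda>_. B)" by (auto simp: cyl_def)
    then have "A \<in> E" using i \<open>B \<in> sets borel\<close> unfolding E_def by blast
    then show "A \<in> sigma_sets (space M) E" by (rule sigma_sets.Basic)
  next
    fix A assume "A \<in> null_sets M"
    then show "A \<in> sigma_sets (space M) E" by (intro sigma_sets.Basic) (simp add: E_def)
  qed
  ultimately show ?thesis
    unfolding I_def[symmetric] indep_sets2_eq by (auto intro: sigma_sets.Basic)
qed

lemma indep_var_increment:
  assumes st: "0 \<le> s" "s < t" and \<zeta>: "\<zeta> \<in> borel_measurable (FF s)"
  shows "indep_var borel \<zeta> borel (\<lambda>w. W t w - W s w)"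
  unfolding indep_var_eq
proof (intro conjI)
  have [measurable]: "W t \<in> borel_measurable M" "W s \<in> borel_measurable M"
    using st by (auto intro!: W_measurable)
  show "random_variable borel \<zeta>" by (rule measurable_FF[OF \<zeta>])
  show "random_variable borel (\<lambda>w. W t w - W s w)" by measurable
  show "indep_set (sigma_sets (space M) {\<zeta> -` A \<inter> space M |A. A \<in> sets borel})
     (sigma_sets (space M) {(\<lambda>w. W t w - W s w) -` A \<inter> space M |A. A \<in> sets borel})"
  proof (rule indep_set_sigma_sets)
    note ind = indep_set_increment[OF st]
    have sub1: "{\<zeta> -` A \<inter> space M |A. A \<in> sets borel} \<subseteq> sets (FF s)"
      using measurable_sets[OF \<zeta>] by (auto simp: space_FF)
    have sub2: "{(\<lambda>w. W t w - W s w) -` A \<inter> space M |A. A \<in> sets borel} \<subseteq> {{w\<in>space M. W t w - W s w \<in> U} |U. U \<in> sets borel}"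
    proof
      fix x assume "x \<in> {(\<lambda>w. W t w - W s w) -` A \<inter> space M |A. A \<in> sets borel}"
      then obtain A where "x = (\<lambda>w. W t w - W s w) -` A \<inter> space M" "A \<in> sets borel" by blast
      moreover from this have "x = {w\<in>space M. W t w - W s w \<in> A}" by blast
      ultimately show "x \<in> {{w\<in>space M. W t w - W s w \<in> U} |U. U \<in> sets borel}" by blast
    qed
    show "indep_set {\<zeta> -` A \<inter> space M |A. A \<in> sets borel} {(\<lambda>w. W t w - W s w) -` A \<inter> space M |A. A \<in> sets borel}"
    proof (rule indep_setI)
      fix a b assume "a \<in> {\<zeta> -` A \<inter> space M |A. A \<in> sets borel}" "b \<in> {(\<lambda>w. W t w - W s w) -` A \<inter> space M |A. A \<in> sets borel}"
      then show "prob (a \<inter> b) = prob a * prob b"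
        by (intro indep_setD[OF ind] subsetD[OF sub1] subsetD[OF sub2])
    qed (rule order.trans[OF sub1 indep_setD_ev1[OF ind]], rule order.trans[OF sub2 indep_setD_ev2[OF ind]])
    show "Int_stable {\<zeta> -` A \<inter> space M |A. A \<in> sets borel}" "Int_stable {(\<lambda>w. W t w - W s w) -` A \<inter> space M |A. A \<in> sets borel}"
      by (rule Int_stable_vimage)+
  qed
qed

text \<open>The form in which \<open>block_data\<close> demands law and independence of the driving
  increments.\<close>

lemma increment_normal:
  assumes st: "0 \<le> s" "s < t" and A: "A \<in> sets (FF s)" and U: "U \<in> sets borel"
  shows "prob (A \<inter> {w\<in>space M. (W t w - W s w) / sqrt (t - s) \<in> U}) = prob A * measure std_normal_distribution U"
proof -
  define Y where "Y w = (W t w - W s w) / sqrt (t - s)" for w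
  have [measurable]: "W t \<in> borel_measurable M" "W s \<in> borel_measurable M"
    using st by (auto intro!: W_measurable)
  have D: "distributed M lborel Y std_normal_density"
    using increment_distributed[OF st] normal_standard_normal_convert[of "sqrt (t - s)" "\<lambda>w. W t w - W s w" 0] st
    by (simp add: Y_def[abs_def])
  have Y[measurable]: "Y \<in> borel_measurable M" unfolding Y_def by measurable
  have "distr M lborel Y = std_normal_distribution"
    using D by (simp add: distributed_def)
  then have "measure (distr M lborel Y) U = measure std_normal_distribution U" by simp
  then have 1: "prob {w\<in>space M. Y w \<in> U} = measure std_normal_distribution U"
    using U by (subst (asm) measure_distr) (auto simp: vimage_def Int_def conj_commute)
  define U' where "U' = (\<lambda>x. x / sqrt (t - s)) -` U"
  have "U' \<in> sets borel" unfolding U'_def using measurable_sets[of "\<lambda>x. x / sqrt (t - s)" borel borel U] U by simp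
  moreover have eq: "{w\<in>space M. Y w \<in> U} = {w\<in>space M. W t w - W s w \<in> U'}" by (auto simp: Y_def U'_def)
  ultimately have "prob (A \<inter> {w\<in>space M. Y w \<in> U}) = prob A * prob {w\<in>space M. Y w \<in> U}"
    unfolding eq by (intro indep_setD[OF indep_set_increment[OF st] A]) blast
  then show ?thesis unfolding 1 by (simp only: Y_def)
qed

lemma increment_moments:
  assumes st: "0 \<le> s" "s \<le> t"
  shows "integrable M (\<lambda>w. W t w - W s w)" "expectation (\<lambda>w. W t w - W s w) = 0"
    "integrable M (\<lambda>w. (W t w - W s w)\<^sup>2)" "expectation (\<lambda>w. (W t w - W s w)\<^sup>2) = t - s"
proof -
  have "integrable M (\<lambda>w. W t w - W s w) \<and> expectation (\<lambda>w. W t w - W s w) = 0 \<and>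
    integrable M (\<lambda>w. (W t w - W s w)\<^sup>2) \<and> expectation (\<lambda>w. (W t w - W s w)\<^sup>2) = t - s"
  proof (cases "s = t")
    case False
    then have st': "s < t" using st by simp
    note D = increment_distributed[OF st(1) st']
    have p: "0 < sqrt (t - s)" using st' by simp
    have E: "expectation (\<lambda>w. W t w - W s w) = 0" by (rule normal_distributed_expectation[OF p D])
    have "variance (\<lambda>w. W t w - W s w) = (sqrt (t - s))\<^sup>2" by (rule normal_distributed_variance[OF p D])
    then have V: "expectation (\<lambda>w. (W t w - W s w)\<^sup>2) = t - s" using st' by (simp add: E)
    have "integrable M (\<lambda>w. W t w - W s w)"
      using distributed_integrable[OF D, of "\<lambda>x. x"] integrable_normal_moment_nz_1[OF p, of 0] by simp
    moreover have "integrable M (\<lambda>w. (W t w - W s w)\<^sup>2)"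
      using distributed_integrable[OF D, of "\<lambda>x. x\<^sup>2"] integrable_normal_moment[OF p, of 0 2] by simp
    ultimately show ?thesis using E V by simp
  qed simp
  then show "integrable M (\<lambda>w. W t w - W s w)" "expectation (\<lambda>w. W t w - W s w) = 0"
    "integrable M (\<lambda>w. (W t w - W s w)\<^sup>2)" "expectation (\<lambda>w. (W t w - W s w)\<^sup>2) = t - s" by auto
qed

lemma increment_mult:
  assumes st: "0 \<le> s" "s \<le> t" and \<zeta>: "\<zeta> \<in> borel_measurable (FF s)" "integrable M \<zeta>"
  shows "integrable M (\<lambda>w. \<zeta> w * (W t w - W s w))" "expectation (\<lambda>w. \<zeta> w * (W t w - W s w)) = 0"
    "integrable M (\<lambda>w. \<zeta> w * (W t w - W s w)\<^sup>2)" "expectation (\<lambda>w. \<zeta> w * (W t w - W s w)\<^sup>2) = expectation \<zeta> * (t - s)"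
proof -
  note mom = increment_moments[OF st]
  have "integrable M (\<lambda>w. \<zeta> w * (W t w - W s w)) \<and> expectation (\<lambda>w. \<zeta> w * (W t w - W s w)) = 0 \<and>
    integrable M (\<lambda>w. \<zeta> w * (W t w - W s w)\<^sup>2) \<and> expectation (\<lambda>w. \<zeta> w * (W t w - W s w)\<^sup>2) = expectation \<zeta> * (t - s)"
  proof (cases "s = t")
    case False
    then have ind: "indep_var borel \<zeta> borel (\<lambda>w. W t w - W s w)" using st by (intro indep_var_increment \<zeta>) auto
    have ind2: "indep_var borel \<zeta> borel (\<lambda>w. (W t w - W s w)\<^sup>2)"
      using indep_var_compose[OF ind, of "\<lambda>x. x" borel "\<lambda>x. x\<^sup>2" borel] by (simp add: o_def)
    show ?thesis
      using indep_var_integrable[OF ind \<zeta>(2) mom(1)] indep_var_integrable[OF ind2 \<zeta>(2) mom(3)]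
        indep_var_lebesgue_integral[OF ind \<zeta>(2) mom(1)] indep_var_lebesgue_integral[OF ind2 \<zeta>(2) mom(3)] mom
      by simp
  qed simp
  then show "integrable M (\<lambda>w. \<zeta> w * (W t w - W s w))" "expectation (\<lambda>w. \<zeta> w * (W t w - W s w)) = 0"
    "integrable M (\<lambda>w. \<zeta> w * (W t w - W s w)\<^sup>2)" "expectation (\<lambda>w. \<zeta> w * (W t w - W s w)\<^sup>2) = expectation \<zeta> * (t - s)"
    by auto
qed

end


section \<open>Isometry and martingale property of elementary integrals\<close>

lemma integral_double_sum:
  fixes f :: "nat => nat => 'b => real"
  assumes "\<And>i j. i < n ==> j < n ==> integrable M (f i j)"
  shows "(\<integral>x. (\<Sum>i<n. \<Sum>j<n. f i j x) \<partial>M) = (\<Sum>i<n. \<Sum>j<n. \<integral>x. f i j x \<partial>M)"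
proof (subst bochner_sum)
  show "(\<Sum>i<n. \<integral>x. (\<Sum>j<n. f i j x) \<partial>M) = (\<Sum>i<n. \<Sum>j<n. \<integral>x. f i j x \<partial>M)"
    using assms by (intro sum.cong refl bochner_sum) auto
qed (use assms in \<open>auto intro!: bochner_integrable_sum\<close>)

context brownian
begin

definition sq_int :: "('a => real) => bool" where
  "sq_int f \<longleftrightarrow> f \<in> borel_measurable M \<and> integrable M (\<lambda>w. (f w)\<^sup>2)"

lemma sq_intD: "sq_int f ==> f \<in> borel_measurable M" "sq_int f ==> integrable M (\<lambda>w. (f w)\<^sup>2)"
  by (auto simp: sq_int_def)

lemma abs_mult_le_squares: "\<bar>x * y\<bar> \<le> x\<^sup>2 + (y :: real)\<^sup>2"
proof -
  have "0 \<le> (\<bar>x\<bar> - \<bar>y\<bar>)\<^sup>2" by simp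
  then have "2 * \<bar>x * y\<bar> \<le> x\<^sup>2 + y\<^sup>2" by (simp add: power2_diff abs_mult)
  then show ?thesis using abs_ge_zero[of "x * y"] by linarith
qed

lemma sq_int_mult: "sq_int f ==> sq_int g ==> integrable M (\<lambda>w. f w * g w)"
  by (rule bochner_bound[of M "\<lambda>w. (f w)\<^sup>2 + (g w)\<^sup>2"])
    (auto simp: sq_int_def intro!: order.trans[OF abs_mult_le_squares])

lemma sq_int_const: "sq_int (\<lambda>_. c)"
  by (simp add: sq_int_def)

lemma sq_int_integrable: "sq_int f ==> integrable M f"
  using sq_int_mult[of f "\<lambda>_. 1"] by (simp add: sq_int_const)

lemma sq_int_add: assumes "sq_int f" "sq_int g" shows "sq_int (\<lambda>w. f w + g w)"
proof -
  have "integrable M (\<lambda>w. (f w)\<^sup>2 + (g w)\<^sup>2 + 2 * (f w * g w))"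
    using assms sq_int_mult[OF assms] by (auto simp: sq_int_def)
  then have "integrable M (\<lambda>w. (f w + g w)\<^sup>2)" by (simp add: power2_sum mult.assoc)
  then show ?thesis unfolding sq_int_def
    by (intro conjI borel_measurable_add sq_intD(1)[OF assms(1)] sq_intD(1)[OF assms(2)])
qed

lemma sq_int_bounded_mult:
  assumes "sq_int f" "\<eta> \<in> borel_measurable M" "\<And>w. w \<in> space M ==> \<bar>\<eta> w\<bar> \<le> B"
  shows "sq_int (\<lambda>w. \<eta> w * f w)"
  unfolding sq_int_def
proof
  show "(\<lambda>w. \<eta> w * f w) \<in> borel_measurable M" using assms by (auto simp: sq_int_def)
  show "integrable M (\<lambda>w. (\<eta> w * f w)\<^sup>2)"
  proof (rule bochner_bound[of M "\<lambda>w. B\<^sup>2 * (f w)\<^sup>2"])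
    show "AE w in M. norm ((\<eta> w * f w)\<^sup>2) \<le> norm (B\<^sup>2 * (f w)\<^sup>2)"
    proof (rule AE_I2)
      fix w assume "w \<in> space M"
      then have "(\<eta> w)\<^sup>2 \<le> B\<^sup>2" using assms(3) by (simp add: power2_le_iff_abs_le abs_le_square_iff[symmetric]) (meson abs_ge_self order_trans)
      then show "norm ((\<eta> w * f w)\<^sup>2) \<le> norm (B\<^sup>2 * (f w)\<^sup>2)"
        by (simp add: power_mult_distrib mult_right_mono)
    qed
  qed (use assms in \<open>auto simp: sq_int_def\<close>)
qed

lemma sq_int_diff: "sq_int f ==> sq_int g ==> sq_int (\<lambda>w. f w - g w)"
  using sq_int_add[of f "\<lambda>w. (-1) * g w"] sq_int_bounded_mult[of g "\<lambda>_. -1" 1] by simp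

lemma sq_int_sum: "(\<And>i. i \<in> I ==> sq_int (f i)) ==> sq_int (\<lambda>w. \<Sum>i\<in>I. f i w)"
  by (induction I rule: infinite_finite_induct) (auto simp: sq_int_const sq_int_add)

lemma sq_int_increment: "0 \<le> s ==> s \<le> t ==> sq_int (\<lambda>w. W t w - W s w)"
  using increment_moments(3)[of s t] W_measurable[of s] W_measurable[of t] by (auto simp: sq_int_def)

lemma increment_orthogonal:
  assumes "0 \<le> s" "s \<le> t" "\<zeta> \<in> borel_measurable (FF s)" "sq_int \<zeta>"
  shows "expectation (\<lambda>w. \<zeta> w * (W t w - W s w)) = 0" "integrable M (\<lambda>w. \<zeta> w * (W t w - W s w))"
  using increment_mult(1,2)[OF assms(1-3) sq_int_integrable[OF assms(4)]] by auto

definition tri_integral :: "real \<times> real \<times> ('a => real) => real => 'a => real" where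
  "tri_integral x t w = (case x of (a, b, \<eta>) => \<eta> w * (W (min b t) w - W (min a t) w))"

definition tri_process :: "real \<times> real \<times> ('a => real) => real => 'a => real" where
  "tri_process x t w = (case x of (a, b, \<eta>) => \<eta> w * indicator {a<..b} t)"

text \<open>For nonnegative left ends this is the length of the intersection of (a, b], (a', b'] and
  [0, t]. Summands of an elementary integrand may overlap, and the isometry is computed pair by pair
  instead of on a common refinement.\<close>

definition tri_overlap :: "real => real \<times> real \<times> ('a => real) => real \<times> real \<times> ('a => real) => real" where
  "tri_overlap t x y = (case x of (a, b, \<eta>) => case y of (a', b', \<eta>') =>
     max 0 (min (min b b') t - max a a'))"

abbreviation tri_coeff :: "real \<times> real \<times> ('a => real) => 'a => real" where
  "tri_coeff x \<equiv> snd (snd x)"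

definition valid_tri :: "real \<times> real \<times> ('a => real) => bool" where
  "valid_tri x = (case x of (a, b, \<eta>) => 0 \<le> a \<and> a \<le> b \<and> b \<le> 1 \<and>
    \<eta> \<in> borel_measurable (FF a) \<and> (\<exists>B. \<forall>w\<in>space M. \<bar>\<eta> w\<bar> \<le> B))"

lemma is_elementary_valid: "is_elementary M W H \<longleftrightarrow> (\<forall>x\<in>set H. valid_tri x)"
  by (auto simp: is_elementary_def valid_tri_def)

lemma elementary_integral_sum: "elementary_integral W H t w = (\<Sum>i<length H. tri_integral (H ! i) t w)"
proof -
  have "elementary_integral W H t w = sum_list (map (\<lambda>x. tri_integral x t w) H)"
    unfolding elementary_integral_def tri_integral_def ..
  then show ?thesis by (simp add: sum_list_sum_nth lessThan_atLeast0)
qed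

lemma elementary_process_sum: "elementary_process H t w = (\<Sum>i<length H. tri_process (H ! i) t w)"
proof -
  have "elementary_process H t w = sum_list (map (\<lambda>x. tri_process x t w) H)"
    unfolding elementary_process_def tri_process_def ..
  then show ?thesis by (simp add: sum_list_sum_nth lessThan_atLeast0)
qed

text \<open>Splitting at a' and at the smaller right end c leaves one square over (a', c]. Every
  other product contains an increment that lies after all remaining factors, and so has mean
  0.\<close>

lemma increment_pair_le:
  assumes ab: "0 \<le> a" "a \<le> b" "a' \<le> b'" "a \<le> a'"
    and \<eta>: "\<eta> \<in> borel_measurable (FF a)" "\<And>w. w \<in> space M ==> \<bar>\<eta> w\<bar> \<le> B"
    and \<eta>': "\<eta>' \<in> borel_measurable (FF a')" "\<And>w. w \<in> space M ==> \<bar>\<eta>' w\<bar> \<le> B'"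
  shows "expectation (\<lambda>w. (\<eta> w * (W b w - W a w)) * (\<eta>' w * (W b' w - W a' w))) =
    expectation (\<lambda>w. \<eta> w * \<eta>' w) * max 0 (min b b' - a')"
proof -
  define \<rho> where "\<rho> w = \<eta> w * \<eta>' w" for w
  have \<rho>: "\<rho> \<in> borel_measurable (FF a')"
    unfolding \<rho>_def using measurable_FF_mono[OF \<eta>(1) ab(4)] \<eta>'(1) by auto
  have \<rho>M: "\<rho> \<in> borel_measurable M" by (rule measurable_FF[OF \<rho>])
  have \<rho>b: "\<bar>\<rho> w\<bar> \<le> B * B'" if "w \<in> space M" for w
    unfolding \<rho>_def abs_mult using \<eta>(2)[OF that] \<eta>'(2)[OF that] by (intro mult_mono) auto
  have inc: "(\<lambda>w. W v w - W u w) \<in> borel_measurable (FF r)" if "0 \<le> u" "u \<le> v" "v \<le> r" for u v r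
    using W_FF[of u r] W_FF[of v r] that by auto
  have \<rho>i: "(\<lambda>w. \<rho> w * (W v w - W u w)) \<in> borel_measurable (FF r)" "sq_int (\<lambda>w. \<rho> w * (W v w - W u w))"
    if "0 \<le> u" "u \<le> v" "v \<le> r" "a' \<le> r" for u v r
    using inc[OF that(1-3)] measurable_FF_mono[OF \<rho> that(4)] sq_int_bounded_mult[OF sq_int_increment[OF that(1,2)] \<rho>M \<rho>b] by auto
  show ?thesis
  proof (cases "b \<le> a'")
    case True
    have "expectation (\<lambda>w. \<rho> w * (W b w - W a w) * (W b' w - W a' w)) = 0"
      using ab True by (intro increment_orthogonal(1) \<rho>i) auto
    then show ?thesis using True by (simp add: \<rho>_def mult_ac)
  next
    case False
    define c where "c = min b b'"
    have c: "a' \<le> c" "c \<le> b" "c \<le> b'" "c = b \<or> c = b'" using ab False by (auto simp: c_def)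
    define t1 t2 t3 t4 where
      "t1 w = (\<rho> w * (W a' w - W a w)) * (W b' w - W a' w)" and
      "t2 w = \<rho> w * (W c w - W a' w)\<^sup>2" and
      "t3 w = (\<rho> w * (W c w - W a' w)) * (W b' w - W c w)" and
      "t4 w = (\<rho> w * (W c w - W a' w)) * (W b w - W c w)" for w
    have split: "(\<eta> w * (W b w - W a w)) * (\<eta>' w * (W b' w - W a' w)) = t1 w + t2 w + t3 w + t4 w" for w
    proof -
      \<comment> \<open>As c is one of b and b', one of the two increments after c is zero.\<close>
      have "(W b w - W c w) * (W b' w - W c w) = 0" using c(4) by auto
      moreover have "(\<eta> w * (W b w - W a w)) * (\<eta>' w * (W b' w - W a' w)) = t1 w + t2 w + t3 w + t4 w + \<rho> w * ((W b w - W c w) * (W b' w - W c w))"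
        by (simp add: t1_def t2_def t3_def t4_def \<rho>_def power2_eq_square algebra_simps)
      ultimately show ?thesis by simp
    qed
    have \<rho>int: "integrable M \<rho>"
      using sq_int_integrable[OF sq_int_bounded_mult[OF sq_int_const[of 1] \<rho>M \<rho>b]] by simp
    have "expectation t1 = 0" "integrable M t1" unfolding t1_def
      using ab by (auto intro!: increment_orthogonal \<rho>i)
    moreover have "expectation t2 = expectation \<rho> * (c - a')" "integrable M t2" unfolding t2_def
      using ab c by (auto intro!: increment_mult(3,4) \<rho> \<rho>int)
    moreover have "expectation t3 = 0" "integrable M t3" unfolding t3_def
      using ab c by (auto intro!: increment_orthogonal \<rho>i)
    moreover have "expectation t4 = 0" "integrable M t4" unfolding t4_def
      using ab c by (auto intro!: increment_orthogonal \<rho>i)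
    ultimately have "expectation (\<lambda>w. t1 w + t2 w + t3 w + t4 w) = expectation \<rho> * (c - a')" by simp
    then show ?thesis unfolding split using c by (simp add: c_def \<rho>_def[abs_def])
  qed
qed

lemma tri_pair:
  assumes x: "valid_tri x" and y: "valid_tri y" and t: "0 \<le> t"
  shows "expectation (\<lambda>w. tri_integral x t w * tri_integral y t w) =
    expectation (\<lambda>w. tri_coeff x w * tri_coeff y w) * tri_overlap t x y"
proof -
  obtain a b \<eta> where x': "x = (a, b, \<eta>)" by (cases x) auto
  obtain a' b' \<eta>' where y': "y = (a', b', \<eta>')" by (cases y) auto
  obtain B B' where xv: "0 \<le> a" "a \<le> b" "\<eta> \<in> borel_measurable (FF a)" "\<And>w. w \<in> space M ==> \<bar>\<eta> w\<bar> \<le> B"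
    and yv: "0 \<le> a'" "a' \<le> b'" "\<eta>' \<in> borel_measurable (FF a')" "\<And>w. w \<in> space M ==> \<bar>\<eta>' w\<bar> \<le> B'"
    using x y by (auto simp: valid_tri_def x' y')
  show ?thesis
  proof (cases "a \<le> t \<and> a' \<le> t")
    case False
    then have "tri_integral x t = (\<lambda>_. 0) \<or> tri_integral y t = (\<lambda>_. 0)"
      using xv yv by (auto simp: tri_integral_def x' y' fun_eq_iff min_def)
    moreover have "tri_overlap t x y = 0" using False by (auto simp: tri_overlap_def x' y')
    ultimately show ?thesis by auto
  next
    case True
    have m: "min a t = a" "min a' t = a'" using True by auto
    show ?thesis
    proof (cases "a \<le> a'")
      case True': True
      have e: "max a a' = a'" "min (min b b') t = min (min b t) (min b' t)" using True' by linarith+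
      have "expectation (\<lambda>w. (\<eta> w * (W (min b t) w - W a w)) * (\<eta>' w * (W (min b' t) w - W a' w))) =
        expectation (\<lambda>w. \<eta> w * \<eta>' w) * max 0 (min (min b t) (min b' t) - a')"
        by (rule increment_pair_le[OF xv(1) _ _ True' xv(3,4) yv(3,4)]) (use True xv(2) yv(2) in auto)
      then show ?thesis by (simp only: tri_integral_def tri_overlap_def x' y' prod.case snd_conv e m)
    next
      case False
      then have le: "a' \<le> a" by simp
      have e: "max a a' = a" "min (min b b') t = min (min b' t) (min b t)" using le by linarith+
      have "expectation (\<lambda>w. (\<eta>' w * (W (min b' t) w - W a' w)) * (\<eta> w * (W (min b t) w - W a w))) =
        expectation (\<lambda>w. \<eta>' w * \<eta> w) * max 0 (min (min b' t) (min b t) - a)"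
        by (rule increment_pair_le[OF yv(1) _ _ le yv(3,4) xv(3,4)]) (use True xv(2) yv(2) in auto)
      moreover have "expectation (\<lambda>w. (\<eta>' w * (W (min b' t) w - W a' w)) * (\<eta> w * (W (min b t) w - W a w))) =
          expectation (\<lambda>w. (\<eta> w * (W (min b t) w - W a w)) * (\<eta>' w * (W (min b' t) w - W a' w)))"
        by (intro bochner_cong refl) (rule mult.commute)
      moreover have "expectation (\<lambda>w. \<eta>' w * \<eta> w) = expectation (\<lambda>w. \<eta> w * \<eta>' w)"
        by (intro bochner_cong refl) (rule mult.commute)
      ultimately show ?thesis
        by (simp only: tri_integral_def tri_overlap_def x' y' prod.case snd_conv e m)
    qed
  qed
qed

lemma sq_int_tri: assumes x: "valid_tri x" and t: "0 \<le> t" shows "sq_int (tri_integral x t)" "sq_int (tri_coeff x)"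
proof -
  obtain a b \<eta> where x': "x = (a, b, \<eta>)" by (cases x) auto
  obtain B where xv: "0 \<le> a" "a \<le> b" "\<eta> \<in> borel_measurable (FF a)" "\<And>w. w \<in> space M ==> \<bar>\<eta> w\<bar> \<le> B"
    using x by (auto simp: valid_tri_def x')
  have "sq_int (\<lambda>w. \<eta> w * (W (min b t) w - W (min a t) w))"
    using xv t by (intro sq_int_bounded_mult[where B = B] sq_int_increment measurable_FF[OF xv(3)]) auto
  then show "sq_int (tri_integral x t)" by (simp add: tri_integral_def[abs_def] x')
  show "sq_int (tri_coeff x)"
    using sq_int_bounded_mult[OF sq_int_const[of 1] measurable_FF[OF xv(3)] xv(4)] by (simp add: x')
qed

lemma tri_process_integral:
  assumes "0 \<le> t" "valid_tri x" "valid_tri y"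
  shows "(LBINT u. indicator {0..t} u * (tri_process x u w * tri_process y u w)) =
      tri_coeff x w * tri_coeff y w * tri_overlap t x y"
    "integrable lborel (\<lambda>u. indicator {0..t} u * (tri_process x u w * tri_process y u w))"
proof -
  obtain a b \<eta> where x': "x = (a, b, \<eta>)" by (cases x) auto
  obtain a' b' \<eta>' where y': "y = (a', b', \<eta>')" by (cases y) auto
  have v: "0 \<le> a" "0 \<le> a'" using assms by (auto simp: valid_tri_def x' y')
  have eq: "indicator {0..t} u * (tri_process x u w * tri_process y u w) =
      (\<eta> w * \<eta>' w) * indicator {max a a'<..min (min b b') t} u" for u
    using v by (auto simp: tri_process_def x' y' indicator_def)
  have I: "integrable lborel (indicator {max a a'<..min (min b b') t} :: real => real)"
    by (cases "max a a' \<le> min (min b b') t") (auto intro!: integrable_real_indicator)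
  then show "integrable lborel (\<lambda>u. indicator {0..t} u * (tri_process x u w * tri_process y u w))"
    unfolding eq by (rule integrable_mult_right)
  have "measure lborel {max a a'<..min (min b b') t} = max 0 (min (min b b') t - max a a')"
    by (cases "max a a' \<le> min (min b b') t") auto
  then show "(LBINT u. indicator {0..t} u * (tri_process x u w * tri_process y u w)) =
      tri_coeff x w * tri_coeff y w * tri_overlap t x y"
    unfolding eq by (simp add: tri_overlap_def x' y')
qed

text \<open>Both sides expand into the same double sum over pairs of summands: the left one through
  \<open>tri_pair\<close>, the right one by integrating products of indicators over time.\<close>

lemma elementary_isometry:
  assumes H: "is_elementary M W H" and t: "0 \<le> t"
  shows "(\<integral>\<^sup>+w. ennreal ((elementary_integral W H t w)\<^sup>2) \<partial>M) =
    (\<integral>\<^sup>+w. (\<integral>\<^sup>+u\<in>{0..t}. ennreal ((elementary_process H u w)\<^sup>2) \<partial>lborel) \<partial>M)"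
proof -
  define n where "n = length H"
  have v: "valid_tri (H ! i)" if "i < n" for i using H that by (auto simp: is_elementary_valid n_def)
  define S where "S w = (\<Sum>i<n. \<Sum>j<n. tri_coeff (H ! i) w * tri_coeff (H ! j) w * tri_overlap t (H ! i) (H ! j))" for w
  have inner: "(\<integral>\<^sup>+u\<in>{0..t}. ennreal ((elementary_process H u w)\<^sup>2) \<partial>lborel) = ennreal (S w)" "0 \<le> S w" for w
  proof -
    have eq: "indicator {0..t} u * (elementary_process H u w)\<^sup>2 =
      (\<Sum>i<n. \<Sum>j<n. indicator {0..t} u * (tri_process (H ! i) u w * tri_process (H ! j) u w))" for u
      by (cases "u \<in> {0..t}") (simp_all add: elementary_process_sum n_def power2_eq_square sum_product)
    have I: "integrable lborel (\<lambda>u. indicator {0..t} u * (elementary_process H u w)\<^sup>2)"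
      unfolding eq using tri_process_integral(2)[OF t v v] by (intro bochner_integrable_sum) auto
    have "(LBINT u. indicator {0..t} u * (elementary_process H u w)\<^sup>2) = S w"
      unfolding eq S_def
      by (subst integral_double_sum) (auto intro!: sum.cong tri_process_integral t v)
    moreover have "(\<integral>\<^sup>+u\<in>{0..t}. ennreal ((elementary_process H u w)\<^sup>2) \<partial>lborel) =
      (\<integral>\<^sup>+u. ennreal (indicator {0..t} u * (elementary_process H u w)\<^sup>2) \<partial>lborel)"
      by (intro nn_integral_cong) (auto simp: indicator_def)
    ultimately show "(\<integral>\<^sup>+u\<in>{0..t}. ennreal ((elementary_process H u w)\<^sup>2) \<partial>lborel) = ennreal (S w)"
      using nn_integral_eq_integral[OF I] by simp
    have "0 \<le> (LBINT u. indicator {0..t} u * (elementary_process H u w)\<^sup>2)"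
      by (intro integral_nonneg_AE) auto
    then show "0 \<le> S w" using \<open>_ = S w\<close> by simp
  qed
  have cI: "integrable M (\<lambda>w. tri_coeff (H ! i) w * tri_coeff (H ! j) w * tri_overlap t (H ! i) (H ! j))"
    if "i < n" "j < n" for i j
    using sq_int_mult[OF sq_int_tri(2)[OF v[OF that(1)] t] sq_int_tri(2)[OF v[OF that(2)] t]] by (rule integrable_mult_left)
  have SI: "integrable M S" unfolding S_def using cI by (intro bochner_integrable_sum) auto
  have I2: "integrable M (\<lambda>w. tri_integral (H ! i) t w * tri_integral (H ! j) t w)" if "i < n" "j < n" for i j
    by (intro sq_int_mult sq_int_tri v that t)
  have eq2: "(elementary_integral W H t w)\<^sup>2 = (\<Sum>i<n. \<Sum>j<n. tri_integral (H ! i) t w * tri_integral (H ! j) t w)" for w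
    by (simp add: elementary_integral_sum n_def power2_eq_square sum_product)
  have EI: "integrable M (\<lambda>w. (elementary_integral W H t w)\<^sup>2)"
    unfolding eq2 using I2 by (intro bochner_integrable_sum) auto
  have "expectation (\<lambda>w. (elementary_integral W H t w)\<^sup>2) =
    (\<Sum>i<n. \<Sum>j<n. expectation (\<lambda>w. tri_integral (H ! i) t w * tri_integral (H ! j) t w))"
    unfolding eq2 by (rule integral_double_sum[OF I2])
  also have "\<dots> = (\<Sum>i<n. \<Sum>j<n. expectation (\<lambda>w. tri_coeff (H ! i) w * tri_coeff (H ! j) w * tri_overlap t (H ! i) (H ! j)))"
    using tri_pair[OF v v t] by (intro sum.cong refl) auto
  also have "\<dots> = expectation S"
    unfolding S_def by (rule integral_double_sum[OF cI, symmetric])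
  finally have "expectation (\<lambda>w. (elementary_integral W H t w)\<^sup>2) = expectation S" .
  then show ?thesis
    unfolding inner(1) using nn_integral_eq_integral[OF EI] nn_integral_eq_integral[OF SI] inner(2) by simp
qed

text \<open>Unless the interval misses (s, t], the difference is \<eta> times the increment from max
  a s to min b t, which starts no earlier than the times at which \<eta> and \<zeta> are
  known.\<close>

lemma tri_martingale:
  assumes x: "valid_tri x" and st: "0 \<le> s" "s \<le> t" and \<zeta>: "\<zeta> \<in> borel_measurable (FF s)" "sq_int \<zeta>"
  shows "expectation (\<lambda>w. \<zeta> w * (tri_integral x t w - tri_integral x s w)) = 0"
proof -
  obtain a b \<eta> where x': "x = (a, b, \<eta>)" by (cases x) auto
  obtain B where xv: "0 \<le> a" "a \<le> b" "\<eta> \<in> borel_measurable (FF a)" "\<And>w. w \<in> space M ==> \<bar>\<eta> w\<bar> \<le> B"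
    using x by (auto simp: valid_tri_def x')
  have sq: "sq_int (\<lambda>w. \<eta> w * \<zeta> w)"
    by (rule sq_int_bounded_mult[OF \<zeta>(2) measurable_FF[OF xv(3)] xv(4)])
  have meas: "(\<lambda>w. \<eta> w * \<zeta> w) \<in> borel_measurable (FF (max a s))"
    using measurable_FF_mono[OF xv(3), of "max a s"] measurable_FF_mono[OF \<zeta>(1), of "max a s"] by auto
  consider "b \<le> s" | "t < a" | "a \<le> t" "s < b" by linarith
  then show ?thesis
  proof cases
    case 1
    then have "min b t = min b s" "min a t = min a s" using st xv by auto
    then show ?thesis by (simp add: tri_integral_def x')
  next
    case 2
    then have "min b t = min a t" "min b s = min a s" using st xv by auto
    then show ?thesis by (simp add: tri_integral_def x')
  next
    case 3
    have "W (min b t) w - W (min a t) w - (W (min b s) w - W (min a s) w) = W (min b t) w - W (max a s) w" for w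
      using 3 st xv by (cases "a \<le> s") (auto simp: min_def max_def)
    then have "\<zeta> w * (tri_integral x t w - tri_integral x s w) = (\<eta> w * \<zeta> w) * (W (min b t) w - W (max a s) w)" for w
      by (simp add: tri_integral_def x' right_diff_distrib[symmetric] mult_ac)
    moreover have "expectation (\<lambda>w. (\<eta> w * \<zeta> w) * (W (min b t) w - W (max a s) w)) = 0"
      using 3 st xv by (intro increment_orthogonal(1) meas sq) auto
    ultimately show ?thesis by (simp only:)
  qed
qed

lemma tri_integral_FF:
  assumes x: "valid_tri x" and t: "0 \<le> t" shows "tri_integral x t \<in> borel_measurable (FF t)"
proof -
  obtain a b \<eta> where x': "x = (a, b, \<eta>)" by (cases x) auto
  have xv: "0 \<le> a" "a \<le> b" "\<eta> \<in> borel_measurable (FF a)"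
    using x by (auto simp: valid_tri_def x')
  show ?thesis
  proof (cases "a \<le> t")
    case True
    then show ?thesis unfolding tri_integral_def x'
      using measurable_FF_mono[OF xv(3) True] W_FF[of "min b t" t] W_FF[of "min a t" t] xv t by simp
  next
    case False
    then have "tri_integral x t = (\<lambda>_. 0)" using xv by (auto simp: tri_integral_def x' fun_eq_iff)
    then show ?thesis by simp
  qed
qed

text \<open>Orthogonality of later increments to every square-integrable variable known at time s
  takes the place of conditional expectations.\<close>

definition sq_martingale :: "(real => 'a => real) => bool" where
  "sq_martingale N \<longleftrightarrow> (\<forall>t\<in>{0..1}. N t \<in> borel_measurable (FF t) \<and> sq_int (N t)) \<and>
    (\<forall>s t \<zeta>. 0 \<le> s --> s \<le> t --> t \<le> 1 --> \<zeta> \<in> borel_measurable (FF s) --> sq_int \<zeta> -->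
      expectation (\<lambda>w. \<zeta> w * (N t w - N s w)) = 0)"

lemma sq_martingale_elementary:
  assumes H: "is_elementary M W H" shows "sq_martingale (elementary_integral W H)"
proof -
  have v: "valid_tri (H ! i)" if "i < length H" for i using H that by (auto simp: is_elementary_valid)
  have eq: "elementary_integral W H t = (\<lambda>w. \<Sum>i<length H. tri_integral (H ! i) t w)" for t
    by (simp add: elementary_integral_sum fun_eq_iff)
  show ?thesis unfolding sq_martingale_def
  proof (intro conjI ballI allI impI)
    fix t :: real assume "t \<in> {0..1}"
    then show "elementary_integral W H t \<in> borel_measurable (FF t)" "sq_int (elementary_integral W H t)"
      unfolding eq using v by (auto intro!: borel_measurable_sum sq_int_sum tri_integral_FF sq_int_tri)
  next
    fix s t \<zeta> assume *: "0 \<le> s" "s \<le> t" "t \<le> 1" "\<zeta> \<in> borel_measurable (FF s)" "sq_int \<zeta>"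
    have I: "integrable M (\<lambda>w. \<zeta> w * (tri_integral (H ! i) t w - tri_integral (H ! i) s w))" if "i < length H" for i
      using * that by (intro sq_int_mult sq_int_diff sq_int_tri v) auto
    have "expectation (\<lambda>w. \<zeta> w * (elementary_integral W H t w - elementary_integral W H s w)) =
      expectation (\<lambda>w. \<Sum>i<length H. \<zeta> w * (tri_integral (H ! i) t w - tri_integral (H ! i) s w))"
      by (simp add: eq sum_distrib_left sum_subtractf[symmetric] right_diff_distrib)
    also have "\<dots> = 0"
      using I tri_martingale[OF v *(1,2,4,5)] by (simp add: bochner_sum)
    finally show "expectation (\<lambda>w. \<zeta> w * (elementary_integral W H t w - elementary_integral W H s w)) = 0" .
  qed
qed

text \<open>Doob's inequality for the squares. With N' the next value, N'^2 \<ge> N^2 + 2 N (N' -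
  N), and on the event S of an earlier crossing the last term has mean 0 because 1_S N is known at
  that time.\<close>

lemma sq_martingale_maximal:
  assumes N: "sq_martingale N" and \<tau>: "\<And>i. i \<le> n ==> \<tau> i \<in> {0..1}" "\<And>i. i < n ==> \<tau> i \<le> \<tau> (Suc i)"
    and \<delta>: "0 < \<delta>"
  shows "\<delta>\<^sup>2 * prob {w\<in>space M. \<exists>i\<in>{0..n}. \<delta>\<^sup>2 \<le> (N (\<tau> i) w)\<^sup>2} \<le> expectation (\<lambda>w. (N (\<tau> n) w)\<^sup>2)"
proof (rule maximal_inequality)
  have sq: "sq_int (N (\<tau> i))" "N (\<tau> i) \<in> borel_measurable (FF (\<tau> i))" if "i \<le> n" for i
    using N \<tau>(1)[OF that] by (auto simp: sq_martingale_def)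
  show "integrable M (\<lambda>w. (N (\<tau> k) w)\<^sup>2)" if "k \<le> n" for k by (rule sq_intD(2)[OF sq(1)[OF that]])
  have mono: "\<tau> i \<le> \<tau> j" if "i \<le> j" "j \<le> n" for i j
    using that
  proof (induction j rule: dec_induct)
    case (step j)
    then show ?case using \<tau>(2)[of j] by simp
  qed simp
  fix k assume k: "k < n"
  define S where "S = {w \<in> space M. \<exists>l\<in>{0..k}. \<delta>\<^sup>2 \<le> (N (\<tau> l) w)\<^sup>2}"
  have S: "S \<in> sets (FF (\<tau> k))"
  proof -
    have "{w\<in>space M. \<delta>\<^sup>2 \<le> (N (\<tau> l) w)\<^sup>2} \<in> sets (FF (\<tau> k))" if "l \<in> {0..k}" for l
    proof -
      have [measurable]: "N (\<tau> l) \<in> borel_measurable (FF (\<tau> k))"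
        using that k by (intro measurable_FF_mono[OF sq(2)] mono) auto
      have "{w\<in>space (FF (\<tau> k)). \<delta>\<^sup>2 \<le> (N (\<tau> l) w)\<^sup>2} \<in> sets (FF (\<tau> k))" by measurable
      then show ?thesis by (simp add: space_FF)
    qed
    moreover have "S = (\<Union>l\<in>{0..k}. {w\<in>space M. \<delta>\<^sup>2 \<le> (N (\<tau> l) w)\<^sup>2})" by (auto simp: S_def)
    ultimately show ?thesis by auto
  qed
  then have SM: "S \<in> events" using sets_FF_subset by auto
  define \<zeta> where "\<zeta> w = indicator S w * N (\<tau> k) w" for w
  have k': "k \<le> n" "Suc k \<le> n" using k by auto
  have \<zeta>: "\<zeta> \<in> borel_measurable (FF (\<tau> k))" "sq_int \<zeta>"
  proof -
    have "(indicator S :: 'a => real) \<in> borel_measurable (FF (\<tau> k))" using S by simp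
    then show "\<zeta> \<in> borel_measurable (FF (\<tau> k))" unfolding \<zeta>_def using sq(2)[OF k'(1)] by simp
    show "sq_int \<zeta>" unfolding \<zeta>_def
      by (rule sq_int_bounded_mult[OF sq(1)[OF k'(1)], of _ 1]) (use SM in \<open>auto simp: indicator_def\<close>)
  qed
  have "0 \<le> \<tau> k" "\<tau> (Suc k) \<le> 1" using \<tau>(1)[of k] \<tau>(1)[of "Suc k"] k by auto
  then have orth: "expectation (\<lambda>w. \<zeta> w * (N (\<tau> (Suc k)) w - N (\<tau> k) w)) = 0"
    using N \<zeta> \<tau>(2)[OF k] by (auto simp: sq_martingale_def)
  have I: "integrable M (\<lambda>w. indicator S w * (N (\<tau> i) w)\<^sup>2)" if "i \<le> n" for i
    using integrable_real_mult_indicator[OF SM sq_intD(2)[OF sq(1)[OF that]]] by (simp add: mult.commute)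
  have "expectation (\<lambda>w. indicator S w * (N (\<tau> k) w)\<^sup>2)
    = expectation (\<lambda>w. indicator S w * (N (\<tau> k) w)\<^sup>2 + 2 * (\<zeta> w * (N (\<tau> (Suc k)) w - N (\<tau> k) w)))"
    using orth by (subst bochner_add) (auto intro!: I sq_int_mult \<zeta> sq_int_diff sq k')
  also have "\<dots> \<le> expectation (\<lambda>w. indicator S w * (N (\<tau> (Suc k)) w)\<^sup>2)"
  proof (rule integral_mono)
    show "integrable M (\<lambda>w. indicator S w * (N (\<tau> k) w)\<^sup>2 + 2 * (\<zeta> w * (N (\<tau> (Suc k)) w - N (\<tau> k) w)))"
      by (intro bochner_integrable_add I integrable_mult_right sq_int_mult \<zeta> sq_int_diff sq k')
    show "integrable M (\<lambda>w. indicator S w * (N (\<tau> (Suc k)) w)\<^sup>2)" by (rule I[OF k'(2)])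
    fix w
    have "0 \<le> (N (\<tau> (Suc k)) w - N (\<tau> k) w)\<^sup>2" by simp
    then have "(N (\<tau> k) w)\<^sup>2 + 2 * (N (\<tau> k) w * (N (\<tau> (Suc k)) w - N (\<tau> k) w)) \<le> (N (\<tau> (Suc k)) w)\<^sup>2"
      by (simp add: power2_eq_square algebra_simps)
    then show "indicator S w * (N (\<tau> k) w)\<^sup>2 + 2 * (\<zeta> w * (N (\<tau> (Suc k)) w - N (\<tau> k) w)) \<le> indicator S w * (N (\<tau> (Suc k)) w)\<^sup>2"
      by (auto simp: \<zeta>_def indicator_def)
  qed
  finally show "expectation (\<lambda>w. indicator {w \<in> space M. \<exists>l\<in>{0..k}. \<delta>\<^sup>2 \<le> (N (\<tau> l) w)\<^sup>2} w * (N (\<tau> k) w)\<^sup>2)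
    \<le> expectation (\<lambda>w. indicator {w \<in> space M. \<exists>l\<in>{0..k}. \<delta>\<^sup>2 \<le> (N (\<tau> l) w)\<^sup>2} w * (N (\<tau> (Suc k)) w)\<^sup>2)"
    by (simp only: S_def)
qed (use \<delta> in auto)

end

section \<open>Grid approximation of progressive processes\<close>


text \<open>Open on the left, like the intervals of elementary integrands.\<close>

definition cell :: "nat => nat => real set" where
  "cell m i = {real i / real m<..real (Suc i) / real m}"

definition grid_step :: "nat => (nat => real) => real => real" where
  "grid_step m c t = (\<Sum>i<m. c i * indicator (cell m i) t)"

text \<open>The average over the previous cell, so that the step function is non-anticipating.\<close>

definition cell_average :: "nat => (real => real) => nat => real" where
  "cell_average m f i = (case i of 0 => 0 | Suc j => real m * (LBINT u. indicator (cell m j) u * f u))"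

lemma cell_sets [measurable]: "cell m i \<in> sets borel"
  by (simp add: cell_def)

lemma cell_measure: "0 < m ==> measure lborel (cell m i) = 1 / real m"
  by (simp add: cell_def divide_right_mono flip: diff_divide_distrib)

lemma cell_integrable: "integrable lborel (indicator (cell m i) :: real => real)"
  unfolding cell_def
  by (cases "real i / real m \<le> real (Suc i) / real m") (auto intro!: integrable_real_indicator)

lemma cell_disjoint: assumes "0 < m" "t \<in> cell m i" "t \<in> cell m j" shows "i = j"
proof -
  have "real i < real m * t" "real m * t \<le> real i + 1" "real j < real m * t" "real m * t \<le> real j + 1"
    using assms by (auto simp: cell_def field_simps)
  then show ?thesis by linarith
qed

lemma cell_exists:
  assumes m: "0 < m" and t: "0 < t" "t \<le> 1" shows "\<exists>i<m. t \<in> cell m i"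
proof -
  define i where "i = nat (\<lceil>real m * t\<rceil> - 1)"
  have "0 < real m * t" using m t by simp
  then have c: "1 \<le> \<lceil>real m * t\<rceil>" by linarith
  then have i: "real i = real_of_int \<lceil>real m * t\<rceil> - 1" by (simp add: i_def)
  have "real m * t \<le> real m" using m t by simp
  then have "\<lceil>real m * t\<rceil> \<le> int m" by linarith
  moreover have "int i = \<lceil>real m * t\<rceil> - 1" unfolding i_def using c by (intro nat_0_le) linarith
  ultimately have "i < m" by linarith
  moreover have "real i < real m * t" "real m * t \<le> real i + 1" unfolding i by linarith+
  then have "t \<in> cell m i" using m by (auto simp: cell_def field_simps)
  ultimately show ?thesis by blast
qed

lemma cell_subset: assumes "i < m" shows "cell m i \<subseteq> {0<..1}"
proof
  fix t assume t: "t \<in> cell m i"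
  have "real (Suc i) / real m \<le> 1" "0 \<le> real i / real m" using assms by auto
  moreover have "real i / real m < t" "t \<le> real (Suc i) / real m" using t by (simp_all add: cell_def)
  ultimately have "0 < t" "t \<le> 1" by linarith+
  then show "t \<in> {0<..1}" by simp
qed

lemma grid_step_cell: assumes "0 < m" "i < m" "t \<in> cell m i" shows "grid_step m c t = c i"
proof -
  have "c j * indicator (cell m j) t = (if i = j then c j else 0)" for j
  proof (cases "i = j")
    case True
    then show ?thesis using assms(3) by simp
  next
    case False
    have "t \<notin> cell m j"
    proof
      assume "t \<in> cell m j"
      from cell_disjoint[OF assms(1,3) this] False show False by contradiction
    qed
    then show ?thesis using False by (simp add: indicator_def)
  qed
  then have "grid_step m c t = (\<Sum>j<m. if i = j then c j else 0)"
    unfolding grid_step_def by (simp only:)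
  also have "\<dots> = c i" using assms(2) by (simp add: sum.delta')
  finally show ?thesis .
qed

lemma grid_step_measurable [measurable]: "grid_step m c \<in> borel_measurable borel"
  unfolding grid_step_def by measurable

lemma grid_step_abs:
  assumes m: "0 < m" shows "\<bar>grid_step m c t\<bar> = (\<Sum>i<m. \<bar>c i\<bar> * indicator (cell m i) t)"
proof (cases "\<exists>i<m. t \<in> cell m i")
  case True
  then obtain i where i: "i < m" "t \<in> cell m i" by auto
  have "(\<Sum>i<m. \<bar>c i\<bar> * indicator (cell m i) t) = grid_step m (\<lambda>i. \<bar>c i\<bar>) t" by (simp add: grid_step_def)
  then show ?thesis using grid_step_cell[OF m i] by simp
next
  case False
  then show ?thesis by (simp add: grid_step_def)
qed

lemma bounded_support_integrable:
  fixes f :: "real => real"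
  assumes [measurable]: "f \<in> borel_measurable borel" and B: "\<And>t. \<bar>f t\<bar> \<le> B" and supp: "\<And>t. t \<notin> {0..1} ==> f t = 0"
  shows "integrable lborel f"
proof (rule bochner_bound[of lborel "\<lambda>t::real. B * indicator {0..1} t"])
  show "integrable lborel (\<lambda>t::real. B * indicator {0..1} t :: real)"
    by (intro integrable_mult_right integrable_real_indicator) (auto simp: emeasure_lborel_Icc_eq)
  have "norm (f t) \<le> norm (B * indicator {0..1} t)" for t
    using B[of t] supp[of t] by (cases "t \<in> {0..1}") auto
  then show "AE t in lborel. norm (f t) \<le> norm (B * indicator {0..1} t)" by simp
qed measurable

lemma grid_step_integral_abs:
  assumes m: "0 < m"
  shows "integrable lborel (\<lambda>t. \<bar>grid_step m c t\<bar>)" "(LBINT t. \<bar>grid_step m c t\<bar>) = (\<Sum>i<m. \<bar>c i\<bar>) / real m"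
proof -
  show "integrable lborel (\<lambda>t. \<bar>grid_step m c t\<bar>)"
    unfolding grid_step_abs[OF m] by (intro bochner_integrable_sum integrable_mult_right cell_integrable)
  have "(LBINT t. (\<Sum>i<m. \<bar>c i\<bar> * indicator (cell m i) t)) = (\<Sum>i<m. LBINT t. \<bar>c i\<bar> * indicator (cell m i) t)"
    by (rule bochner_sum) (intro integrable_mult_right cell_integrable)
  also have "\<dots> = (\<Sum>i<m. \<bar>c i\<bar>) / real m"
    by (simp add: cell_measure[OF m] sum_divide_distrib)
  finally show "(LBINT t. \<bar>grid_step m c t\<bar>) = (\<Sum>i<m. \<bar>c i\<bar>) / real m"
    unfolding grid_step_abs[OF m] .
qed

text \<open>Averaging contracts the L1 norm, and the shift by one cell merely discards the last
  cell. The bound is uniform in m, which reduces convergence to the case of continuous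
  functions.\<close>

lemma cell_average_contraction:
  assumes m: "0 < m" and f: "integrable lborel f"
  shows "(LBINT t. \<bar>grid_step m (cell_average m f) t\<bar>) \<le> (LBINT t. \<bar>f t\<bar>)"
proof -
  have I: "integrable lborel (\<lambda>u. indicator (cell m j) u * \<bar>f u\<bar>)" for j
    using integrable_mult_indicator[of "cell m j" lborel "\<lambda>u. \<bar>f u\<bar>"] f by simp
  have "(\<Sum>i<m. \<bar>cell_average m f i\<bar>) / real m \<le> (\<Sum>j<m. LBINT u. indicator (cell m j) u * \<bar>f u\<bar>)"
  proof -
    obtain k where k: "m = Suc k" using m by (cases m) auto
    have *: "\<bar>LBINT u. indicator (cell m j) u * f u\<bar> \<le> (LBINT u. indicator (cell m j) u * \<bar>f u\<bar>)" for j
      using integral_abs_bound[of lborel "\<lambda>u. indicator (cell m j) u * f u"] by (simp add: abs_mult)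
    have "(\<Sum>i<m. \<bar>cell_average m f i\<bar>) = (\<Sum>j<k. real m * \<bar>LBINT u. indicator (cell m j) u * f u\<bar>)"
      unfolding k by (subst sum.lessThan_Suc_shift) (simp add: cell_average_def abs_mult)
    also have "\<dots> / real m = (\<Sum>j<k. \<bar>LBINT u. indicator (cell m j) u * f u\<bar>)"
      using m by (simp flip: sum_distrib_left)
    also have "\<dots> \<le> (\<Sum>j<k. LBINT u. indicator (cell m j) u * \<bar>f u\<bar>)"
      by (intro sum_mono *)
    also have "\<dots> \<le> (\<Sum>j<m. LBINT u. indicator (cell m j) u * \<bar>f u\<bar>)"
      unfolding k by (intro sum_mono2) (auto intro!: integral_nonneg_AE)
    finally show ?thesis .
  qed
  also have "\<dots> = (LBINT u. (\<Sum>j<m. indicator (cell m j) u * \<bar>f u\<bar>))"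
    by (rule bochner_sum[OF I, symmetric])
  also have "\<dots> \<le> (LBINT u. \<bar>f u\<bar>)"
  proof (rule integral_mono)
    fix u
    have "(\<Sum>j<m. indicator (cell m j) u) = grid_step m (\<lambda>_. 1) u" by (simp add: grid_step_def)
    also have "\<dots> \<le> 1"
    proof (cases "\<exists>i<m. u \<in> cell m i")
      case True then show ?thesis using grid_step_cell[OF m] by auto
    next
      case False then show ?thesis by (simp add: grid_step_def)
    qed
    finally have "(\<Sum>j<m. indicat_real (cell m j) u) * \<bar>f u\<bar> \<le> 1 * \<bar>f u\<bar>" by (intro mult_right_mono) auto
    then show "(\<Sum>j<m. indicator (cell m j) u * \<bar>f u\<bar>) \<le> \<bar>f u\<bar>" by (simp add: sum_distrib_right)
  next
    show "integrable lborel (\<lambda>u. \<Sum>j<m. indicator (cell m j) u * \<bar>f u\<bar>)"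
      by (rule bochner_integrable_sum) (rule I)
    show "integrable lborel (\<lambda>u. \<bar>f u\<bar>)" using f by simp
  qed
  finally show ?thesis by (simp add: grid_step_integral_abs(2)[OF m])
qed

text \<open>A measurable function is an almost everywhere limit of continuous ones; clipping these
  at \<plusminus>B keeps the bound and permits dominated convergence.\<close>

lemma continuous_approximation:
  fixes f :: "real => real"
  assumes f: "f \<in> borel_measurable borel" and B: "\<And>t. \<bar>f t\<bar> \<le> B" and e: "0 < e"
  shows "\<exists>g. continuous_on UNIV g \<and> (\<forall>t. \<bar>g t\<bar> \<le> B) \<and> (LBINT t. indicator {0..1} t * \<bar>f t - g t\<bar>) < e"
proof -
  have "f \<in> borel_measurable lebesgue" using f by (simp add: measurable_completion)
  then have "f measurable_on UNIV"
    by (rule lebesgue_measurable_imp_measurable_on) simp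
  then obtain N g where N: "negligible N" and g: "\<And>n. continuous_on UNIV (g n)"
    and lim: "\<And>x. x \<notin> N ==> (\<lambda>n. g n x) \<longlonglongrightarrow> f x"
    unfolding measurable_on_def by auto
  define g' where "g' n x = max (- B) (min B (g n x))" for n x
  have g': "continuous_on UNIV (g' n)" for n unfolding g'_def by (intro continuous_intros g)
  have B0: "0 \<le> B" using B[of 0] by linarith
  have g'B: "\<bar>g' n x\<bar> \<le> B" for n x using B0 by (auto simp: g'_def)
  have [measurable]: "g' n \<in> borel_measurable borel" for n
    using g' by (rule borel_measurable_continuous_onI)
  have lim': "(\<lambda>n. g' n x) \<longlonglongrightarrow> f x" if "x \<notin> N" for x
  proof -
    have "(\<lambda>n. max (- B) (min B (g n x))) \<longlonglongrightarrow> max (- B) (min B (f x))"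
      by (intro tendsto_intros lim that)
    moreover have "max (- B) (min B (f x)) = f x" using B[of x] by auto
    ultimately show ?thesis by (simp add: g'_def)
  qed
  have AE: "AE x in lborel. x \<notin> N"
  proof -
    have "N \<in> null_sets lebesgue" using N by (simp add: negligible_iff_null_sets)
    then have "AE x in lebesgue. x \<notin> N" by (rule AE_not_in)
    then show ?thesis by (simp add: AE_completion_iff)
  qed
  have "(\<lambda>n. LBINT t. indicator {0..1} t * \<bar>f t - g' n t\<bar>) \<longlonglongrightarrow> (\<integral>t. 0 \<partial>(lborel :: real measure))"
  proof (rule integral_dominated_convergence[where w = "\<lambda>t. (2 * B) * indicator {0..1} t"])
    show "AE x in lborel. (\<lambda>n. indicator {0..1} x * \<bar>f x - g' n x\<bar>) \<longlonglongrightarrow> (0 :: real)"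
      using AE
    proof eventually_elim
      case (elim x)
      have "(\<lambda>n. indicator {0..1} x * \<bar>f x - g' n x\<bar>) \<longlonglongrightarrow> indicator {0..1} x * \<bar>f x - f x\<bar>"
        by (intro tendsto_intros lim' elim)
      then show ?case by simp
    qed
    have "\<bar>f x - g' n x\<bar> \<le> 2 * B" for n x using B[of x] g'B[of n x] by linarith
    then show "AE x in lborel. norm (indicator {0..1} x * \<bar>f x - g' n x\<bar>) \<le> 2 * B * indicator {0..1} x" for n
      by (intro AE_I2) (auto simp: indicator_def)
  qed (use f in auto)
  then have "\<forall>\<^sub>F n in sequentially. (LBINT t. indicator {0..1} t * \<bar>f t - g' n t\<bar>) < e"
    using e by (intro order_tendstoD(2)) auto
  then obtain n where "(LBINT t. indicator {0..1} t * \<bar>f t - g' n t\<bar>) < e"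
    using eventually_happens'[OF sequentially_bot] by blast
  then show ?thesis using g' g'B by blast
qed

text \<open>Points of adjacent cells are less than 2/m apart, so uniform continuity handles every
  cell but the first. There the step function is 0 by convention, which costs at most B / m.\<close>

lemma cell_average_continuous:
  assumes g: "continuous_on UNIV g" and B: "\<And>t. \<bar>g t\<bar> \<le> B" and e: "0 < (e :: real)"
  shows "\<forall>\<^sub>F m in sequentially. (LBINT t. indicator {0..1} t * \<bar>grid_step m (cell_average m (\<lambda>t. indicator {0..1} t * g t)) t - g t\<bar>) \<le> e"
proof -
  define f where "f t = indicator {0..1} t * g t" for t
  have "uniformly_continuous_on {0..1} g"
    by (rule compact_uniformly_continuous[OF continuous_on_subset[OF g]]) auto
  then obtain d where d: "0 < d" "\<And>s t. s \<in> {0..1} ==> t \<in> {0..1} ==> \<bar>s - t\<bar> < d ==> \<bar>g s - g t\<bar> < e / 2"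
    using e unfolding uniformly_continuous_on_def dist_real_def by (metis half_gt_zero)
  have [measurable]: "g \<in> borel_measurable borel" using g by (rule borel_measurable_continuous_onI)
  have B0: "0 \<le> B" using B[of 0] by linarith
  have "(\<lambda>m. 2 / real m) \<longlonglongrightarrow> 0" by real_asymp
  from order_tendstoD(2)[OF this d(1)] have ev1: "\<forall>\<^sub>F m in sequentially. 2 / real m < d" .
  have "(\<lambda>m. B / real m) \<longlonglongrightarrow> 0" by real_asymp
  from order_tendstoD(2)[OF this half_gt_zero[OF e]] have ev2: "\<forall>\<^sub>F m in sequentially. B / real m < e / 2" .
  show ?thesis
    using ev1 ev2 eventually_gt_at_top[of 0]
  proof eventually_elim
    case (elim m)
    have m: "0 < m" by fact
    have [measurable]: "f \<in> borel_measurable borel" unfolding f_def by measurable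
    have fI: "integrable lborel f"
    proof (rule bounded_support_integrable[of f B])
      show "f \<in> borel_measurable borel" by measurable
    qed (use B B0 in \<open>auto simp: f_def indicator_def\<close>)
    have near: "\<bar>cell_average m f (Suc j) - g t\<bar> \<le> e / 2" if t: "t \<in> cell m (Suc j)" and j: "Suc j < m" for t j
    proof -
      have Ij: "integrable lborel (\<lambda>u. indicator (cell m j) u * f u)"
        using integrable_mult_indicator[of "cell m j" lborel f] fI by simp
      have "cell_average m f (Suc j) - g t = real m * (LBINT u. indicator (cell m j) u * f u - indicator (cell m j) u * g t)"
        using Ij cell_integrable[of m j] m by (simp add: cell_average_def cell_measure[OF m] algebra_simps)
      also have "\<bar>\<dots>\<bar> \<le> real m * (LBINT u. indicator (cell m j) u * (e / 2))"
      proof -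
        have "\<bar>LBINT u. indicator (cell m j) u * f u - indicator (cell m j) u * g t\<bar>
          \<le> (LBINT u. \<bar>indicator (cell m j) u * f u - indicator (cell m j) u * g t\<bar>)"
          by (rule integral_abs_bound)
        also have "\<dots> \<le> (LBINT u. indicator (cell m j) u * (e / 2))"
        proof (rule integral_mono)
          fix u
          show "\<bar>indicator (cell m j) u * f u - indicator (cell m j) u * g t\<bar> \<le> indicator (cell m j) u * (e / 2)"
          proof (cases "u \<in> cell m j")
            case True
            have u01: "u \<in> {0..1}" "t \<in> {0..1}" using cell_subset[of j m] cell_subset[of "Suc j" m] True t j by auto
            have "real j < real m * u" "real m * u \<le> real j + 1" "real j + 1 < real m * t" "real m * t \<le> real j + 2"
              using True t m by (auto simp: cell_def field_simps)
            then have "\<bar>real m * (u - t)\<bar> < 2" by (simp add: right_diff_distrib abs_less_iff)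
            then have "real m * \<bar>u - t\<bar> < 2" using m by (simp add: abs_mult)
            then have "\<bar>u - t\<bar> < 2 / real m" using m by (simp add: pos_less_divide_eq mult.commute)
            then have "\<bar>g u - g t\<bar> < e / 2" using d(2)[OF u01] elim by simp
            then show ?thesis using True u01 by (simp add: f_def)
          qed simp
        qed (use Ij cell_integrable[of m j] in auto)
        finally show ?thesis using m by (simp add: abs_mult mult_left_mono)
      qed
      also have "\<dots> = e / 2" using m by (simp add: cell_measure[OF m])
      finally show ?thesis .
    qed
    have ptw: "indicator {0..1} t * \<bar>grid_step m (cell_average m f) t - g t\<bar> \<le> indicator {0..1} t * (e / 2) + B * indicator (cell m 0) t"
      if "t \<noteq> 0" for t
    proof (cases "t \<in> {0<..1}")
      case True
      then obtain i where i: "i < m" "t \<in> cell m i" using cell_exists[OF m] by auto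
      show ?thesis
      proof (cases i)
        case 0
        then have "grid_step m (cell_average m f) t = 0"
          using grid_step_cell[OF m i] by (simp add: cell_average_def)
        then show ?thesis using B[of t] i 0 e True by (simp add: add_increasing)
      next
        case (Suc j)
        then show ?thesis using grid_step_cell[OF m i] near[of t j] i True B0 by (simp add: add_increasing2)
      qed
    next
      case False
      then show ?thesis using that B0 e by (auto simp: indicator_def)
    qed
    have "(LBINT t. indicator {0..1} t * \<bar>grid_step m (cell_average m f) t - g t\<bar>)
      \<le> (LBINT t. indicator {0..1} t * (e / 2) + B * indicator (cell m 0) t)"
    proof (rule integral_mono_AE')
      show "integrable lborel (\<lambda>t. indicator {0..1} t * (e / 2) + B * indicator (cell m 0) t)"
        using cell_integrable[of m 0] by auto
      show "AE t in lborel. indicator {0..1} t * \<bar>grid_step m (cell_average m f) t - g t\<bar> \<le> indicator {0..1} t * (e / 2) + B * indicator (cell m 0) t"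
        using AE_lborel_singleton[of 0] by eventually_elim (rule ptw)
      show "AE t in lborel. 0 \<le> indicat_real {0..1} t * (e / 2) + B * indicator (cell m 0) t" using e B0 by simp
    qed
    also have "\<dots> = e / 2 + B / real m"
      using cell_integrable[of m 0] by (subst bochner_add) (auto simp: cell_measure[OF m])
    also have "\<dots> \<le> e" using elim(2) by linarith
    finally show ?case by (simp add: f_def[abs_def])
  qed
qed

text \<open>A density argument: f is replaced by a continuous function close in L1, once directly
  and once under the averages, where the contraction applies.\<close>

lemma cell_average_converges:
  fixes f :: "real => real"
  assumes f: "f \<in> borel_measurable borel" and B: "\<And>t. \<bar>f t\<bar> \<le> B" and supp: "\<And>t. t \<notin> {0..1} ==> f t = 0"
  shows "(\<lambda>m. LBINT t. indicator {0..1} t * \<bar>grid_step m (cell_average m f) t - f t\<bar>) \<longlonglongrightarrow> 0"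
proof (rule LIMSEQ_I)
  fix e :: real assume e: "0 < e"
  obtain g where g: "continuous_on UNIV g" "\<And>t. \<bar>g t\<bar> \<le> B" "(LBINT t. indicator {0..1} t * \<bar>f t - g t\<bar>) < e / 4"
    using continuous_approximation[OF f B, of "e / 4"] e by auto
  have [measurable]: "g \<in> borel_measurable borel" using g(1) by (rule borel_measurable_continuous_onI)
  note f[measurable]
  define g' where "g' t = indicator {0..1} t * g t" for t
  have B0: "0 \<le> B" using B[of 0] by linarith
  have [measurable]: "g' \<in> borel_measurable borel" unfolding g'_def by measurable
  have g'I: "integrable lborel g'"
  proof (rule bounded_support_integrable[of g' B])
    show "g' \<in> borel_measurable borel" by measurable
  qed (use g(2) B0 in \<open>auto simp: g'_def indicator_def\<close>)
  have fI: "integrable lborel f" using f B supp by (rule bounded_support_integrable)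
  have fg: "(LBINT t. \<bar>f t - g' t\<bar>) < e / 4"
  proof -
    have "(\<lambda>t. \<bar>f t - g' t\<bar>) = (\<lambda>t. indicator {0..1} t * \<bar>f t - g t\<bar>)"
      using supp by (auto simp: g'_def fun_eq_iff indicator_def)
    then show ?thesis using g(3) by simp
  qed
  have ev: "\<forall>\<^sub>F m in sequentially. (LBINT t. indicator {0..1} t * \<bar>grid_step m (cell_average m g') t - g t\<bar>) \<le> e / 4"
    unfolding g'_def by (rule cell_average_continuous[OF g(1,2)]) (use e in auto)
  have "\<forall>\<^sub>F m in sequentially. (LBINT t. indicator {0..1} t * \<bar>grid_step m (cell_average m f) t - f t\<bar>) < e"
    using ev eventually_gt_at_top[of 0]
  proof eventually_elim
    case (elim m)
    have m: "0 < m" by fact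
    have lin: "cell_average m f i - cell_average m g' i = cell_average m (\<lambda>t. f t - g' t) i" for i
    proof (cases i)
      case (Suc j)
      have J: "integrable lborel (\<lambda>u. indicator (cell m j) u * f u)" "integrable lborel (\<lambda>u. indicator (cell m j) u * g' u)"
        using integrable_mult_indicator[OF _ fI, of "cell m j"] integrable_mult_indicator[OF _ g'I, of "cell m j"] by simp_all
      have "(LBINT u. indicator (cell m j) u * (f u - g' u))
          = (LBINT u. indicator (cell m j) u * f u) - (LBINT u. indicator (cell m j) u * g' u)"
        unfolding right_diff_distrib by (rule bochner_diff[OF J])
      then show ?thesis unfolding Suc cell_average_def by (simp only: nat.case right_diff_distrib)
    qed (simp add: cell_average_def)
    have step_lin: "grid_step m (cell_average m f) t - grid_step m (cell_average m g') t = grid_step m (cell_average m (\<lambda>t. f t - g' t)) t" for t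
      by (simp add: grid_step_def lin[symmetric] sum_subtractf left_diff_distrib)
    have I1: "integrable lborel (\<lambda>t. \<bar>grid_step m c t\<bar>)" for c by (rule grid_step_integral_abs(1)[OF m])
    have I1': "integrable lborel (grid_step m c)" for c
      using I1[of c] by (simp add: integrable_abs_iff)
    have I2: "integrable lborel (\<lambda>t. \<bar>f t - g' t\<bar>)" using fI g'I by simp
    have I3: "integrable lborel (\<lambda>t. indicator {0..1} t * \<bar>grid_step m (cell_average m g') t - g t\<bar>)"
    proof -
      have eq: "(\<lambda>t. indicator {0..1} t * \<bar>grid_step m (cell_average m g') t - g t\<bar>) = (\<lambda>t. indicator {0..1} t *\<^sub>R \<bar>grid_step m (cell_average m g') t - g' t\<bar>)"
        by (auto simp: fun_eq_iff g'_def indicator_def)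
      show ?thesis unfolding eq using I1' g'I by (intro integrable_mult_indicator) auto
    qed
    have "(LBINT t. indicator {0..1} t * \<bar>grid_step m (cell_average m f) t - f t\<bar>)
      \<le> (LBINT t. \<bar>grid_step m (cell_average m (\<lambda>t. f t - g' t)) t\<bar> + indicator {0..1} t * \<bar>grid_step m (cell_average m g') t - g t\<bar> + \<bar>f t - g' t\<bar>)"
    proof (rule integral_mono')
      show "integrable lborel (\<lambda>t. \<bar>grid_step m (cell_average m (\<lambda>t. f t - g' t)) t\<bar> + indicator {0..1} t * \<bar>grid_step m (cell_average m g') t - g t\<bar> + \<bar>f t - g' t\<bar>)"
        by (intro bochner_integrable_add I1 I2 I3)
      fix t
      show "indicator {0..1} t * \<bar>grid_step m (cell_average m f) t - f t\<bar> \<le>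
        \<bar>grid_step m (cell_average m (\<lambda>t. f t - g' t)) t\<bar> + indicator {0..1} t * \<bar>grid_step m (cell_average m g') t - g t\<bar> + \<bar>f t - g' t\<bar>"
        unfolding step_lin[symmetric] by (cases "t \<in> {0..1}") (auto simp: g'_def)
      show "0 \<le> \<bar>grid_step m (cell_average m (\<lambda>t. f t - g' t)) t\<bar> + indicator {0..1} t * \<bar>grid_step m (cell_average m g') t - g t\<bar> + \<bar>f t - g' t\<bar>" by simp
    qed
    also have "\<dots> = (LBINT t. \<bar>grid_step m (cell_average m (\<lambda>t. f t - g' t)) t\<bar>)
        + (LBINT t. indicator {0..1} t * \<bar>grid_step m (cell_average m g') t - g t\<bar>) + (LBINT t. \<bar>f t - g' t\<bar>)"
      by (simp add: bochner_add I1 I2 I3)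
    finally have "(LBINT t. indicator {0..1} t * \<bar>grid_step m (cell_average m f) t - f t\<bar>)
      \<le> (LBINT t. \<bar>grid_step m (cell_average m (\<lambda>t. f t - g' t)) t\<bar>)
        + (LBINT t. indicator {0..1} t * \<bar>grid_step m (cell_average m g') t - g t\<bar>) + (LBINT t. \<bar>f t - g' t\<bar>)" .
    moreover have "(LBINT t. \<bar>grid_step m (cell_average m (\<lambda>t. f t - g' t)) t\<bar>) \<le> (LBINT t. \<bar>f t - g' t\<bar>)"
      using fI g'I by (intro cell_average_contraction[OF m]) auto
    ultimately show ?case using fg elim e by linarith
  qed
  moreover have "0 \<le> (LBINT t. indicator {0..1} t * \<bar>grid_step m (cell_average m f) t - f t\<bar>)" for m
    by (intro integral_nonneg_AE) auto
  ultimately show "\<exists>no. \<forall>n\<ge>no. norm ((LBINT t. indicator {0..1} t * \<bar>grid_step n (cell_average n f) t - f t\<bar>) - 0) < e"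
    by (simp add: eventually_sequentially)
qed


section \<open>Rounding to finitely many nonzero volatility levels\<close>

definition grid_round :: "nat => real => real" where
  "grid_round m x = (real_of_int \<lfloor>real m * x\<rfloor> + 1/2) / real m"

lemma grid_round_measurable [measurable]: "grid_round m \<in> borel_measurable borel"
  unfolding grid_round_def[abs_def] by measurable

lemma grid_round_error: assumes "0 < m" shows "\<bar>grid_round m x - x\<bar> \<le> 1 / real m"
proof -
  have "\<bar>real_of_int \<lfloor>real m * x\<rfloor> + 1/2 - real m * x\<bar> \<le> 1" by linarith
  moreover have "grid_round m x - x = (real_of_int \<lfloor>real m * x\<rfloor> + 1/2 - real m * x) / real m"
    using assms by (simp add: grid_round_def field_simps)
  ultimately show ?thesis using assms by (simp add: divide_right_mono)
qed

text \<open>The listed fractions cover all roundings of numbers in [-B, B]; the intersection with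
  [-(B + 1), B + 1] makes the bound immediate.\<close>

definition grid_values :: "nat => real => real set" where
  "grid_values m B = (\<lambda>k. (real_of_int k + 1/2) / real m) ` {\<lfloor>- (real m * B)\<rfloor>..\<lfloor>real m * B\<rfloor>} \<inter> {- (B + 1)..B + 1}"

lemma grid_values_finite: "finite (grid_values m B)"
  by (simp add: grid_values_def)

lemma grid_round_values: assumes m: "0 < m" and x: "\<bar>x\<bar> \<le> B" shows "grid_round m x \<in> grid_values m B"
proof -
  have "real m * x \<le> real m * B" "- (real m * B) \<le> real m * x"
    using x mult_left_mono[of x B "real m"] mult_left_mono[of "- B" x "real m"] by auto
  then have "\<lfloor>real m * x\<rfloor> \<in> {\<lfloor>- (real m * B)\<rfloor>..\<lfloor>real m * B\<rfloor>}" by (auto intro: floor_mono)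
  moreover have "\<bar>grid_round m x\<bar> \<le> B + 1"
  proof -
    have "1 / real m \<le> 1" using m by simp
    then show ?thesis using grid_round_error[OF m, of x] x by linarith
  qed
  then have "grid_round m x \<in> {- (B + 1)..B + 1}" by (simp add: abs_le_iff)
  ultimately show ?thesis unfolding grid_values_def grid_round_def by blast
qed

lemma grid_values_bound: "v \<in> grid_values m B ==> \<bar>v\<bar> \<le> B + 1"
  by (auto simp: grid_values_def)

text \<open>The purpose of the half in \<open>grid_round\<close>: up to the factor 2 m the levels
  are odd integers.\<close>

lemma grid_values_nonzero: assumes "0 < m" shows "0 \<notin> grid_values m B"
proof
  assume "0 \<in> grid_values m B"
  then obtain k :: int where "(real_of_int k + 1/2) / real m = 0" by (auto simp: grid_values_def)
  then have "2 * real_of_int k = -1" using assms by simp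
  then have "2 * k = -1" by linarith
  then show False by presburger
qed

lemma cell_average_bound:
  assumes m: "0 < m" and f: "f \<in> borel_measurable borel" and B: "\<And>t. \<bar>f t\<bar> \<le> B"
  shows "\<bar>cell_average m f i\<bar> \<le> B"
proof (cases i)
  case 0
  then show ?thesis using B[of 0] by (simp add: cell_average_def)
next
  case (Suc j)
  have "\<bar>LBINT u. indicator (cell m j) u * f u\<bar> \<le> (LBINT u. \<bar>indicator (cell m j) u * f u\<bar>)"
    by (rule integral_abs_bound)
  also have "\<dots> \<le> (LBINT u. B * indicator (cell m j) u)"
  proof (rule integral_mono')
    show "integrable lborel (\<lambda>u. B * indicator (cell m j) u)" by (intro integrable_mult_right cell_integrable)
    fix u
    show "\<bar>indicator (cell m j) u * f u\<bar> \<le> B * indicator (cell m j) u" using B[of u] by (auto simp: indicator_def)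
    show "0 \<le> B * indicator (cell m j) u" using B[of u] by (auto simp: indicator_def)
  qed
  also have "\<dots> = B / real m" by (simp add: cell_measure[OF m])
  finally have "real m * \<bar>LBINT u. indicator (cell m j) u * f u\<bar> \<le> B" using m by (simp add: field_simps)
  then show ?thesis by (simp add: Suc cell_average_def abs_mult)
qed

lemma grid_step_close:
  assumes m: "0 < m" and e: "\<And>i. i < m ==> \<bar>c i - d i\<bar> \<le> e" and "0 \<le> e"
  shows "\<bar>grid_step m c t - grid_step m d t\<bar> \<le> e"
proof (cases "\<exists>i<m. t \<in> cell m i")
  case True
  then show ?thesis using grid_step_cell[OF m] e by auto
next
  case False
  then show ?thesis using assms(3) by (simp add: grid_step_def)
qed

section \<open>Elementary approximation of a bounded progressive control\<close>

context brownian
begin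

lemma measurable_pair_FF:
  assumes "(\<lambda>(w, u). f w u) \<in> borel_measurable (FF t \<Otimes>\<^sub>M lborel)"
  shows "(\<lambda>(w, u). f w u) \<in> borel_measurable (M \<Otimes>\<^sub>M lborel)"
proof -
  have id: "(\<lambda>w. w) \<in> measurable M (FF t)"
    using sets_FF_subset[of t] by (auto simp: measurable_def space_FF)
  have "(\<lambda>x. (fst x, snd x)) \<in> measurable (M \<Otimes>\<^sub>M lborel) (FF t \<Otimes>\<^sub>M lborel)"
    by (intro measurable_Pair measurable_compose[OF measurable_fst id] measurable_snd)
  from measurable_compose[OF this assms] show ?thesis by (simp add: case_prod_beta)
qed

text \<open>Clamping the time to [0, t] turns measurability on a restricted time interval into joint
  measurability on the whole line, while using only information up to t.\<close>

lemma progressive_stopped: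
  assumes "progressive M W \<alpha>" and t: "t \<in> {0..1}"
  shows "(\<lambda>(w, u). \<alpha> (max 0 (min t u)) w) \<in> borel_measurable (FF t \<Otimes>\<^sub>M lborel)"
proof -
  have \<alpha>: "(\<lambda>(s, w). \<alpha> s w) \<in> borel_measurable (restrict_space borel {0..t} \<Otimes>\<^sub>M FF t)"
    using assms by (simp add: progressive_def)
  have "(\<lambda>x. max 0 (min t (snd x))) \<in> measurable (FF t \<Otimes>\<^sub>M lborel) (restrict_space borel {0..t})"
    using t by (intro measurable_restrict_space2) auto
  then have "(\<lambda>x. (max 0 (min t (snd x)), fst x)) \<in> measurable (FF t \<Otimes>\<^sub>M lborel) (restrict_space borel {0..t} \<Otimes>\<^sub>M FF t)"
    by (intro measurable_Pair measurable_fst)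
  from measurable_compose[OF this \<alpha>] show ?thesis by (simp add: case_prod_beta)
qed

definition trunc :: "(real => 'a => real) => 'a => real => real" where
  "trunc \<alpha> w t = indicator {0..1} t * \<alpha> t w"

lemma trunc_stopped: "t \<in> {0..1} ==> u \<in> {0..t} ==> trunc \<alpha> w u = \<alpha> (max 0 (min t u)) w"
  by (auto simp: trunc_def min_absorb2 max_absorb2)

lemma trunc_joint:
  assumes "progressive M W \<alpha>" shows "(\<lambda>(w, u). trunc \<alpha> w u) \<in> borel_measurable (M \<Otimes>\<^sub>M lborel)"
proof -
  have [measurable]: "(\<lambda>(w, u). \<alpha> (max 0 (min 1 u)) w) \<in> borel_measurable (M \<Otimes>\<^sub>M lborel)"
    using progressive_stopped[OF assms, of 1] by (intro measurable_pair_FF) auto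
  have "(\<lambda>x. indicator {0..1} (snd x) * (case x of (w, u) => \<alpha> (max 0 (min 1 u)) w)) \<in> borel_measurable (M \<Otimes>\<^sub>M lborel)"
    by measurable
  also have "(\<lambda>x. indicator {0..1} (snd x) * (case x of (w, u) => \<alpha> (max 0 (min 1 u)) w)) = (\<lambda>(w, u). trunc \<alpha> w u)"
    by (auto simp: fun_eq_iff trunc_def indicator_def min_absorb2 max_absorb2)
  finally show ?thesis .
qed

lemma trunc_borel: "progressive M W \<alpha> ==> w \<in> space M ==> trunc \<alpha> w \<in> borel_measurable borel"
  using measurable_compose[OF measurable_Pair1'[of w M lborel] trunc_joint[of \<alpha>]] by (simp add: case_prod_beta)

text \<open>The average assigned to cell i is taken over the previous cell, so only values of
  \<alpha> up to time i/m enter, and integrating out the time variable preserves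
  measurability.\<close>

lemma cell_average_FF:
  assumes \<alpha>: "progressive M W \<alpha>" and m: "0 < m" and i: "i \<le> m"
  shows "(\<lambda>w. cell_average m (trunc \<alpha> w) i) \<in> borel_measurable (FF (real i / real m))"
proof (cases i)
  case 0
  then show ?thesis by (simp add: cell_average_def)
next
  case (Suc j)
  define t where "t = real i / real m"
  have t: "t \<in> {0..1}" using m i by (simp add: t_def)
  have [measurable]: "(\<lambda>(w, u). \<alpha> (max 0 (min t u)) w) \<in> borel_measurable (FF t \<Otimes>\<^sub>M lborel)"
    by (rule progressive_stopped[OF \<alpha> t])
  have "(\<lambda>x. indicator (cell m j) (snd x) * (case x of (w, u) => \<alpha> (max 0 (min t u)) w)) \<in> borel_measurable (FF t \<Otimes>\<^sub>M lborel)"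
    by measurable
  then have "(\<lambda>w. LBINT u. indicator (cell m j) u * \<alpha> (max 0 (min t u)) w) \<in> borel_measurable (FF t)"
    by (intro lborel.borel_measurable_lebesgue_integral) (simp add: case_prod_beta)
  moreover have "indicator (cell m j) u * \<alpha> (max 0 (min t u)) w = indicator (cell m j) u * trunc \<alpha> w u" for u w
  proof (cases "u \<in> cell m j")
    case True
    then have "u \<in> {0..t}" by (auto simp: cell_def t_def Suc intro: order_trans[of _ "real j / real m"])
    then show ?thesis using trunc_stopped[OF t] by simp
  qed simp
  ultimately have "(\<lambda>w. LBINT u. indicator (cell m j) u * trunc \<alpha> w u) \<in> borel_measurable (FF t)" by simp
  then have "(\<lambda>w. real m * (LBINT u. indicator (cell m j) u * trunc \<alpha> w u)) \<in> borel_measurable (FF t)" by simp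
  then show ?thesis by (simp add: cell_average_def t_def Suc)
qed

definition grid_coeff :: "(real => 'a => real) => nat => nat => 'a => real" where
  "grid_coeff \<alpha> m i w = grid_round m (cell_average m (trunc \<alpha> w) i)"

definition grid_elementary :: "(real => 'a => real) => nat => 'a elementary" where
  "grid_elementary \<alpha> m = map (\<lambda>i. (real i / real m, real (Suc i) / real m, grid_coeff \<alpha> m i)) [0..<m]"

lemma grid_elementary_process: "elementary_process (grid_elementary \<alpha> m) t w = grid_step m (\<lambda>i. grid_coeff \<alpha> m i w) t"
  by (simp add: elementary_process_def grid_elementary_def grid_step_def cell_def o_def interv_sum_list_conv_sum_set_nat
      lessThan_atLeast0)

text \<open>Squared distance between an elementary process and the control in L2 of the product of
  time and probability.\<close>

definition square_gap :: "'a elementary => (real => 'a => real) => ennreal" where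
  "square_gap H \<alpha> = (\<integral>\<^sup>+w. (\<integral>\<^sup>+t\<in>{0..1}. ennreal ((elementary_process H t w - \<alpha> t w)\<^sup>2) \<partial>lborel) \<partial>M)"

lemma elementary_process_joint:
  assumes "is_elementary M W H"
  shows "(\<lambda>(w, u). elementary_process H u w) \<in> borel_measurable (M \<Otimes>\<^sub>M lborel)"
  using assms
proof (induction H)
  case Nil
  then show ?case by (simp add: elementary_process_def)
next
  case (Cons x H)
  obtain a b \<eta> where x: "x = (a, b, \<eta>)" by (cases x) auto
  have IH [measurable]: "(\<lambda>(w, u). elementary_process H u w) \<in> borel_measurable (M \<Otimes>\<^sub>M lborel)"
    using Cons by (auto simp: is_elementary_def)
  have [measurable]: "\<eta> \<in> borel_measurable M"
    using Cons(2) by (auto simp: is_elementary_def x intro: measurable_FF)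
  have "(\<lambda>z. \<eta> (fst z) * indicator {a<..b} (snd z) + (case z of (w, u) => elementary_process H u w)) \<in> borel_measurable (M \<Otimes>\<^sub>M lborel)"
    by measurable
  then show ?case by (simp add: elementary_process_def x case_prod_beta)
qed

lemma gap_joint:
  assumes "is_elementary M W H" "progressive M W \<alpha>"
  shows "(\<lambda>(w, t). ennreal ((elementary_process H t w - \<alpha> t w)\<^sup>2) * indicator {0..1} t) \<in> borel_measurable (M \<Otimes>\<^sub>M lborel)"
proof -
  note [measurable] = elementary_process_joint[OF assms(1)] trunc_joint[OF assms(2)]
  have "(\<lambda>z. ennreal (((case z of (w, t) => elementary_process H t w) - (case z of (w, t) => trunc \<alpha> w t))\<^sup>2) * indicator {0..1} (snd z)) \<in> borel_measurable (M \<Otimes>\<^sub>M lborel)"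
    by measurable
  also have "(\<lambda>z. ennreal (((case z of (w, t) => elementary_process H t w) - (case z of (w, t) => trunc \<alpha> w t))\<^sup>2) * indicator {0..1} (snd z))
    = (\<lambda>(w, t). ennreal ((elementary_process H t w - \<alpha> t w)\<^sup>2) * indicator {0..1} t)"
    by (auto simp: fun_eq_iff trunc_def indicator_def)
  finally show ?thesis .
qed

end

locale bounded_progressive_process = brownian +
  fixes \<alpha> :: "real => 'a => real" and B :: real
  assumes prog: "progressive M W \<alpha>" and \<alpha>_bound: "\<And>t w. t \<in> {0..1} ==> w \<in> space M ==> \<bar>\<alpha> t w\<bar> \<le> B"
begin

abbreviation grid :: "nat => 'a elementary" where "grid \<equiv> grid_elementary \<alpha>"

lemma B_nonneg: "0 \<le> B"
proof -
  obtain w where "w \<in> space M" using not_empty by auto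
  from \<alpha>_bound[of 0, OF _ this] show ?thesis by simp
qed

lemma trunc_bound: "w \<in> space M ==> \<bar>trunc \<alpha> w t\<bar> \<le> B"
  using \<alpha>_bound[of t w] B_nonneg by (auto simp: trunc_def indicator_def)

lemma grid_coeff_FF: "0 < m ==> i \<le> m ==> grid_coeff \<alpha> m i \<in> borel_measurable (FF (real i / real m))"
  unfolding grid_coeff_def[abs_def]
  by (rule measurable_compose[OF cell_average_FF[OF prog] grid_round_measurable])

lemma grid_coeff_values: "0 < m ==> w \<in> space M ==> grid_coeff \<alpha> m i w \<in> grid_values m B"
  unfolding grid_coeff_def using trunc_borel[OF prog] trunc_bound by (intro grid_round_values cell_average_bound)

lemma grid_coeff_bound: "0 < m ==> w \<in> space M ==> \<bar>grid_coeff \<alpha> m i w\<bar> \<le> B + 1"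
  using grid_values_bound grid_coeff_values by blast

lemma grid_is_elementary: assumes m: "0 < m" shows "is_elementary M W (grid m)"
  unfolding is_elementary_def
proof (rule ballI)
  fix x assume "x \<in> set (grid m)"
  then obtain i where i: "i < m" and x: "x = (real i / real m, real (Suc i) / real m, grid_coeff \<alpha> m i)"
    by (auto simp: grid_elementary_def)
  have "real i / real m \<le> real (Suc i) / real m" by (simp add: divide_right_mono)
  moreover have "real (Suc i) / real m \<le> 1" using i by (simp add: divide_le_eq_1)
  moreover have "grid_coeff \<alpha> m i \<in> borel_measurable (FF (real i / real m))" using i m by (intro grid_coeff_FF) auto
  moreover have "\<exists>B. \<forall>w\<in>space M. \<bar>grid_coeff \<alpha> m i w\<bar> \<le> B" using grid_coeff_bound[OF m] by blast
  ultimately show "case x of (a, b, \<eta>) => 0 \<le> a \<and> a \<le> b \<and> b \<le> 1 \<and> \<eta> \<in> borel_measurable (FF a) \<and> (\<exists>B. \<forall>w\<in>space M. \<bar>\<eta> w\<bar> \<le> B)"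
    unfolding x prod.case by simp
qed

lemma grid_process_bound:
  assumes m: "0 < m" and w: "w \<in> space M" shows "\<bar>elementary_process (grid m) t w\<bar> \<le> B + 1"
  using grid_step_close[OF m, of "\<lambda>i. grid_coeff \<alpha> m i w" "\<lambda>_. 0" "B + 1" t] grid_coeff_bound[OF m w] B_nonneg
  by (simp add: grid_elementary_process) (simp add: grid_step_def)

lemma grid_difference_integrable:
  assumes m: "0 < m" and w: "w \<in> space M"
  shows "integrable lborel (\<lambda>t. indicator {0..1} t * \<bar>elementary_process (grid m) t w - trunc \<alpha> w t\<bar>)"
proof (rule bounded_support_integrable)
  have [measurable]: "trunc \<alpha> w \<in> borel_measurable borel" by (rule trunc_borel[OF prog w])
  show "(\<lambda>t. indicator {0..1} t * \<bar>elementary_process (grid m) t w - trunc \<alpha> w t\<bar>) \<in> borel_measurable borel"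
    unfolding grid_elementary_process by measurable
  fix t
  have "\<bar>elementary_process (grid m) t w - trunc \<alpha> w t\<bar> \<le> 2 * B + 1"
    using grid_process_bound[OF m w, of t] trunc_bound[OF w, of t] by linarith
  then show "\<bar>indicator {0..1} t * \<bar>elementary_process (grid m) t w - trunc \<alpha> w t\<bar>\<bar> \<le> 2 * B + 1"
    using B_nonneg by (auto simp: indicator_def)
qed simp

text \<open>Rounding adds at most 1/m to the error of the cell averages.\<close>

lemma grid_L1_pathwise:
  assumes w: "w \<in> space M"
  shows "(\<lambda>m. LBINT t. indicator {0..1} t * \<bar>elementary_process (grid m) t w - trunc \<alpha> w t\<bar>) \<longlonglongrightarrow> 0"
proof -
  define f where "f = trunc \<alpha> w"
  have f [measurable]: "f \<in> borel_measurable borel" unfolding f_def by (rule trunc_borel[OF prog w])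
  have fB: "\<bar>f t\<bar> \<le> B" for t unfolding f_def by (rule trunc_bound[OF w])
  define I where "I m = (LBINT t. indicator {0..1} t * \<bar>grid_step m (cell_average m f) t - f t\<bar>)" for m
  have I: "I \<longlonglongrightarrow> 0" unfolding I_def
    by (rule cell_average_converges[OF f fB]) (simp add: f_def trunc_def)
  have lim: "(\<lambda>m. I m + 1 / real m) \<longlonglongrightarrow> 0"
    using tendsto_add[OF I lim_inverse_n'] by simp
  have bound: "(LBINT t. indicator {0..1} t * \<bar>elementary_process (grid m) t w - f t\<bar>) \<le> I m + 1 / real m" if m: "0 < m" for m
  proof -
    define A where "A = grid_step m (cell_average m f)"
    have KA: "\<bar>elementary_process (grid m) t w - A t\<bar> \<le> 1 / real m" for t
      unfolding grid_elementary_process A_def grid_coeff_def f_def by (intro grid_step_close m grid_round_error) simp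
    have i1: "integrable lborel (\<lambda>t. indicator {0..1} t * \<bar>A t - f t\<bar>)"
    proof (rule bounded_support_integrable)
      have [measurable]: "A \<in> borel_measurable borel" by (simp add: A_def)
      show "(\<lambda>t. indicator {0..1} t * \<bar>A t - f t\<bar>) \<in> borel_measurable borel" by measurable
      fix t
      have "\<bar>A t\<bar> \<le> B + 2"
      proof -
        have "1 / real m \<le> 1" using m by simp
        then show ?thesis using KA[of t] grid_process_bound[OF m w, of t] by linarith
      qed
      then have "\<bar>A t - f t\<bar> \<le> 2 * B + 2" using fB[of t] by linarith
      then show "\<bar>indicator {0..1} t * \<bar>A t - f t\<bar>\<bar> \<le> 2 * B + 2" using B_nonneg by (auto simp: indicator_def)
    qed simp
    have i2: "integrable lborel (\<lambda>t::real. indicator {0..1} t * (1 / real m))"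
      by (intro integrable_mult_left integrable_real_indicator) (auto simp: emeasure_lborel_Icc_eq)
    have "(LBINT t. indicator {0..1} t * \<bar>elementary_process (grid m) t w - f t\<bar>)
      \<le> (LBINT t. indicator {0..1} t * \<bar>A t - f t\<bar> + indicator {0..1} t * (1 / real m))"
    proof (rule integral_mono)
      show "integrable lborel (\<lambda>t. indicator {0..1} t * \<bar>elementary_process (grid m) t w - f t\<bar>)"
        unfolding f_def by (rule grid_difference_integrable[OF m w])
      show "integrable lborel (\<lambda>t. indicator {0..1} t * \<bar>A t - f t\<bar> + indicator {0..1} t * (1 / real m))"
        by (intro bochner_integrable_add i1 i2)
      fix t
      have "\<bar>elementary_process (grid m) t w - f t\<bar> \<le> \<bar>A t - f t\<bar> + 1 / real m" using KA[of t] by linarith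
      then show "indicator {0..1} t * \<bar>elementary_process (grid m) t w - f t\<bar>
        \<le> indicator {0..1} t * \<bar>A t - f t\<bar> + indicator {0..1} t * (1 / real m)" by (auto simp: indicator_def)
    qed
    also have "\<dots> = (LBINT t. indicator {0..1} t * \<bar>A t - f t\<bar>) + (\<integral>t. indicator {0..1} t * (1 / real m) \<partial>(lborel :: real measure))"
      by (rule bochner_add[OF i1 i2])
    also have "\<dots> = I m + 1 / real m" by (simp add: I_def A_def)
    finally show ?thesis .
  qed
  show ?thesis
    unfolding f_def[symmetric]
  proof (rule tendsto_sandwich[OF _ _ tendsto_const lim])
    show "\<forall>\<^sub>F m in sequentially. 0 \<le> (LBINT t. indicator {0..1} t * \<bar>elementary_process (grid m) t w - f t\<bar>)"
      by (intro always_eventually allI integral_nonneg_AE) simp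
    show "\<forall>\<^sub>F m in sequentially. (LBINT t. indicator {0..1} t * \<bar>elementary_process (grid m) t w - f t\<bar>) \<le> I m + 1 / real m"
      by (rule eventually_sequentiallyI[of 1]) (rule bound, simp)
  qed
qed

text \<open>The difference is bounded by 2 B + 1, so pathwise L1 convergence implies L2
  convergence.\<close>

lemma grid_gap_pathwise:
  assumes w: "w \<in> space M"
  shows "(\<lambda>m. \<integral>\<^sup>+t\<in>{0..1}. ennreal ((elementary_process (grid m) t w - \<alpha> t w)\<^sup>2) \<partial>lborel) \<longlonglongrightarrow> 0"
proof -
  define d where "d m t = indicator {0..1} t * \<bar>elementary_process (grid m) t w - trunc \<alpha> w t\<bar>" for m t
  have "(\<lambda>m. (2 * B + 1) * (LBINT t. d m t)) \<longlonglongrightarrow> (2 * B + 1) * 0"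
    unfolding d_def by (intro tendsto_intros grid_L1_pathwise w)
  then have lim: "(\<lambda>m. ennreal ((2 * B + 1) * (LBINT t. d m t))) \<longlonglongrightarrow> 0"
    using tendsto_ennrealI by fastforce
  have bound: "(\<integral>\<^sup>+t\<in>{0..1}. ennreal ((elementary_process (grid m) t w - \<alpha> t w)\<^sup>2) \<partial>lborel)
    \<le> ennreal ((2 * B + 1) * (LBINT t. d m t))" if m: "0 < m" for m
  proof -
    have int: "integrable lborel (d m)" unfolding d_def by (rule grid_difference_integrable[OF m w])
    have "(\<integral>\<^sup>+t\<in>{0..1}. ennreal ((elementary_process (grid m) t w - \<alpha> t w)\<^sup>2) \<partial>lborel)
      \<le> (\<integral>\<^sup>+t. ennreal ((2 * B + 1) * d m t) \<partial>lborel)"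
    proof (rule nn_integral_mono)
      fix t :: real
      define K where "K = elementary_process (grid m) t w"
      show "ennreal ((elementary_process (grid m) t w - \<alpha> t w)\<^sup>2) * indicator {0..1} t \<le> ennreal ((2 * B + 1) * d m t)"
      proof (cases "t \<in> {0..1}")
        case True
        have "(K - trunc \<alpha> w t)\<^sup>2 = \<bar>K - trunc \<alpha> w t\<bar> * \<bar>K - trunc \<alpha> w t\<bar>" by (simp add: power2_eq_square)
        also have "\<dots> \<le> (2 * B + 1) * \<bar>K - trunc \<alpha> w t\<bar>"
          using grid_process_bound[OF m w, of t] trunc_bound[OF w, of t] by (intro mult_right_mono) (auto simp: K_def)
        finally show ?thesis using True by (simp add: K_def d_def trunc_def ennreal_leI)
      qed simp
    qed
    also have "\<dots> = ennreal (LBINT t. (2 * B + 1) * d m t)"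
      using B_nonneg by (intro nn_integral_eq_integral integrable_mult_right int) (simp add: d_def)
    finally show ?thesis by simp
  qed
  show ?thesis
    by (rule tendsto_sandwich[OF _ _ tendsto_const lim])
      (auto intro!: eventually_sequentiallyI[of 1] bound)
qed

theorem grid_approximation: "(\<lambda>m. square_gap (grid m) \<alpha>) \<longlonglongrightarrow> 0"
proof -
  define g where "g m w = (\<integral>\<^sup>+t\<in>{0..1}. ennreal ((elementary_process (grid m) t w - \<alpha> t w)\<^sup>2) \<partial>lborel)" for m w
  have meas: "g m \<in> borel_measurable M" if "0 < m" for m
    unfolding g_def[abs_def] using gap_joint[OF grid_is_elementary[OF that] prog]
    by (intro lborel.borel_measurable_nn_integral) simp
  have "(\<lambda>m. \<integral>\<^sup>+w. g (Suc m) w \<partial>M) \<longlonglongrightarrow> (\<integral>\<^sup>+w. 0 \<partial>M)"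
  proof (rule nn_integral_dominated_convergence[where w = "\<lambda>_. ennreal ((2 * B + 1)\<^sup>2)"])
    show "AE w in M. (\<lambda>m. g (Suc m) w) \<longlonglongrightarrow> 0"
      unfolding g_def by (intro AE_I2 LIMSEQ_Suc grid_gap_pathwise)
    show "AE w in M. g (Suc m) w \<le> ennreal ((2 * B + 1)\<^sup>2)" for m
    proof (rule AE_I2)
      fix w assume w: "w \<in> space M"
      have "g (Suc m) w \<le> (\<integral>\<^sup>+t. ennreal ((2 * B + 1)\<^sup>2) * indicator {0..1} (t :: real) \<partial>lborel)"
        unfolding g_def
      proof (rule nn_integral_mono)
        fix t :: real
        have "\<bar>elementary_process (grid (Suc m)) t w\<bar> \<le> B + 1"
          by (rule grid_process_bound[OF _ w]) simp
        then have "\<bar>elementary_process (grid (Suc m)) t w - \<alpha> t w\<bar> \<le> \<bar>2 * B + 1\<bar>" if "t \<in> {0..1}"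
          using \<alpha>_bound[OF that w] B_nonneg by linarith
        then have "(elementary_process (grid (Suc m)) t w - \<alpha> t w)\<^sup>2 \<le> (2 * B + 1)\<^sup>2" if "t \<in> {0..1}"
          using that by (simp only: abs_le_square_iff)
        then show "ennreal ((elementary_process (grid (Suc m)) t w - \<alpha> t w)\<^sup>2) * indicator {0..1} t
          \<le> ennreal ((2 * B + 1)\<^sup>2) * indicator {0..1} t" by (auto simp: indicator_def intro: ennreal_leI)
      qed
      also have "\<dots> = ennreal ((2 * B + 1)\<^sup>2)" by (simp add: nn_integral_cmult_indicator emeasure_lborel_Icc_eq)
      finally show "g (Suc m) w \<le> ennreal ((2 * B + 1)\<^sup>2)" .
    qed
  qed (use meas in \<open>auto simp: emeasure_space_1 ennreal_mult_less_top\<close>)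
  then have "(\<lambda>m. \<integral>\<^sup>+w. g m w \<partial>M) \<longlonglongrightarrow> 0" by (simp add: filterlim_sequentially_Suc[of "\<lambda>m. \<integral>\<^sup>+w. g m w \<partial>M"])
  then show ?thesis by (simp add: square_gap_def g_def)
qed

end

section \<open>The stochastic integral\<close>


text \<open>Rounding t down to level l gives dyadic points that converge to t, and f is
  continuous.\<close>

lemma dyadic_bound:
  fixes f :: "real => real"
  assumes f: "continuous_on {0..1} f" and c: "\<And>l i. i \<le> 2 ^ l ==> \<bar>f (real i / 2 ^ l)\<bar> \<le> c" and t: "t \<in> {0..1}"
  shows "\<bar>f t\<bar> \<le> c"
proof -
  define i where "i l = nat \<lfloor>2 ^ l * t\<rfloor>" for l :: nat
  define x where "x l = real (i l) / 2 ^ l" for l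
  have i: "real (i l) \<le> 2 ^ l * t" "2 ^ l * t < real (i l) + 1" for l
    using t by (simp_all add: i_def of_nat_floor)
  have i': "i l \<le> 2 ^ l" for l
  proof -
    have "2 ^ l * t \<le> 2 ^ l * 1" using t by (intro mult_left_mono) auto
    then have "real (i l) \<le> real (2 ^ l)" using i(1)[of l] unfolding of_nat_power of_nat_numeral by linarith
    then show ?thesis by (simp only: of_nat_le_iff)
  qed
  have x: "t - (1 / 2) ^ l \<le> x l" "x l \<le> t" for l
  proof -
    have "t \<le> (real (i l) + 1) / 2 ^ l" using i(2)[of l] by (simp add: pos_le_divide_eq mult.commute)
    then show "t - (1 / 2) ^ l \<le> x l" by (simp add: x_def add_divide_distrib power_one_over)
    show "x l \<le> t" using i(1)[of l] by (simp add: x_def pos_divide_le_eq mult.commute)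
  qed
  have "x \<longlonglongrightarrow> t"
  proof (rule tendsto_sandwich[of "\<lambda>l. t - (1 / 2) ^ l" _ _ "\<lambda>_. t"])
    show "(\<lambda>l. t - (1 / 2) ^ l) \<longlonglongrightarrow> t"
      using tendsto_diff[OF tendsto_const[of t] LIMSEQ_power_zero[of "1 / 2 :: real"]] by simp
  qed (use x in auto)
  moreover have "x l \<in> {0..1}" for l using x(2)[of l] t i'[of l] by (auto simp: x_def)
  ultimately have "(\<lambda>l. f (x l)) \<longlonglongrightarrow> f t"
    using f t by (auto simp: continuous_on_sequentially o_def)
  then have "(\<lambda>l. \<bar>f (x l)\<bar>) \<longlonglongrightarrow> \<bar>f t\<bar>" by (rule tendsto_rabs)
  then show ?thesis using c[OF i'] by (intro LIMSEQ_le_const2) (auto simp: x_def)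
qed

lemma square_sum_le: "(x + y)\<^sup>2 \<le> 2 * x\<^sup>2 + 2 * (y :: real)\<^sup>2"
  using zero_le_power2[of "x - y"] by (simp add: power2_sum power2_diff)

lemma ennreal_square_sum_le: "ennreal ((x + y)\<^sup>2) \<le> 2 * ennreal (x\<^sup>2) + 2 * ennreal (y\<^sup>2)"
proof -
  have "ennreal ((x + y)\<^sup>2) \<le> ennreal (2 * x\<^sup>2 + 2 * y\<^sup>2)" by (rule ennreal_leI[OF square_sum_le])
  also have "\<dots> = 2 * ennreal (x\<^sup>2) + 2 * ennreal (y\<^sup>2)"
    by (simp add: ennreal_plus ennreal_mult'')
  finally show ?thesis .
qed

section \<open>Existence of the stochastic integral\<close>

context brownian
begin

definition elementary_diff :: "'a elementary => 'a elementary => 'a elementary" where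
  "elementary_diff H H' = H @ map (\<lambda>(a, b, \<eta>). (a, b, \<lambda>w. - \<eta> w)) H'"

lemma elementary_process_diff:
  "elementary_process (elementary_diff H H') t w = elementary_process H t w - elementary_process H' t w"
proof -
  have "(\<Sum>x\<leftarrow>H'. case case x of (a, b, \<eta>) => (a, b, \<lambda>w. - \<eta> w) of (a, b, \<eta>) => \<eta> w * indicat_real {a<..b} t)
    = - (\<Sum>(a, b, \<eta>)\<leftarrow>H'. \<eta> w * indicat_real {a<..b} t)"
    by (induction H') auto
  then show ?thesis by (simp add: elementary_process_def elementary_diff_def o_def)
qed

lemma elementary_integral_diff:
  "elementary_integral W (elementary_diff H H') t w = elementary_integral W H t w - elementary_integral W H' t w"
proof -
  have "(\<Sum>x\<leftarrow>H'. case case x of (a, b, \<eta>) => (a, b, \<lambda>w. - \<eta> w) of (a, b, \<eta>) => \<eta> w * (W (min b t) w - W (min a t) w))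
    = - (\<Sum>(a, b, \<eta>)\<leftarrow>H'. \<eta> w * (W (min b t) w - W (min a t) w))"
    by (induction H') auto
  then show ?thesis by (simp add: elementary_integral_def elementary_diff_def o_def)
qed

lemma is_elementary_diff:
  assumes "is_elementary M W H" "is_elementary M W H'" shows "is_elementary M W (elementary_diff H H')"
  using assms by (fastforce simp: is_elementary_def elementary_diff_def)

text \<open>The isometry for the difference of the two processes, with the control inserted between
  them.\<close>

lemma elementary_integral_gap:
  assumes H: "is_elementary M W H" "is_elementary M W H'" and \<alpha>: "progressive M W \<alpha>" and t: "t \<in> {0..1}"
  shows "(\<integral>\<^sup>+w. ennreal ((elementary_integral W H t w - elementary_integral W H' t w)\<^sup>2) \<partial>M)
    \<le> 2 * square_gap H \<alpha> + 2 * square_gap H' \<alpha>"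
proof -
  define f where "f H w u = ennreal ((elementary_process H u w - \<alpha> u w)\<^sup>2) * indicator {0..1} u" for H w and u :: real
  have [measurable]: "(\<lambda>(w, u). f H w u) \<in> borel_measurable (M \<Otimes>\<^sub>M lborel)" "(\<lambda>(w, u). f H' w u) \<in> borel_measurable (M \<Otimes>\<^sub>M lborel)"
    unfolding f_def using gap_joint[OF H(1) \<alpha>] gap_joint[OF H(2) \<alpha>] by auto
  have [measurable]: "f H w \<in> borel_measurable lborel" "f H' w \<in> borel_measurable lborel" if "w \<in> space M" for w
    using measurable_compose[OF measurable_Pair1'[OF that, of lborel], of "\<lambda>(w, u). f H w u"]
      measurable_compose[OF measurable_Pair1'[OF that, of lborel], of "\<lambda>(w, u). f H' w u"] by auto
  have [measurable]: "(\<lambda>w. \<integral>\<^sup>+u. f H w u \<partial>lborel) \<in> borel_measurable M" "(\<lambda>w. \<integral>\<^sup>+u. f H' w u \<partial>lborel) \<in> borel_measurable M"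
    by (intro lborel.borel_measurable_nn_integral; measurable)+
  have "(\<integral>\<^sup>+w. ennreal ((elementary_integral W H t w - elementary_integral W H' t w)\<^sup>2) \<partial>M)
    = (\<integral>\<^sup>+w. (\<integral>\<^sup>+u\<in>{0..t}. ennreal ((elementary_process H u w - elementary_process H' u w)\<^sup>2) \<partial>lborel) \<partial>M)"
    using elementary_isometry[OF is_elementary_diff[OF H], of t] t
    by (simp add: elementary_process_diff elementary_integral_diff)
  also have "\<dots> \<le> (\<integral>\<^sup>+w. (\<integral>\<^sup>+u. 2 * f H w u + 2 * f H' w u \<partial>lborel) \<partial>M)"
  proof (intro nn_integral_mono)
    fix w and u :: real
    have "ennreal ((elementary_process H u w - elementary_process H' u w)\<^sup>2)
      \<le> 2 * ennreal ((elementary_process H u w - \<alpha> u w)\<^sup>2) + 2 * ennreal ((elementary_process H' u w - \<alpha> u w)\<^sup>2)"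
      using ennreal_square_sum_le[of "elementary_process H u w - \<alpha> u w" "\<alpha> u w - elementary_process H' u w"]
      by (simp add: power2_commute)
    then show "ennreal ((elementary_process H u w - elementary_process H' u w)\<^sup>2) * indicator {0..t} u \<le> 2 * f H w u + 2 * f H' w u"
      using t by (auto simp: f_def indicator_def)
  qed
  also have "\<dots> = (\<integral>\<^sup>+w. 2 * (\<integral>\<^sup>+u. f H w u \<partial>lborel) + 2 * (\<integral>\<^sup>+u. f H' w u \<partial>lborel) \<partial>M)"
    by (intro nn_integral_cong) (simp add: nn_integral_add nn_integral_cmult)
  also have "\<dots> = 2 * (\<integral>\<^sup>+w. (\<integral>\<^sup>+u. f H w u \<partial>lborel) \<partial>M) + 2 * (\<integral>\<^sup>+w. (\<integral>\<^sup>+u. f H' w u \<partial>lborel) \<partial>M)"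
    by (simp add: nn_integral_add nn_integral_cmult)
  also have "\<dots> = 2 * square_gap H \<alpha> + 2 * square_gap H' \<alpha>"
    by (simp add: square_gap_def f_def)
  finally show ?thesis .
qed

lemma elementary_integral_FF:
  "is_elementary M W H ==> t \<in> {0..1} ==> elementary_integral W H t \<in> borel_measurable (FF t)"
  using sq_martingale_elementary unfolding sq_martingale_def by blast

lemma elementary_integral_measurable:
  "is_elementary M W H ==> t \<in> {0..1} ==> elementary_integral W H t \<in> borel_measurable M"
  by (rule measurable_FF[OF elementary_integral_FF])

lemma elementary_integral_continuous:
  assumes H: "is_elementary M W H" and W: "continuous_on {0..} (\<lambda>t. W t w)"
  shows "continuous_on {0..1} (\<lambda>t. elementary_integral W H t w)"
  using H
proof (induction H)
  case Nil
  then show ?case by (simp add: elementary_integral_def)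
next
  case (Cons x H)
  obtain a b \<eta> where x: "x = (a, b, \<eta>)" by (cases x) auto
  have ab: "0 \<le> a" "0 \<le> b" using Cons(2) by (auto simp: is_elementary_def x)
  have "continuous_on {0..1} (\<lambda>t. W (min c t) w)" if "0 \<le> c" for c
    using that by (intro continuous_on_compose2[OF W] continuous_intros) auto
  from this[OF ab(1)] this[OF ab(2)]
  have "continuous_on {0..1} (\<lambda>t. \<eta> w * (W (min b t) w - W (min a t) w) + elementary_integral W H t w)"
    using Cons by (intro continuous_intros) (auto simp: is_elementary_def)
  then show ?case by (simp add: elementary_integral_def x)
qed

lemma grid_maximal:
  assumes N: "sq_martingale N" and n: "0 < n" and \<delta>: "0 < \<delta>" and c: "0 \<le> c" "(\<integral>\<^sup>+w. ennreal ((N 1 w)\<^sup>2) \<partial>M) \<le> ennreal c"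
  shows "{w\<in>space M. \<exists>i\<in>{0..n}. \<delta>\<^sup>2 \<le> (N (real i / real n) w)\<^sup>2} \<in> events"
    "prob {w\<in>space M. \<exists>i\<in>{0..n}. \<delta>\<^sup>2 \<le> (N (real i / real n) w)\<^sup>2} \<le> c / \<delta>\<^sup>2"
proof -
  have [measurable]: "N (real i / real n) \<in> borel_measurable M" if "i \<in> {0..n}" for i
    using N that n by (auto simp: sq_martingale_def sq_int_def)
  show "{w\<in>space M. \<exists>i\<in>{0..n}. \<delta>\<^sup>2 \<le> (N (real i / real n) w)\<^sup>2} \<in> events" by measurable
  have "integrable M (\<lambda>w. (N 1 w)\<^sup>2)" using N by (auto simp: sq_martingale_def sq_int_def)
  then have "ennreal (expectation (\<lambda>w. (N 1 w)\<^sup>2)) = (\<integral>\<^sup>+w. ennreal ((N 1 w)\<^sup>2) \<partial>M)"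
    by (intro nn_integral_eq_integral[symmetric]) auto
  with c have "expectation (\<lambda>w. (N 1 w)\<^sup>2) \<le> c" by (metis ennreal_le_iff)
  moreover have "\<delta>\<^sup>2 * prob {w\<in>space M. \<exists>i\<in>{0..n}. \<delta>\<^sup>2 \<le> (N (real i / real n) w)\<^sup>2} \<le> expectation (\<lambda>w. (N (real n / real n) w)\<^sup>2)"
    using n by (intro sq_martingale_maximal[OF N _ _ \<delta>]) (auto simp: divide_right_mono)
  ultimately show "prob {w\<in>space M. \<exists>i\<in>{0..n}. \<delta>\<^sup>2 \<le> (N (real i / real n) w)\<^sup>2} \<le> c / \<delta>\<^sup>2"
    using n \<delta> by (simp add: field_simps)
qed

text \<open>The crossing events on the dyadic grids increase with the level, so their common bound
  passes to the union.\<close>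

lemma dyadic_maximal:
  assumes N: "sq_martingale N" and \<delta>: "0 < \<delta>" and c: "0 \<le> c" "(\<integral>\<^sup>+w. ennreal ((N 1 w)\<^sup>2) \<partial>M) \<le> ennreal c"
  shows "\<exists>U\<in>events. prob U \<le> c / \<delta>\<^sup>2 \<and> (\<forall>w\<in>space M - U. \<forall>l. \<forall>i\<le>2 ^ l. \<bar>N (real i / 2 ^ l) w\<bar> \<le> \<delta>)"
proof -
  define E where "E l = {w\<in>space M. \<exists>i\<in>{0..2 ^ l}. \<delta>\<^sup>2 \<le> (N (real i / real (2 ^ l)) w)\<^sup>2}" for l
  have E: "E l \<in> events" "prob (E l) \<le> c / \<delta>\<^sup>2" for l
    unfolding E_def by (rule grid_maximal[OF N _ \<delta> c]; simp)+
  have "incseq E"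
  proof (rule incseq_SucI, rule subsetI)
    fix l w assume "w \<in> E l"
    then obtain i where i: "w \<in> space M" "i \<le> 2 ^ l" "\<delta>\<^sup>2 \<le> (N (real i / real (2 ^ l)) w)\<^sup>2" by (auto simp: E_def)
    have "real (2 * i) / real (2 ^ Suc l) = real i / real (2 ^ l)" by simp
    then show "w \<in> E (Suc l)" unfolding E_def using i by (intro CollectI conjI bexI[of _ "2 * i"]) (simp_all only:, auto)
  qed
  then have "(\<lambda>l. prob (E l)) \<longlonglongrightarrow> prob (\<Union>l. E l)" using E by (intro finite_Lim_measure_incseq) auto
  then have "prob (\<Union>l. E l) \<le> c / \<delta>\<^sup>2" using E by (intro LIMSEQ_le_const2) auto
  moreover have "\<bar>N (real i / 2 ^ l) w\<bar> \<le> \<delta>" if "w \<in> space M - (\<Union>l. E l)" "i \<le> 2 ^ l" for w l i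
  proof -
    have "\<not> \<delta>\<^sup>2 \<le> (N (real i / 2 ^ l) w)\<^sup>2" using that by (auto simp: E_def)
    then have "(N (real i / 2 ^ l) w)\<^sup>2 \<le> \<delta>\<^sup>2" by linarith
    then show ?thesis using \<delta> by (simp add: abs_le_square_iff[symmetric])
  qed
  ultimately show ?thesis using E(1) by (intro bexI[of _ "\<Union>l. E l"]) auto
qed

text \<open>Along a subsequence with gaps below 16^(-j), consecutive integrals differ by more than
  2^(-j) somewhere with probability of order 4^(-j). By Borel-Cantelli the telescoping series
  converges uniformly in time for almost every outcome.\<close>

theorem ito_integral_exists:
  assumes \<alpha>: "progressive M W \<alpha>"
    and K: "\<And>m :: nat. is_elementary M W (K m)" "(\<lambda>m. square_gap (K m) \<alpha>) \<longlonglongrightarrow> 0"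
  shows "\<exists>X. is_ito_integral M W \<alpha> X"
proof -
  have sixteenth: "0 \<le> (1 / 16 :: real)" and nonneg: "0 \<le> 2 * (1 / 16 :: real) ^ j" for j by simp_all
  have "\<exists>m. square_gap (K m) \<alpha> < ennreal ((1 / 16) ^ j)" for j :: nat
    using order_tendstoD(2)[OF K(2), of "ennreal ((1 / 16) ^ j)"] eventually_happens'[OF sequentially_bot] by auto
  then obtain r where r: "\<And>j. square_gap (K (r j)) \<alpha> < ennreal ((1 / 16) ^ j)" by metis
  define H where "H j = K (r j)" for j :: nat
  have H: "is_elementary M W (H j)" "square_gap (H j) \<alpha> \<le> ennreal ((1 / 16) ^ j)" for j
    using K(1) r[of j] by (auto simp: H_def less_imp_le)
  have H0: "(\<lambda>j. square_gap (H j) \<alpha>) \<longlonglongrightarrow> 0"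
  proof (rule tendsto_sandwich[OF _ _ tendsto_const])
    show "(\<lambda>j. ennreal ((1 / 16) ^ j)) \<longlonglongrightarrow> 0"
      using tendsto_ennrealI[OF LIMSEQ_power_zero[of "1 / 16 :: real"]] by simp
  qed (auto simp: H)
  define I where "I j t w = elementary_integral W (H j) t w" for j t w
  define D where "D j t w = I (Suc j) t w - I j t w" for j t w
  have I_FF: "I j t \<in> borel_measurable (FF t)" if "t \<in> {0..1}" for j t
    using elementary_integral_FF[OF H(1) that] by (simp add: I_def[abs_def])
  note I_M = measurable_FF[OF I_FF]
  have "\<exists>U\<in>events. prob U \<le> 4 * (1 / 4) ^ j \<and> (\<forall>w\<in>space M - U. \<forall>l. \<forall>i\<le>2 ^ l. \<bar>D j (real i / 2 ^ l) w\<bar> \<le> (1 / 2) ^ j)" for j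
  proof -
    have "(\<integral>\<^sup>+w. ennreal ((D j 1 w)\<^sup>2) \<partial>M) \<le> 2 * square_gap (H (Suc j)) \<alpha> + 2 * square_gap (H j) \<alpha>"
      unfolding D_def I_def by (rule elementary_integral_gap[OF H(1) H(1) \<alpha>]) simp
    also have "\<dots> \<le> 2 * ennreal ((1 / 16) ^ Suc j) + 2 * ennreal ((1 / 16) ^ j)"
      by (intro add_mono mult_left_mono H(2)) simp_all
    also have "2 * ennreal ((1 / 16) ^ Suc j) + 2 * ennreal ((1 / 16) ^ j) = ennreal (2 * (1 / 16) ^ Suc j + 2 * (1 / 16) ^ j)"
      unfolding ennreal_mult''[OF zero_le_power[OF sixteenth]] ennreal_plus[OF nonneg nonneg] by simp
    also have "\<dots> \<le> ennreal (4 * (1 / 16) ^ j)" by (intro ennreal_leI) simp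
    finally have le: "(\<integral>\<^sup>+w. ennreal ((D j 1 w)\<^sup>2) \<partial>M) \<le> ennreal (4 * (1 / 16) ^ j)" .
    have "D j = elementary_integral W (elementary_diff (H (Suc j)) (H j))"
      by (simp add: fun_eq_iff D_def I_def elementary_integral_diff)
    then have "sq_martingale (D j)" using sq_martingale_elementary[OF is_elementary_diff[OF H(1) H(1)]] by simp
    from dyadic_maximal[OF this, of "(1 / 2) ^ j" "4 * (1 / 16) ^ j"] le
    have "\<exists>U\<in>events. prob U \<le> 4 * (1 / 16) ^ j / ((1 / 2) ^ j)\<^sup>2 \<and> (\<forall>w\<in>space M - U. \<forall>l. \<forall>i\<le>2 ^ l. \<bar>D j (real i / 2 ^ l) w\<bar> \<le> (1 / 2) ^ j)" by simp
    moreover have "4 * (1 / 16) ^ j / ((1 / 2) ^ j)\<^sup>2 = 4 * (1 / 4 :: real) ^ j"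
    proof -
      have "((1 / 2 :: real) ^ j)\<^sup>2 = (1 / 4) ^ j" by (simp add: power2_eq_square flip: power_mult_distrib)
      moreover have "(1 / 16 :: real) ^ j = (1 / 4) ^ j * (1 / 4) ^ j" by (simp flip: power_mult_distrib)
      ultimately show ?thesis by simp
    qed
    ultimately show ?thesis by simp
  qed
  then obtain U where U: "\<And>j. U j \<in> events" "\<And>j. prob (U j) \<le> 4 * (1 / 4) ^ j"
    "\<And>j w l i. w \<in> space M - U j ==> i \<le> 2 ^ l ==> \<bar>D j (real i / 2 ^ l) w\<bar> \<le> (1 / 2) ^ j"
    by metis
  define good where "good w \<longleftrightarrow> continuous_on {0..} (\<lambda>t. W t w) \<and> (\<forall>\<^sub>F j in sequentially. \<forall>t\<in>{0..1}. \<bar>D j t w\<bar> \<le> (1 / 2) ^ j)" for w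
  have "AE w in M. \<forall>\<^sub>F j in sequentially. w \<in> space M - U j"
  proof (rule borel_cantelli_AE1)
    show "summable (\<lambda>j. prob (U j))"
    proof (rule summable_comparison_test)
      show "\<exists>N. \<forall>j\<ge>N. norm (prob (U j)) \<le> 4 * (1 / 4) ^ j" using U(2) by simp
      show "summable (\<lambda>j. 4 * (1 / 4 :: real) ^ j)" by (intro summable_mult summable_geometric) simp
    qed
  qed (use U(1) in \<open>auto simp: emeasure_eq_measure\<close>)
  moreover have "AE w in M. continuous_on {0..} (\<lambda>t. W t w)" using bm by (simp add: brownian_motion_def)
  ultimately have good: "AE w in M. good w"
  proof eventually_elim
    case (elim w)
    have "\<bar>D j t w\<bar> \<le> (1 / 2) ^ j" if j: "w \<in> space M - U j" and t: "t \<in> {0..1}" for j t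
    proof (rule dyadic_bound[OF _ _ t])
      show "continuous_on {0..1} (\<lambda>t. D j t w)"
        unfolding D_def I_def by (intro continuous_intros elementary_integral_continuous H elim)
    qed (rule U(3)[OF j])
    with elim show ?case unfolding good_def by (auto elim!: eventually_mono)
  qed
  \<comment> \<open>Continuity is demanded for every outcome, hence the value 0 off the good set;
    the exceptional null set does not disturb adaptedness.\<close>
  define X where "X t w = (if good w then I 0 t w + (\<Sum>j. D j t w) else 0)" for t w
  have tele: "I 0 t w + (\<Sum>j<n. D j t w) = I n t w" for n t w
    by (induction n) (simp_all add: D_def)
  have unif: "uniform_limit {0..1} (\<lambda>n t. I n t w) (\<lambda>t. X t w) sequentially" if "good w" for w
  proof -
    have "uniform_limit {0..1} (\<lambda>n t. \<Sum>j<n. D j t w) (\<lambda>t. \<Sum>j. D j t w) sequentially"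
    proof (rule Weierstrass_m_test_ev)
      show "\<forall>\<^sub>F j in sequentially. \<forall>t\<in>{0..1}. norm (D j t w) \<le> (1 / 2) ^ j" using that by (simp add: good_def)
    qed (intro summable_geometric, simp)
    then have "uniform_limit {0..1} (\<lambda>n t. I 0 t w + (\<Sum>j<n. D j t w)) (\<lambda>t. I 0 t w + (\<Sum>j. D j t w)) sequentially"
      by (intro uniform_limit_intros)
    then show ?thesis using that by (simp add: tele X_def)
  qed
  have lim: "(\<lambda>n. I n t w) \<longlonglongrightarrow> X t w" if "good w" "t \<in> {0..1}" for t w
    by (rule tendsto_uniform_limitI[OF unif[OF that(1)] that(2)])
  have cont: "continuous_on {0..1} (\<lambda>t. X t w)" for w
  proof (cases "good w")
    case True
    then have "continuous_on {0..} (\<lambda>t. W t w)" by (simp add: good_def)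
    then show ?thesis
      by (intro uniform_limit_theorem[OF _ unif[OF True]] always_eventually allI)
        (auto simp: I_def intro: elementary_integral_continuous H)
  next
    case False
    then show ?thesis by (simp add: X_def)
  qed
  have XFF: "X t \<in> borel_measurable (FF t)" if t: "t \<in> {0..1}" for t
  proof (rule measurable_FF_AE)
    show "(\<lambda>w. lim (\<lambda>n. I n t w)) \<in> borel_measurable (FF t)"
      using I_FF[OF t] by (rule borel_measurable_lim_metric)
    show "AE w in M. lim (\<lambda>n. I n t w) = X t w"
      using good by eventually_elim (rule limI[OF lim[OF _ t]])
  qed
  \<comment> \<open>Fatou's lemma in k turns the distance between two elementary integrals into the
    distance between one of them and the limit.\<close>
  have gap: "(\<integral>\<^sup>+w. ennreal ((I m t w - X t w)\<^sup>2) \<partial>M) \<le> 2 * square_gap (H m) \<alpha>" if t: "t \<in> {0..1}" for m t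
  proof -
    note I_M[OF t, measurable]
    have "(\<integral>\<^sup>+w. ennreal ((I m t w - X t w)\<^sup>2) \<partial>M) = (\<integral>\<^sup>+w. liminf (\<lambda>k. ennreal ((I m t w - I k t w)\<^sup>2)) \<partial>M)"
    proof (rule nn_integral_cong_AE)
      show "AE w in M. ennreal ((I m t w - X t w)\<^sup>2) = liminf (\<lambda>k. ennreal ((I m t w - I k t w)\<^sup>2))"
        using good
      proof eventually_elim
        case (elim w)
        have "(\<lambda>k. ennreal ((I m t w - I k t w)\<^sup>2)) \<longlonglongrightarrow> ennreal ((I m t w - X t w)\<^sup>2)"
          by (intro tendsto_ennrealI tendsto_intros lim elim t)
        then show ?case by (rule lim_imp_Liminf[OF sequentially_bot, symmetric])
      qed
    qed
    also have "\<dots> \<le> liminf (\<lambda>k. \<integral>\<^sup>+w. ennreal ((I m t w - I k t w)\<^sup>2) \<partial>M)"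
      by (rule nn_integral_liminf) measurable
    also have "\<dots> \<le> liminf (\<lambda>k. 2 * square_gap (H m) \<alpha> + 2 * square_gap (H k) \<alpha>)"
      unfolding I_def by (intro Liminf_mono always_eventually allI elementary_integral_gap H \<alpha> t)
    also have "\<dots> = 2 * square_gap (H m) \<alpha>"
    proof -
      have "(\<lambda>k. 2 * square_gap (H m) \<alpha> + 2 * square_gap (H k) \<alpha>) \<longlonglongrightarrow> 2 * square_gap (H m) \<alpha> + 2 * 0"
        by (intro tendsto_add tendsto_const ennreal_tendsto_cmult H0) simp
      then show ?thesis by (simp add: lim_imp_Liminf)
    qed
    finally show ?thesis .
  qed
  have "(\<lambda>m. \<integral>\<^sup>+w. ennreal ((I m t w - X t w)\<^sup>2) \<partial>M) \<longlonglongrightarrow> 0" if t: "t \<in> {0..1}" for t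
  proof (rule tendsto_sandwich[OF _ _ tendsto_const])
    show "(\<lambda>m. 2 * square_gap (H m) \<alpha>) \<longlonglongrightarrow> 0"
      using ennreal_tendsto_cmult[OF _ H0, of 2] by simp
  qed (auto simp: gap[OF t])
  then have "is_ito_integral M W \<alpha> X"
    unfolding is_ito_integral_def using cont XFF H H0
    by (auto simp: I_def square_gap_def intro!: exI[of _ H])
  then show ?thesis by (rule exI[where x = X])
qed

end


section \<open>Distance between the Ito integral and its grid approximation\<close>

context bounded_progressive_process
begin

abbreviation X :: "real => 'a => real" where "X \<equiv> ito_integral M W \<alpha>"

text \<open>\<open>ito_integral\<close> is a choice, so its defining properties become available
  only through existence. The index is shifted because the grid needs m > 0.\<close>

lemma ito: "is_ito_integral M W \<alpha> X"
proof -
  have "is_elementary M W (grid (Suc m))" for m by (rule grid_is_elementary) simp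
  moreover have "(\<lambda>m. square_gap (grid (Suc m)) \<alpha>) \<longlonglongrightarrow> 0" by (rule LIMSEQ_Suc[OF grid_approximation])
  ultimately have "\<exists>X. is_ito_integral M W \<alpha> X" by (rule ito_integral_exists[OF prog])
  then show ?thesis unfolding ito_integral_def by (rule someI_ex)
qed

lemma ito_continuous: "w \<in> space M ==> continuous_on {0..1} (\<lambda>t. X t w)"
  using ito by (simp add: is_ito_integral_def)

lemma ito_FF: "t \<in> {0..1} ==> X t \<in> borel_measurable (FF t)"
  using ito by (simp add: is_ito_integral_def)

lemma ito_approximation:
  "\<exists>H. (\<forall>m :: nat. is_elementary M W (H m)) \<and> (\<lambda>m. square_gap (H m) \<alpha>) \<longlonglongrightarrow> 0 \<and>
    (\<forall>t\<in>{0..1}. (\<lambda>m. \<integral>\<^sup>+w. ennreal ((elementary_integral W (H m) t w - X t w)\<^sup>2) \<partial>M) \<longlonglongrightarrow> 0)"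
  using ito unfolding is_ito_integral_def square_gap_def by blast

text \<open>The chosen X comes with some approximating sequence H of its own. A late member H m is
  close to X at the finitely many grid times by Chebyshev's inequality, and the integral of K - H m
  is an elementary martingale to which the maximal inequality applies.\<close>

theorem ito_grid_error:
  assumes K: "is_elementary M W K" and n: "0 < n" and \<delta>: "0 < \<delta>" and c: "0 < c" "square_gap K \<alpha> \<le> ennreal c"
  defines "E \<equiv> {w\<in>space M. \<exists>i\<in>{0..n}. \<delta>\<^sup>2 \<le> (elementary_integral W K (real i / real n) w - X (real i / real n) w)\<^sup>2}"
  shows "E \<in> events" "prob E \<le> 20 * c / \<delta>\<^sup>2"
proof -
  define \<tau> where "\<tau> i = real i / real n" for i
  have \<tau>: "\<tau> i \<in> {0..1}" if "i \<in> {0..n}" for i using that n by (simp add: \<tau>_def)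
  define d where "d = (\<delta> / 2)\<^sup>2"
  have d: "0 < d" "\<delta>\<^sup>2 = 4 * d" using \<delta> by (simp_all add: d_def power_divide)
  \<comment> \<open>The budget c is shared among the n + 1 grid times, so that the Chebyshev bounds
    add up to c / d.\<close>
  define e where "e = c / real (Suc n)"
  have e0: "0 \<le> e" using c by (simp add: e_def)
  obtain H :: "nat => 'a elementary" where H: "\<And>m. is_elementary M W (H m)" "(\<lambda>m. square_gap (H m) \<alpha>) \<longlonglongrightarrow> 0"
    "\<And>t. t \<in> {0..1} ==> (\<lambda>m. \<integral>\<^sup>+w. ennreal ((elementary_integral W (H m) t w - X t w)\<^sup>2) \<partial>M) \<longlonglongrightarrow> 0"
    using ito_approximation by blast
  have "\<forall>\<^sub>F m in sequentially. \<forall>i\<in>{0..n}. (\<integral>\<^sup>+w. ennreal ((elementary_integral W (H m) (\<tau> i) w - X (\<tau> i) w)\<^sup>2) \<partial>M) < ennreal e"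
    using c by (intro eventually_ball_finite ballI order_tendstoD(2)[OF H(3)[OF \<tau>]]) (auto simp: e_def)
  moreover have "\<forall>\<^sub>F m in sequentially. square_gap (H m) \<alpha> < ennreal c"
    by (rule order_tendstoD(2)[OF H(2)]) (use c in simp)
  ultimately have "\<exists>m. (\<forall>i\<in>{0..n}. (\<integral>\<^sup>+w. ennreal ((elementary_integral W (H m) (\<tau> i) w - X (\<tau> i) w)\<^sup>2) \<partial>M) < ennreal e) \<and> square_gap (H m) \<alpha> < ennreal c"
    by (intro eventually_happens'[OF sequentially_bot] eventually_conj)
  then obtain m where m: "\<And>i. i \<in> {0..n} ==> (\<integral>\<^sup>+w. ennreal ((elementary_integral W (H m) (\<tau> i) w - X (\<tau> i) w)\<^sup>2) \<partial>M) < ennreal e"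
    "square_gap (H m) \<alpha> < ennreal c" by blast
  define N where "N = elementary_integral W (elementary_diff K (H m))"
  define Y where "Y i w = elementary_integral W (H m) (\<tau> i) w - X (\<tau> i) w" for i w
  have "(\<integral>\<^sup>+w. ennreal ((N 1 w)\<^sup>2) \<partial>M) \<le> 2 * square_gap K \<alpha> + 2 * square_gap (H m) \<alpha>"
    unfolding N_def elementary_integral_diff by (rule elementary_integral_gap[OF K H(1) prog]) simp
  also have "\<dots> \<le> 2 * ennreal c + 2 * ennreal c" using c m(2) by (intro add_mono mult_left_mono) auto
  also have "\<dots> = ennreal (4 * c)" using c by (simp add: ennreal_mult'' flip: mult_2)
  finally have N: "(\<integral>\<^sup>+w. ennreal ((N 1 w)\<^sup>2) \<partial>M) \<le> ennreal (4 * c)" .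
  define A where "A = {w\<in>space M. \<exists>i\<in>{0..n}. (\<delta> / 2)\<^sup>2 \<le> (N (\<tau> i) w)\<^sup>2}"
  have A: "A \<in> events" "prob A \<le> 4 * c / d"
    unfolding A_def N_def d_def \<tau>_def using \<delta> c N[unfolded N_def]
    by (intro grid_maximal[OF sq_martingale_elementary[OF is_elementary_diff[OF K H(1)]] n]; simp)+
  have Y: "Y i \<in> borel_measurable M" if "i \<in> {0..n}" for i
    unfolding Y_def[abs_def] using elementary_integral_measurable[OF H(1) \<tau>[OF that]] measurable_FF[OF ito_FF[OF \<tau>[OF that]]] by simp
  define V where "V i = {w\<in>space M. d \<le> (Y i w)\<^sup>2}" for i
  have V: "V i \<in> events" "prob (V i) \<le> e / d" if i: "i \<in> {0..n}" for i
  proof -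
    note [measurable] = Y[OF i]
    show V: "V i \<in> events" unfolding V_def by measurable
    have "ennreal (d * prob (V i)) = (\<integral>\<^sup>+w. ennreal d * indicator (V i) w \<partial>M)"
      using V d by (simp add: nn_integral_cmult_indicator emeasure_eq_measure ennreal_mult'')
    also have "\<dots> \<le> (\<integral>\<^sup>+w. ennreal ((Y i w)\<^sup>2) \<partial>M)"
      by (intro nn_integral_mono) (auto simp: V_def indicator_def intro: ennreal_leI)
    also have "\<dots> \<le> ennreal e" using m(1)[OF i] by (simp add: Y_def)
    finally have "d * prob (V i) \<le> e" using e0 by simp
    then show "prob (V i) \<le> e / d" using d(1) by (simp add: pos_le_divide_eq mult.commute)
  qed
  have Kt: "elementary_integral W K (\<tau> i) w - X (\<tau> i) w = N (\<tau> i) w + Y i w" for i w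
    by (simp add: N_def Y_def elementary_integral_diff)
  show E: "E \<in> events"
  proof -
    have [measurable]: "elementary_integral W K (\<tau> i) \<in> borel_measurable M" "X (\<tau> i) \<in> borel_measurable M" if "i \<in> {0..n}" for i
      using elementary_integral_measurable[OF K \<tau>[OF that]] measurable_FF[OF ito_FF[OF \<tau>[OF that]]] by simp_all
    show ?thesis unfolding E_def \<tau>_def[symmetric] by measurable
  qed
  have "E \<subseteq> A \<union> (\<Union>i\<in>{0..n}. V i)"
  proof
    fix w assume "w \<in> E"
    then obtain i where i: "w \<in> space M" "i \<in> {0..n}" "4 * d \<le> (N (\<tau> i) w + Y i w)\<^sup>2"
      unfolding E_def \<tau>_def[symmetric] Kt d(2) by blast
    then have "d \<le> (N (\<tau> i) w)\<^sup>2 \<or> d \<le> (Y i w)\<^sup>2"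
      using square_sum_le[of "N (\<tau> i) w" "Y i w"] by linarith
    then show "w \<in> A \<union> (\<Union>i\<in>{0..n}. V i)" using i(1,2) unfolding A_def V_def d_def by blast
  qed
  then have "prob E \<le> prob (A \<union> (\<Union>i\<in>{0..n}. V i))" using A V by (intro finite_measure_mono) auto
  also have "\<dots> \<le> prob A + (\<Sum>i\<in>{0..n}. prob (V i))"
    using A V by (intro order.trans[OF measure_Un_le] add_mono measure_UNION_le) auto
  also have "\<dots> \<le> 4 * c / d + (\<Sum>i\<in>{0..n}. e / d)" using A V by (intro add_mono sum_mono) auto
  also have "(\<Sum>i\<in>{0..n}. e / d) = c / d" by (simp add: e_def del: of_nat_Suc)
  also have "4 * c / d + c / d = 20 * c / \<delta>\<^sup>2" unfolding d(2) by simp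
  finally show "prob E \<le> 20 * c / \<delta>\<^sup>2" .
qed

end

section \<open>Approximating chains\<close>


locale volatility_control = bounded_progressive_process +
  fixes \<sigma> s0 :: real
  assumes \<sigma>: "0 < \<sigma>" and s0: "0 < s0"
begin

definition grid_increment :: "nat => nat => 'a => real" where
  "grid_increment m i w = (W (real (Suc i) / real m) w - W (real i / real m) w) / sqrt (real (Suc i) / real m - real i / real m)"

lemma grid_block_data:
  assumes m: "0 < m"
  shows "block_data M m \<sigma> (B + 1) (grid_values m B) (\<lambda>i. FF (real i / real m)) (grid_coeff \<alpha> m) (grid_increment m)"
proof
  have le: "real i / real m \<le> real (Suc i) / real m" for i by (simp add: divide_right_mono)
  show "sets (FF (real i / real m)) \<subseteq> sets (FF (real (Suc i) / real m))" for i by (rule sets_FF_mono[OF le])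
  show "grid_increment m i \<in> borel_measurable (FF (real (Suc i) / real m))" for i
    unfolding grid_increment_def[abs_def] using le
    by (intro borel_measurable_divide borel_measurable_diff borel_measurable_const W_FF) auto
  fix i E and U :: "real set" assume "i < m" and E: "E \<in> sets (FF (real i / real m))" and U: "U \<in> sets borel"
  have "real i / real m < real (Suc i) / real m" using m by (simp add: divide_strict_right_mono)
  from increment_normal[OF _ this E U]
  show "prob (E \<inter> {w\<in>space M. grid_increment m i w \<in> U}) = prob E * measure std_normal_distribution U"
    unfolding grid_increment_def by simp
qed (use m \<sigma> in \<open>auto simp: sets_FF_subset[THEN subsetD] space_FF grid_values_finite grid_values_nonzero
    intro: grid_values_bound grid_coeff_FF grid_coeff_values\<close>)

lemma grid_integral_at:
  assumes m: "0 < m" and i: "i \<le> m"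
  shows "elementary_integral W (grid m) (real i / real m) w
    = (\<Sum>l<i. grid_coeff \<alpha> m l w * (W (real (Suc l) / real m) w - W (real l / real m) w))"
proof -
  define g where "g l = grid_coeff \<alpha> m l w * (W (min (real (Suc l) / real m) (real i / real m)) w - W (min (real l / real m) (real i / real m)) w)" for l
  have "elementary_integral W (grid m) (real i / real m) w = (\<Sum>l<m. g l)"
    by (simp add: elementary_integral_def grid_elementary_def o_def interv_sum_list_conv_sum_set_nat lessThan_atLeast0 g_def)
  also have "\<dots> = (\<Sum>l<i. g l)"
  proof (rule sum.mono_neutral_right)
    show "\<forall>l\<in>{..<m} - {..<i}. g l = 0"
    proof
      fix l assume "l \<in> {..<m} - {..<i}"
      then have "real i / real m \<le> real l / real m" "real i / real m \<le> real (Suc l) / real m"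
        by (auto intro!: divide_right_mono)
      then show "g l = 0" by (simp add: g_def min_absorb2)
    qed
  qed (use i in auto)
  also have "\<dots> = (\<Sum>l<i. grid_coeff \<alpha> m l w * (W (real (Suc l) / real m) w - W (real l / real m) w))"
  proof (rule sum.cong[OF refl])
    fix l assume "l \<in> {..<i}"
    then have "real l / real m \<le> real i / real m" "real (Suc l) / real m \<le> real i / real m"
      by (auto intro!: divide_right_mono)
    then show "g l = grid_coeff \<alpha> m l w * (W (real (Suc l) / real m) w - W (real l / real m) w)"
      by (simp add: g_def min_absorb1)
  qed
  finally show ?thesis .
qed

text \<open>The log price of the grid control at time i/m, relative to s0; the sum divided by m is
  the integral of its square.\<close>

definition grid_log :: "nat => nat => 'a => real" where
  "grid_log m i w = elementary_integral W (grid m) (real i / real m) w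
     - (\<Sum>l<i. (grid_coeff \<alpha> m l w)\<^sup>2) / (2 * real m)"

text \<open>Dividing the normalised increment by sqrt m returns the Brownian increment over a
  cell.\<close>

lemma grid_target:
  assumes m: "0 < m" and i: "i \<le> m"
  shows "block_data.target m (grid_coeff \<alpha> m) (grid_increment m) i w = grid_log m i w"
proof -
  interpret bd: block_data M m \<sigma> "B + 1" "grid_values m B" "\<lambda>i. FF (real i / real m)" "grid_coeff \<alpha> m" "grid_increment m"
    by (rule grid_block_data[OF m])
  have "grid_coeff \<alpha> m l w * grid_increment m l w / sqrt m = grid_coeff \<alpha> m l w * (W (real (Suc l) / real m) w - W (real l / real m) w)" for l
  proof -
    have "sqrt (real (Suc l) / real m - real l / real m) * sqrt m = 1"
      using m by (simp add: diff_divide_distrib[symmetric] real_sqrt_divide)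
    then show ?thesis by (simp add: grid_increment_def)
  qed
  then show ?thesis
    by (simp add: bd.target_def grid_log_def grid_integral_at[OF m i] sum_subtractf sum_divide_distrib)
qed

definition dev_bound :: real where "dev_bound = block_data.A \<sigma> (B + 1)"
definition ramp :: nat where "ramp = block_data.r \<sigma> (B + 1)"

definition coupled_chain ::
    "nat => nat => real => (nat => 'a => real list \<times> real list) => (nat => 'a => real) => (nat => 'a => real) => 'a set => bool" where
  "coupled_chain m n \<delta> T \<xi> a E \<longleftrightarrow> scaled_chain M n \<sigma> dev_bound T \<xi> a s0 \<and>
    (\<forall>w i k. i < m --> block_start m n i < k --> k + ramp \<le> block_start m n (Suc i) --> a k w = excess \<sigma> (grid_coeff \<alpha> m i w)) \<and>
    E \<in> events \<and> (\<forall>w\<in>space M - E. \<forall>i<m. \<forall>k\<in>{block_start m n i..block_start m n (Suc i)}.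
      \<bar>\<sigma> / sqrt n * (\<Sum>j=1..k. \<xi> j w) - grid_log m i w\<bar> \<le> \<delta>)"

definition grid_bound :: "nat => real => real" where "grid_bound m \<delta> = block_data.error_bound m \<sigma> (B + 1) \<delta>"

lemma grid_bound_eq:
  assumes "0 < m"
  shows "grid_bound m \<delta> = \<delta> + 2 * real m * exp (12 * (\<sigma> + 2 * dev_bound)\<^sup>2) * exp (- sqrt m * (\<delta> / 3))"
  unfolding grid_bound_def dev_bound_def by (rule block_data.error_bound_def[OF grid_block_data[OF assms]])

lemma grid_chain:
  assumes m: "0 < m" and \<delta>: "0 < \<delta>"
  shows "\<exists>N. \<forall>n\<ge>N. \<exists>T \<xi> a E. coupled_chain m n \<delta> T \<xi> a E \<and> prob E \<le> grid_bound m \<delta>"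
proof -
  interpret bd: block_data M m \<sigma> "B + 1" "grid_values m B" "\<lambda>i. FF (real i / real m)" "grid_coeff \<alpha> m" "grid_increment m"
    by (rule grid_block_data[OF m])
  have t: "i < m ==> bd.target i w = grid_log m i w" for i w by (rule grid_target[OF m less_imp_le])
  have "coupled_chain m n \<delta> T \<xi> a E \<and> prob E \<le> grid_bound m \<delta>" if "bd.tracks_target n \<delta> T \<xi> a E" for n T \<xi> a E
    using that s0 unfolding bd.tracks_target_def coupled_chain_def scaled_chain_def scaled_chain_axioms_def dev_bound_def ramp_def grid_bound_def
    by (simp add: t)
  then show ?thesis using bd.discrete_approximation[OF \<delta>] by meson
qed

definition log_price :: "real => 'a => real" where
  "log_price t w = X t w - 1/2 * (LBINT u:{0..t}. (\<alpha> u w)\<^sup>2)"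

abbreviation S :: "'a => real => real" where "S \<equiv> exp_martingale M W s0 \<alpha>"

lemma S_eq: "t \<in> {0..1} ==> S w t = s0 * exp (log_price t w)"
  by (simp add: exp_martingale_def log_price_def)

lemma square_integrable_trunc:
  assumes w: "w \<in> space M" shows "integrable lborel (\<lambda>t. (trunc \<alpha> w t)\<^sup>2)"
proof (rule bounded_support_integrable)
  have [measurable]: "trunc \<alpha> w \<in> borel_measurable borel" by (rule trunc_borel[OF prog w])
  show "(\<lambda>t. (trunc \<alpha> w t)\<^sup>2) \<in> borel_measurable borel" by measurable
  show "\<bar>(trunc \<alpha> w t)\<^sup>2\<bar> \<le> B\<^sup>2" for t
    using trunc_bound[OF w, of t] by (simp add: abs_le_square_iff power2_le_iff_abs_le B_nonneg)
qed (simp add: trunc_def)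

lemma quadratic_variation_trunc:
  "t \<le> 1 ==> (LBINT u:{0..t}. (\<alpha> u w)\<^sup>2) = (LBINT u. indicator {0..t} u * (trunc \<alpha> w u)\<^sup>2)"
  unfolding set_lebesgue_integral_def
  by (rule bochner_cong) (auto simp: trunc_def indicator_def)

lemma quadratic_variation_lipschitz:
  assumes w: "w \<in> space M" and st: "0 \<le> s" "s \<le> t" "t \<le> 1"
  shows "\<bar>(LBINT u:{0..t}. (\<alpha> u w)\<^sup>2) - (LBINT u:{0..s}. (\<alpha> u w)\<^sup>2)\<bar> \<le> B\<^sup>2 * (t - s)"
proof -
  have I: "integrable lborel (\<lambda>u. indicator {0..v} u * (trunc \<alpha> w u)\<^sup>2)" for v
    using integrable_mult_indicator[OF _ square_integrable_trunc[OF w], of "{0..v}"] by simp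
  have eq: "(LBINT u:{0..t}. (\<alpha> u w)\<^sup>2) - (LBINT u:{0..s}. (\<alpha> u w)\<^sup>2)
    = (LBINT u. indicator {0..t} u * (trunc \<alpha> w u)\<^sup>2 - indicator {0..s} u * (trunc \<alpha> w u)\<^sup>2)"
    unfolding quadratic_variation_trunc[OF st(3)] quadratic_variation_trunc[OF order_trans[OF st(2,3)]]
    by (rule bochner_diff[OF I I, symmetric])
  have "\<bar>LBINT u. indicator {0..t} u * (trunc \<alpha> w u)\<^sup>2 - indicator {0..s} u * (trunc \<alpha> w u)\<^sup>2\<bar>
    \<le> (LBINT u. \<bar>indicator {0..t} u * (trunc \<alpha> w u)\<^sup>2 - indicator {0..s} u * (trunc \<alpha> w u)\<^sup>2\<bar>)"
    by (rule integral_abs_bound)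
  also have "\<dots> \<le> (LBINT u. B\<^sup>2 * indicator {s..t} u)"
  proof (rule integral_mono)
    show "integrable lborel (\<lambda>u. \<bar>indicator {0..t} u * (trunc \<alpha> w u)\<^sup>2 - indicator {0..s} u * (trunc \<alpha> w u)\<^sup>2\<bar>)"
      by (rule integrable_abs[OF bochner_integrable_diff[OF I I]])
    show "integrable lborel (\<lambda>u. B\<^sup>2 * indicator {s..t} u)"
      by (intro integrable_mult_right integrable_real_indicator) (auto simp: emeasure_lborel_Icc_eq)
    fix u
    have "(trunc \<alpha> w u)\<^sup>2 \<le> B\<^sup>2" using trunc_bound[OF w, of u] by (simp add: power2_le_iff_abs_le B_nonneg)
    moreover have "\<bar>indicat_real {0..t} u - indicat_real {0..s} u\<bar> \<le> indicat_real {s..t} u"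
      using st by (auto simp: indicator_def)
    ultimately have "(trunc \<alpha> w u)\<^sup>2 * \<bar>indicat_real {0..t} u - indicat_real {0..s} u\<bar> \<le> B\<^sup>2 * indicator {s..t} u"
      by (intro mult_mono) simp_all
    moreover have "indicator {0..t} u * (trunc \<alpha> w u)\<^sup>2 - indicator {0..s} u * (trunc \<alpha> w u)\<^sup>2
        = (trunc \<alpha> w u)\<^sup>2 * (indicat_real {0..t} u - indicat_real {0..s} u)"
      by (simp add: right_diff_distrib mult.commute)
    ultimately show "\<bar>indicator {0..t} u * (trunc \<alpha> w u)\<^sup>2 - indicator {0..s} u * (trunc \<alpha> w u)\<^sup>2\<bar> \<le> B\<^sup>2 * indicator {s..t} u"
      by (simp add: abs_mult)
  qed
  also have "\<dots> = B\<^sup>2 * (t - s)" using st by simp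
  finally show ?thesis unfolding eq .
qed

lemma log_price_continuous:
  assumes w: "w \<in> space M" shows "continuous_on {0..1} (\<lambda>t. log_price t w)"
proof -
  have "(B\<^sup>2)-lipschitz_on {0..1} (\<lambda>t. LBINT u:{0..t}. (\<alpha> u w)\<^sup>2)"
  proof (rule lipschitz_onI)
    fix s t :: real assume st: "s \<in> {0..1}" "t \<in> {0..1}"
    show "dist (LBINT u:{0..s}. (\<alpha> u w)\<^sup>2) (LBINT u:{0..t}. (\<alpha> u w)\<^sup>2) \<le> B\<^sup>2 * dist s t"
    proof (cases "s \<le> t")
      case True
      then show ?thesis using quadratic_variation_lipschitz[OF w, of s t] st by (auto simp: dist_real_def abs_minus_commute)
    next
      case False
      then show ?thesis using quadratic_variation_lipschitz[OF w, of t s] st by (auto simp: dist_real_def)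
    qed
  qed simp
  from lipschitz_on_continuous_on[OF this] show ?thesis
    unfolding log_price_def by (intro continuous_intros ito_continuous w)
qed

lemma S_pos: "w \<in> space M ==> S w \<in> C01_pos"
proof (rule C01_posI)
  assume w: "w \<in> space M"
  have "continuous_on {0..1} (\<lambda>t. s0 * exp (log_price t w))" by (intro continuous_intros log_price_continuous w)
  then show "continuous_on {0..1} (S w)" by (rule continuous_on_eq) (simp add: S_eq)
  show "0 < S w t" if "t \<in> {0..1}" for t using that s0 by (simp add: S_eq)
qed (simp add: exp_martingale_def)

definition grid_error :: "nat => 'a => real" where
  "grid_error m w = (LBINT t. indicator {0..1} t * \<bar>elementary_process (grid m) t w - trunc \<alpha> w t\<bar>)"

lemma grid_square_integral:
  assumes m: "0 < m" and i: "i \<le> m"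
  shows "(LBINT t. indicator {0..real i / real m} t * (elementary_process (grid m) t w)\<^sup>2)
    = (\<Sum>l<i. (grid_coeff \<alpha> m l w)\<^sup>2) / real m"
    "integrable lborel (\<lambda>t. indicator {0..real i / real m} t * (elementary_process (grid m) t w)\<^sup>2)"
proof -
  define d where "d l = (if l < i then (grid_coeff \<alpha> m l w)\<^sup>2 else 0)" for l
  have eq: "indicator {0..real i / real m} t * (elementary_process (grid m) t w)\<^sup>2 = \<bar>grid_step m d t\<bar>" for t
  proof (cases "\<exists>l<m. t \<in> cell m l")
    case True
    then obtain l where l: "l < m" "t \<in> cell m l" by auto
    have t: "0 < t" using cell_subset[OF l(1)] l(2) by auto
    have "t \<le> real i / real m \<longleftrightarrow> l < i"
    proof
      assume "l < i"
      then have "real (Suc l) / real m \<le> real i / real m" by (intro divide_right_mono) auto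
      then show "t \<le> real i / real m" using l(2) by (simp add: cell_def)
    next
      assume "t \<le> real i / real m"
      then have "real l / real m < real i / real m" using l(2) by (simp add: cell_def)
      then show "l < i" using m by (simp add: divide_less_cancel)
    qed
    then show ?thesis using t
      by (simp add: grid_elementary_process grid_step_cell[OF m l] d_def indicator_def)
  next
    case False
    then show ?thesis by (simp add: grid_elementary_process grid_step_def)
  qed
  show "integrable lborel (\<lambda>t. indicator {0..real i / real m} t * (elementary_process (grid m) t w)\<^sup>2)"
    unfolding eq by (rule grid_step_integral_abs(1)[OF m])
  have "(\<Sum>l<m. \<bar>d l\<bar>) = (\<Sum>l<i. (grid_coeff \<alpha> m l w)\<^sup>2)"
    using i by (intro sum.mono_neutral_cong_right) (auto simp: d_def)
  then show "(LBINT t. indicator {0..real i / real m} t * (elementary_process (grid m) t w)\<^sup>2)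
    = (\<Sum>l<i. (grid_coeff \<alpha> m l w)\<^sup>2) / real m"
    unfolding eq grid_step_integral_abs(2)[OF m] by simp
qed

text \<open>Factor the difference of squares as |x + y| |x - y|; the first factor is at most 2 B + 1
  and the second integrates to the L1 error of the grid control.\<close>

lemma grid_quadratic_variation:
  assumes m: "0 < m" and i: "i \<le> m" and w: "w \<in> space M"
  shows "\<bar>(\<Sum>l<i. (grid_coeff \<alpha> m l w)\<^sup>2) / real m - (LBINT u:{0..real i / real m}. (\<alpha> u w)\<^sup>2)\<bar> \<le> (2 * B + 1) * grid_error m w"
proof -
  define t where "t = real i / real m"
  have t: "t \<le> 1" using m i by (simp add: t_def)
  define K where "K u = elementary_process (grid m) u w" for u
  have I: "integrable lborel (\<lambda>u. indicator {0..t} u * (trunc \<alpha> w u)\<^sup>2)"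
    using integrable_mult_indicator[OF _ square_integrable_trunc[OF w], of "{0..t}"] by simp
  have KI: "integrable lborel (\<lambda>u. indicator {0..t} u * (K u)\<^sup>2)"
    unfolding K_def t_def by (rule grid_square_integral(2)[OF m i])
  have EI: "integrable lborel (\<lambda>u. indicator {0..1} u * \<bar>K u - trunc \<alpha> w u\<bar>)"
    unfolding K_def by (rule grid_difference_integrable[OF m w])
  have eq: "(\<Sum>l<i. (grid_coeff \<alpha> m l w)\<^sup>2) / real m - (LBINT u:{0..t}. (\<alpha> u w)\<^sup>2)
    = (LBINT u. indicator {0..t} u * (K u)\<^sup>2 - indicator {0..t} u * (trunc \<alpha> w u)\<^sup>2)"
    unfolding quadratic_variation_trunc[OF t] grid_square_integral(1)[OF m i, symmetric, of w, folded K_def t_def]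
    by (rule bochner_diff[OF KI I, symmetric])
  have "\<bar>LBINT u. indicator {0..t} u * (K u)\<^sup>2 - indicator {0..t} u * (trunc \<alpha> w u)\<^sup>2\<bar>
    \<le> (LBINT u. \<bar>indicator {0..t} u * (K u)\<^sup>2 - indicator {0..t} u * (trunc \<alpha> w u)\<^sup>2\<bar>)"
    by (rule integral_abs_bound)
  also have "\<dots> \<le> (LBINT u. (2 * B + 1) * (indicator {0..1} u * \<bar>K u - trunc \<alpha> w u\<bar>))"
  proof (rule integral_mono)
    show "integrable lborel (\<lambda>u. \<bar>indicator {0..t} u * (K u)\<^sup>2 - indicator {0..t} u * (trunc \<alpha> w u)\<^sup>2\<bar>)"
      by (rule integrable_abs[OF bochner_integrable_diff[OF KI I]])
    show "integrable lborel (\<lambda>u. (2 * B + 1) * (indicator {0..1} u * \<bar>K u - trunc \<alpha> w u\<bar>))"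
      by (intro integrable_mult_right EI)
    fix u
    have "\<bar>(K u)\<^sup>2 - (trunc \<alpha> w u)\<^sup>2\<bar> = \<bar>K u + trunc \<alpha> w u\<bar> * \<bar>K u - trunc \<alpha> w u\<bar>"
      by (simp add: power2_eq_square square_diff_square_factored abs_mult)
    also have "\<dots> \<le> (2 * B + 1) * \<bar>K u - trunc \<alpha> w u\<bar>"
      using grid_process_bound[OF m w, of u] trunc_bound[OF w, of u] by (intro mult_right_mono) (auto simp: K_def)
    finally show "\<bar>indicator {0..t} u * (K u)\<^sup>2 - indicator {0..t} u * (trunc \<alpha> w u)\<^sup>2\<bar>
      \<le> (2 * B + 1) * (indicator {0..1} u * \<bar>K u - trunc \<alpha> w u\<bar>)"
      using t B_nonneg by (auto simp: indicator_def)
  qed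
  also have "\<dots> = (2 * B + 1) * grid_error m w" by (simp add: grid_error_def K_def)
  finally show ?thesis unfolding t_def[symmetric] eq .
qed

definition grid_defect :: "nat => nat => 'a => real" where
  "grid_defect m i w = elementary_integral W (grid m) (real i / real m) w - X (real i / real m) w"

lemma grid_log_error:
  assumes m: "0 < m" and i: "i \<le> m" and w: "w \<in> space M"
    and e: "\<bar>grid_defect m i w\<bar> \<le> e"
  shows "\<bar>grid_log m i w - log_price (real i / real m) w\<bar> \<le> e + (B + 1) * grid_error m w"
proof -
  have q: "0 \<le> grid_error m w" unfolding grid_error_def by (intro integral_nonneg_AE) simp
  have "(2 * B + 1) * grid_error m w \<le> 2 * ((B + 1) * grid_error m w)"
    using q by (simp add: algebra_simps)
  moreover have "(\<Sum>l<i. (grid_coeff \<alpha> m l w)\<^sup>2) / (2 * real m) = (\<Sum>l<i. (grid_coeff \<alpha> m l w)\<^sup>2) / real m / 2" by simp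
  ultimately show ?thesis
    using grid_quadratic_variation[OF m i w] e unfolding grid_defect_def grid_log_def log_price_def by (simp add: abs_le_iff)
qed

end


section \<open>Uniform convergence of prices and convergence of coefficients\<close>

lemma block_exists:
  assumes "0 < m" "k \<le> n" shows "\<exists>i<m. k \<in> {block_start m n i..block_start m n (Suc i)}"
proof -
  have "0 < l ==> k \<le> block_start m n l ==> \<exists>i<l. k \<in> {block_start m n i..block_start m n (Suc i)}" for l
  proof (induction l)
    case (Suc l)
    show ?case
    proof (cases "0 < l \<and> k \<le> block_start m n l")
      case True
      then show ?thesis using Suc(1) less_SucI by blast
    next
      case False
      then have "block_start m n l \<le> k" by (cases "l = 0") auto
      then show ?thesis using Suc(3) by (intro exI[of _ l]) simp
    qed
  qed simp
  from this[of m] show ?thesis using assms by simp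
qed

lemma block_near:
  assumes m: "0 < m" and n: "0 < n" and k: "k \<in> {block_start m n i..block_start m n (Suc i)}"
  shows "\<bar>real k / real n - real i / real m\<bar> \<le> 1 / real m + 1 / real n"
proof -
  have "real i * real n / real m - 1 \<le> real k" using block_start_bounds(2)[OF m, of i n] k by simp
  then have "(real i * real n / real m - 1) / real n \<le> real k / real n" by (intro divide_right_mono) simp_all
  then have 1: "real i / real m - 1 / real n \<le> real k / real n" using n by (simp add: diff_divide_distrib)
  have "real k \<le> real (Suc i) * real n / real m" using block_start_bounds(1)[OF m, of n "Suc i"] k by simp
  then have "real k / real n \<le> real (Suc i) * real n / real m / real n" by (intro divide_right_mono) simp_all
  then have 2: "real k / real n \<le> real i / real m + 1 / real m" using n by (simp add: add_divide_distrib)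
  have "0 \<le> 1 / real m" "0 \<le> 1 / real n" by simp_all
  with 1 2 show ?thesis by linarith
qed

lemma exp_minus_one_abs: "\<bar>exp z - 1\<bar> \<le> exp \<bar>z\<bar> - (1 :: real)"
proof (cases "0 \<le> z")
  case False
  have "exp z \<ge> 1 + z" "exp (- z) \<ge> 1 - z" using exp_ge_add_one_self[of z] exp_ge_add_one_self[of "- z"] by simp_all
  moreover have "\<bar>exp z - 1\<bar> = 1 - exp z" "\<bar>z\<bar> = - z" using False by simp_all
  ultimately show ?thesis by linarith
qed simp

text \<open>The times within c/n of a grid point, where the ramp of a block or the rounding of
  indices interferes. For fixed m the measure is of order 1/n.\<close>

definition boundary_zone :: "nat => nat => nat => real set" where
  "boundary_zone c m n = (\<Union>i\<in>{..m}. {real i / real m - real c / real n..real i / real m + real c / real n})"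

lemma boundary_zone_measure:
  "boundary_zone c m n \<in> sets lborel" "emeasure lborel (boundary_zone c m n) < \<infinity>"
  "measure lborel (boundary_zone c m n) \<le> real (Suc m) * (2 * real c / real n)"
proof -
  show [measurable]: "boundary_zone c m n \<in> sets lborel" unfolding boundary_zone_def by measurable
  have "bounded (boundary_zone c m n)" unfolding boundary_zone_def by (intro bounded_UN) auto
  then show "emeasure lborel (boundary_zone c m n) < \<infinity>" by (intro emeasure_bounded_finite)
  have "measure lborel (boundary_zone c m n) \<le> (\<Sum>i\<le>m. measure lborel {real i / real m - real c / real n..real i / real m + real c / real n})"
    unfolding boundary_zone_def by (rule measure_UNION_le) auto
  also have "\<dots> = (\<Sum>i\<le>m. 2 * real c / real n)" by (intro sum.cong refl) simp
  finally show "measure lborel (boundary_zone c m n) \<le> real (Suc m) * (2 * real c / real n)" by simp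
qed

lemma scale_add_divide:
  fixes n :: real assumes "n \<noteq> 0"
  shows "n * (x / m + c / n) = x * n / m + c" "n * (x / m - c / n) = x * n / m - c"
  using assms by (simp_all only: distrib_left right_diff_distrib times_divide_eq_right nonzero_mult_div_cancel_left mult.commute[of n x] mult.commute[of n c])
    simp_all

text \<open>The radius of r + 2 steps leaves r for the ramp and the rest for rounding down n t and
  the block starts.\<close>

lemma block_bulk:
  assumes m: "0 < m" and n: "0 < n" and t: "t \<in> {0<..1}" "t \<notin> boundary_zone (Suc (Suc r)) m n"
  shows "\<exists>i<m. t \<in> cell m i \<and> block_start m n i < nat \<lfloor>real n * t\<rfloor> \<and> nat \<lfloor>real n * t\<rfloor> + r \<le> block_start m n (Suc i)"
proof -
  obtain i where i: "i < m" "t \<in> cell m i" using cell_exists[OF m, of t] t(1) by auto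
  have nt: "0 \<le> real n * t" using t(1) by simp
  have c: "0 \<le> real (Suc (Suc r)) / real n" by simp
  have "real n \<noteq> 0" using n by simp
  note scale = scale_add_divide[OF this]
  have "t \<notin> {real i / real m - real (Suc (Suc r)) / real n..real i / real m + real (Suc (Suc r)) / real n}"
    using t(2) i(1) by (auto simp: boundary_zone_def)
  moreover have "real i / real m < t" using i(2) by (simp add: cell_def)
  ultimately have "real i / real m + real (Suc (Suc r)) / real n < t" using c by (auto simp: not_le)
  then have "real n * (real i / real m + real (Suc (Suc r)) / real n) < real n * t"
    using n by (intro mult_strict_left_mono) simp_all
  then have lo: "real i * real n / real m + real (Suc (Suc r)) < real n * t" unfolding scale(1) .
  have "Suc i \<in> {..m}" using i(1) by simp
  then have "{real (Suc i) / real m - real (Suc (Suc r)) / real n..real (Suc i) / real m + real (Suc (Suc r)) / real n} \<subseteq> boundary_zone (Suc (Suc r)) m n"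
    unfolding boundary_zone_def by (rule UN_upper)
  from contra_subsetD[OF this t(2)]
  have out: "t \<notin> {real (Suc i) / real m - real (Suc (Suc r)) / real n..real (Suc i) / real m + real (Suc (Suc r)) / real n}" .
  have below: "t \<le> real (Suc i) / real m" using i(2) unfolding cell_def by (rule greaterThanAtMost_iff[THEN iffD1, THEN conjunct2])
  have "t < x - y" if "t \<notin> {x - y..x + y}" "t \<le> x" "0 \<le> y" for x y using that by auto
  from this[OF out below c] have "t < real (Suc i) / real m - real (Suc (Suc r)) / real n" .
  then have "real n * t < real n * (real (Suc i) / real m - real (Suc (Suc r)) / real n)"
    by (rule mult_strict_left_mono) (use n in simp)
  then have hi: "real n * t < real (Suc i) * real n / real m - real (Suc (Suc r))" unfolding scale(2) .
  define k where "k = nat \<lfloor>real n * t\<rfloor>"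
  have k: "real k \<le> real n * t" "real n * t < real k + 1"
    using nt by (simp_all add: k_def of_nat_floor)
  have "real (block_start m n i) < real k"
    using block_start_bounds(1)[OF m, of n i] lo k by simp
  moreover have "real (k + r) \<le> real (block_start m n (Suc i))"
    using block_start_bounds(2)[OF m, of "Suc i" n] hi k by simp
  ultimately show ?thesis using i unfolding k_def[symmetric] of_nat_less_iff of_nat_le_iff by blast
qed

context volatility_control
begin

text \<open>A log price of the chain is compared with \<open>grid_log\<close> at the start of its
  block, then with the limit at the same grid time, and finally with the limit at t by uniform
  continuity.\<close>

lemma price_path_converges:
  fixes T :: "nat => nat => 'a => 't"
  assumes chain: "\<And>j. scaled_chain M (\<nu> j) \<sigma> dev_bound (T j) (\<xi> j) (a j) s0"
    and m: "\<And>j. 0 < m j" "filterlim m at_top sequentially" and \<nu>: "filterlim \<nu> at_top sequentially"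
    and \<delta>: "\<delta> \<longlonglongrightarrow> 0" and w: "w \<in> space M"
    and ev1: "\<forall>\<^sub>F j in sequentially. \<forall>i<m j. \<forall>k\<in>{block_start (m j) (\<nu> j) i..block_start (m j) (\<nu> j) (Suc i)}.
         \<bar>\<sigma> / sqrt (\<nu> j) * (\<Sum>l=1..k. \<xi> j l w) - grid_log (m j) i w\<bar> \<le> \<delta> j"
    and ev2: "\<forall>\<^sub>F j in sequentially. \<forall>i\<le>m j.
      \<bar>grid_defect (m j) i w\<bar> \<le> \<delta> j"
    and e: "0 < e"
  shows "\<forall>\<^sub>F j in sequentially. \<forall>t\<in>{0..1}. \<bar>scaled_chain.price_path (\<nu> j) \<sigma> (\<xi> j) s0 w t - S w t\<bar> \<le> e"
proof -
  have cont: "continuous_on {0..1} (\<lambda>t. log_price t w)" by (rule log_price_continuous[OF w])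
  then have "bounded ((\<lambda>t. log_price t w) ` {0..1})" by (intro compact_imp_bounded compact_continuous_image) auto
  then obtain R where "\<forall>x\<in>{0..1}. \<bar>log_price x w\<bar> \<le> R" by (auto simp: bounded_iff)
  then have R: "\<bar>log_price t w\<bar> \<le> R" if "t \<in> {0..1}" for t using that by blast
  \<comment> \<open>Chosen so that an error e' in the logarithm changes a price of at most s0 exp R
    by at most e.\<close>
  define e' where "e' = ln (1 + e / (s0 * exp R))"
  have e': "0 < e'" unfolding e'_def using e s0 by (intro ln_gt_zero) simp
  have e'_eq: "s0 * exp R * (exp e' - 1) = e"
  proof -
    have "0 < 1 + e / (s0 * exp R)" using e s0 by (simp add: add_pos_pos)
    then show ?thesis using s0 by (simp add: e'_def)
  qed
  have "uniformly_continuous_on {0..1} (\<lambda>t. log_price t w)" by (rule compact_uniformly_continuous[OF cont]) simp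
  then obtain d where d: "0 < d" "\<And>s t. s \<in> {0..1} ==> t \<in> {0..1} ==> \<bar>s - t\<bar> < d ==> \<bar>log_price s w - log_price t w\<bar> < e' / 2"
    using half_gt_zero[OF e'] unfolding uniformly_continuous_on_def dist_real_def by metis
  have "(\<lambda>j. grid_error (m j) w) \<longlonglongrightarrow> 0"
    unfolding grid_error_def by (rule filterlim_compose[OF grid_L1_pathwise[OF w] m(2)])
  then have "(\<lambda>j. \<delta> j + (\<delta> j + (B + 1) * grid_error (m j) w)) \<longlonglongrightarrow> 0 + (0 + (B + 1) * 0)" by (intro tendsto_intros \<delta>)
  moreover have "0 + (0 + (B + 1) * 0) < e' / 2" using e' by simp
  ultimately have ev3: "\<forall>\<^sub>F j in sequentially. \<delta> j + (\<delta> j + (B + 1) * grid_error (m j) w) < e' / 2"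
    by (rule order_tendstoD(2))
  have "(\<lambda>j. 1 / real (m j) + 2 * (1 / real (\<nu> j))) \<longlonglongrightarrow> 0 + 2 * 0"
    by (intro tendsto_intros filterlim_compose[OF lim_inverse_n' m(2)] filterlim_compose[OF lim_inverse_n' \<nu>])
  then have ev4: "\<forall>\<^sub>F j in sequentially. 1 / real (m j) + 2 * (1 / real (\<nu> j)) < d"
    using order_tendstoD(2)[of _ 0 sequentially d] d by simp
  show ?thesis
    using ev1 ev2 ev3 ev4
  proof eventually_elim
    case (elim j)
    interpret c: scaled_chain M "\<nu> j" \<sigma> dev_bound "T j" "\<xi> j" "a j" s0 by (rule chain)
    show ?case
    proof
      fix t :: real assume t: "t \<in> {0..1}"
      show "\<bar>c.price_path w t - S w t\<bar> \<le> e"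
        unfolding c.price_path_def
      proof (rule interpolation_close[OF c.n_pos t])
        fix k assume k: "k \<le> \<nu> j" "\<bar>real k / real (\<nu> j) - t\<bar> \<le> 1 / real (\<nu> j)"
        obtain i where i: "i < m j" "k \<in> {block_start (m j) (\<nu> j) i..block_start (m j) (\<nu> j) (Suc i)}"
          using block_exists[OF m(1) k(1), of j] by auto
        define x where "x = \<sigma> / sqrt (\<nu> j) * (\<Sum>l=1..k. \<xi> j l w)"
        have "\<bar>x - grid_log (m j) i w\<bar> \<le> \<delta> j" using elim(1) i unfolding x_def by blast
        moreover have "\<bar>grid_log (m j) i w - log_price (real i / real (m j)) w\<bar> \<le> \<delta> j + (B + 1) * grid_error (m j) w"
          using elim(2) i(1) by (intro grid_log_error m w) auto
        moreover have "\<bar>log_price (real i / real (m j)) w - log_price t w\<bar> < e' / 2"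
        proof (rule d(2)[OF _ t])
          show "real i / real (m j) \<in> {0..1}" using i(1) by simp
          show "\<bar>real i / real (m j) - t\<bar> < d" using block_near[OF m(1) c.n_pos i(2)] k(2) elim(4) by linarith
        qed
        ultimately have z: "\<bar>x - log_price t w\<bar> \<le> e'" using elim(3) by linarith
        have "stock \<sigma> s0 (\<nu> j) (c.coins w) k - S w t = s0 * exp (log_price t w) * (exp (x - log_price t w) - 1)"
          using c.price_eq[OF k(1), of w] t by (simp add: c.price_def x_def S_eq exp_diff right_diff_distrib)
        also have "\<bar>\<dots>\<bar> = s0 * exp (log_price t w) * \<bar>exp (x - log_price t w) - 1\<bar>" using s0 by (simp add: abs_mult)
        also have "\<dots> \<le> s0 * exp R * (exp e' - 1)"
        proof (intro mult_mono)
          show "exp (log_price t w) \<le> exp R" using R[OF t] by simp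
          show "\<bar>exp (x - log_price t w) - 1\<bar> \<le> exp e' - 1"
            using exp_minus_one_abs[of "x - log_price t w"] z by (smt (verit) exp_le_cancel_iff)
        qed (use s0 in auto)
        also have "\<dots> = e" by (rule e'_eq)
        finally show "\<bar>stock \<sigma> s0 (\<nu> j) (c.coins w) k - S w t\<bar> \<le> e" .
      qed
    qed
  qed
qed

lemma coefficient_bulk:
  assumes m: "0 < m" and n: "0 < n"
    and bulk: "\<And>i k. i < m ==> block_start m n i < k ==> k + ramp \<le> block_start m n (Suc i) ==> a k w = excess \<sigma> (grid_coeff \<alpha> m i w)"
    and t: "t \<in> {0<..1}" "t \<notin> boundary_zone (Suc (Suc ramp)) m n"
  shows "a (nat \<lfloor>real n * t\<rfloor>) w = excess \<sigma> (elementary_process (grid m) t w)"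
proof -
  obtain i where i: "i < m" "t \<in> cell m i" "block_start m n i < nat \<lfloor>real n * t\<rfloor>" "nat \<lfloor>real n * t\<rfloor> + ramp \<le> block_start m n (Suc i)"
    using block_bulk[OF m n t] by blast
  then show ?thesis using bulk[OF i(1,3,4)] grid_step_cell[OF m i(1,2)] by (simp add: grid_elementary_process)
qed

text \<open>The gaps are summable, so by Tonelli the squared errors are summable in j for almost
  every outcome and time, and in particular tend to 0.\<close>

lemma grid_process_converges_AE:
  assumes m: "\<And>j. 0 < m j" and gap: "\<And>j. square_gap (grid (m j)) \<alpha> \<le> ennreal ((1 / 16) ^ j)"
  shows "AE w in M. AE t in lborel. t \<in> {0..1} --> (\<lambda>j. elementary_process (grid (m j)) t w) \<longlonglongrightarrow> \<alpha> t w"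
proof -
  define f where "f j w t = ennreal ((elementary_process (grid (m j)) t w - \<alpha> t w)\<^sup>2) * indicator {0..1} t" for j w and t :: real
  have joint [measurable]: "(\<lambda>(w, t). f j w t) \<in> borel_measurable (M \<Otimes>\<^sub>M lborel)" for j
    unfolding f_def by (rule gap_joint[OF grid_is_elementary[OF m] prog])
  have sect: "f j w \<in> borel_measurable lborel" if "w \<in> space M" for j w
    using measurable_compose[OF measurable_Pair1'[OF that, of lborel] joint[of j]] by simp
  have [measurable]: "(\<lambda>w. \<integral>\<^sup>+t. f j w t \<partial>lborel) \<in> borel_measurable M" for j
    by (rule lborel.borel_measurable_nn_integral[OF joint])
  have "(\<integral>\<^sup>+w. (\<Sum>j. \<integral>\<^sup>+t. f j w t \<partial>lborel) \<partial>M) = (\<Sum>j. \<integral>\<^sup>+w. (\<integral>\<^sup>+t. f j w t \<partial>lborel) \<partial>M)"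
    by (rule nn_integral_suminf) measurable
  also have "\<dots> \<le> (\<Sum>j. ennreal ((1 / 16) ^ j))"
    using gap by (intro suminf_le) (auto simp: f_def square_gap_def)
  also have "\<dots> < \<infinity>"
    by (subst suminf_ennreal2) (auto intro!: summable_geometric)
  finally have "AE w in M. (\<Sum>j. \<integral>\<^sup>+t. f j w t \<partial>lborel) \<noteq> \<infinity>"
    by (intro nn_integral_PInf_AE) (auto simp: less_top)
  from this AE_space show ?thesis
  proof eventually_elim
    fix w assume fin: "(\<Sum>j. \<integral>\<^sup>+t. f j w t \<partial>lborel) \<noteq> \<infinity>" and w: "w \<in> space M"
    have "(\<integral>\<^sup>+t. (\<Sum>j. f j w t) \<partial>lborel) = (\<Sum>j. \<integral>\<^sup>+t. f j w t \<partial>lborel)"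
      by (rule nn_integral_suminf[OF sect[OF w]])
    then have "AE t in lborel. (\<Sum>j. f j w t) \<noteq> \<infinity>"
      using fin sect[OF w] by (intro nn_integral_PInf_AE borel_measurable_suminf) auto
    then show "AE t in lborel. t \<in> {0..1} --> (\<lambda>j. elementary_process (grid (m j)) t w) \<longlonglongrightarrow> \<alpha> t w"
    proof (rule eventually_mono[OF _ impI])
      fix t :: real assume "(\<Sum>j. f j w t) \<noteq> \<infinity>" and t: "t \<in> {0..1}"
      then have "summable (\<lambda>j. (elementary_process (grid (m j)) t w - \<alpha> t w)\<^sup>2)"
        by (intro summable_suminf_not_top) (auto simp: f_def)
      then have "(\<lambda>j. (elementary_process (grid (m j)) t w - \<alpha> t w)\<^sup>2) \<longlonglongrightarrow> 0" by (rule summable_LIMSEQ_zero)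
      then have "(\<lambda>j. sqrt ((elementary_process (grid (m j)) t w - \<alpha> t w)\<^sup>2)) \<longlonglongrightarrow> sqrt 0" by (rule tendsto_real_sqrt)
      then have "(\<lambda>j. elementary_process (grid (m j)) t w - \<alpha> t w) \<longlonglongrightarrow> 0"
        by (simp add: tendsto_rabs_zero_iff)
      then show "(\<lambda>j. elementary_process (grid (m j)) t w) \<longlonglongrightarrow> \<alpha> t w" by (rule LIM_zero_cancel)
    qed
  qed
qed

text \<open>The grid size m j is fixed first, large enough for the error of the control and for the
  oscillation term. Then \<nu> j is taken large in terms of m j among the n with \<open>P n\<close>;
  for this \<open>P\<close> has to hold infinitely often only.\<close>

lemma grid_chain_sequence:
  assumes P: "\<exists>\<^sub>F n in sequentially. P n"
  shows "\<exists>m \<nu> T \<xi> a E. strict_mono \<nu> \<and> (\<forall>j. P (\<nu> j) \<and>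
    j < m j \<and> square_gap (grid (m j)) \<alpha> \<le> ennreal ((1 / 16) ^ j) \<and>
    coupled_chain (m j) (\<nu> j) ((1 / 2) ^ j) (T j) (\<xi> j) (a j) (E j) \<and> prob (E j) \<le> 2 * (1 / 2) ^ j \<and>
    measure lborel (boundary_zone (Suc (Suc ramp)) (m j) (\<nu> j)) \<le> (1 / 2) ^ j)"
proof -
  define C where "C = 2 * exp (12 * (\<sigma> + 2 * dev_bound)\<^sup>2)"
  have "\<exists>m>j. square_gap (grid m) \<alpha> \<le> ennreal ((1 / 16) ^ j) \<and> C * (real m * exp (- sqrt m * ((1 / 2) ^ j / 3))) \<le> (1 / 2) ^ j" for j
  proof -
    have "\<forall>\<^sub>F m in sequentially. square_gap (grid m) \<alpha> < ennreal ((1 / 16) ^ j)"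
      by (rule order_tendstoD(2)[OF grid_approximation]) simp
    moreover have "\<forall>\<^sub>F m in sequentially. C * (real m * exp (- sqrt m * ((1 / 2) ^ j / 3))) < (1 / 2) ^ j"
    proof (rule order_tendstoD(2))
      define d where "d = (1 / 2 :: real) ^ j / 3"
      have "0 < d" by (simp add: d_def)
      then have "(\<lambda>m. C * (real m * exp (- sqrt (real m) * d))) \<longlonglongrightarrow> 0" by real_asymp
      then show "(\<lambda>m. C * (real m * exp (- sqrt m * ((1 / 2) ^ j / 3)))) \<longlonglongrightarrow> 0" by (simp add: d_def)
    qed simp
    ultimately have "\<forall>\<^sub>F m in sequentially. j < m \<and> square_gap (grid m) \<alpha> \<le> ennreal ((1 / 16) ^ j) \<and> C * (real m * exp (- sqrt m * ((1 / 2) ^ j / 3))) \<le> (1 / 2) ^ j"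
      using eventually_gt_at_top[of j] by eventually_elim simp
    then show ?thesis by (rule eventually_happens'[OF sequentially_bot])
  qed
  then obtain m where m: "\<And>j. j < m j" "\<And>j. square_gap (grid (m j)) \<alpha> \<le> ennreal ((1 / 16) ^ j)"
    "\<And>j. C * (real (m j) * exp (- sqrt (m j) * ((1 / 2) ^ j / 3))) \<le> (1 / 2) ^ j" by metis
  have m0: "0 < m j" for j using m(1)[of j] by simp
  define good where "good j n T \<xi> a E \<longleftrightarrow> coupled_chain (m j) n ((1 / 2) ^ j) T \<xi> a E \<and> prob E \<le> 2 * (1 / 2) ^ j" for j n T \<xi> a E
  have ev: "\<forall>\<^sub>F n in sequentially. \<exists>T \<xi> a E. good j n T \<xi> a E" for j
  proof -
    have le: "grid_bound (m j) ((1 / 2) ^ j) \<le> 2 * (1 / 2) ^ j"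
      using m(3)[of j] by (simp add: grid_bound_eq[OF m0] C_def mult_ac)
    have "0 < (1 / 2 :: real) ^ j" by simp
    from grid_chain[OF m0 this] obtain N where N: "\<forall>n\<ge>N. \<exists>T \<xi> a E. coupled_chain (m j) n ((1 / 2) ^ j) T \<xi> a E \<and>
      prob E \<le> grid_bound (m j) ((1 / 2) ^ j)" by blast
    show ?thesis
    proof (rule eventually_sequentiallyI)
      fix n assume "N \<le> n"
      from N[THEN spec, THEN mp, OF this] show "\<exists>T \<xi> a E. good j n T \<xi> a E"
      proof (elim exE conjE)
        fix T \<xi> a E assume "coupled_chain (m j) n ((1 / 2) ^ j) T \<xi> a E"
          "prob E \<le> grid_bound (m j) ((1 / 2) ^ j)"
        then show ?thesis
          using le by (intro exI[of _ T] exI[of _ \<xi>] exI[of _ a] exI[of _ E]) (simp add: good_def)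
      qed
    qed
  qed
  have small: "\<forall>\<^sub>F n in sequentially. measure lborel (boundary_zone (Suc (Suc ramp)) (m j) n) \<le> (1 / 2) ^ j" for j
  proof -
    have "(\<lambda>n. real (Suc (m j)) * (2 * real (Suc (Suc ramp)) / real n)) \<longlonglongrightarrow> 0" by real_asymp
    from order_tendstoD(2)[OF this, of "(1 / 2) ^ j"]
    have "\<forall>\<^sub>F n in sequentially. real (Suc (m j)) * (2 * real (Suc (Suc ramp)) / real n) < (1 / 2) ^ j" by simp
    then show ?thesis
      by (rule eventually_mono) (rule order.trans[OF boundary_zone_measure(3)], rule less_imp_le)
  qed
  define Q where "Q j n \<longleftrightarrow> P n \<and> (\<exists>T \<xi> a E. good j n T \<xi> a E) \<and> measure lborel (boundary_zone (Suc (Suc ramp)) (m j) n) \<le> (1 / 2) ^ j" for j n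
  \<comment> \<open>All requirements except \<open>P\<close> hold for every large n, so they meet
    \<open>P\<close> at arbitrarily large n.\<close>
  have ex: "\<exists>n. Q j n \<and> b < n" for b j
  proof -
    have "\<forall>\<^sub>F n in sequentially. b < n \<and> (\<exists>T \<xi> a E. good j n T \<xi> a E) \<and> measure lborel (boundary_zone (Suc (Suc ramp)) (m j) n) \<le> (1 / 2) ^ j"
      using eventually_gt_at_top[of b] ev[of j] small[of j] by eventually_elim simp
    from frequently_ex[OF frequently_eventually_conj[OF P this]] show ?thesis unfolding Q_def by blast
  qed
  have "\<exists>\<nu>. \<forall>j. Q j (\<nu> j) \<and> \<nu> j < \<nu> (Suc j)"
  proof (rule dependent_nat_choice)
    show "\<exists>n. Q 0 n" using ex[of 0 0] by (elim exE conjE) (rule exI)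
    show "\<exists>n'. Q (Suc j) n' \<and> n < n'" for n j by (rule ex)
  qed
  then obtain \<nu> where \<nu>: "\<And>j. Q j (\<nu> j)" "\<And>j. \<nu> j < \<nu> (Suc j)" by blast
  have "\<forall>j. \<exists>T \<xi> a E. good j (\<nu> j) T \<xi> a E" using \<nu>(1) by (simp add: Q_def)
  then obtain T \<xi> a E where good: "\<And>j. good j (\<nu> j) (T j) (\<xi> j) (a j) (E j)" by metis
  show ?thesis
  proof (rule exI[of _ m], rule exI[of _ \<nu>], rule exI[of _ T], rule exI[of _ \<xi>], rule exI[of _ a], rule exI[of _ E], intro conjI)
    show "strict_mono \<nu>" using \<nu>(2) by (simp add: strict_mono_Suc_iff)
    show "\<forall>j. P (\<nu> j) \<and> j < m j \<and> square_gap (grid (m j)) \<alpha> \<le> ennreal ((1 / 16) ^ j) \<and>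
      coupled_chain (m j) (\<nu> j) ((1 / 2) ^ j) (T j) (\<xi> j) (a j) (E j) \<and> prob (E j) \<le> 2 * (1 / 2) ^ j \<and>
      measure lborel (boundary_zone (Suc (Suc ramp)) (m j) (\<nu> j)) \<le> (1 / 2) ^ j"
      using \<nu>(1) m(1,2) good unfolding Q_def good_def by blast
  qed
qed

text \<open>Exceptional probabilities and measures of the boundary zones are summable.
  Borel-Cantelli is applied twice: over outcomes for the prices, and over time, with Lebesgue
  measure, for the coefficients.\<close>

theorem approximating_chains:
  assumes P: "\<exists>\<^sub>F n in sequentially. P n"
  shows "\<exists>\<nu> (T :: nat => nat => 'a => real list \<times> real list) \<xi> a. strict_mono \<nu> \<and> (\<forall>j. P (\<nu> j)) \<and>
    (\<forall>j. scaled_chain M (\<nu> j) \<sigma> dev_bound (T j) (\<xi> j) (a j) s0) \<and>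
    (AE w in M. \<forall>e>0. \<forall>\<^sub>F j in sequentially. \<forall>t\<in>{0..1}. \<bar>scaled_chain.price_path (\<nu> j) \<sigma> (\<xi> j) s0 w t - S w t\<bar> \<le> e) \<and>
    (AE w in M. AE t in lborel. t \<in> {0<..1} --> (\<lambda>j. a j (nat \<lfloor>real (\<nu> j) * t\<rfloor>) w) \<longlonglongrightarrow> excess \<sigma> (\<alpha> t w))"
proof -
  obtain m \<nu> T \<xi> a E where \<nu>: "strict_mono \<nu>" and all: "\<forall>j. P (\<nu> j) \<and>
    j < m j \<and> square_gap (grid (m j)) \<alpha> \<le> ennreal ((1 / 16) ^ j) \<and>
    coupled_chain (m j) (\<nu> j) ((1 / 2) ^ j) (T j) (\<xi> j) (a j) (E j) \<and> prob (E j) \<le> 2 * (1 / 2) ^ j \<and>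
    measure lborel (boundary_zone (Suc (Suc ramp)) (m j) (\<nu> j)) \<le> (1 / 2) ^ j"
    using grid_chain_sequence[OF P] by (elim exE conjE) (rule that)
  have m: "j < m j" "square_gap (grid (m j)) \<alpha> \<le> ennreal ((1 / 16) ^ j)"
    and cc: "coupled_chain (m j) (\<nu> j) ((1 / 2) ^ j) (T j) (\<xi> j) (a j) (E j)" and EB: "prob (E j) \<le> 2 * (1 / 2) ^ j"
    and zone: "measure lborel (boundary_zone (Suc (Suc ramp)) (m j) (\<nu> j)) \<le> (1 / 2) ^ j" for j
    using all[THEN spec, of j] by simp_all
  note cc' = cc[unfolded coupled_chain_def]
  note chain = cc'[THEN conjunct1] and bulk = cc'[THEN conjunct2, THEN conjunct1, rule_format]
    and E = cc'[THEN conjunct2, THEN conjunct2, THEN conjunct1] EB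
    and close = cc'[THEN conjunct2, THEN conjunct2, THEN conjunct2, THEN bspec]
  have m0: "0 < m j" for j using m(1)[of j] by simp
  have m_top: "filterlim m at_top sequentially"
    by (rule filterlim_at_top_mono[OF filterlim_ident always_eventually]) (use m(1) less_imp_le in blast)
  have \<nu>_top: "filterlim \<nu> at_top sequentially" by (rule filterlim_subseq[OF \<nu>])
  note \<nu>0 = scaled_chain.n_pos[OF chain]
  have summable: "summable (\<lambda>j. c * (1 / 2 :: real) ^ j)" for c by (intro summable_mult summable_geometric) simp
  \<comment> \<open>The grid integral misses the Ito integral by at least 2^(-j) at some grid time;
    the gap 16^(-j) makes this an event of probability of order 4^(-j).\<close>
  define E' where "E' j = {w\<in>space M. \<exists>i\<in>{0..m j}. ((1 / 2) ^ j)\<^sup>2 \<le>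
    (grid_defect (m j) i w)\<^sup>2}" for j
  have E': "E' j \<in> events" "prob (E' j) \<le> 20 * (1 / 2) ^ j" for j
  proof -
    have p: "0 < (1 / 2 :: real) ^ j" "0 < (1 / 16 :: real) ^ j" by simp_all
    note * = ito_grid_error[OF grid_is_elementary[OF m0] m0 p(1) p(2) m(2)]
    show "E' j \<in> events" unfolding E'_def grid_defect_def by (rule *(1))
    have "prob (E' j) \<le> 20 * (1 / 16) ^ j / ((1 / 2) ^ j)\<^sup>2" unfolding E'_def grid_defect_def by (rule *(2))
    also have "\<dots> = 20 * (1 / 4) ^ j"
    proof -
      have "((1 / 2 :: real) ^ j)\<^sup>2 = (1 / 4) ^ j" by (simp add: power2_eq_square flip: power_mult_distrib)
      moreover have "(1 / 16 :: real) ^ j = (1 / 4) ^ j * (1 / 4) ^ j" by (simp flip: power_mult_distrib)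
      ultimately show ?thesis by simp
    qed
    also have "\<dots> \<le> 20 * (1 / 2) ^ j" by (intro mult_left_mono power_mono) simp_all
    finally show "prob (E' j) \<le> 20 * (1 / 2) ^ j" .
  qed
  have bc: "AE w in M. \<forall>\<^sub>F j in sequentially. w \<in> space M - A j"
    if "\<And>j. A j \<in> events" "\<And>j. prob (A j) \<le> c * (1 / 2) ^ j" for A c
  proof (rule borel_cantelli_AE1)
    show "summable (\<lambda>j. prob (A j))" by (rule summable_comparison_test[OF _ summable[of c]]) (use that(2) in simp)
  qed (use that(1) in \<open>auto simp: emeasure_eq_measure\<close>)
  have path: "AE w in M. \<forall>e>0. \<forall>\<^sub>F j in sequentially. \<forall>t\<in>{0..1}. \<bar>scaled_chain.price_path (\<nu> j) \<sigma> (\<xi> j) s0 w t - S w t\<bar> \<le> e"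
    using bc[OF E] bc[OF E'] AE_space
  proof eventually_elim
    case (elim w)
    show ?case
    proof (intro allI impI, rule price_path_converges[OF chain m0 m_top \<nu>_top LIMSEQ_power_zero[of "1 / 2"] elim(3)])
      show "\<forall>\<^sub>F j in sequentially. \<forall>i<m j. \<forall>k\<in>{block_start (m j) (\<nu> j) i..block_start (m j) (\<nu> j) (Suc i)}.
         \<bar>\<sigma> / sqrt (\<nu> j) * (\<Sum>l=1..k. \<xi> j l w) - grid_log (m j) i w\<bar> \<le> (1 / 2) ^ j"
        by (rule eventually_mono[OF elim(1) close])
      show "\<forall>\<^sub>F j in sequentially. \<forall>i\<le>m j.
        \<bar>grid_defect (m j) i w\<bar> \<le> (1 / 2) ^ j"
      proof (rule eventually_mono[OF elim(2)], intro allI impI)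
        fix j i assume "w \<in> space M - E' j" "i \<le> m j"
        then have "(grid_defect (m j) i w)\<^sup>2 \<le> ((1 / 2) ^ j)\<^sup>2"
          unfolding E'_def by (auto simp: not_le intro: less_imp_le)
        then have "\<bar>grid_defect (m j) i w\<bar> \<le> \<bar>(1 / 2) ^ j\<bar>"
          by (simp only: abs_le_square_iff)
        then show "\<bar>grid_defect (m j) i w\<bar> \<le> (1 / 2) ^ j" by simp
      qed
    qed simp_all
  qed
  have zone_AE: "AE t in lborel. \<forall>\<^sub>F j in sequentially. t \<in> space lborel - boundary_zone (Suc (Suc ramp)) (m j) (\<nu> j)"
  proof (rule borel_cantelli_AE1)
    show "summable (\<lambda>j. measure lborel (boundary_zone (Suc (Suc ramp)) (m j) (\<nu> j)))"
      by (rule summable_comparison_test[OF _ summable[of 1]]) (use zone in simp)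
  qed (rule boundary_zone_measure)+
  have coeff: "AE w in M. AE t in lborel. t \<in> {0<..1} --> (\<lambda>j. a j (nat \<lfloor>real (\<nu> j) * t\<rfloor>) w) \<longlonglongrightarrow> excess \<sigma> (\<alpha> t w)"
    using grid_process_converges_AE[OF m0 m(2)]
  proof (rule eventually_mono)
    fix w assume "AE t in lborel. t \<in> {0..1} --> (\<lambda>j. elementary_process (grid (m j)) t w) \<longlonglongrightarrow> \<alpha> t w"
    then show "AE t in lborel. t \<in> {0<..1} --> (\<lambda>j. a j (nat \<lfloor>real (\<nu> j) * t\<rfloor>) w) \<longlonglongrightarrow> excess \<sigma> (\<alpha> t w)"
      using zone_AE
    proof eventually_elim
      case (elim t)
      show ?case
      proof
        assume t: "t \<in> {0<..1}"
        have "(\<lambda>j. excess \<sigma> (elementary_process (grid (m j)) t w)) \<longlonglongrightarrow> excess \<sigma> (\<alpha> t w)"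
          unfolding excess_def using t \<sigma> by (intro tendsto_intros elim(1)[THEN mp]) auto
        then show "(\<lambda>j. a j (nat \<lfloor>real (\<nu> j) * t\<rfloor>) w) \<longlonglongrightarrow> excess \<sigma> (\<alpha> t w)"
        proof (rule Lim_transform_eventually)
          show "\<forall>\<^sub>F j in sequentially. excess \<sigma> (elementary_process (grid (m j)) t w) = a j (nat \<lfloor>real (\<nu> j) * t\<rfloor>) w"
            using elim(2)
          proof (rule eventually_mono)
            fix j assume "t \<in> space lborel - boundary_zone (Suc (Suc ramp)) (m j) (\<nu> j)"
            then show "excess \<sigma> (elementary_process (grid (m j)) t w) = a j (nat \<lfloor>real (\<nu> j) * t\<rfloor>) w"
              by (intro coefficient_bulk[OF m0 \<nu>0 bulk t, symmetric]) auto
          qed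
        qed
      qed
    qed
  qed
  show ?thesis using all
    by (intro exI[of _ \<nu>] exI[of _ T] exI[of _ \<xi>] exI[of _ a] conjI \<nu> path coeff allI chain) blast
qed

end

section \<open>Passage to the limit\<close>


text \<open>Fatou's lemma suits the nonnegative f but points the wrong way for the subtracted k. The
  uniform second moment gives E k \<le> E (min k L) + K / L; the truncated part converges by
  dominated convergence, and L tends to infinity at the end.\<close>

lemma (in prob_space) fatou_with_truncation:
  fixes f k :: "nat => 'a => real"
  assumes f: "\<And>j. integrable M (f j)" "\<And>j w. w \<in> space M ==> 0 \<le> f j w"
    and k: "\<And>j. integrable M (k j)" "\<And>j w. w \<in> space M ==> 0 \<le> k j w"
    and k2: "\<And>j. integrable M (\<lambda>w. (k j w)\<^sup>2)" "\<And>j. expectation (\<lambda>w. (k j w)\<^sup>2) \<le> K"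
    and le: "\<And>j. expectation (\<lambda>w. f j w - k j w) \<le> c"
    and f': "f' \<in> borel_measurable M" "\<And>w. w \<in> space M ==> 0 \<le> f' w" "AE w in M. (\<lambda>j. f j w) \<longlonglongrightarrow> f' w"
    and k': "k' \<in> borel_measurable M" "\<And>w. w \<in> space M ==> 0 \<le> k' w" "AE w in M. (\<lambda>j. k j w) \<longlonglongrightarrow> k' w"
  shows "expectation (\<lambda>w. f' w - k' w) \<le> c"
proof -
  have fatou: "(\<integral>\<^sup>+w. ennreal (u' w) \<partial>M) \<le> ennreal b"
    if u: "\<And>j. integrable M (u j)" "\<And>j w. w \<in> space M ==> 0 \<le> u j w" "AE w in M. (\<lambda>j. u j w) \<longlonglongrightarrow> u' w"
      and b: "\<And>j. expectation (u j) \<le> x j" "x \<longlonglongrightarrow> b" for u u' b and x :: "nat => real"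
  proof -
    have "(\<integral>\<^sup>+w. ennreal (u' w) \<partial>M) = (\<integral>\<^sup>+w. liminf (\<lambda>j. ennreal (u j w)) \<partial>M)"
    proof (rule nn_integral_cong_AE)
      show "AE w in M. ennreal (u' w) = liminf (\<lambda>j. ennreal (u j w))"
        using u(3) by eventually_elim (rule lim_imp_Liminf[OF sequentially_bot tendsto_ennrealI, symmetric])
    qed
    also have "\<dots> \<le> liminf (\<lambda>j. \<integral>\<^sup>+w. ennreal (u j w) \<partial>M)" using u(1) by (intro nn_integral_liminf) auto
    also have "\<dots> \<le> liminf (\<lambda>j. ennreal (x j))"
    proof (intro Liminf_mono always_eventually allI)
      fix j
      have "(\<integral>\<^sup>+w. ennreal (u j w) \<partial>M) = ennreal (expectation (u j))"
        by (rule nn_integral_eq_integral[OF u(1) AE_I2[OF u(2)]])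
      then show "(\<integral>\<^sup>+w. ennreal (u j w) \<partial>M) \<le> ennreal (x j)" using b(1) by (simp add: ennreal_leI)
    qed
    also have "\<dots> = ennreal b" by (rule lim_imp_Liminf[OF sequentially_bot tendsto_ennrealI[OF b(2)]])
    finally show ?thesis .
  qed
  have real: "integrable M u \<and> expectation u \<le> b"
    if "u \<in> borel_measurable M" "\<And>w. w \<in> space M ==> 0 \<le> u w" "(\<integral>\<^sup>+w. ennreal (u w) \<partial>M) \<le> ennreal b" "0 \<le> b" for u b
  proof
    show I: "integrable M u" using that by (intro integrableI_nonneg) (auto intro: le_less_trans)
    have "ennreal (expectation u) \<le> ennreal b"
      using that(3) nn_integral_eq_integral[OF I AE_I2[OF that(2)]] by simp
    then show "expectation u \<le> b" using that(4) by simp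
  qed
  have "0 \<le> expectation (\<lambda>w. (k 0 w)\<^sup>2)" by (intro integral_nonneg_AE) simp
  with k2(2)[of 0] have K0: "0 \<le> K" by linarith
  have "expectation (k j) \<le> 1 + K" for j
  proof -
    have "expectation (k j) \<le> expectation (\<lambda>w. 1 + (k j w)\<^sup>2)"
    proof (rule integral_mono[OF k(1)])
      show "integrable M (\<lambda>w. 1 + (k j w)\<^sup>2)" using k2(1) by simp
      have "x \<le> 1 + x\<^sup>2" for x :: real using zero_le_power2[of "x - 1 / 2"] by (simp add: power2_diff power_divide)
      then show "k j w \<le> 1 + (k j w)\<^sup>2" for w .
    qed
    also have "\<dots> \<le> 1 + K" using k2 by (simp add: prob_space)
    finally show ?thesis .
  qed
  from real[OF k'(1,2) fatou[OF k k'(3) this tendsto_const]] K0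
  have k'I: "integrable M k'" by simp
  define y where "y = expectation k'"
  have main: "(\<integral>\<^sup>+w. ennreal (f' w) \<partial>M) \<le> ennreal (c + (y + K / L)) \<and> 0 \<le> c + (y + K / L)" if L: "0 < L" for L
  proof -
    define z where "z j = expectation (\<lambda>w. min (k j w) L)" for j
    have minI: "integrable M (\<lambda>w. min (k j w) L)" for j using k(1) by simp
    have z: "z \<longlonglongrightarrow> expectation (\<lambda>w. min (k' w) L)"
      unfolding z_def
    proof (rule integral_dominated_convergence[where w = "\<lambda>_. L"])
      show "AE w in M. (\<lambda>j. min (k j w) L) \<longlonglongrightarrow> min (k' w) L"
        using k'(3) by eventually_elim (intro tendsto_intros)
      show "AE w in M. norm (min (k j w) L) \<le> L" for j using k(2) L by (intro AE_I2) auto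
    qed (use k'(1) k(1) in auto)
    have up: "expectation (f j) \<le> c + (z j + K / L)" for j
    proof -
      have "expectation (k j) \<le> expectation (\<lambda>w. min (k j w) L + (k j w)\<^sup>2 / L)"
      proof (rule integral_mono[OF k(1)])
        show "integrable M (\<lambda>w. min (k j w) L + (k j w)\<^sup>2 / L)" using minI k2(1) by simp
        fix w
        show "k j w \<le> min (k j w) L + (k j w)\<^sup>2 / L"
        proof (cases "k j w \<le> L")
          case True
          then show ?thesis using L by simp
        next
          case False
          then have "k j w * L \<le> (k j w)\<^sup>2" using L by (simp add: power2_eq_square)
          then have "k j w \<le> (k j w)\<^sup>2 / L" using L by (simp add: pos_le_divide_eq)
          then show ?thesis using False L by simp
        qed
      qed
      also have "\<dots> = z j + expectation (\<lambda>w. (k j w)\<^sup>2) / L" using minI k2(1) by (simp add: z_def)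
      also have "\<dots> \<le> z j + K / L" using k2(2) L by (simp add: divide_right_mono)
      finally show ?thesis using le[of j] f(1) k(1) by simp
    qed
    have lim: "(\<lambda>j. c + (z j + K / L)) \<longlonglongrightarrow> c + (expectation (\<lambda>w. min (k' w) L) + K / L)" by (intro tendsto_intros z)
    have y: "c + (expectation (\<lambda>w. min (k' w) L) + K / L) \<le> c + (y + K / L)"
      unfolding y_def using k'I by (intro add_mono order_refl integral_mono) auto
    \<comment> \<open>\<open>ennreal\<close> sends negative numbers to 0, so the bound must be known
      to be nonnegative before it can be read as an inequality of reals.\<close>
    have "0 \<le> c + (z j + K / L)" for j
    proof -
      have "0 \<le> expectation (f j)" by (rule integral_nonneg_AE[OF AE_I2[OF f(2)]])
      then show ?thesis using up[of j] by linarith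
    qed
    then have "0 \<le> c + (expectation (\<lambda>w. min (k' w) L) + K / L)" by (intro LIMSEQ_le_const[OF lim]) auto
    moreover have "(\<integral>\<^sup>+w. ennreal (f' w) \<partial>M) \<le> ennreal (c + (expectation (\<lambda>w. min (k' w) L) + K / L))"
      by (rule fatou[OF f f'(3) up lim])
    ultimately show ?thesis using order.trans[OF _ ennreal_leI[OF y]] y by auto
  qed
  have f'I: "integrable M f' \<and> expectation f' \<le> c + (y + K / real (Suc n))" for n
    using main[of "real (Suc n)"] by (intro real f') auto
  have "(\<lambda>n. c + (y + K * (1 / real (Suc n)))) \<longlonglongrightarrow> c + (y + K * 0)"
    by (intro tendsto_intros LIMSEQ_Suc[OF lim_inverse_n'])
  then have "expectation f' \<le> c + (y + K * 0)" using f'I by (intro LIMSEQ_le_const) auto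
  then show ?thesis using f'I k'I by (simp add: y_def)
qed

text \<open>The limit agrees outside a null set with a measurable function, and the measure is
  complete.\<close>

lemma (in complete_measure) AE_limit_measurable:
  fixes u :: "nat => 'a => real"
  assumes u: "\<And>j. u j \<in> borel_measurable M" and lim: "AE w in M. (\<lambda>j. u j w) \<longlonglongrightarrow> f w"
  shows "f \<in> borel_measurable M"
proof (rule measurableI)
  define g where "g w = lim (\<lambda>j. u j w)" for w
  have g: "g \<in> borel_measurable M" unfolding g_def[abs_def] using u by (rule borel_measurable_lim_metric)
  fix U :: "real set" assume U: "U \<in> sets borel"
  have "AE w in M. w \<in> g -` U \<inter> space M \<longleftrightarrow> w \<in> f -` U \<inter> space M"
    using lim AE_space by eventually_elim (simp add: g_def limI)
  then show "f -` U \<inter> space M \<in> sets M"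
    by (rule in_sets_AE[OF _ measurable_sets[OF g U]]) simp
qed simp

text \<open>The scaling condition ties its factor n to the index of the sequences, whereas the
  chains exist only along \<nu>. The remaining indices are filled with the limit itself, which
  preserves convergence.\<close>

lemma extend_subsequence:
  assumes \<nu>: "strict_mono \<nu>" and Q: "\<forall>\<^sub>F j in sequentially. Q (u j)" "Q c"
  shows "\<forall>\<^sub>F n in sequentially. Q (if n \<in> range \<nu> then u (inv \<nu> n) else c)"
proof -
  obtain J where J: "\<And>j. J \<le> j ==> Q (u j)" using Q(1) by (auto simp: eventually_sequentially)
  have inj: "inj \<nu>" using \<nu> by (rule strict_mono_imp_inj_on)
  show ?thesis
  proof (rule eventually_sequentiallyI[of "\<nu> J"])
    fix n assume n: "\<nu> J \<le> n"
    show "Q (if n \<in> range \<nu> then u (inv \<nu> n) else c)"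
    proof (cases "n \<in> range \<nu>")
      case True
      then obtain j where j: "n = \<nu> j" by auto
      then have "J \<le> j" using n \<nu> by (simp add: strict_mono_less_eq)
      then show ?thesis using J inj by (simp add: j)
    qed (simp add: Q(2))
  qed
qed

lemma extend_subsequence_tendsto:
  fixes u :: "nat => real"
  assumes \<nu>: "strict_mono \<nu>" and u: "u \<longlonglongrightarrow> c"
  shows "(\<lambda>n. if n \<in> range \<nu> then u (inv \<nu> n) else c) \<longlonglongrightarrow> c"
proof (rule tendstoI)
  fix e :: real assume "0 < e"
  then show "\<forall>\<^sub>F n in sequentially. dist (if n \<in> range \<nu> then u (inv \<nu> n) else c) c < e"
    using extend_subsequence[OF \<nu>, of "\<lambda>x. dist x c < e" u c] tendstoD[OF u] by simp
qed

lemma exp_minus_one_le: "\<bar>exp z - 1\<bar> \<le> \<bar>z\<bar> * exp \<bar>z\<bar>" for z :: real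
proof -
  have "exp \<bar>z\<bar> * (1 - \<bar>z\<bar>) \<le> exp \<bar>z\<bar> * exp (- \<bar>z\<bar>)"
    using exp_ge_add_one_self[of "- \<bar>z\<bar>"] by (intro mult_left_mono) auto
  then have "exp \<bar>z\<bar> - 1 \<le> \<bar>z\<bar> * exp \<bar>z\<bar>" by (simp add: exp_minus algebra_simps)
  then show ?thesis using exp_minus_one_abs[of z] by linarith
qed

text \<open>With \<epsilon> the last sign and b the sequence in the claim, the gap M_k - S_k equals
  \<epsilon> b / sqrt n times the price exactly. The scaling condition can thus be applied to b,
  which has the same limit as the coefficients.\<close>

lemma exp_increment_limit:
  fixes a \<epsilon> :: "nat => real"
  assumes a: "a \<longlonglongrightarrow> c" "\<And>j. \<bar>a j\<bar> \<le> A" and \<epsilon>: "\<And>j. \<epsilon> j \<in> {-1, 1}" and n: "filterlim n at_top sequentially"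
  shows "(\<lambda>j. \<epsilon> j * (sqrt (real (n j)) * (exp (a j * \<epsilon> j / sqrt (real (n j))) - 1))) \<longlonglongrightarrow> c"
proof (rule Lim_transform[OF a(1)], rule Lim_null_comparison)
  define h where "h j = 1 / sqrt (real (n j))" for j
  have h: "h \<longlonglongrightarrow> 0" unfolding h_def
    by (rule filterlim_compose[OF _ n, of "\<lambda>k. 1 / sqrt (real k)"]) real_asymp
  show "(\<lambda>j. 3 * A\<^sup>2 * h j) \<longlonglongrightarrow> 0" using tendsto_mult[OF tendsto_const h, of "3 * A\<^sup>2"] by simp
  have "(\<lambda>j. A * h j) \<longlonglongrightarrow> A * 0" by (intro tendsto_intros h)
  then have "\<forall>\<^sub>F j in sequentially. A * h j < 1" by (intro order_tendstoD(2)) auto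
  then show "\<forall>\<^sub>F j in sequentially. norm (\<epsilon> j * (sqrt (real (n j)) * (exp (a j * \<epsilon> j / sqrt (real (n j))) - 1)) - a j) \<le> 3 * A\<^sup>2 * h j"
    using filterlim_at_top[THEN iffD1, OF n, rule_format, of 1]
  proof eventually_elim
    case (elim j)
    define s where "s = sqrt (real (n j))"
    have s: "0 < s" using elim by (simp add: s_def)
    define z where "z = a j * \<epsilon> j / s"
    have az: "a j = \<epsilon> j * (s * z)" using \<epsilon>[of j] s by (auto simp: z_def)
    have zb: "\<bar>z\<bar> \<le> A * h j" using a(2)[of j] \<epsilon>[of j] s by (auto simp: z_def h_def s_def[symmetric] abs_mult divide_right_mono)
    then have "\<bar>z\<bar> \<le> 1" using elim by linarith
    then have "\<bar>exp z - 1 - z\<bar> \<le> 3 * z\<^sup>2"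
      using exp_quadratic_bound[of z] exp_ge_add_one_self[of z] by linarith
    then have "s * \<bar>exp z - 1 - z\<bar> \<le> s * (3 * (A * h j)\<^sup>2)"
      using s abs_le_square_iff[of z "A * h j"] zb by (intro mult_left_mono) auto
    also have "\<dots> = 3 * A\<^sup>2 * h j" using s by (simp add: h_def s_def[symmetric] power_mult_distrib power2_eq_square)
    finally have "s * \<bar>exp z - 1 - z\<bar> \<le> 3 * A\<^sup>2 * h j" .
    moreover have "\<bar>a j - \<epsilon> j * (s * (exp z - 1))\<bar> = s * \<bar>exp z - 1 - z\<bar>"
    proof -
      have "a j - \<epsilon> j * (s * (exp z - 1)) = - (\<epsilon> j * (s * (exp z - 1 - z)))" unfolding az by (simp add: algebra_simps)
      then show ?thesis using \<epsilon>[of j] s by (auto simp: abs_mult)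
    qed
    ultimately show ?case unfolding z_def s_def by (simp add: abs_minus_commute)
  qed
qed


section \<open>Convergence of the trading costs\<close>

locale cost_limit = volatility_control +
  fixes G Gh :: "real => (real => real) => real => real" and C p \<beta> :: real
  assumes G_nonneg: "\<And>t S y. t \<in> {0..1} ==> S \<in> C01_pos ==> 0 \<le> G t S y"
    and growth: "0 < C" "0 < p" "2 \<le> \<beta>"
      "\<And>t S y. t \<in> {0..1} ==> S \<in> C01_pos ==> G t S y \<le> C * \<bar>y\<bar> powr \<beta> * (1 + sup_norm S) powr p"
    and Gh_nonneg: "\<And>t S y. t \<in> {0..1} ==> S \<in> C01_pos ==> 0 \<le> Gh t S y"
    and Gh_continuous: "\<And>S. S \<in> C01_pos ==> continuous_on ({0..1} \<times> UNIV) (\<lambda>(t, y). Gh t S y)"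
    and scaling: "\<And>(a :: nat => real) \<epsilon> tn t Sn S. bounded (range a) ==> range \<epsilon> \<subseteq> {-1, 1} ==>
        tn \<longlonglongrightarrow> t ==> t \<in> {0..1} ==> range tn \<subseteq> {0..1} ==>
        limitin C01_pos_topology Sn S sequentially ==> range Sn \<subseteq> C01_pos ==>
        (\<lambda>n. real n * G (tn n) (Sn n) (\<epsilon> n * a n / sqrt (real n) * Sn n (tn n)) - Gh t S (a n * S t)) \<longlonglongrightarrow> 0"
begin

text \<open>An integer exponent that dominates \<beta> + p, so that integer moments of the maximal
  price bound the cost.\<close>

definition q :: nat where "q = nat \<lceil>\<beta> + p\<rceil>"
definition cost_factor :: real where "cost_factor = C * (dev_bound * exp dev_bound) powr \<beta>"

lemma cost_factor_nonneg: "0 \<le> cost_factor" using growth by (simp add: cost_factor_def)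

lemma dev_bound_nonneg: "0 \<le> dev_bound"
proof -
  have "0 < (1 :: nat)" by simp
  interpret bd: block_data M 1 \<sigma> "B + 1" "grid_values 1 B" "\<lambda>i. FF (real i / real 1)" "grid_coeff \<alpha> 1" "grid_increment 1"
    by (rule grid_block_data) simp
  show ?thesis unfolding dev_bound_def bd.A_def using \<sigma> by simp
qed

text \<open>The gap is at most of order 1 / sqrt n times 1 plus the maximal price, and \<beta> \<ge>
  2 makes its power of order 1/n. Hence the sum of n terms stays below a fixed power of 1 plus the
  maximal price.\<close>

lemma cost_term_bound:
  assumes "scaled_chain M n \<sigma> dev_bound T \<xi> a s0" and w: "w \<in> space M" and k: "k \<le> n"
  defines "Y \<equiv> scaled_chain.price_path n \<sigma> \<xi> s0 w"
  shows "real n * G (real k / real n) Y (scaled_chain.deviation n \<sigma> \<xi> a s0 k w) \<le> cost_factor * (1 + sup_norm Y) ^ q"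
proof -
  interpret c: scaled_chain M n \<sigma> dev_bound T \<xi> a s0 by fact
  define s where "s = sup_norm Y"
  define R where "R = dev_bound * exp dev_bound"
  have n: "1 \<le> real n" using c.n_pos by simp
  have Y: "Y \<in> C01_pos" unfolding Y_def by (rule c.price_path_pos)
  have t: "real k / real n \<in> {0..1}" using k c.n_pos by simp
  have s: "0 \<le> s" unfolding s_def by (rule sup_norm_nonneg[OF C01_posD(1)[OF Y]])
  have R: "0 \<le> R" using dev_bound_nonneg by (simp add: R_def)
  have "Y (real k / real n) = c.price k w"
    unfolding Y_def c.price_path_def c.price_def by (rule interpolation_grid[OF k c.n_pos])
  then have price: "c.price k w \<le> s" using le_sup_norm[OF C01_posD(1)[OF Y] t] by (simp add: s_def)
  have a\<xi>: "\<bar>a k w * \<xi> k w\<bar> \<le> dev_bound"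
  proof (cases "k = 0")
    case True
    then show ?thesis using c.a_0[OF w] dev_bound_nonneg by simp
  next
    case False
    then have "\<xi> k w \<in> {-1, 1}" using c.\<xi>_values[OF _ k w] by simp
    then show ?thesis using c.a_bound[OF k w] by (auto simp: abs_mult)
  qed
  have z: "\<bar>a k w * \<xi> k w / sqrt n\<bar> \<le> dev_bound / sqrt n" "\<bar>a k w * \<xi> k w / sqrt n\<bar> \<le> dev_bound"
  proof -
    show 1: "\<bar>a k w * \<xi> k w / sqrt n\<bar> \<le> dev_bound / sqrt n" using a\<xi> by (simp add: divide_right_mono)
    have "dev_bound / sqrt n \<le> dev_bound" using n dev_bound_nonneg by (simp add: divide_le_eq mult_le_cancel_left1)
    with 1 show "\<bar>a k w * \<xi> k w / sqrt n\<bar> \<le> dev_bound" by linarith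
  qed
  have "\<bar>exp (a k w * \<xi> k w / sqrt n) - 1\<bar> \<le> \<bar>a k w * \<xi> k w / sqrt n\<bar> * exp \<bar>a k w * \<xi> k w / sqrt n\<bar>"
    by (rule exp_minus_one_le)
  also have "\<dots> \<le> dev_bound / sqrt n * exp dev_bound" using z dev_bound_nonneg by (intro mult_mono) auto
  also have "\<dots> = R * (1 / sqrt n)" by (simp add: R_def)
  finally have "c.price k w * \<bar>exp (a k w * \<xi> k w / sqrt n) - 1\<bar> \<le> (1 + s) * (R * (1 / sqrt n))"
    using price s R c.price_pos[of k w] by (intro mult_mono) auto
  then have dev: "\<bar>c.deviation k w\<bar> \<le> (1 + s) * (R * (1 / sqrt n))"
    using c.price_pos[of k w] by (simp add: c.deviation_eq[OF k] abs_mult)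
  have "G (real k / real n) Y (c.deviation k w) \<le> C * \<bar>c.deviation k w\<bar> powr \<beta> * (1 + s) powr p"
    unfolding s_def by (rule growth(4)[OF t Y])
  also have "\<dots> \<le> C * ((1 + s) powr \<beta> * (R powr \<beta> * (1 / real n))) * (1 + s) powr p"
  proof (intro mult_right_mono mult_left_mono)
    have "\<bar>c.deviation k w\<bar> powr \<beta> \<le> ((1 + s) * (R * (1 / sqrt n))) powr \<beta>"
      using dev growth(3) by (intro powr_mono2) auto
    also have "\<dots> = (1 + s) powr \<beta> * (R powr \<beta> * (1 / sqrt n) powr \<beta>)"
      by (simp only: powr_mult)
    also have "\<dots> \<le> (1 + s) powr \<beta> * (R powr \<beta> * (1 / real n))"
    proof (intro mult_left_mono)
      have "(1 / sqrt n) powr \<beta> \<le> (1 / sqrt n) powr 2" using growth(3) n by (intro powr_mono') auto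
      also have "\<dots> = 1 / real n" using n by (simp add: powr_numeral power_divide)
      finally show "(1 / sqrt n) powr \<beta> \<le> 1 / real n" .
    qed auto
    finally show "\<bar>c.deviation k w\<bar> powr \<beta> \<le> (1 + s) powr \<beta> * (R powr \<beta> * (1 / real n))" .
  qed (use growth in auto)
  finally have "real n * G (real k / real n) Y (c.deviation k w) \<le> real n * (C * ((1 + s) powr \<beta> * (R powr \<beta> * (1 / real n))) * (1 + s) powr p)"
    by (intro mult_left_mono) auto
  also have "\<dots> = cost_factor * (1 + s) powr (\<beta> + p)"
    using n by (simp add: cost_factor_def R_def powr_add)
  also have "\<dots> \<le> cost_factor * (1 + s) ^ q"
  proof (intro mult_left_mono cost_factor_nonneg)
    have "(1 + s) powr (\<beta> + p) \<le> (1 + s) powr real q"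
      using s unfolding q_def by (intro powr_mono real_nat_ceiling_ge) auto
    then show "(1 + s) powr (\<beta> + p) \<le> (1 + s) ^ q" using s by (simp add: powr_realpow)
  qed
  finally show ?thesis by (simp add: s_def)
qed

lemma cost_bound:
  assumes "scaled_chain M n \<sigma> dev_bound T \<xi> a s0" and w: "w \<in> space M"
  shows "0 \<le> scaled_chain.cost n \<sigma> \<xi> a s0 G w"
    "scaled_chain.cost n \<sigma> \<xi> a s0 G w \<le> cost_factor * (1 + sup_norm (scaled_chain.price_path n \<sigma> \<xi> s0 w)) ^ q"
proof -
  interpret c: scaled_chain M n \<sigma> dev_bound T \<xi> a s0 by fact
  show "0 \<le> c.cost G w" unfolding c.cost_def by (intro sum_nonneg G_nonneg c.price_path_pos) auto
  have n: "0 < real n" using c.n_pos by simp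
  have "c.cost G w \<le> (\<Sum>k<n. cost_factor * (1 + sup_norm (c.price_path w)) ^ q / real n)"
    unfolding c.cost_def
  proof (rule sum_mono)
    fix k assume "k \<in> {..<n}"
    then show "G (real k / real n) (c.price_path w) (c.deviation k w) \<le> cost_factor * (1 + sup_norm (c.price_path w)) ^ q / real n"
      using cost_term_bound[OF assms, of k] n by (simp add: pos_le_divide_eq mult.commute)
  qed
  then show "c.cost G w \<le> cost_factor * (1 + sup_norm (c.price_path w)) ^ q" using n by simp
qed

definition limit_cost :: "'a => real => real" where
  "limit_cost w t = indicator {0..1} t * Gh t (S w) (excess \<sigma> (\<alpha> t w) * S w t)"

text \<open>\<open>Gh\<close> and the price path are controlled only for times in [0, 1]; clamping
  the time yields continuous functions on the whole line, which the indicator then cuts off.\<close>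

lemma limit_cost_borel: assumes w: "w \<in> space M" shows "limit_cost w \<in> borel_measurable borel"
proof -
  define cl :: "real => real" where "cl t = max 0 (min 1 t)" for t
  have cl: "cl t \<in> {0..1}" "t \<in> {0..1} ==> cl t = t" for t by (auto simp: cl_def)
  have cl_cont: "continuous_on UNIV cl" unfolding cl_def by (intro continuous_intros)
  have "continuous_on UNIV (\<lambda>x :: real \<times> real. (cl (fst x), snd x))"
    by (intro continuous_intros continuous_on_compose2[OF cl_cont]) auto
  note continuous_on_compose2[OF Gh_continuous[OF S_pos[OF w]] this]
  moreover have "range (\<lambda>x :: real \<times> real. (cl (fst x), snd x)) \<subseteq> {0..1} \<times> UNIV"
    using cl(1) by (auto simp del: atLeastAtMost_iff)
  ultimately have "continuous_on UNIV (\<lambda>x :: real \<times> real. Gh (cl (fst x)) (S w) (snd x))" by simp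
  then have m: "(\<lambda>x :: real \<times> real. Gh (cl (fst x)) (S w) (snd x)) \<in> borel_measurable borel"
    by (rule borel_measurable_continuous_onI)
  have "continuous_on UNIV (\<lambda>t. S w (cl t))"
    by (rule continuous_on_compose2[OF C01_posD(2)[OF S_pos[OF w]] cl_cont]) (use cl(1) in auto)
  then have [measurable]: "(\<lambda>t. S w (cl t)) \<in> borel_measurable borel" by (rule borel_measurable_continuous_onI)
  have [measurable]: "trunc \<alpha> w \<in> borel_measurable borel" by (rule trunc_borel[OF prog w])
  have "(\<lambda>t :: real. (t, excess \<sigma> (trunc \<alpha> w t) * S w (cl t))) \<in> measurable borel borel"
    unfolding excess_def by measurable
  from measurable_compose[OF this m]
  have [measurable]: "(\<lambda>t. Gh (cl t) (S w) (excess \<sigma> (trunc \<alpha> w t) * S w (cl t))) \<in> borel_measurable borel" by simp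
  have "limit_cost w = (\<lambda>t. indicator {0..1} t * Gh (cl t) (S w) (excess \<sigma> (trunc \<alpha> w t) * S w (cl t)))"
    using cl(2) by (auto simp: limit_cost_def fun_eq_iff trunc_def indicator_def)
  then show ?thesis by simp
qed

lemma cost_term_converges:
  fixes T :: "nat => nat => 'a => 't"
  assumes chain: "\<And>j. scaled_chain M (\<nu> j) \<sigma> dev_bound (T j) (\<xi> j) (a j) s0" and \<nu>: "strict_mono \<nu>" and w: "w \<in> space M"
    and path: "\<And>e. 0 < e ==> \<forall>\<^sub>F j in sequentially. \<forall>t\<in>{0..1}. \<bar>scaled_chain.price_path (\<nu> j) \<sigma> (\<xi> j) s0 w t - S w t\<bar> \<le> e"
    and t: "t \<in> {0<..<1}" and coeff: "(\<lambda>j. a j (nat \<lfloor>real (\<nu> j) * t\<rfloor>) w) \<longlonglongrightarrow> excess \<sigma> (\<alpha> t w)"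
  shows "(\<lambda>j. real (\<nu> j) * G (real (nat \<lfloor>real (\<nu> j) * t\<rfloor>) / real (\<nu> j)) (scaled_chain.price_path (\<nu> j) \<sigma> (\<xi> j) s0 w)
      (scaled_chain.deviation (\<nu> j) \<sigma> (\<xi> j) (a j) s0 (nat \<lfloor>real (\<nu> j) * t\<rfloor>) w)) \<longlonglongrightarrow> limit_cost w t"
proof -
  have \<nu>_top: "filterlim \<nu> at_top sequentially" by (rule filterlim_subseq[OF \<nu>])
  have inj: "inj \<nu>" using \<nu> by (rule strict_mono_imp_inj_on)
  define k where "k j = nat \<lfloor>real (\<nu> j) * t\<rfloor>" for j
  define tn where "tn j = real (k j) / real (\<nu> j)" for j
  define P where "P j = scaled_chain.price_path (\<nu> j) \<sigma> (\<xi> j) s0 w" for j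
  \<comment> \<open>At k = 0 the value of \<xi> need not be a sign; the default -1 is one, and the
    vanishing coefficient hides the difference.\<close>
  define \<epsilon> where "\<epsilon> j = (if \<xi> j (k j) w = 1 then 1 else - 1 :: real)" for j
  define b where "b j = \<epsilon> j * (sqrt (real (\<nu> j)) * (exp (a j (k j) w * \<epsilon> j / sqrt (real (\<nu> j))) - 1))" for j
  define c where "c = excess \<sigma> (\<alpha> t w)"
  have n0: "0 < \<nu> j" for j by (rule scaled_chain.n_pos[OF chain])
  have nt: "0 < real (\<nu> j) * t" "real (\<nu> j) * t < real (\<nu> j)" for j using n0[of j] t by auto
  have k: "real (k j) \<le> real (\<nu> j) * t" "real (\<nu> j) * t < real (k j) + 1" for j
    using nt(1)[of j] by (simp_all add: k_def of_nat_floor)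
  have kn: "k j < \<nu> j" for j
  proof -
    have "real (k j) < real (\<nu> j)" using k(1)[of j] nt(2)[of j] by linarith
    then show ?thesis by simp
  qed
  have tn01: "tn j \<in> {0..1}" for j using kn[of j] by (simp add: tn_def)
  have tn: "tn \<longlonglongrightarrow> t"
  proof (rule tendsto_sandwich[of "\<lambda>j. t - 1 / real (\<nu> j)" _ _ "\<lambda>_. t"])
    show "(\<lambda>j. t - 1 / real (\<nu> j)) \<longlonglongrightarrow> t"
      using tendsto_diff[OF tendsto_const filterlim_compose[OF lim_inverse_n' \<nu>_top], of t] by simp
    have "t \<le> (real (k j) + 1) / real (\<nu> j)" for j
      using k(2)[of j] n0[of j] by (simp add: pos_le_divide_eq mult.commute)
    then show "\<forall>\<^sub>F j in sequentially. t - 1 / real (\<nu> j) \<le> tn j"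
      by (intro always_eventually allI) (simp add: tn_def add_divide_distrib diff_le_eq)
    show "\<forall>\<^sub>F j in sequentially. tn j \<le> t"
      using k(1) n0 by (intro always_eventually allI) (simp add: tn_def pos_divide_le_eq mult.commute)
  qed simp
  have Pp: "P j \<in> C01_pos" for j unfolding P_def by (rule scaled_chain.price_path_pos[OF chain])
  have b: "b \<longlonglongrightarrow> c"
    unfolding b_def
  proof (rule exp_increment_limit[OF _ _ _ \<nu>_top])
    show "(\<lambda>j. a j (k j) w) \<longlonglongrightarrow> c" using coeff by (simp add: k_def c_def)
    show "\<bar>a j (k j) w\<bar> \<le> dev_bound" for j
    proof -
      interpret c: scaled_chain M "\<nu> j" \<sigma> dev_bound "T j" "\<xi> j" "a j" s0 by (rule chain)
      show ?thesis using c.a_bound[OF _ w] kn[of j] by simp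
    qed
  qed (simp add: \<epsilon>_def)
  have dev: "scaled_chain.deviation (\<nu> j) \<sigma> (\<xi> j) (a j) s0 (k j) w = \<epsilon> j * b j / sqrt (real (\<nu> j)) * P j (tn j)" for j
  proof -
    interpret c: scaled_chain M "\<nu> j" \<sigma> dev_bound "T j" "\<xi> j" "a j" s0 by (rule chain)
    have "a j (k j) w * \<xi> j (k j) w = a j (k j) w * \<epsilon> j"
    proof (cases "k j = 0")
      case True
      then show ?thesis using c.a_0[OF w] by simp
    next
      case False
      then have "\<xi> j (k j) w \<in> {-1, 1}" using c.\<xi>_values[OF _ _ w, of "k j"] kn[of j] by simp
      then show ?thesis by (auto simp: \<epsilon>_def)
    qed
    moreover have "P j (tn j) = c.price (k j) w"
      unfolding P_def tn_def c.price_path_def c.price_def by (rule interpolation_grid[OF less_imp_le[OF kn] c.n_pos])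
    moreover have "\<epsilon> j * b j / sqrt (real (\<nu> j)) = exp (a j (k j) w * \<epsilon> j / sqrt (real (\<nu> j))) - 1"
      using n0[of j] by (simp add: b_def \<epsilon>_def)
    ultimately show ?thesis using c.deviation_eq[OF less_imp_le[OF kn], of w] by simp
  qed
  define ext :: "(nat => real) => real => nat => real" where "ext u l n = (if n \<in> range \<nu> then u (inv \<nu> n) else l)" for u l n
  define Sn where "Sn n = (if n \<in> range \<nu> then P (inv \<nu> n) else S w)" for n
  have ext_\<nu>: "ext u l (\<nu> j) = u j" for u l j using inj by (simp add: ext_def)
  have Sn_\<nu>: "Sn (\<nu> j) = P j" for j using inj by (simp add: Sn_def)
  have ext_in: "range (ext u l) \<subseteq> A" if "\<And>j. u j \<in> A" "l \<in> A" for u l A using that by (auto simp: ext_def)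
  have ext_lim: "ext u l \<longlonglongrightarrow> l" if "u \<longlonglongrightarrow> l" for u l
    unfolding ext_def[abs_def] by (rule extend_subsequence_tendsto[OF \<nu> that])
  have "bounded (range (ext b c))" by (rule convergent_imp_bounded[OF ext_lim[OF b]])
  moreover have "range (ext \<epsilon> 1) \<subseteq> {-1, 1}" by (rule ext_in) (simp_all add: \<epsilon>_def)
  moreover have "ext tn t \<longlonglongrightarrow> t" by (rule ext_lim[OF tn])
  moreover have t01: "t \<in> {0..1}" using t by simp
  moreover have "range (ext tn t) \<subseteq> {0..1}" using tn01 t01 by (rule ext_in)
  moreover have "limitin C01_pos_topology Sn (S w) sequentially"
  proof (rule limitin_C01_pos[OF S_pos[OF w]])
    show "Sn n \<in> C01_pos" for n using Pp S_pos[OF w] by (simp add: Sn_def)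
    fix e :: real assume e: "0 < e"
    show "\<forall>\<^sub>F n in sequentially. \<forall>t\<in>{0..1}. \<bar>Sn n t - S w t\<bar> \<le> e"
      unfolding Sn_def 
      using extend_subsequence[OF \<nu>, where Q = "\<lambda>f. \<forall>t\<in>{0..1}. \<bar>f t - S w t\<bar> \<le> e" and u = P and c = "S w"] path[OF e] e
      by (simp add: P_def)
  qed
  moreover have "range Sn \<subseteq> C01_pos" using Pp S_pos[OF w] by (auto simp: Sn_def)
  ultimately have "(\<lambda>n. real n * G (ext tn t n) (Sn n) (ext \<epsilon> 1 n * ext b c n / sqrt (real n) * Sn n (ext tn t n)) - Gh t (S w) (ext b c n * S w t)) \<longlonglongrightarrow> 0"
    by (rule scaling)
  from filterlim_compose[OF this \<nu>_top]
  have "(\<lambda>j. real (\<nu> j) * G (tn j) (P j) (\<epsilon> j * b j / sqrt (real (\<nu> j)) * P j (tn j)) - Gh t (S w) (b j * S w t)) \<longlonglongrightarrow> 0"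
    by (simp only: ext_\<nu> Sn_\<nu>)
  moreover have "(\<lambda>j. Gh t (S w) (b j * S w t)) \<longlonglongrightarrow> Gh t (S w) (c * S w t)"
  proof -
    have "continuous_on UNIV (\<lambda>y. Gh t (S w) y)"
    proof -
      have "continuous_on UNIV (\<lambda>y :: real. (t, y))" by (intro continuous_intros)
      from continuous_on_compose2[OF Gh_continuous[OF S_pos[OF w]] this] t01 show ?thesis
        by (simp add: image_subset_iff)
    qed
    then have "isCont (\<lambda>y. Gh t (S w) y) (c * S w t)" by (simp add: continuous_on_eq_continuous_at)
    then show ?thesis by (rule isCont_tendsto_compose) (intro tendsto_intros b)
  qed
  ultimately have "(\<lambda>j. real (\<nu> j) * G (tn j) (P j) (\<epsilon> j * b j / sqrt (real (\<nu> j)) * P j (tn j)) - Gh t (S w) (b j * S w t) + Gh t (S w) (b j * S w t)) \<longlonglongrightarrow> 0 + Gh t (S w) (c * S w t)"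
    by (rule tendsto_add)
  then show ?thesis
    using t01 unfolding dev[symmetric] by (simp add: limit_cost_def c_def tn_def P_def k_def)
qed

text \<open>The cost is the integral of a step function whose value on cell k is n times the k-th
  term. These values converge for almost every time, and along a fixed outcome the maximal prices
  are eventually bounded, which supplies the dominating constant.\<close>

lemma cost_converges:
  fixes T :: "nat => nat => 'a => 't"
  assumes chain: "\<And>j. scaled_chain M (\<nu> j) \<sigma> dev_bound (T j) (\<xi> j) (a j) s0" and \<nu>: "strict_mono \<nu>" and w: "w \<in> space M"
    and path: "\<And>e. 0 < e ==> \<forall>\<^sub>F j in sequentially. \<forall>t\<in>{0..1}. \<bar>scaled_chain.price_path (\<nu> j) \<sigma> (\<xi> j) s0 w t - S w t\<bar> \<le> e"
    and coeff: "AE t in lborel. t \<in> {0<..1} --> (\<lambda>j. a j (nat \<lfloor>real (\<nu> j) * t\<rfloor>) w) \<longlonglongrightarrow> excess \<sigma> (\<alpha> t w)"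
  shows "(\<lambda>j. scaled_chain.cost (\<nu> j) \<sigma> (\<xi> j) (a j) s0 G w) \<longlonglongrightarrow> (LBINT t. limit_cost w t)"
proof -
  define P where "P j = scaled_chain.price_path (\<nu> j) \<sigma> (\<xi> j) s0 w" for j
  define d where "d j k = scaled_chain.deviation (\<nu> j) \<sigma> (\<xi> j) (a j) s0 k w" for j k
  define e where "e j k = real (\<nu> j) * G (real k / real (\<nu> j)) (P j) (d j k)" for j k
  have P: "P j \<in> C01_pos" for j unfolding P_def by (rule scaled_chain.price_path_pos[OF chain])
  have n0: "0 < \<nu> j" for j by (rule scaled_chain.n_pos[OF chain])
  have e0: "0 \<le> e j k" if "k < \<nu> j" for j k using that G_nonneg[OF _ P] by (simp add: e_def)
  have e1: "e j k \<le> cost_factor * (1 + sup_norm (P j)) ^ q" if "k < \<nu> j" for j k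
    unfolding e_def P_def d_def by (rule cost_term_bound[OF chain w less_imp_le[OF that]])
  obtain J where "\<forall>j\<ge>J. \<forall>t\<in>{0..1}. \<bar>P j t - S w t\<bar> \<le> 1"
    using path[of 1] unfolding P_def[symmetric] eventually_sequentially by auto
  then have J: "\<bar>P j t - S w t\<bar> \<le> 1" if "J \<le> j" "t \<in> {0..1}" for j t using that by blast
  define s where "s = sup_norm (S w) + 1"
  have Ps: "sup_norm (P j) \<le> s" if "J \<le> j" for j
    unfolding s_def
  proof (rule sup_norm_le)
    fix t :: real assume t: "t \<in> {0..1}"
    show "\<bar>P j t\<bar> \<le> sup_norm (S w) + 1"
      using J[OF that t] le_sup_norm[OF C01_posD(1)[OF S_pos[OF w]] t] by linarith
  qed
  define D where "D = cost_factor * (1 + s) ^ q"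
  have eD: "e j k \<le> D" if "J \<le> j" "k < \<nu> j" for j k
  proof -
    have "(1 + sup_norm (P j)) ^ q \<le> (1 + s) ^ q"
      using Ps[OF that(1)] sup_norm_nonneg[OF C01_posD(1)[OF P]] by (intro power_mono) (auto intro: add_nonneg_nonneg)
    then show ?thesis using e1[OF that(2)] mult_left_mono[OF _ cost_factor_nonneg] unfolding D_def by (meson order_trans)
  qed
  have D0: "0 \<le> D" using e0[of 0 J] eD[of J 0] n0[of J] by simp
  have cost: "scaled_chain.cost (\<nu> j) \<sigma> (\<xi> j) (a j) s0 G w = (LBINT t. grid_step (\<nu> j) (e j) t)" for j
  proof -
    interpret c: scaled_chain M "\<nu> j" \<sigma> dev_bound "T j" "\<xi> j" "a j" s0 by (rule chain)
    have "grid_step (\<nu> j) (e j) t = \<bar>grid_step (\<nu> j) (e j) t\<bar>" for t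
      unfolding grid_step_def using e0 by (intro abs_of_nonneg[symmetric] sum_nonneg) auto
    then have "(LBINT t. grid_step (\<nu> j) (e j) t) = (\<Sum>k<\<nu> j. \<bar>e j k\<bar>) / real (\<nu> j)"
      using grid_step_integral_abs(2)[OF n0, of j "e j"] by simp
    also have "(\<Sum>k<\<nu> j. \<bar>e j k\<bar>) = (\<Sum>k<\<nu> j. e j k)" using e0 by (intro sum.cong refl abs_of_nonneg) auto
    also have "\<dots> = real (\<nu> j) * c.cost G w" by (simp add: e_def P_def d_def c.cost_def sum_distrib_left)
    finally show ?thesis using n0[of j] by simp
  qed
  \<comment> \<open>The dominating constant is valid from index J on, hence the shift.\<close>
  have "(\<lambda>i. LBINT t. grid_step (\<nu> (i + J)) (e (i + J)) t) \<longlonglongrightarrow> (LBINT t. limit_cost w t)"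
  proof (rule integral_dominated_convergence[where w = "\<lambda>t. D * indicator {0..1} t"])
    show "limit_cost w \<in> borel_measurable lborel" using limit_cost_borel[OF w] by simp
    show "grid_step (\<nu> (i + J)) (e (i + J)) \<in> borel_measurable lborel" for i by simp
    show "integrable lborel (\<lambda>t. D * indicator {0..1} (t :: real))"
      by (intro integrable_mult_right integrable_real_indicator) (auto simp: emeasure_lborel_Icc_eq)
    show "AE t in lborel. norm (grid_step (\<nu> (i + J)) (e (i + J)) t) \<le> D * indicator {0..1} t" for i
    proof (rule AE_I2)
      fix t :: real
      show "norm (grid_step (\<nu> (i + J)) (e (i + J)) t) \<le> D * indicator {0..1} t"
      proof (cases "\<exists>k<\<nu> (i + J). t \<in> cell (\<nu> (i + J)) k")
        case True
        then obtain k where k: "k < \<nu> (i + J)" "t \<in> cell (\<nu> (i + J)) k" by auto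
        have "t \<in> {0..1}" using cell_subset[OF k(1)] k(2) by auto
        then show ?thesis using grid_step_cell[OF n0 k] e0[OF k(1)] eD[OF _ k(1)] by simp
      next
        case False
        then show ?thesis using D0 by (simp add: grid_step_def)
      qed
    qed
    \<comment> \<open>Cells are closed on the right, whereas k = floor (n t) describes intervals
      closed on the left; the conventions agree for irrational t.\<close>
    have "AE t in lborel. t \<notin> \<rat>"
      by (intro AE_not_in countable_imp_null_set_lborel countable_rat)
    with coeff show "AE t in lborel. (\<lambda>i. grid_step (\<nu> (i + J)) (e (i + J)) t) \<longlonglongrightarrow> limit_cost w t"
    proof eventually_elim
      case (elim t)
      show ?case
      proof (cases "t \<in> {0<..<1}")
        case True
        have eq: "grid_step (\<nu> j) (e j) t = e j (nat \<lfloor>real (\<nu> j) * t\<rfloor>)" for j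
        proof -
          obtain k where k: "k < \<nu> j" "t \<in> cell (\<nu> j) k" using cell_exists[OF n0, of t] True by auto
          have "t \<noteq> real (Suc k) / real (\<nu> j)" using elim(2) by auto
          then have "real k / real (\<nu> j) < t" "t < real (Suc k) / real (\<nu> j)" using k(2) by (auto simp: cell_def)
          then have "real k < real (\<nu> j) * t" "real (\<nu> j) * t < real k + 1"
            using n0[of j] by (simp_all add: pos_divide_less_eq pos_less_divide_eq mult.commute)
          then have "nat \<lfloor>real (\<nu> j) * t\<rfloor> = k" by (intro floor_eq4) auto
          then show ?thesis using grid_step_cell[OF n0 k] by simp
        qed
        have "t \<in> {0<..1}" using True by simp
        with elim(1) have "(\<lambda>j. a j (nat \<lfloor>real (\<nu> j) * t\<rfloor>) w) \<longlonglongrightarrow> excess \<sigma> (\<alpha> t w)" by simp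
        from cost_term_converges[OF chain \<nu> w path True this]
        have "(\<lambda>j. grid_step (\<nu> j) (e j) t) \<longlonglongrightarrow> limit_cost w t" unfolding eq by (simp add: e_def P_def d_def)
        then show ?thesis by (rule LIMSEQ_ignore_initial_segment)
      next
        case False
        then have "t \<noteq> 0 \<and> t \<noteq> 1" using elim(2) by auto
        then have "t \<notin> {0..1}" using False by auto
        moreover from this have "t \<notin> cell (\<nu> j) k" if "k < \<nu> j" for j k using cell_subset[OF that] by auto
        ultimately have "limit_cost w t = 0" "grid_step (\<nu> j) (e j) t = 0" for j
          by (simp_all add: limit_cost_def grid_step_def)
        then show ?thesis by simp
      qed
    qed
  qed
  then show ?thesis unfolding cost[symmetric] by (rule LIMSEQ_offset)
qed

text \<open>Chains are chosen along the infinitely many n whose replication cost lies below x, so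
  duality bounds each expected value by x, and the bound passes to the limit.\<close>

theorem value_le_of_replication:
  assumes F: "\<And>y. y \<in> mspace C01 ==> 0 \<le> F y" "continuous_map C01_topology euclideanreal F"
    and g: "\<And>t S y v. t \<in> {0..1} ==> S \<in> C01_pos ==> v * y - g t S v \<le> G t S y"
    and freq: "\<exists>\<^sub>F n in sequentially. super_replication_cost \<sigma> s0 n g (\<lambda>w. F (stock_path \<sigma> s0 n w)) < ereal x"
  shows "expectation (\<lambda>w. F (S w) - (LBINT t:{0..1}. Gh t (S w) (excess_volatility \<sigma> \<alpha> t w * S w t))) \<le> x"
proof -
  \<comment> \<open>Squared costs involve the moment of order 2 q of the maximal price, and
    \<open>sup_moment\<close> at this exponent requires n to be large.\<close>
  define Q where "Q n \<longleftrightarrow> super_replication_cost \<sigma> s0 n g (\<lambda>w. F (stock_path \<sigma> s0 n w)) < ereal x \<and>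
    2 * real (2 * q) * (\<sigma> + 2 * dev_bound) \<le> sqrt (real n)" for n
  have "\<forall>\<^sub>F n in sequentially. 2 * real (2 * q) * (\<sigma> + 2 * dev_bound) \<le> sqrt (real n)"
  proof -
    have "filterlim (\<lambda>n. sqrt (real n)) at_top sequentially" by real_asymp
    then show ?thesis by (simp add: filterlim_at_top)
  qed
  then have "\<exists>\<^sub>F n in sequentially. Q n" unfolding Q_def by (rule frequently_eventually_conj[OF freq, THEN frequently_elim1]) auto
  from approximating_chains[OF this]
  obtain \<nu> and T :: "nat => nat => 'a => real list \<times> real list" and \<xi> a where
    \<nu>: "strict_mono \<nu>" and Q: "\<forall>j. Q (\<nu> j)" and chain': "\<forall>j. scaled_chain M (\<nu> j) \<sigma> dev_bound (T j) (\<xi> j) (a j) s0" and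
    paths: "AE w in M. \<forall>e>0. \<forall>\<^sub>F j in sequentially. \<forall>t\<in>{0..1}. \<bar>scaled_chain.price_path (\<nu> j) \<sigma> (\<xi> j) s0 w t - S w t\<bar> \<le> e" and
    coeff: "AE w in M. AE t in lborel. t \<in> {0<..1} --> (\<lambda>j. a j (nat \<lfloor>real (\<nu> j) * t\<rfloor>) w) \<longlonglongrightarrow> excess \<sigma> (\<alpha> t w)"
    by (elim exE conjE) (rule that)
  note chain = chain'[THEN spec]
  define P where "P j = scaled_chain.price_path (\<nu> j) \<sigma> (\<xi> j) s0" for j
  define k where "k j = scaled_chain.cost (\<nu> j) \<sigma> (\<xi> j) (a j) s0 G" for j
  define K where "K = cost_factor\<^sup>2 * (2 ^ (2 * q) * (1 + (s0 * exp dev_bound) ^ (2 * q) * (1 + 2 * exp (24 * (real (2 * q))\<^sup>2 * (\<sigma> + 2 * dev_bound)\<^sup>2))))"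
  have PC: "P j w \<in> C01_pos" for j w unfolding P_def by (rule scaled_chain.price_path_pos[OF chain])
  note PC' = C01_posD(1)[OF PC]
  have int: "integrable M (\<lambda>w. F (P j w))" "integrable M (k j)" "integrable M (\<lambda>w. (k j w)\<^sup>2)" and
    k2: "expectation (\<lambda>w. (k j w)\<^sup>2) \<le> K" and le: "expectation (\<lambda>w. F (P j w) - k j w) \<le> x" for j
  proof -
    interpret c: scaled_chain M "\<nu> j" \<sigma> dev_bound "T j" "\<xi> j" "a j" s0 by (rule chain)
    have int_path: "integrable M (\<lambda>w. h (c.price_path w))" for h :: "(real => real) => real"
      by (rule c.det_integrable[OF order_refl c.det_comp2[OF c.det_price_path c.det_price_path, of "\<lambda>u _. h u"]])
    then show "integrable M (\<lambda>w. F (P j w))" by (simp add: P_def)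
    show "integrable M (k j)" unfolding k_def by (rule c.det_integrable[OF order_refl c.det_cost])
    show k2I: "integrable M (\<lambda>w. (k j w)\<^sup>2)" unfolding k_def
      by (rule c.det_integrable[OF order_refl c.det_comp2[OF c.det_cost c.det_cost, of "\<lambda>u _. u\<^sup>2"]])
    have "expectation (\<lambda>w. (k j w)\<^sup>2) \<le> expectation (\<lambda>w. cost_factor\<^sup>2 * (1 + sup_norm (c.price_path w)) ^ (2 * q))"
    proof (rule integral_mono[OF k2I])
      show "integrable M (\<lambda>w. cost_factor\<^sup>2 * (1 + sup_norm (c.price_path w)) ^ (2 * q))" by (rule int_path)
      fix w assume w: "w \<in> space M"
      have "(k j w)\<^sup>2 \<le> (cost_factor * (1 + sup_norm (c.price_path w)) ^ q)\<^sup>2"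
        unfolding k_def using cost_bound[OF chain w] by (intro power_mono)
      then show "(k j w)\<^sup>2 \<le> cost_factor\<^sup>2 * (1 + sup_norm (c.price_path w)) ^ (2 * q)"
        by (simp add: power_mult_distrib power_mult[symmetric] mult.commute)
    qed
    also have "\<dots> \<le> K"
    proof -
      have "1 \<le> q" using growth unfolding q_def by linarith
      then have "expectation (\<lambda>w. (1 + sup_norm (c.price_path w)) ^ (2 * q)) \<le> 2 ^ (2 * q) * (1 + (s0 * exp dev_bound) ^ (2 * q) * (1 + 2 * exp (24 * (real (2 * q))\<^sup>2 * (\<sigma> + 2 * dev_bound)\<^sup>2)))"
        using Q by (intro c.sup_moment) (simp_all add: Q_def)
      then have "cost_factor\<^sup>2 * expectation (\<lambda>w. (1 + sup_norm (c.price_path w)) ^ (2 * q)) \<le> K"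
        unfolding K_def by (intro mult_left_mono) auto
      then show ?thesis by simp
    qed
    finally show "expectation (\<lambda>w. (k j w)\<^sup>2) \<le> K" .
    have "ereal (expectation (\<lambda>w. F (c.price_path w) - c.cost G w)) < ereal x"
      using c.duality[where G = G and g = g and F = F, OF g] Q unfolding Q_def by (meson le_less_trans)
    then show "expectation (\<lambda>w. F (P j w) - k j w) \<le> x" by (simp add: P_def k_def)
  qed
  have k0: "0 \<le> k j w" if "w \<in> space M" for j w unfolding k_def by (rule cost_bound(1)[OF chain that])
  have Flim: "AE w in M. (\<lambda>j. F (P j w)) \<longlonglongrightarrow> F (S w)"
    using paths AE_space
  proof eventually_elim
    case (elim w)
    have "limitin C01_topology (\<lambda>j. P j w) (S w) sequentially"
      using elim by (intro limitin_C01[OF C01_posD(1)[OF S_pos] PC']) (auto simp: P_def)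
    from continuous_map_limit[OF F(2) this] show ?case by (simp add: o_def)
  qed
  have klim: "AE w in M. (\<lambda>j. k j w) \<longlonglongrightarrow> (LBINT t. limit_cost w t)"
    using paths coeff AE_space
  proof eventually_elim
    case (elim w)
    show ?case unfolding k_def by (rule cost_converges[OF chain \<nu> elim(3) elim(1)[rule_format] elim(2)])
  qed
  have "expectation (\<lambda>w. F (S w) - (LBINT t. limit_cost w t)) \<le> x"
  proof (rule fatou_with_truncation[OF int(1) F(1)[OF PC'] int(2) k0 int(3) k2 le _ _ Flim _ _ klim])
    show "(\<lambda>w. F (S w)) \<in> borel_measurable M"
      using int(1) by (intro AE_limit_measurable[OF _ Flim]) auto
    show "(\<lambda>w. LBINT t. limit_cost w t) \<in> borel_measurable M"
      using int(2) by (intro AE_limit_measurable[OF _ klim]) auto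
    show "0 \<le> F (S w)" if "w \<in> space M" for w using F(1) C01_posD(1)[OF S_pos[OF that]] .
    show "0 \<le> (LBINT t. limit_cost w t)" if "w \<in> space M" for w
      using Gh_nonneg[OF _ S_pos[OF that]] by (intro integral_nonneg_AE AE_I2) (auto simp: limit_cost_def indicator_def)
  qed
  moreover have "(LBINT t:{0..1}. Gh t (S w) (excess_volatility \<sigma> \<alpha> t w * S w t)) = (LBINT t. limit_cost w t)" for w
    by (simp add: set_lebesgue_integral_def limit_cost_def excess_volatility_def excess_def)
  ultimately show ?thesis by simp
qed

end

section \<open>Real-valued conjugate costs and the final bound\<close>

lemma legendre_nonneg:
  assumes "trading_cost g" "t \<in> {0..1}" "S \<in> C01_pos" shows "0 \<le> legendre g t S y"
proof -
  have "g t S 0 = 0" using assms unfolding trading_cost_def by blast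
  then have "0 \<le> ereal (0 * y - g t S 0)" by simp
  also have "\<dots> \<le> legendre g t S y" unfolding legendre_def by (rule SUP_upper) simp
  finally show ?thesis .
qed

text \<open>On admissible arguments the transform is finite, so convergence in the extended reals
  can be read in the reals.\<close>

lemma scaling_condition_real:
  assumes L: "scaling_condition L Gh" "\<And>t S y. t \<in> {0..1} ==> S \<in> C01_pos ==> ereal (G t S y) = L t S y"
    and seq: "bounded (range a)" "range \<epsilon> \<subseteq> {-1, 1}" "tn \<longlonglongrightarrow> t" "t \<in> {0..1}" "range tn \<subseteq> {0..1}"
      "limitin C01_pos_topology Sn S sequentially" "range Sn \<subseteq> C01_pos"
  shows "(\<lambda>n. real n * G (tn n) (Sn n) (\<epsilon> n * a n / sqrt (real n) * Sn n (tn n)) - Gh t S (a n * S t)) \<longlonglongrightarrow> 0"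
proof -
  have "tn n \<in> {0..1}" for n using seq(5) by blast
  then have lim: "limitin (top_of_set {0..1}) tn t sequentially"
    using seq(3,4) by (simp add: limitin_subtopology del: atLeastAtMost_iff)
  have "(\<lambda>n. \<bar>ereal (real n) * L (tn n) (Sn n) (\<epsilon> n * a n / sqrt (real n) * Sn n (tn n)) - ereal (Gh t S (a n * S t))\<bar>) \<longlonglongrightarrow> 0"
    by (rule L(1)[unfolded scaling_condition_def, THEN conjunct2, THEN conjunct2, rule_format, OF seq(1,2) lim seq(5-7)])
  moreover have "L (tn n) (Sn n) y = ereal (G (tn n) (Sn n) y)" for n y
    using seq(5,7) by (intro L(2)[symmetric]) blast+
  ultimately have "(\<lambda>n. \<bar>ereal (real n) * ereal (G (tn n) (Sn n) (\<epsilon> n * a n / sqrt (real n) * Sn n (tn n))) - ereal (Gh t S (a n * S t))\<bar>) \<longlonglongrightarrow> 0"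
    by simp
  then have "(\<lambda>n. ereal \<bar>real n * G (tn n) (Sn n) (\<epsilon> n * a n / sqrt (real n) * Sn n (tn n)) - Gh t S (a n * S t)\<bar>) \<longlonglongrightarrow> ereal 0"
    by (simp add: zero_ereal_def)
  then have "(\<lambda>n. \<bar>real n * G (tn n) (Sn n) (\<epsilon> n * a n / sqrt (real n) * Sn n (tn n)) - Gh t S (a n * S t)\<bar>) \<longlonglongrightarrow> 0"
    by (simp only: lim_ereal)
  then show ?thesis by (rule tendsto_rabs_zero_cancel)
qed

theorem corollary3p6:
  fixes \<sigma> s0 :: real
    and F :: "(real \<Rightarrow> real) \<Rightarrow> real"
    and g Gh :: "real \<Rightarrow> (real \<Rightarrow> real) \<Rightarrow> real \<Rightarrow> real"
    and M :: "'a measure"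
    and W :: "real \<Rightarrow> 'a \<Rightarrow> real"
  assumes "\<sigma> > 0" and "s0 > 0"
    and "prob_space M" and "complete_measure M" and "brownian_motion M W"
    and "\<forall>y\<in>mspace C01. F y \<ge> 0"
    and "continuous_map C01_topology euclideanreal F"
    and "\<exists>C>0. \<exists>p>0. \<forall>y\<in>mspace C01. F y \<le> C * (1 + sup_norm y powr p)"
    and "trading_cost g"
    and "growth_condition (legendre g)"
    and "scaling_condition (legendre g) Gh"
  shows "liminf (\<lambda>n. super_replication_cost \<sigma> s0 n g (\<lambda>\<omega>. F (stock_path \<sigma> s0 n \<omega>)))
    \<ge> (SUP \<alpha>\<in>bounded_progressive M W.
        ereal (prob_space.expectation M (\<lambda>\<omega>.
          F (exp_martingale M W s0 \<alpha> \<omega>)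
          - (LBINT t:{0..1}. Gh t (exp_martingale M W s0 \<alpha> \<omega>)
               (excess_volatility \<sigma> \<alpha> t \<omega> * exp_martingale M W s0 \<alpha> \<omega> t)))))"
proof (rule SUP_least)
  fix \<alpha> assume "\<alpha> \<in> bounded_progressive M W"
  then obtain B where \<alpha>: "progressive M W \<alpha>" "\<forall>t\<in>{0..1}. \<forall>w\<in>space M. \<bar>\<alpha> t w\<bar> \<le> B"
    by (auto simp: bounded_progressive_def)
  obtain C p \<beta> where growth: "0 < C" "0 < p" "2 \<le> \<beta>"
    "\<And>t S y. t \<in> {0..1} ==> S \<in> C01_pos ==> legendre g t S y \<le> ereal (C * \<bar>y\<bar> powr \<beta> * (1 + sup_norm S) powr p)"
    using assms(10) unfolding growth_condition_def by blast
  \<comment> \<open>The transform is finite on admissible arguments: \<nu> = 0 gives the lower bound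
    0 and the growth condition the upper bound.\<close>
  define G where "G t S y = real_of_ereal (legendre g t S y)" for t S y
  have G: "ereal (G t S y) = legendre g t S y" if "t \<in> {0..1}" "S \<in> C01_pos" for t S y
  proof -
    have "\<bar>legendre g t S y\<bar> \<noteq> \<infinity>"
      using legendre_nonneg[OF assms(9) that, of y] growth(4)[OF that, of y] by auto
    then show ?thesis unfolding G_def by (rule ereal_real')
  qed
  have cont: "continuous_on ({0..1} \<times> UNIV) (\<lambda>(t, y). Gh t S y)" if S: "S \<in> C01_pos" for S
  proof -
    have c: "continuous_map (prod_topology (top_of_set {0..1}) (prod_topology C01_pos_topology euclideanreal)) euclideanreal (\<lambda>(t, S, y). Gh t S y)"
      using assms(11) unfolding scaling_condition_def by (elim conjE)
    have "continuous_map (prod_topology (top_of_set {0..1}) euclideanreal)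
      (prod_topology (top_of_set {0..1}) (prod_topology C01_pos_topology euclideanreal)) (\<lambda>x. (fst x, S, snd x))"
      using S C01_posD(1)[OF S] by (simp add: continuous_map_pairwise o_def continuous_map_fst continuous_map_snd)
    from continuous_map_compose[OF this c]
    have "continuous_map (prod_topology (top_of_set {0..1}) euclideanreal) euclideanreal (\<lambda>(t, y). Gh t S y)"
      by (simp add: o_def case_prod_unfold)
    then show ?thesis
      using prod_topology_subtopology_eu[of "{0..1 :: real}" "UNIV :: real set"] by simp
  qed
  interpret cost_limit M W \<alpha> B \<sigma> s0 G Gh C p \<beta>
  proof (intro cost_limit.intro volatility_control.intro bounded_progressive_process.intro brownian.intro assms
      brownian_axioms.intro bounded_progressive_process_axioms.intro volatility_control_axioms.intro cost_limit_axioms.intro growth(1-3) \<alpha>(1))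
    show "\<bar>\<alpha> t w\<bar> \<le> B" if "t \<in> {0..1}" "w \<in> space M" for t w using \<alpha>(2) that by blast
    show "0 \<le> G t S y" if "t \<in> {0..1}" "S \<in> C01_pos" for t S y
      using legendre_nonneg[OF assms(9) that, of y] G[OF that, of y] by (metis ereal_less_eq(5))
    show "G t S y \<le> C * \<bar>y\<bar> powr \<beta> * (1 + sup_norm S) powr p" if "t \<in> {0..1}" "S \<in> C01_pos" for t S y
      using growth(4)[OF that, of y] G[OF that, of y] by (metis ereal_less_eq(3))
    show "0 \<le> Gh t S y" if "t \<in> {0..1}" "S \<in> C01_pos" for t S y
      using assms(11)[unfolded scaling_condition_def, THEN conjunct1] that by blast
    show "continuous_on ({0..1} \<times> UNIV) (\<lambda>(t, y). Gh t S y)" if "S \<in> C01_pos" for S by (rule cont[OF that])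
    show "(\<lambda>n. real n * G (tn n) (Sn n) (\<epsilon> n * a n / sqrt (real n) * Sn n (tn n)) - Gh t S (a n * S t)) \<longlonglongrightarrow> 0"
      if "bounded (range a)" "range \<epsilon> \<subseteq> {-1, 1}" "tn \<longlonglongrightarrow> t" "t \<in> {0..1}" "range tn \<subseteq> {0..1}"
        "limitin C01_pos_topology Sn S sequentially" "range Sn \<subseteq> C01_pos"
      for a \<epsilon> tn :: "nat => real" and t Sn S
      by (rule scaling_condition_real[OF assms(11) G that])
  qed
  have conjugate: "v * y - g t S v \<le> G t S y" if "t \<in> {0..1}" "S \<in> C01_pos" for t S y v
  proof -
    have "ereal (v * y - g t S v) \<le> ereal (G t S y)"
      unfolding G[OF that] legendre_def by (rule SUP_upper) simp
    then show ?thesis by simp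
  qed
  show "ereal (expectation (\<lambda>w. F (S w) - (LBINT t:{0..1}. Gh t (S w) (excess_volatility \<sigma> \<alpha> t w * S w t))))
    \<le> liminf (\<lambda>n. super_replication_cost \<sigma> s0 n g (\<lambda>w. F (stock_path \<sigma> s0 n w)))"
  proof (rule ccontr)
    assume "\<not> ?thesis"
    \<comment> \<open>A real number strictly between the two sides is undercut by infinitely many
      replication costs; along those n the expectation cannot exceed it.\<close>
    then obtain x where x: "liminf (\<lambda>n. super_replication_cost \<sigma> s0 n g (\<lambda>w. F (stock_path \<sigma> s0 n w))) < ereal x"
      "ereal x < ereal (expectation (\<lambda>w. F (S w) - (LBINT t:{0..1}. Gh t (S w) (excess_volatility \<sigma> \<alpha> t w * S w t))))"
      using ereal_dense2 by (meson not_le)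
    have "\<exists>\<^sub>F n in sequentially. super_replication_cost \<sigma> s0 n g (\<lambda>w. F (stock_path \<sigma> s0 n w)) < ereal x"
    proof (rule ccontr)
      assume "\<not> ?thesis"
      then have "\<forall>\<^sub>F n in sequentially. ereal x \<le> super_replication_cost \<sigma> s0 n g (\<lambda>w. F (stock_path \<sigma> s0 n w))"
        by (simp add: not_frequently not_less)
      then have "ereal x \<le> liminf (\<lambda>n. super_replication_cost \<sigma> s0 n g (\<lambda>w. F (stock_path \<sigma> s0 n w)))"
        by (rule Liminf_bounded)
      with x(1) show False by (simp add: not_le[symmetric])
    qed
    from value_le_of_replication[OF bspec[OF assms(6)] assms(7) conjugate this] x(2) show False by simp
  qed
qed

end
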